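(* Let $R$ be a commutative Noetherian ring of finite Krull dimension such that $R_{\mathfrak{p}}$ is a field for all $\mathfrak{p}\in\operatorname{Assh}R$. Then we have $$\dim\mathsf{D}^{\mathrm{b}}(\operatorname{mod} R)\ge\dim R-1,$$ where $\dim R$ is the Krull dimension of $R$.
   Context: $\operatorname{Assh}R$ denotes the set of prime ideals $\mathfrak{p}$ of $R$ with $\dim R/\mathfrak{p}=\dim R$. $\mathsf{D}^{\mathrm{b}}(\operatorname{mod} R)$ is the bounded derived category of finitely generated $R$-modules. Let $\mathcal{T}$ be a triangulated category with shift $\Sigma$, and $\mathcal{X},\mathcal{Y}$ (full, isomorphism-closed) subcategories. $\mathcal{X}*\mathcal{Y}$ is the subcategory of objects $M$ admitting an exact triangle $X\to M\to Y\to\Sigma X$ with $X\in\mathcal{X}$, $Y\in\mathcal{Y}$. $\langle\mathcal{X}\rangle$ is the smallest subcategory of $\mathcal{T}$ containing $\mathcal{X}$ and closed under finite direct sums, direct summands and shifts. Set $\langle\mathcal{X}\rangle_0=\{0\}$, $\langle\mathcal{X}\rangle_1=\langle\mathcal{X}\rangle$ and $\langle\mathcal{X}\rangle_n=\langle\langle\mathcal{X}\rangle*\langle\mathcal{X}\rangle_{n-1}\rangle$ for $n\ge2$. For an object $G$, $\langle G\rangle_n$ means $\langle\{G\}\rangle_n$. The dimension $\dim\mathcal{T}$ of a triangulated category is the infimum of the integers $d$ such that $\mathcal{T}=\langle M\rangle_{d+1}$ for some object $M\in\mathcal{T}$ ($\infty$ if there is none). *)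

theory Defs
  imports "HOL-Algebra.Module" "HOL-Algebra.Ring_Divisibility" "HOL-Library.Extended_Real"
begin

section \<open>Krull dimension, Assh and localization\<close>

definition prime_chain :: "('a, 'r) ring_scheme \<Rightarrow> nat \<Rightarrow> (nat \<Rightarrow> 'a set) \<Rightarrow> bool" where
  "prime_chain R n P \<longleftrightarrow> (\<forall>i\<le>n. primeideal (P i) R) \<and> (\<forall>i<n. P i \<subset> P (Suc i))"

text \<open>The value is \<open>-\<infinity>\<close> exactly for the zero ring, and \<open>\<infinity>\<close> if chains of primes are arbitrarily long.\<close>

definition krull_dim :: "('a, 'r) ring_scheme \<Rightarrow> ereal" where
  "krull_dim R = (SUP n \<in> {n. \<exists>P. prime_chain R n P}. ereal (real n))"

definition Assh :: "('a, 'r) ring_scheme \<Rightarrow> 'a set set" where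
  "Assh R = {p. primeideal p R \<and> krull_dim (R Quot p) = krull_dim R}"

definition frac_rel :: "('a, 'r) ring_scheme \<Rightarrow> 'a set \<Rightarrow> (('a \<times> 'a) \<times> ('a \<times> 'a)) set" where
  "frac_rel R S = {((a, s), (b, t)). a \<in> carrier R \<and> s \<in> S \<and> b \<in> carrier R \<and> t \<in> S \<and>
     (\<exists>u\<in>S. u \<otimes>\<^bsub>R\<^esub> (t \<otimes>\<^bsub>R\<^esub> a \<ominus>\<^bsub>R\<^esub> s \<otimes>\<^bsub>R\<^esub> b) = \<zero>\<^bsub>R\<^esub>)}"

definition fraction :: "('a, 'r) ring_scheme \<Rightarrow> 'a set \<Rightarrow> 'a \<Rightarrow> 'a \<Rightarrow> ('a \<times> 'a) set" where
  "fraction R S a s = frac_rel R S `` {(a, s)}"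

text \<open>The ring of fractions \<open>S\<^sup>-\<^sup>1R\<close> for a multiplicative set \<open>S\<close>; operations on classes are unions
  over representatives.\<close>

definition ring_of_fractions :: "('a, 'r) ring_scheme \<Rightarrow> 'a set \<Rightarrow> ('a \<times> 'a) set ring" where
  "ring_of_fractions R S =
    \<lparr>carrier = (carrier R \<times> S) // frac_rel R S,
     mult = (\<lambda>X Y. \<Union>(a, s)\<in>X. \<Union>(b, t)\<in>Y. fraction R S (a \<otimes>\<^bsub>R\<^esub> b) (s \<otimes>\<^bsub>R\<^esub> t)),
     one = fraction R S \<one>\<^bsub>R\<^esub> \<one>\<^bsub>R\<^esub>,
     zero = fraction R S \<zero>\<^bsub>R\<^esub> \<one>\<^bsub>R\<^esub>,
     add = (\<lambda>X Y. \<Union>(a, s)\<in>X. \<Union>(b, t)\<in>Y.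
              fraction R S (t \<otimes>\<^bsub>R\<^esub> a \<oplus>\<^bsub>R\<^esub> s \<otimes>\<^bsub>R\<^esub> b) (s \<otimes>\<^bsub>R\<^esub> t))\<rparr>"

definition localization_at :: "('a, 'r) ring_scheme \<Rightarrow> 'a set \<Rightarrow> ('a \<times> 'a) set ring" where
  "localization_at R p = ring_of_fractions R (carrier R - p)"


section \<open>Dimension of a triangulated category\<close>

text \<open>Morphisms need not determine their source and target, so composition, addition and the shift
  of morphisms take the objects as arguments: \<open>hom_comp C X Y Z g f\<close> is \<open>g \<circ> f\<close> for \<open>f : X \<rightarrow> Y\<close> and
  \<open>g : Y \<rightarrow> Z\<close>. A triangle \<open>X \<rightarrow> Y \<rightarrow> Z \<rightarrow> \<Sigma>X\<close> with maps \<open>f\<close>, \<open>g\<close>, \<open>h\<close> is the tuple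
  \<open>(X, Y, Z, f, g, h)\<close>. The records carry the data of an additive and of a triangulated category;
  the axioms play no role in the definition of the dimension.\<close>

record ('o, 'h) additive_cat =
  obj :: "'o set"
  hom_set :: "'o \<Rightarrow> 'o \<Rightarrow> 'h set"
  ident :: "'o \<Rightarrow> 'h"
  hom_comp :: "'o \<Rightarrow> 'o \<Rightarrow> 'o \<Rightarrow> 'h \<Rightarrow> 'h \<Rightarrow> 'h"
  zero_hom :: "'o \<Rightarrow> 'o \<Rightarrow> 'h"
  add_hom :: "'o \<Rightarrow> 'o \<Rightarrow> 'h \<Rightarrow> 'h \<Rightarrow> 'h"

record ('o, 'h) triangulated_cat = "('o, 'h) additive_cat" +
  shift_obj :: "'o \<Rightarrow> 'o"
  shift_hom :: "'o \<Rightarrow> 'o \<Rightarrow> 'h \<Rightarrow> 'h"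
  exact_triangles :: "('o \<times> 'o \<times> 'o \<times> 'h \<times> 'h \<times> 'h) set"

definition is_iso :: "('o, 'h, 'x) additive_cat_scheme \<Rightarrow> 'o \<Rightarrow> 'o \<Rightarrow> 'h \<Rightarrow> bool" where
  "is_iso C X Y f \<longleftrightarrow> f \<in> hom_set C X Y \<and>
     (\<exists>g\<in>hom_set C Y X. hom_comp C X Y X g f = ident C X \<and> hom_comp C Y X Y f g = ident C Y)"

definition isomorphic :: "('o, 'h, 'x) additive_cat_scheme \<Rightarrow> 'o \<Rightarrow> 'o \<Rightarrow> bool" where
  "isomorphic C X Y \<longleftrightarrow> (\<exists>f. is_iso C X Y f)"

definition zero_objects :: "('o, 'h, 'x) additive_cat_scheme \<Rightarrow> 'o set" where
  "zero_objects C = {X \<in> obj C. ident C X = zero_hom C X X}"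

text \<open>\<open>Z\<close> is a direct sum (biproduct) of \<open>X\<close> and \<open>Y\<close>.\<close>

definition direct_sum :: "('o, 'h, 'x) additive_cat_scheme \<Rightarrow> 'o \<Rightarrow> 'o \<Rightarrow> 'o \<Rightarrow> bool" where
  "direct_sum C X Y Z \<longleftrightarrow>
     (\<exists>i\<in>hom_set C X Z. \<exists>j\<in>hom_set C Y Z. \<exists>p\<in>hom_set C Z X. \<exists>q\<in>hom_set C Z Y.
        hom_comp C X Z X p i = ident C X \<and> hom_comp C Y Z Y q j = ident C Y \<and>
        hom_comp C Y Z X p j = zero_hom C Y X \<and> hom_comp C X Z Y q i = zero_hom C X Y \<and>
        add_hom C Z Z (hom_comp C Z X Z i p) (hom_comp C Z Y Z j q) = ident C Z)"

inductive_set gen :: "('o, 'h, 'x) triangulated_cat_scheme \<Rightarrow> 'o set \<Rightarrow> 'o set"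
  for T :: "('o, 'h, 'x) triangulated_cat_scheme" and S :: "'o set" where
  base: "X \<in> S \<Longrightarrow> X \<in> obj T \<Longrightarrow> X \<in> gen T S"
| iso: "X \<in> gen T S \<Longrightarrow> Y \<in> obj T \<Longrightarrow> isomorphic T X Y \<Longrightarrow> Y \<in> gen T S"
| empty_sum: "Z \<in> zero_objects T \<Longrightarrow> Z \<in> gen T S"
| binary_sum: "X \<in> gen T S \<Longrightarrow> Y \<in> gen T S \<Longrightarrow> Z \<in> obj T \<Longrightarrow> direct_sum T X Y Z \<Longrightarrow> Z \<in> gen T S"
| summand: "Z \<in> gen T S \<Longrightarrow> X \<in> obj T \<Longrightarrow> Y \<in> obj T \<Longrightarrow> direct_sum T X Y Z \<Longrightarrow> X \<in> gen T S"
| shift: "X \<in> gen T S \<Longrightarrow> shift_obj T X \<in> gen T S"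
| unshift: "shift_obj T X \<in> gen T S \<Longrightarrow> X \<in> obj T \<Longrightarrow> X \<in> gen T S"

definition star :: "('o, 'h, 'x) triangulated_cat_scheme \<Rightarrow> 'o set \<Rightarrow> 'o set \<Rightarrow> 'o set" where
  "star T A B = {M \<in> obj T. \<exists>X\<in>A. \<exists>Y\<in>B. \<exists>f g h. (X, M, Y, f, g, h) \<in> exact_triangles T}"

fun gen_n :: "('o, 'h, 'x) triangulated_cat_scheme \<Rightarrow> 'o set \<Rightarrow> nat \<Rightarrow> 'o set" where
  "gen_n T S 0 = zero_objects T"
| "gen_n T S (Suc 0) = gen T S"
| "gen_n T S (Suc (Suc n)) = gen T (star T (gen T S) (gen_n T S (Suc n)))"

text \<open>Here \<open>n = d + 1\<close>; the value \<open>d = -1\<close> occurs only for the zero category, and the infimum of the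
  empty set is \<open>\<infinity>\<close>.\<close>

definition triangulated_dim :: "('o, 'h, 'x) triangulated_cat_scheme \<Rightarrow> ereal" where
  "triangulated_dim T = (INF n \<in> {n. \<exists>M\<in>obj T. gen_n T {M} n = obj T}. ereal (real n - 1))"


section \<open>Bounded complexes of finitely generated modules\<close>

definition fg_module :: "('a, 'r) ring_scheme \<Rightarrow> ('a, 'm) module \<Rightarrow> bool" where
  "fg_module R M \<longleftrightarrow> module R M \<and>
     (\<exists>A. finite A \<and> A \<subseteq> carrier M \<and> (\<forall>N. submodule N R M \<and> A \<subseteq> N \<longrightarrow> N = carrier M))"

definition mod_hom ::
    "('a, 'r) ring_scheme \<Rightarrow> ('a, 'm) module \<Rightarrow> ('a, 'n) module \<Rightarrow> ('m \<Rightarrow> 'n) set" where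
  "mod_hom R M N = {f. f \<in> carrier M \<rightarrow> carrier N \<and>
     (\<forall>x\<in>carrier M. \<forall>y\<in>carrier M. f (x \<oplus>\<^bsub>M\<^esub> y) = f x \<oplus>\<^bsub>N\<^esub> f y) \<and>
     (\<forall>r\<in>carrier R. \<forall>x\<in>carrier M. f (r \<odot>\<^bsub>M\<^esub> x) = r \<odot>\<^bsub>N\<^esub> f x)}"

text \<open>Complexes are graded cohomologically.\<close>

record ('a, 'm) cochain =
  ob :: "int \<Rightarrow> ('a, 'm) module"
  df :: "int \<Rightarrow> 'm \<Rightarrow> 'm"

definition bounded_complexes :: "('a, 'r) ring_scheme \<Rightarrow> ('a, 'm) cochain set" where
  "bounded_complexes R = {X.
     (\<forall>n. fg_module R (ob X n)) \<and>
     (\<forall>n. df X n \<in> mod_hom R (ob X n) (ob X (n + 1))) \<and>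
     (\<forall>n. \<forall>x\<in>carrier (ob X n). df X (n + 1) (df X n x) = \<zero>\<^bsub>ob X (n + 1 + 1)\<^esub>) \<and>
     (\<exists>b. \<forall>n. \<bar>n\<bar> > b \<longrightarrow> carrier (ob X n) = {\<zero>\<^bsub>ob X n\<^esub>})}"

type_synonym 'm graded_map = "int \<Rightarrow> 'm \<Rightarrow> 'm"

definition graded_comp :: "'m graded_map \<Rightarrow> 'm graded_map \<Rightarrow> 'm graded_map"  (infixl \<open>\<circ>\<circ>\<close> 55) where
  "g \<circ>\<circ> f = (\<lambda>n. g n \<circ> f n)"

definition chain_maps ::
    "('a, 'r) ring_scheme \<Rightarrow> ('a, 'm) cochain \<Rightarrow> ('a, 'm) cochain \<Rightarrow> 'm graded_map set" where
  "chain_maps R X Y = {f.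
     (\<forall>n. f n \<in> mod_hom R (ob X n) (ob Y n)) \<and>
     (\<forall>n. \<forall>x\<in>carrier (ob X n). f (n + 1) (df X n x) = df Y n (f n x))}"

definition homotopic :: "('a, 'r) ring_scheme \<Rightarrow> ('a, 'm) cochain \<Rightarrow> ('a, 'm) cochain \<Rightarrow>
    'm graded_map \<Rightarrow> 'm graded_map \<Rightarrow> bool" where
  "homotopic R X Y f g \<longleftrightarrow>
     (\<exists>h. (\<forall>n. h n \<in> mod_hom R (ob X n) (ob Y (n - 1))) \<and>
          (\<forall>n. \<forall>x\<in>carrier (ob X n).
             f n x \<ominus>\<^bsub>ob Y n\<^esub> g n x = df Y (n - 1) (h n x) \<oplus>\<^bsub>ob Y n\<^esub> h (n + 1) (df X n x)))"

definition cocycles :: "('a, 'm) cochain \<Rightarrow> int \<Rightarrow> 'm set" where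
  "cocycles X n = {x \<in> carrier (ob X n). df X n x = \<zero>\<^bsub>ob X (n + 1)\<^esub>}"

definition coboundaries :: "('a, 'm) cochain \<Rightarrow> int \<Rightarrow> 'm set" where
  "coboundaries X n = df X (n - 1) ` carrier (ob X (n - 1))"

definition cohomology :: "('a, 'm) cochain \<Rightarrow> int \<Rightarrow> 'm set set" where
  "cohomology X n = (\<lambda>z. coboundaries X n +>\<^bsub>ob X n\<^esub> z) ` cocycles X n"

text \<open>The map induced on cohomology by \<open>f : X \<rightarrow> Y\<close> (only the target complex enters the formula).\<close>

definition cohomology_map :: "('a, 'm) cochain \<Rightarrow> 'm graded_map \<Rightarrow> int \<Rightarrow> 'm set \<Rightarrow> 'm set" where
  "cohomology_map Y f n c = (\<Union>z\<in>c. coboundaries Y n +>\<^bsub>ob Y n\<^esub> f n z)"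

definition quasi_isos ::
    "('a, 'r) ring_scheme \<Rightarrow> ('a, 'm) cochain \<Rightarrow> ('a, 'm) cochain \<Rightarrow> 'm graded_map set" where
  "quasi_isos R X Y = {f \<in> chain_maps R X Y.
     \<forall>n. bij_betw (cohomology_map Y f n) (cohomology X n) (cohomology Y n)}"

definition shift_complex :: "('a, 'm) cochain \<Rightarrow> ('a, 'm) cochain" where
  "shift_complex X =
     \<lparr>ob = (\<lambda>n. ob X (n + 1)), df = (\<lambda>n x. \<ominus>\<^bsub>ob X (n + 1 + 1)\<^esub> df X (n + 1) x)\<rparr>"

definition shift_map :: "'m graded_map \<Rightarrow> 'm graded_map" where
  "shift_map f = (\<lambda>n. f (n + 1))"


section \<open>The bounded derived category\<close>

text \<open>
  The derived category is the localization of the homotopy category of bounded complexes at the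
  quasi-isomorphisms. A roof \<open>(Z, s, f)\<close> represents the morphism \<open>f \<circ> s\<^sup>-\<^sup>1\<close> for a
  quasi-isomorphism \<open>s : Z \<rightarrow> X\<close> and a chain map \<open>f : Z \<rightarrow> Y\<close>; morphisms are equivalence classes of
  roofs, and operations on them are unions over representatives.
\<close>

type_synonym ('a, 'm) roof = "('a, 'm) cochain \<times> 'm graded_map \<times> 'm graded_map"

definition roofs ::
    "('a, 'r) ring_scheme \<Rightarrow> ('a, 'm) cochain \<Rightarrow> ('a, 'm) cochain \<Rightarrow> ('a, 'm) roof set" where
  "roofs R X Y = {(Z, s, f). Z \<in> bounded_complexes R \<and> s \<in> quasi_isos R Z X \<and> f \<in> chain_maps R Z Y}"

definition roof_rel :: "('a, 'r) ring_scheme \<Rightarrow> ('a, 'm) cochain \<Rightarrow> ('a, 'm) cochain \<Rightarrow>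
    (('a, 'm) roof \<times> ('a, 'm) roof) set" where
  "roof_rel R X Y = {((Z, s, f), (Z', s', f')).
     (Z, s, f) \<in> roofs R X Y \<and> (Z', s', f') \<in> roofs R X Y \<and>
     (\<exists>W\<in>bounded_complexes R. \<exists>u\<in>chain_maps R W Z. \<exists>u'\<in>chain_maps R W Z'.
        s \<circ>\<circ> u \<in> quasi_isos R W X \<and>
        homotopic R W X (s \<circ>\<circ> u) (s' \<circ>\<circ> u') \<and> homotopic R W Y (f \<circ>\<circ> u) (f' \<circ>\<circ> u'))}"

definition roof_class :: "('a, 'r) ring_scheme \<Rightarrow> ('a, 'm) cochain \<Rightarrow> ('a, 'm) cochain \<Rightarrow>
    ('a, 'm) roof \<Rightarrow> ('a, 'm) roof set" where
  "roof_class R X Y \<rho> = roof_rel R X Y `` {\<rho>}"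

definition derived_map :: "('a, 'r) ring_scheme \<Rightarrow> ('a, 'm) cochain \<Rightarrow> ('a, 'm) cochain \<Rightarrow>
    'm graded_map \<Rightarrow> ('a, 'm) roof set" where
  "derived_map R X Y f = roof_class R X Y (X, (\<lambda>n x. x), f)"

text \<open>Roofs \<open>(Z, s, f)\<close> and \<open>(Z', t, g)\<close> compose to \<open>(W, s \<circ> u, g \<circ> v)\<close> for any completion
  \<open>f \<circ> u \<simeq> t \<circ> v\<close> with \<open>u\<close> a quasi-isomorphism.\<close>

definition derived_comp :: "('a, 'r) ring_scheme \<Rightarrow> ('a, 'm) cochain \<Rightarrow> ('a, 'm) cochain \<Rightarrow>
    ('a, 'm) cochain \<Rightarrow> ('a, 'm) roof set \<Rightarrow> ('a, 'm) roof set \<Rightarrow> ('a, 'm) roof set" where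
  "derived_comp R X Y V G F = \<Union>{roof_class R X V (W, s \<circ>\<circ> u, g \<circ>\<circ> v) | W u v Z s f Z' t g.
     (Z, s, f) \<in> F \<and> (Z', t, g) \<in> G \<and> W \<in> bounded_complexes R \<and>
     u \<in> quasi_isos R W Z \<and> v \<in> chain_maps R W Z' \<and> homotopic R W Y (f \<circ>\<circ> u) (t \<circ>\<circ> v)}"

definition derived_add :: "('a, 'r) ring_scheme \<Rightarrow> ('a, 'm) cochain \<Rightarrow> ('a, 'm) cochain \<Rightarrow>
    ('a, 'm) roof set \<Rightarrow> ('a, 'm) roof set \<Rightarrow> ('a, 'm) roof set" where
  "derived_add R X Y F G =
     \<Union>{roof_class R X Y (Z, s, \<lambda>n x. f n x \<oplus>\<^bsub>ob Y n\<^esub> g n x) | Z s f g. (Z, s, f) \<in> F \<and> (Z, s, g) \<in> G}"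

definition derived_shift :: "('a, 'r) ring_scheme \<Rightarrow> ('a, 'm) cochain \<Rightarrow> ('a, 'm) cochain \<Rightarrow>
    ('a, 'm) roof set \<Rightarrow> ('a, 'm) roof set" where
  "derived_shift R X Y F =
     \<Union>{roof_class R (shift_complex X) (shift_complex Y) (shift_complex Z, shift_map s, shift_map f)
        | Z s f. (Z, s, f) \<in> F}"

definition derived_additive ::
    "('a, 'r) ring_scheme \<Rightarrow> (('a, 'm) cochain, ('a, 'm) roof set) additive_cat" where
  "derived_additive R =
     \<lparr>obj = bounded_complexes R,
      hom_set = (\<lambda>X Y. roofs R X Y // roof_rel R X Y),
      ident = (\<lambda>X. derived_map R X X (\<lambda>n x. x)),
      hom_comp = derived_comp R,
      zero_hom = (\<lambda>X Y. derived_map R X Y (\<lambda>n x. \<zero>\<^bsub>ob Y n\<^esub>)),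
      add_hom = derived_add R\<rparr>"

text \<open>
  All modules have to live on one HOL type. Every finitely generated \<open>R\<close>-module is isomorphic to a
  quotient of some \<open>R\<^sup>n\<close>, whose elements are sets of lists over the carrier type of \<open>R\<close>; so the
  modules with elements in the type below exhaust \<open>mod R\<close> up to isomorphism (lemma
  \<open>fg_module_representable\<close>), and \<open>Pr\<close> closes the type under the direct sums needed for mapping
  cones.
\<close>

datatype 'a fg_elem = Cls "'a list set" | Pr (pfst: "'a fg_elem") (psnd: "'a fg_elem")

fun lin_comb :: "('a, 'm, 'x) module_scheme \<Rightarrow> 'a list \<Rightarrow> 'm list \<Rightarrow> 'm" where
  "lin_comb M (c # cs) (x # xs) = c \<odot>\<^bsub>M\<^esub> x \<oplus>\<^bsub>M\<^esub> lin_comb M cs xs"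
| "lin_comb M _ _ = \<zero>\<^bsub>M\<^esub>"

context module
begin

lemma lin_comb_closed: "set cs \<subseteq> carrier R \<Longrightarrow> set xs \<subseteq> carrier M \<Longrightarrow> lin_comb M cs xs \<in> carrier M"
proof (induction xs arbitrary: cs)
  case (Cons x xs)
  then show ?case by (cases cs) auto
qed auto

lemma lin_comb_add:
  "length cs = length xs \<Longrightarrow> length ds = length xs \<Longrightarrow> set cs \<subseteq> carrier R \<Longrightarrow> set ds \<subseteq> carrier R \<Longrightarrow>
   set xs \<subseteq> carrier M \<Longrightarrow>
   lin_comb M (map2 (\<oplus>\<^bsub>R\<^esub>) cs ds) xs = lin_comb M cs xs \<oplus>\<^bsub>M\<^esub> lin_comb M ds xs"
proof (induction xs arbitrary: cs ds)
  case (Cons x xs)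
  then obtain c cs' d ds' where [simp]: "cs = c # cs'" "ds = d # ds'"
    by (metis length_Suc_conv length_Cons)
  show ?case using Cons by (simp add: smult_l_distr lin_comb_closed M.a_ac)
qed auto

lemma lin_comb_smult:
  "length cs = length xs \<Longrightarrow> set cs \<subseteq> carrier R \<Longrightarrow> set xs \<subseteq> carrier M \<Longrightarrow> r \<in> carrier R \<Longrightarrow>
   lin_comb M (map (\<lambda>c. r \<otimes>\<^bsub>R\<^esub> c) cs) xs = r \<odot>\<^bsub>M\<^esub> lin_comb M cs xs"
proof (induction xs arbitrary: cs)
  case (Cons x xs)
  then obtain c cs' where [simp]: "cs = c # cs'"
    by (metis length_Suc_conv length_Cons)
  show ?case using Cons by (simp add: smult_r_distr smult_assoc1 lin_comb_closed)
qed auto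

lemma lin_comb_unit:
  "x \<in> set xs \<Longrightarrow> set xs \<subseteq> carrier M \<Longrightarrow>
   \<exists>cs. length cs = length xs \<and> set cs \<subseteq> carrier R \<and> lin_comb M cs xs = x"
proof (induction xs)
  case (Cons y xs)
  have z: "lin_comb M (map (\<lambda>_. \<zero>\<^bsub>R\<^esub>) xs) xs = \<zero>\<^bsub>M\<^esub>" if "set xs \<subseteq> carrier M"
    using that by (induction xs) auto
  show ?case
  proof (cases "x = y")
    case True
    then show ?thesis using Cons z by (intro exI[of _ "\<one>\<^bsub>R\<^esub> # map (\<lambda>_. \<zero>\<^bsub>R\<^esub>) xs"]) auto
  next
    case False
    then obtain cs where "length cs = length xs" "set cs \<subseteq> carrier R" "lin_comb M cs xs = x"
      using Cons by auto
    then show ?thesis using Cons False by (intro exI[of _ "\<zero>\<^bsub>R\<^esub> # cs"]) auto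
  qed
qed auto

lemma lin_comb_submodule:
  assumes xs: "set xs \<subseteq> carrier M"
  shows "submodule {lin_comb M cs xs | cs. length cs = length xs \<and> set cs \<subseteq> carrier R} R M"
    (is "submodule ?N R M")
proof -
  have sm: "r \<odot>\<^bsub>M\<^esub> x \<in> ?N" if r: "r \<in> carrier R" and x: "x \<in> ?N" for r x
  proof -
    obtain cs where "length cs = length xs" "set cs \<subseteq> carrier R" "x = lin_comb M cs xs"
      using x by blast
    moreover from this have "set (map (\<lambda>c. r \<otimes>\<^bsub>R\<^esub> c) cs) \<subseteq> carrier R" using r by auto
    ultimately have "r \<odot>\<^bsub>M\<^esub> x = lin_comb M (map (\<lambda>c. r \<otimes>\<^bsub>R\<^esub> c) cs) xs \<and>
        length (map (\<lambda>c. r \<otimes>\<^bsub>R\<^esub> c) cs) = length xs \<and> set (map (\<lambda>c. r \<otimes>\<^bsub>R\<^esub> c) cs) \<subseteq> carrier R"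
      using lin_comb_smult[of cs xs r] r xs by (metis length_map)
    then show ?thesis by blast
  qed
  have ad: "x \<oplus>\<^bsub>M\<^esub> y \<in> ?N" if x: "x \<in> ?N" and y: "y \<in> ?N" for x y
  proof -
    obtain cs where cs: "length cs = length xs" "set cs \<subseteq> carrier R" "x = lin_comb M cs xs"
      using x by blast
    obtain ds where ds: "length ds = length xs" "set ds \<subseteq> carrier R" "y = lin_comb M ds xs"
      using y by blast
    have "set (map2 (\<oplus>\<^bsub>R\<^esub>) cs ds) \<subseteq> carrier R"
    proof
      fix c assume "c \<in> set (map2 (\<oplus>\<^bsub>R\<^esub>) cs ds)"
      then obtain a b where ab: "(a, b) \<in> set (zip cs ds)" "c = a \<oplus>\<^bsub>R\<^esub> b" by auto
      have "a \<in> carrier R" "b \<in> carrier R"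
        using set_zip_leftD[OF ab(1)] set_zip_rightD[OF ab(1)] cs(2) ds(2) by blast+
      then show "c \<in> carrier R" by (simp add: ab(2))
    qed
    moreover have "lin_comb M (map2 (\<oplus>\<^bsub>R\<^esub>) cs ds) xs = x \<oplus>\<^bsub>M\<^esub> y"
      using lin_comb_add[of cs xs ds] cs ds xs by simp
    moreover have "length (map2 (\<oplus>\<^bsub>R\<^esub>) cs ds) = length xs" using cs(1) ds(1) by simp
    ultimately show ?thesis by (metis (mono_tags, lifting) mem_Collect_eq)
  qed
  have sub: "?N \<subseteq> carrier M" using xs lin_comb_closed by auto
  have z: "\<zero>\<^bsub>M\<^esub> \<in> ?N"
  proof -
    have l: "lin_comb M (map (\<lambda>_. \<zero>\<^bsub>R\<^esub>) xs) xs \<in> ?N"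
      by (auto intro!: exI[of _ "map (\<lambda>_. \<zero>\<^bsub>R\<^esub>) xs"])
    have "\<zero>\<^bsub>R\<^esub> \<odot>\<^bsub>M\<^esub> lin_comb M (map (\<lambda>_. \<zero>\<^bsub>R\<^esub>) xs) xs = \<zero>\<^bsub>M\<^esub>"
      using l sub by (intro smult_l_null) blast
    then show ?thesis using sm[OF R.zero_closed l] by simp
  qed
  show ?thesis
  proof (rule submoduleI[OF sub z])
    fix a assume a: "a \<in> ?N"
    then have "(\<ominus>\<^bsub>R\<^esub> \<one>\<^bsub>R\<^esub>) \<odot>\<^bsub>M\<^esub> a \<in> ?N" using sm[of "\<ominus>\<^bsub>R\<^esub> \<one>\<^bsub>R\<^esub>" a] by simp
    moreover have "a \<in> carrier M" using a sub by blast
    ultimately show "\<ominus>\<^bsub>M\<^esub> a \<in> ?N" by (simp add: smult_l_minus)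
  next
    fix a b assume "a \<in> ?N" "b \<in> ?N"
    then show "a \<oplus>\<^bsub>M\<^esub> b \<in> ?N" using ad by simp
  next
    fix a x assume "a \<in> carrier R" "x \<in> ?N"
    then show "a \<odot>\<^bsub>M\<^esub> x \<in> ?N" using sm by simp
  qed
qed

end

lemma fg_module_transport:
  fixes R :: "('a, 'r) ring_scheme" and M :: "('a, 'm) module" and e :: "'m \<Rightarrow> 'n"
  assumes M: "fg_module R M" and inj: "inj_on e (carrier M)"
  shows "\<exists>N. fg_module R N \<and> e \<in> mod_hom R M N \<and> bij_betw e (carrier M) (carrier N)"
proof -
  interpret M: module R M using M by (simp add: fg_module_def)
  obtain A where A: "finite A" "A \<subseteq> carrier M" "\<And>N. submodule N R M \<Longrightarrow> A \<subseteq> N \<Longrightarrow> N = carrier M"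
    using M by (auto simp: fg_module_def)
  define d where "d = the_inv_into (carrier M) e"
  have de[simp]: "d (e x) = x" if "x \<in> carrier M" for x
    using that inj by (simp add: d_def the_inv_into_f_f)
  define N :: "('a, 'n) module" where
    "N = \<lparr>carrier = e ` carrier M, mult = undefined, one = undefined, zero = e \<zero>\<^bsub>M\<^esub>,
          add = (\<lambda>p q. e (d p \<oplus>\<^bsub>M\<^esub> d q)), smult = (\<lambda>r p. e (r \<odot>\<^bsub>M\<^esub> d p))\<rparr>"
  have cN: "carrier N = e ` carrier M" and zN: "\<zero>\<^bsub>N\<^esub> = e \<zero>\<^bsub>M\<^esub>"
    and aN: "\<And>x y. x \<in> carrier M \<Longrightarrow> y \<in> carrier M \<Longrightarrow> e x \<oplus>\<^bsub>N\<^esub> e y = e (x \<oplus>\<^bsub>M\<^esub> y)"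
    and sN: "\<And>r x. x \<in> carrier M \<Longrightarrow> r \<odot>\<^bsub>N\<^esub> e x = e (r \<odot>\<^bsub>M\<^esub> x)"
    by (simp_all add: N_def)
  interpret N: module R N
  proof (rule moduleI)
    show "cring R" by (rule M.R.is_cring)
    show "abelian_group N"
    proof (rule abelian_groupI)
      fix x assume "x \<in> carrier N"
      then obtain m where m: "m \<in> carrier M" "x = e m" by (auto simp: cN)
      then have "e (\<ominus>\<^bsub>M\<^esub> m) \<oplus>\<^bsub>N\<^esub> x = \<zero>\<^bsub>N\<^esub>" by (simp add: aN zN M.M.l_neg)
      then show "\<exists>y\<in>carrier N. y \<oplus>\<^bsub>N\<^esub> x = \<zero>\<^bsub>N\<^esub>" using m by (auto simp: cN)
    qed (auto simp: cN zN aN M.M.a_ac)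
  qed (auto simp: cN aN sN M.smult_l_distr M.smult_r_distr M.smult_assoc1)
  have fg: "fg_module R N"
    unfolding fg_module_def
  proof (intro conjI exI[of _ "e ` A"] allI impI)
    show "module R N" by (rule N.module_axioms)
    show "finite (e ` A)" "e ` A \<subseteq> carrier N" using A by (auto simp: cN)
    fix K assume K: "submodule K R N \<and> e ` A \<subseteq> K"
    interpret K: submodule K R N using K by simp
    have KN: "K \<subseteq> carrier N" using K.subset by simp
    have z: "\<zero>\<^bsub>N\<^esub> \<in> K" using K.one_closed by simp
    have ad: "x \<oplus>\<^bsub>N\<^esub> y \<in> K" if "x \<in> K" "y \<in> K" for x y using K.m_closed[OF that] by simp
    let ?K' = "{x \<in> carrier M. e x \<in> K}"
    have "submodule ?K' R M"
    proof (rule M.submoduleI)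
      fix a assume a: "a \<in> ?K'"
      then have "(\<ominus>\<^bsub>R\<^esub> \<one>\<^bsub>R\<^esub>) \<odot>\<^bsub>N\<^esub> e a \<in> K" by (intro K.smult_closed) auto
      then have "e (\<ominus>\<^bsub>M\<^esub> a) \<in> K" using a by (simp add: sN M.smult_l_minus)
      then show "\<ominus>\<^bsub>M\<^esub> a \<in> ?K'" using a by simp
    next
      fix a b assume "a \<in> ?K'" "b \<in> ?K'"
      then show "a \<oplus>\<^bsub>M\<^esub> b \<in> ?K'" using ad[of "e a" "e b"] by (simp add: aN)
    next
      fix r a assume "r \<in> carrier R" "a \<in> ?K'"
      then show "r \<odot>\<^bsub>M\<^esub> a \<in> ?K'" using K.smult_closed[of r "e a"] by (simp add: sN)
    qed (use z in \<open>auto simp: zN\<close>)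
    moreover have "A \<subseteq> ?K'" using A K by auto
    ultimately have "?K' = carrier M" by (rule A(3))
    then show "K = carrier N" using KN by (auto simp: cN)
  qed
  moreover have "e \<in> mod_hom R M N" by (auto simp: mod_hom_def cN aN sN)
  moreover have "bij_betw e (carrier M) (carrier N)" using inj by (auto simp: bij_betw_def cN)
  ultimately show ?thesis by blast
qed

theorem fg_module_representable:
  fixes R :: "('a, 'r) ring_scheme" and M :: "('a, 'm) module"
  assumes M: "fg_module R M"
  shows "\<exists>(N :: ('a, 'a fg_elem) module) e.
    fg_module R N \<and> e \<in> mod_hom R M N \<and> bij_betw e (carrier M) (carrier N)"
proof -
  interpret M: module R M using M by (simp add: fg_module_def)
  obtain A where A: "finite A" "A \<subseteq> carrier M" "\<And>N. submodule N R M \<Longrightarrow> A \<subseteq> N \<Longrightarrow> N = carrier M"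
    using M by (auto simp: fg_module_def)
  obtain xs where xs: "set xs = A" using A(1) finite_list by blast
  have "A \<subseteq> {lin_comb M cs xs | cs. length cs = length xs \<and> set cs \<subseteq> carrier R}"
    using M.lin_comb_unit[of _ xs] A(2) xs by fastforce
  then have gen: "{lin_comb M cs xs | cs. length cs = length xs \<and> set cs \<subseteq> carrier R} = carrier M"
    using A(2,3) M.lin_comb_submodule xs by simp
  define e where "e x = Cls {cs. length cs = length xs \<and> set cs \<subseteq> carrier R \<and> lin_comb M cs xs = x}" for x
  have "inj_on e (carrier M)"
  proof (rule inj_onI)
    fix x y assume "x \<in> carrier M" and eq: "e x = e y"
    then obtain cs where "length cs = length xs" "set cs \<subseteq> carrier R" "x = lin_comb M cs xs"
      using gen by blast
    then show "x = y" using eq by (auto simp: e_def)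
  qed
  from fg_module_transport[OF M this] show ?thesis by blast
qed

text \<open>The fields \<open>mult\<close> and \<open>one\<close> are inherited from the ring record and have no meaning for
  modules.\<close>

definition dsum_module :: "('a, 'a fg_elem) module \<Rightarrow> ('a, 'a fg_elem) module \<Rightarrow> ('a, 'a fg_elem) module"
  where
  "dsum_module M N =
    \<lparr>carrier = {Pr x y | x y. x \<in> carrier M \<and> y \<in> carrier N},
     mult = undefined, one = undefined,
     zero = Pr \<zero>\<^bsub>M\<^esub> \<zero>\<^bsub>N\<^esub>,
     add = (\<lambda>p q. Pr (pfst p \<oplus>\<^bsub>M\<^esub> pfst q) (psnd p \<oplus>\<^bsub>N\<^esub> psnd q)),
     smult = (\<lambda>r p. Pr (r \<odot>\<^bsub>M\<^esub> pfst p) (r \<odot>\<^bsub>N\<^esub> psnd p))\<rparr>"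

definition cone :: "('a, 'a fg_elem) cochain \<Rightarrow> ('a, 'a fg_elem) cochain \<Rightarrow> 'a fg_elem graded_map \<Rightarrow>
    ('a, 'a fg_elem) cochain" where
  "cone X Y f =
    \<lparr>ob = (\<lambda>n. dsum_module (ob X (n + 1)) (ob Y n)),
     df = (\<lambda>n p. Pr (\<ominus>\<^bsub>ob X (n + 1 + 1)\<^esub> df X (n + 1) (pfst p))
                    (f (n + 1) (pfst p) \<oplus>\<^bsub>ob Y (n + 1)\<^esub> df Y n (psnd p)))\<rparr>"

definition cone_in :: "('a, 'a fg_elem) cochain \<Rightarrow> 'a fg_elem graded_map" where
  "cone_in X n y = Pr \<zero>\<^bsub>ob X (n + 1)\<^esub> y"

definition cone_out :: "'a fg_elem graded_map" where
  "cone_out n p = pfst p"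

text \<open>The exact triangles are those isomorphic in the derived category to a cone triangle
  \<open>A \<rightarrow> B \<rightarrow> cone u \<rightarrow> \<Sigma>A\<close> of a chain map \<open>u : A \<rightarrow> B\<close>.\<close>

definition derived_triangles :: "('a, 'r) ring_scheme \<Rightarrow>
    (('a, 'a fg_elem) cochain \<times> ('a, 'a fg_elem) cochain \<times> ('a, 'a fg_elem) cochain \<times>
     ('a, 'a fg_elem) roof set \<times> ('a, 'a fg_elem) roof set \<times> ('a, 'a fg_elem) roof set) set" where
  "derived_triangles R = {(X, Y, Z, f, g, h).
     X \<in> bounded_complexes R \<and> Y \<in> bounded_complexes R \<and> Z \<in> bounded_complexes R \<and>
     f \<in> hom_set (derived_additive R) X Y \<and> g \<in> hom_set (derived_additive R) Y Z \<and>
     h \<in> hom_set (derived_additive R) Z (shift_complex X) \<and>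
     (\<exists>A\<in>bounded_complexes R. \<exists>B\<in>bounded_complexes R. \<exists>u\<in>chain_maps R A B. \<exists>a b c.
        is_iso (derived_additive R) X A a \<and> is_iso (derived_additive R) Y B b \<and>
        is_iso (derived_additive R) Z (cone A B u) c \<and>
        derived_comp R X Y B b f = derived_comp R X A B (derived_map R A B u) a \<and>
        derived_comp R Y Z (cone A B u) c g =
          derived_comp R Y B (cone A B u) (derived_map R B (cone A B u) (cone_in A)) b \<and>
        derived_comp R Z (shift_complex X) (shift_complex A) (derived_shift R X A a) h =
          derived_comp R Z (cone A B u) (shift_complex A)
            (derived_map R (cone A B u) (shift_complex A) cone_out) c)}"

definition Db_mod :: "('a, 'r) ring_scheme \<Rightarrow>
    (('a, 'a fg_elem) cochain, ('a, 'a fg_elem) roof set) triangulated_cat" where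
  "Db_mod R = additive_cat.extend (derived_additive R)
     \<lparr>shift_obj = shift_complex,
      shift_hom = derived_shift R,
      exact_triangles = derived_triangles R\<rparr>"

lemma Db_mod_simps [simp]:
  "obj (Db_mod R) = bounded_complexes R"
  "hom_set (Db_mod R) X Y = roofs R X Y // roof_rel R X Y"
  "ident (Db_mod R) X = derived_map R X X (\<lambda>n x. x)"
  "hom_comp (Db_mod R) = derived_comp R"
  "zero_hom (Db_mod R) X Y = derived_map R X Y (\<lambda>n x. \<zero>\<^bsub>ob Y n\<^esub>)"
  "add_hom (Db_mod R) = derived_add R"
  "shift_obj (Db_mod R) = shift_complex"
  "shift_hom (Db_mod R) = derived_shift R"
  "exact_triangles (Db_mod R) = derived_triangles R"
  by (simp_all add: Db_mod_def derived_additive_def additive_cat.defs)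

end

theory Submission
  imports Defs
begin

text \<open>
  Let \<open>P\<^sub>0 \<subset> \<dots> \<subset> P\<^sub>d\<close> be a chain of primes of maximal length. The field \<open>R\<^sub>p\<close>, \<open>p = P\<^sub>0\<close>, makes every
  bounded complex \<open>G\<close> split generically: for some \<open>t \<notin> p\<close> multiplication by \<open>t\<close> on \<open>G\<close> factors up to
  homotopy through a complex of free modules with zero differential. Hence for every free resolution
  \<open>F\<close> the truncation maps \<open>F\<^sub>\<ge>\<^sub>i \<rightarrow> F\<^sub>\<ge>\<^sub>i\<^sub>+\<^sub>1\<close> induce zero on the cohomology of the tensor product with
  \<open>G\<close> at all primes that do not contain \<open>t\<close>. By the ghost lemma \<open>F\<^sub>\<ge>\<^sub>0 \<rightarrow> F\<^sub>\<ge>\<^sub>n\<close> then induces zero for all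
  objects of \<open>\<langle>G\<rangle>\<^sub>n\<close>, and if this is the whole category, \<open>Tor\<^sub>n(R/J, M)\<close> vanishes at these primes for
  all \<open>J\<close> and all finitely generated \<open>M\<close>. Krull's principal ideal theorem provides a chain of length
  \<open>d - 1\<close> whose primes avoid \<open>t\<close>, and a chain of length \<open>n\<close> ending in \<open>q\<close> produces a nonzero
  \<open>Tor\<^sub>n(R/J, R/I)\<^sub>q\<close>. So \<open>n \<ge> d\<close>.
\<close>

subsection \<open>Linear combinations\<close>

text \<open>Neither localizations nor tensor products nor derived functors are formed. A statement
  at \<open>q\<close> means: after multiplication by some element outside \<open>q\<close>. An
  element of total degree 0 in the tensor product of \<open>F\<close> with \<open>X\<close> is a
  family of vectors whose member of index \<open>p\<close> has entries in \<open>ob X p\<close>; the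
  other total degrees are reached because \<open>ghost\<close> ranges over all starting indices of
  \<open>F\<close>. Truncating \<open>F\<close> just drops the conditions of low index. Morphisms of
  the derived category are classes of roofs, so they act on such families only as relations, total
  and single valued up to coboundaries. As \<open>R\<close> is not assumed local or Cohen-Macaulay,
  no regular sequence yields a nonzero Tor. It comes from a contradiction: if all Tor in degree
  \<open>i + 1\<close> vanish at \<open>q'\<close>, then all Tor in degree \<open>i\<close> vanish
  at each prime \<open>q\<close> strictly below. Descending the chain ends in degree 0 with
  \<open>R/q\<close> against itself at \<open>q\<close>, the residue field. The element
  \<open>t\<close> avoids \<open>P 0\<close> but may lie in \<open>P 1\<close>. Replacing the chain
  by one that avoids \<open>t\<close> costs one prime, and this is the 1 subtracted in the
  bound.\<close>

fun lc :: "('a, 'm, 'x) module_scheme \<Rightarrow> nat \<Rightarrow> (nat \<Rightarrow> 'a) \<Rightarrow> (nat \<Rightarrow> 'm) \<Rightarrow> 'm" where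
  "lc M 0 c z = \<zero>\<^bsub>M\<^esub>"
| "lc M (Suc n) c z = lc M n c z \<oplus>\<^bsub>M\<^esub> c n \<odot>\<^bsub>M\<^esub> z n"

text \<open>\<open>lc\<close> over \<open>regm R\<close> is a dot product, so rows of matrices over
  \<open>R\<close> act by the same function that forms combinations in a module.\<close>

definition regm :: "('a, 'r) ring_scheme \<Rightarrow> ('a, 'a) module" where
  "regm R = \<lparr>carrier = carrier R, mult = mult R, one = one R, zero = zero R, add = add R,
     smult = mult R\<rparr>"

lemma regm_simps [simp]:
  "carrier (regm R) = carrier R" "zero (regm R) = zero R" "add (regm R) = add R"
  "smult (regm R) = mult R"
  by (simp_all add: regm_def)

lemma regm_minus [simp]: "a_inv (regm R) x = a_inv R x" "a_minus (regm R) x y = a_minus R x y"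
  by (simp_all add: a_inv_def a_minus_def m_inv_def)

lemma (in cring) regm_module: "module R (regm R)"
proof (rule moduleI)
  show "abelian_group (regm R)"
    by (rule abelian_groupI) (auto simp: a_ac intro: bexI[of _ "\<ominus> _"] l_neg)
qed (auto simp: m_ac l_distr r_distr intro: is_cring)

lemma a_inv_zero: "abelian_group G \<Longrightarrow> \<ominus>\<^bsub>G\<^esub> \<zero>\<^bsub>G\<^esub> = \<zero>\<^bsub>G\<^esub>"
  by (metis abelian_group.minus_equality abelian_group.axioms(1) abelian_monoid.l_zero abelian_monoid.zero_closed)

lemma lc_cong:
  "(\<And>l. l < n \<Longrightarrow> c l = c' l) \<Longrightarrow> (\<And>l. l < n \<Longrightarrow> z l = z' l) \<Longrightarrow> lc M n c z = lc M n c' z'"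
  by (induction n) auto

lemma lc_mem:
  assumes "\<zero>\<^bsub>M\<^esub> \<in> B" "\<And>x y. x \<in> B \<Longrightarrow> y \<in> B \<Longrightarrow> x \<oplus>\<^bsub>M\<^esub> y \<in> B"
    and "\<And>l. l < n \<Longrightarrow> c l \<odot>\<^bsub>M\<^esub> z l \<in> B"
  shows "lc M n c z \<in> B"
  using assms by (induction n) auto

context module
begin

lemma lc_closed [simp]: "(\<And>l. c l \<in> carrier R) \<Longrightarrow> (\<And>l. z l \<in> carrier M) \<Longrightarrow> lc M n c z \<in> carrier M"
  by (induction n) auto

lemma lc_add:
  "(\<And>l. c l \<in> carrier R) \<Longrightarrow> (\<And>l. z l \<in> carrier M) \<Longrightarrow> (\<And>l. y l \<in> carrier M) \<Longrightarrow>
   lc M n c (\<lambda>l. z l \<oplus>\<^bsub>M\<^esub> y l) = lc M n c z \<oplus>\<^bsub>M\<^esub> lc M n c y"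
  by (induction n) (auto simp: smult_r_distr M.a_ac)

lemma lc_smult:
  "r \<in> carrier R \<Longrightarrow> (\<And>l. c l \<in> carrier R) \<Longrightarrow> (\<And>l. z l \<in> carrier M) \<Longrightarrow>
   lc M n c (\<lambda>l. r \<odot>\<^bsub>M\<^esub> z l) = r \<odot>\<^bsub>M\<^esub> lc M n c z"
  by (induction n) (auto simp: smult_r_distr smult_assoc1[symmetric] R.m_comm)

lemma lc_add_left:
  "(\<And>l. c l \<in> carrier R) \<Longrightarrow> (\<And>l. d l \<in> carrier R) \<Longrightarrow> (\<And>l. z l \<in> carrier M) \<Longrightarrow>
   lc M n (\<lambda>l. c l \<oplus>\<^bsub>R\<^esub> d l) z = lc M n c z \<oplus>\<^bsub>M\<^esub> lc M n d z"
  by (induction n) (auto simp: smult_l_distr M.a_ac)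

lemma lc_smult_left:
  "r \<in> carrier R \<Longrightarrow> (\<And>l. c l \<in> carrier R) \<Longrightarrow> (\<And>l. z l \<in> carrier M) \<Longrightarrow>
   lc M n (\<lambda>l. r \<otimes>\<^bsub>R\<^esub> c l) z = r \<odot>\<^bsub>M\<^esub> lc M n c z"
  by (induction n) (auto simp: smult_r_distr smult_assoc1)

lemma lc_zero: "(\<And>l. l < n \<Longrightarrow> c l \<in> carrier R) \<Longrightarrow> (\<And>l. l < n \<Longrightarrow> z l = \<zero>\<^bsub>M\<^esub>) \<Longrightarrow> lc M n c z = \<zero>\<^bsub>M\<^esub>"
  by (induction n) auto

lemma lc_zero_left: "(\<And>l. l < n \<Longrightarrow> c l = \<zero>\<^bsub>R\<^esub>) \<Longrightarrow> (\<And>l. l < n \<Longrightarrow> z l \<in> carrier M) \<Longrightarrow> lc M n c z = \<zero>\<^bsub>M\<^esub>"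
  by (induction n) auto

lemma lc_minus:
  "(\<And>l. c l \<in> carrier R) \<Longrightarrow> (\<And>l. z l \<in> carrier M) \<Longrightarrow>
   lc M n c (\<lambda>l. \<ominus>\<^bsub>M\<^esub> z l) = \<ominus>\<^bsub>M\<^esub> lc M n c z"
  by (induction n) (auto simp: smult_r_minus M.minus_add a_inv_zero[OF M.abelian_group_axioms])

lemma lc_minus_left:
  "(\<And>l. c l \<in> carrier R) \<Longrightarrow> (\<And>l. z l \<in> carrier M) \<Longrightarrow>
   lc M n (\<lambda>l. \<ominus>\<^bsub>R\<^esub> c l) z = \<ominus>\<^bsub>M\<^esub> lc M n c z"
  by (induction n) (auto simp: smult_l_minus M.minus_add a_inv_zero[OF M.abelian_group_axioms])

lemma lc_diff:
  "(\<And>l. c l \<in> carrier R) \<Longrightarrow> (\<And>l. z l \<in> carrier M) \<Longrightarrow> (\<And>l. y l \<in> carrier M) \<Longrightarrow>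
   lc M n c (\<lambda>l. z l \<ominus>\<^bsub>M\<^esub> y l) = lc M n c z \<ominus>\<^bsub>M\<^esub> lc M n c y"
  by (simp add: a_minus_def lc_add lc_minus)

lemma lc_append:
  "(\<And>l. c l \<in> carrier R) \<Longrightarrow> (\<And>l. z l \<in> carrier M) \<Longrightarrow>
   lc M (a + b) c z = lc M a c z \<oplus>\<^bsub>M\<^esub> lc M b (\<lambda>l. c (a + l)) (\<lambda>l. z (a + l))"
  by (induction b) (auto simp: M.a_ac)

lemma lc_unit_left:
  "(\<And>l. z l \<in> carrier M) \<Longrightarrow>
   lc M n (\<lambda>l. if l = k then \<one>\<^bsub>R\<^esub> else \<zero>\<^bsub>R\<^esub>) z = (if k < n then z k else \<zero>\<^bsub>M\<^esub>)"
proof (induction n)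
  case (Suc n)
  then show ?case by (cases "k = n") auto
qed simp

text \<open>Interchange of summation. With \<open>B\<close> read as a matrix it is associativity of
  matrix multiplication, the form in which composites of differentials and chain maps are computed
  below.\<close>

lemma lc_lc:
  assumes "\<And>l. c l \<in> carrier R" "\<And>l i. B l i \<in> carrier R" "\<And>l. z l \<in> carrier M"
  shows "lc M n c (\<lambda>l. lc M m (B l) z) = lc M m (\<lambda>i. lc (regm R) n c (\<lambda>l. B l i)) z"
proof (induction n)
  interpret r: module R "regm R" by (rule R.regm_module)
  case 0
  show ?case using assms by (simp add: lc_zero_left)
next
  interpret r: module R "regm R" by (rule R.regm_module)
  case (Suc n)
  have "\<And>i. lc (regm R) n c (\<lambda>l. B l i) \<in> carrier R"
    using r.lc_closed[of c "\<lambda>l. B l _" n] assms by simp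
  then show ?case using Suc assms by (simp add: lc_add_left lc_smult_left)
qed

end

lemma (in cring) lc_unit_right:
  "(\<And>l. c l \<in> carrier R) \<Longrightarrow>
   lc (regm R) n c (\<lambda>l. if l = k then \<one> else \<zero>) = (if k < n then c k else \<zero>)"
proof (induction n)
  case (Suc n)
  then show ?case by (cases "k = n") auto
qed simp

text \<open>Generators of an ideal enter as vectors, matrix rows as coefficients; this passes from
  one convention to the other.\<close>

lemma (in cring) lc_regm_comm:
  "(\<And>l. c l \<in> carrier R) \<Longrightarrow> (\<And>l. z l \<in> carrier R) \<Longrightarrow> lc (regm R) n c z = lc (regm R) n z c"
  by (induction n) (auto simp: m_comm)

lemma lc_hom:
  fixes M :: "('a, 'm) module" and N :: "('a, 'n) module"
  assumes M: "module R M" and N: "module R N" and f: "f \<in> mod_hom R M N"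
    and "\<And>l. c l \<in> carrier R" "\<And>l. z l \<in> carrier M"
  shows "f (lc M n c z) = lc N n c (\<lambda>l. f (z l))"
proof (induction n)
  interpret M: module R M by fact
  interpret N: module R N by fact
  case 0
  have "f (\<zero>\<^bsub>R\<^esub> \<odot>\<^bsub>M\<^esub> \<zero>\<^bsub>M\<^esub>) = \<zero>\<^bsub>R\<^esub> \<odot>\<^bsub>N\<^esub> f \<zero>\<^bsub>M\<^esub>"
    using f by (simp add: mod_hom_def del: M.smult_r_null M.smult_l_null)
  moreover have "f \<zero>\<^bsub>M\<^esub> \<in> carrier N" using f by (auto simp: mod_hom_def)
  ultimately show ?case by simp
next
  interpret M: module R M by fact
  interpret N: module R N by fact
  case (Suc n)
  then show ?case using assms by (auto simp: mod_hom_def)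
qed

subsection \<open>Ideals of a Noetherian ring\<close>

locale noeth_cring = cring R + noetherian_ring R for R (structure)

definition colon :: "('a, 'r) ring_scheme \<Rightarrow> 'a set \<Rightarrow> 'a \<Rightarrow> 'a set" where
  "colon R I a = {r \<in> carrier R. r \<otimes>\<^bsub>R\<^esub> a \<in> I}"

definition ideal_plus :: "('a, 'r) ring_scheme \<Rightarrow> 'a set \<Rightarrow> 'a \<Rightarrow> 'a set" where
  "ideal_plus R I a = {i \<oplus>\<^bsub>R\<^esub> r \<otimes>\<^bsub>R\<^esub> a | i r. i \<in> I \<and> r \<in> carrier R}"

lemma primeideal_mult_compl:
  "primeideal q R \<Longrightarrow> s \<in> carrier R - q \<Longrightarrow> t \<in> carrier R - q \<Longrightarrow> s \<otimes>\<^bsub>R\<^esub> t \<in> carrier R - q"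
  by (meson DiffD1 DiffD2 DiffI cring.cring_simprules(5) primeideal.I_prime primeideal.axioms(2))

lemma primeideal_one_compl: "primeideal q R \<Longrightarrow> \<one>\<^bsub>R\<^esub> \<in> carrier R - q"
  by (metis DiffI cring.cring_simprules(6) ideal.one_imp_carrier primeideal.I_notcarr
      primeideal.axioms(1) primeideal.axioms(2))

section \<open>Ideal arithmetic, common denominators and Nakayama's lemma\<close>

context cring
begin

lemma cring_idealI:
  assumes "I \<subseteq> carrier R" "\<zero> \<in> I" "\<And>x y. x \<in> I \<Longrightarrow> y \<in> I \<Longrightarrow> x \<oplus> y \<in> I"
    and m: "\<And>r x. r \<in> carrier R \<Longrightarrow> x \<in> I \<Longrightarrow> r \<otimes> x \<in> I"
  shows "ideal I R"
proof (rule idealI)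
  show "subgroup I (add_monoid R)"
  proof
    fix x assume x: "x \<in> I"
    then have "(\<ominus> \<one>) \<otimes> x \<in> I" "x \<in> carrier R" using m assms(1) by auto
    then have "\<ominus> x \<in> I" by (simp add: l_minus)
    then show "inv\<^bsub>add_monoid R\<^esub> x \<in> I" by (simp add: a_inv_def)
  qed (use assms in auto)
  fix a x assume "a \<in> I" "x \<in> carrier R"
  then show "x \<otimes> a \<in> I" "a \<otimes> x \<in> I" using assms m_comm by (metis subsetD)+
qed (rule ring_axioms)

lemma ideal_sub: "ideal I R \<Longrightarrow> x \<in> I \<Longrightarrow> x \<in> carrier R"
  by (rule ideal.Icarr)

lemma ideal_zero: "ideal I R \<Longrightarrow> \<zero> \<in> I"
  by (simp add: additive_subgroup.zero_closed ideal.axioms(1))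

lemma ideal_add: "ideal I R \<Longrightarrow> x \<in> I \<Longrightarrow> y \<in> I \<Longrightarrow> x \<oplus> y \<in> I"
  by (simp add: additive_subgroup.a_closed ideal.axioms(1))

lemma ideal_minus: "ideal I R \<Longrightarrow> x \<in> I \<Longrightarrow> \<ominus> x \<in> I"
  by (simp add: additive_subgroup.a_inv_closed ideal.axioms(1))

lemma ideal_diff: "ideal I R \<Longrightarrow> x \<in> I \<Longrightarrow> y \<in> I \<Longrightarrow> x \<ominus> y \<in> I"
  by (simp add: a_minus_def ideal_add ideal_minus)

lemma ideal_mult: "ideal I R \<Longrightarrow> x \<in> I \<Longrightarrow> r \<in> carrier R \<Longrightarrow> r \<otimes> x \<in> I"
  by (rule ideal.I_l_closed)

lemma ideal_mult_right: "ideal I R \<Longrightarrow> x \<in> I \<Longrightarrow> r \<in> carrier R \<Longrightarrow> x \<otimes> r \<in> I"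
  by (rule ideal.I_r_closed)

lemma ideal_lc:
  assumes "ideal I R" "\<And>l. l < n \<Longrightarrow> c l \<in> carrier R" "\<And>l. l < n \<Longrightarrow> z l \<in> I"
  shows "lc (regm R) n c z \<in> I"
  by (rule lc_mem) (use assms in \<open>auto simp: ideal_zero ideal_add ideal_mult\<close>)

lemma lc_regm_closed [simp]:
  "(\<And>l. c l \<in> carrier R) \<Longrightarrow> (\<And>l. z l \<in> carrier R) \<Longrightarrow> lc (regm R) n c z \<in> carrier R"
  using module.lc_closed[OF regm_module] by fastforce

lemma colon_ideal: assumes I: "ideal I R" and a: "a \<in> carrier R" shows "ideal (colon R I a) R"
  by (rule cring_idealI)
    (use a ideal_zero[OF I] in \<open>auto simp: colon_def l_distr m_assoc ideal_add[OF I] ideal_mult[OF I]\<close>)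

lemma colon_sub: "ideal I R \<Longrightarrow> a \<in> carrier R \<Longrightarrow> I \<subseteq> colon R I a"
  by (auto simp: colon_def ideal_sub ideal_mult_right)

lemma ideal_plus_ideal: assumes I: "ideal I R" and a: "a \<in> carrier R" shows "ideal (ideal_plus R I a) R"
proof (rule cring_idealI)
  note s = ideal_sub[OF I]
  show "ideal_plus R I a \<subseteq> carrier R" using a s by (auto simp: ideal_plus_def)
  have "\<zero> = \<zero> \<oplus> \<zero> \<otimes> a" using a by simp
  then show "\<zero> \<in> ideal_plus R I a" using ideal_zero[OF I] unfolding ideal_plus_def by blast
next
  fix x y assume "x \<in> ideal_plus R I a" "y \<in> ideal_plus R I a"
  then obtain i r j t where h: "i \<in> I" "r \<in> carrier R" "x = i \<oplus> r \<otimes> a" "j \<in> I" "t \<in> carrier R" "y = j \<oplus> t \<otimes> a"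
    unfolding ideal_plus_def by blast
  then have c: "i \<in> carrier R" "j \<in> carrier R" using ideal_sub[OF I] by auto
  then have "x \<oplus> y = (i \<oplus> j) \<oplus> (r \<oplus> t) \<otimes> a" using h a by (simp add: l_distr a_ac)
  then show "x \<oplus> y \<in> ideal_plus R I a" using h ideal_add[OF I] unfolding ideal_plus_def by blast
next
  fix u x assume u: "u \<in> carrier R" and "x \<in> ideal_plus R I a"
  then obtain i r where h: "i \<in> I" "r \<in> carrier R" "x = i \<oplus> r \<otimes> a"
    unfolding ideal_plus_def by blast
  then have "u \<otimes> x = u \<otimes> i \<oplus> (u \<otimes> r) \<otimes> a" using a u ideal_sub[OF I] by (simp add: r_distr m_assoc)
  then show "u \<otimes> x \<in> ideal_plus R I a" using h u ideal_mult[OF I] unfolding ideal_plus_def by blast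
qed

lemma ideal_plusI: "i \<in> I \<Longrightarrow> r \<in> carrier R \<Longrightarrow> i \<oplus> r \<otimes> a \<in> ideal_plus R I a"
  by (auto simp: ideal_plus_def)

lemma ideal_plus_sub: assumes "ideal I R" "a \<in> carrier R" shows "I \<subseteq> ideal_plus R I a"
proof
  fix x assume "x \<in> I"
  then show "x \<in> ideal_plus R I a"
    using ideal_plusI[of x I \<zero> a] assms ideal_sub[OF assms(1)] by simp
qed

lemma ideal_plus_mem: "ideal I R \<Longrightarrow> a \<in> carrier R \<Longrightarrow> a \<in> ideal_plus R I a"
  using ideal_plusI[of \<zero> I \<one> a] ideal_zero by simp

lemma ideal_plus_least: "ideal J R \<Longrightarrow> I \<subseteq> J \<Longrightarrow> a \<in> J \<Longrightarrow> ideal_plus R I a \<subseteq> J"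
  by (auto simp: ideal_plus_def intro!: ideal_add ideal_mult)

lemma primeidealI':
  assumes "ideal I R" "\<one> \<notin> I"
    "\<And>a b. a \<in> carrier R \<Longrightarrow> b \<in> carrier R \<Longrightarrow> a \<otimes> b \<in> I \<Longrightarrow> a \<notin> I \<Longrightarrow> b \<in> I"
  shows "primeideal I R"
  by (rule primeidealI) (use assms is_cring one_closed in blast)+

text \<open>Products of elements outside a prime stay outside it, so finitely many local statements
  hold with one common denominator.\<close>

lemma prime_common:
  fixes m :: nat
  assumes q: "primeideal q R" and ex: "\<And>i. i < m \<Longrightarrow> \<exists>t\<in>carrier R - q. P i t"
    and up: "\<And>i r t. r \<in> carrier R \<Longrightarrow> t \<in> carrier R \<Longrightarrow> P i t \<Longrightarrow> P i (r \<otimes> t)"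
  shows "\<exists>t\<in>carrier R - q. \<forall>i<m. P i t"
  using ex
proof (induction m)
  case 0
  then show ?case using primeideal_one_compl[OF q] by blast
next
  case (Suc m)
  then obtain t where t: "t \<in> carrier R - q" "\<forall>i<m. P i t" by (metis less_SucI)
  obtain u where u: "u \<in> carrier R - q" "P m u" using Suc.prems by blast
  have "P i (u \<otimes> t)" if "i < Suc m" for i
  proof (cases "i = m")
    case True
    then show ?thesis using up[of t u m] t u by (simp add: m_comm)
  next
    case False
    then show ?thesis using up[of u t i] t u that by simp
  qed
  then show ?case using primeideal_mult_compl[OF q u(1) t(1)] by blast
qed

end

text \<open>Nakayama's lemma at \<open>q\<close> modulo \<open>B\<close>, without localizing: a
  diagonal matrix with entries outside \<open>q\<close> minus a matrix over \<open>q\<close> is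
  invertible at \<open>q\<close>. Gaussian elimination takes the place of the determinant trick,
  since its pivots stay outside \<open>q\<close>.\<close>

lemma (in module) nakayama_at:
  assumes q: "primeideal q R" and B: "B \<subseteq> carrier M" "\<zero>\<^bsub>M\<^esub> \<in> B"
    "\<And>x y. x \<in> B \<Longrightarrow> y \<in> B \<Longrightarrow> x \<oplus>\<^bsub>M\<^esub> y \<in> B" "\<And>r x. r \<in> carrier R \<Longrightarrow> x \<in> B \<Longrightarrow> r \<odot>\<^bsub>M\<^esub> x \<in> B"
    and g: "\<And>i. g i \<in> carrier M" and c: "\<And>i l. c i l \<in> q" and s: "\<And>i. s i \<in> carrier R - q"
    and rel: "\<And>i. i < m \<Longrightarrow> s i \<odot>\<^bsub>M\<^esub> g i \<ominus>\<^bsub>M\<^esub> lc M m (c i) g \<in> B"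
  shows "\<forall>i<m. \<exists>t\<in>carrier R - q. t \<odot>\<^bsub>M\<^esub> g i \<in> B"
  using c s rel
proof (induction m arbitrary: c s)
  case (Suc m)
  interpret q: primeideal q R by fact
  have c: "c i l \<in> carrier R" for i l using Suc.prems(1) q.Icarr by blast
  have s: "s i \<in> carrier R" for i using Suc.prems(2) by blast
  \<comment> \<open>The pivot: the coefficient of \<open>g m\<close> in the last relation.\<close>
  define t where "t = s m \<ominus>\<^bsub>R\<^esub> c m m"
  have tR: "t \<in> carrier R" using s c by (simp add: t_def)
  have tq: "t \<notin> q"
  proof
    assume "t \<in> q"
    then have "t \<oplus>\<^bsub>R\<^esub> c m m \<in> q" using Suc.prems(1) by (simp add: q.a_closed)
    moreover have "t \<oplus>\<^bsub>R\<^esub> c m m = s m"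
      using c s by (simp add: t_def a_minus_def R.a_ac R.r_neg)
    ultimately show False using Suc.prems(2)[of m] by simp
  qed
  let ?S = "\<lambda>i. lc M m (c i) g"
  have S: "?S i \<in> carrier M" for i using c g by simp
  have Em: "t \<odot>\<^bsub>M\<^esub> g m \<ominus>\<^bsub>M\<^esub> ?S m \<in> B"
  proof -
    have "t \<odot>\<^bsub>M\<^esub> g m = s m \<odot>\<^bsub>M\<^esub> g m \<ominus>\<^bsub>M\<^esub> c m m \<odot>\<^bsub>M\<^esub> g m"
      using c s g by (simp add: t_def a_minus_def smult_l_distr smult_l_minus)
    then have "t \<odot>\<^bsub>M\<^esub> g m \<ominus>\<^bsub>M\<^esub> ?S m = s m \<odot>\<^bsub>M\<^esub> g m \<ominus>\<^bsub>M\<^esub> lc M (Suc m) (c m) g"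
      using c s g S by (simp add: a_minus_def M.minus_add M.a_ac)
    then show ?thesis using Suc.prems(3)[of m] by simp
  qed
  \<comment> \<open>The pivot times row \<open>i\<close> plus \<open>c i m\<close> times the last
    row no longer involves \<open>g m\<close> and has again the shape required by the induction
    hypothesis.\<close>
  have Ei: "(t \<otimes>\<^bsub>R\<^esub> s i) \<odot>\<^bsub>M\<^esub> g i \<ominus>\<^bsub>M\<^esub> lc M m (\<lambda>l. t \<otimes>\<^bsub>R\<^esub> c i l \<oplus>\<^bsub>R\<^esub> c i m \<otimes>\<^bsub>R\<^esub> c m l) g \<in> B" if "i < m" for i
  proof -
    let ?A = "s i \<odot>\<^bsub>M\<^esub> g i \<ominus>\<^bsub>M\<^esub> lc M (Suc m) (c i) g" and ?C = "t \<odot>\<^bsub>M\<^esub> g m \<ominus>\<^bsub>M\<^esub> ?S m"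
    have "t \<odot>\<^bsub>M\<^esub> ?A \<oplus>\<^bsub>M\<^esub> c i m \<odot>\<^bsub>M\<^esub> ?C \<in> B"
      using that Suc.prems(3)[of i] Em B tR c by simp
    moreover have "lc M m (\<lambda>l. t \<otimes>\<^bsub>R\<^esub> c i l \<oplus>\<^bsub>R\<^esub> c i m \<otimes>\<^bsub>R\<^esub> c m l) g = t \<odot>\<^bsub>M\<^esub> ?S i \<oplus>\<^bsub>M\<^esub> c i m \<odot>\<^bsub>M\<^esub> ?S m"
      using tR c g by (simp add: lc_add_left lc_smult_left)
    moreover have "t \<odot>\<^bsub>M\<^esub> ?A = (t \<otimes>\<^bsub>R\<^esub> s i) \<odot>\<^bsub>M\<^esub> g i \<oplus>\<^bsub>M\<^esub> (\<ominus>\<^bsub>M\<^esub> (t \<odot>\<^bsub>M\<^esub> ?S i) \<oplus>\<^bsub>M\<^esub> \<ominus>\<^bsub>M\<^esub> (c i m \<odot>\<^bsub>M\<^esub> (t \<odot>\<^bsub>M\<^esub> g m)))"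
      using tR s c g S by (simp add: a_minus_def smult_r_distr smult_r_minus M.minus_add smult_assoc1[symmetric] R.m_comm)
    moreover have "c i m \<odot>\<^bsub>M\<^esub> ?C = c i m \<odot>\<^bsub>M\<^esub> (t \<odot>\<^bsub>M\<^esub> g m) \<oplus>\<^bsub>M\<^esub> \<ominus>\<^bsub>M\<^esub> (c i m \<odot>\<^bsub>M\<^esub> ?S m)"
      using tR s c g S by (simp add: a_minus_def smult_r_distr smult_r_minus)
    moreover have "(x \<oplus>\<^bsub>M\<^esub> (\<ominus>\<^bsub>M\<^esub> y \<oplus>\<^bsub>M\<^esub> \<ominus>\<^bsub>M\<^esub> w)) \<oplus>\<^bsub>M\<^esub> (w \<oplus>\<^bsub>M\<^esub> \<ominus>\<^bsub>M\<^esub> v) = x \<ominus>\<^bsub>M\<^esub> (y \<oplus>\<^bsub>M\<^esub> v)"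
      if "x \<in> carrier M" "y \<in> carrier M" "w \<in> carrier M" "v \<in> carrier M" for x y w v
      using that by (simp add: a_minus_def M.minus_add M.a_assoc M.r_neg1 M.r_neg2)
    ultimately show ?thesis using tR s c g S by simp
  qed
  have "\<forall>i<m. \<exists>t\<in>carrier R - q. t \<odot>\<^bsub>M\<^esub> g i \<in> B"
  proof (rule Suc.IH[where s = "\<lambda>i. t \<otimes>\<^bsub>R\<^esub> s i" and c = "\<lambda>i l. t \<otimes>\<^bsub>R\<^esub> c i l \<oplus>\<^bsub>R\<^esub> c i m \<otimes>\<^bsub>R\<^esub> c m l"])
    show "t \<otimes>\<^bsub>R\<^esub> c i l \<oplus>\<^bsub>R\<^esub> c i m \<otimes>\<^bsub>R\<^esub> c m l \<in> q" for i l
      using Suc.prems(1) tR c by (simp add: q.a_closed q.I_l_closed)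
    show "t \<otimes>\<^bsub>R\<^esub> s i \<in> carrier R - q" for i using primeideal_mult_compl[OF q] tR tq Suc.prems(2) by blast
  qed (rule Ei)
  then obtain u where u: "u \<in> carrier R - q" "\<forall>i<m. u \<odot>\<^bsub>M\<^esub> g i \<in> B"
    using R.prime_common[OF q, of m "\<lambda>i t. t \<odot>\<^bsub>M\<^esub> g i \<in> B"] B g by (auto simp: smult_assoc1)
  \<comment> \<open>Back substitution: \<open>u\<close> puts all earlier generators into
    \<open>B\<close>, and the last relation then handles \<open>g m\<close>.\<close>
  have "lc M m (c m) (\<lambda>i. u \<odot>\<^bsub>M\<^esub> g i) \<in> B" by (rule lc_mem) (use B u c in auto)
  then have "u \<odot>\<^bsub>M\<^esub> ?S m \<in> B" using u c g by (simp add: lc_smult)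
  then have "u \<odot>\<^bsub>M\<^esub> (t \<odot>\<^bsub>M\<^esub> g m \<ominus>\<^bsub>M\<^esub> ?S m) \<oplus>\<^bsub>M\<^esub> u \<odot>\<^bsub>M\<^esub> ?S m \<in> B" using B Em u by simp
  moreover have "u \<odot>\<^bsub>M\<^esub> (t \<odot>\<^bsub>M\<^esub> g m \<ominus>\<^bsub>M\<^esub> ?S m) \<oplus>\<^bsub>M\<^esub> u \<odot>\<^bsub>M\<^esub> ?S m = (u \<otimes>\<^bsub>R\<^esub> t) \<odot>\<^bsub>M\<^esub> g m"
    using u tR g S by (simp add: smult_r_distr[symmetric] a_minus_def M.a_assoc M.l_neg smult_assoc1)
  ultimately have "\<exists>t\<in>carrier R - q. t \<odot>\<^bsub>M\<^esub> g m \<in> B"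
    using primeideal_mult_compl[OF q u(1)] tR tq by (metis DiffI)
  then show ?case using u by (auto simp: less_Suc_eq)
qed simp

section \<open>Noetherian induction and finite generation\<close>

context noeth_cring
begin

text \<open>Zorn's lemma applies to the counterexamples because in a Noetherian ring the union of a
  nonempty chain of ideals is a member of the chain.\<close>

lemma ideal_noeth_induct:
  assumes I: "ideal I R" and step: "\<And>I. ideal I R \<Longrightarrow> (\<And>J. ideal J R \<Longrightarrow> I \<subset> J \<Longrightarrow> P J) \<Longrightarrow> P I"
  shows "P I"
proof (rule ccontr)
  assume "\<not> P I"
  let ?A = "{I. ideal I R \<and> \<not> P I}"
  have "\<exists>M\<in>?A. \<forall>X\<in>?A. M \<subseteq> X \<longrightarrow> X = M"
  proof (rule subset_Zorn_nonempty)
    show "?A \<noteq> {}" using I \<open>\<not> P I\<close> by blast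
    fix C assume C: "C \<noteq> {}" "subset.chain ?A C"
    then have "subset.chain {I. ideal I R} C" by (auto simp: pred_on.chain_def)
    then have "\<Union>C \<in> C" using ideal_chain_is_trivial C(1) by blast
    then show "\<Union>C \<in> ?A" using C(2) by (auto simp: pred_on.chain_def)
  qed
  then show False using step by blast
qed

text \<open>Devissage along \<open>0 \<rightarrow> R/(I:a) \<rightarrow> R/I \<rightarrow> R/(I+Ra)
  \<rightarrow> 0\<close>. A proper ideal that is not prime contains a product \<open>a b\<close>
  with both factors outside; then \<open>b\<close> enlarges the colon ideal and \<open>a\<close> the
  sum, so both outer ideals are strictly larger.\<close>

lemma ideal_prime_induct:
  assumes I: "ideal I R" and triv: "P (carrier R)"
    and prime: "\<And>I. primeideal I R \<Longrightarrow> (\<And>J. ideal J R \<Longrightarrow> I \<subset> J \<Longrightarrow> P J) \<Longrightarrow> P I"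
    and split: "\<And>I a. ideal I R \<Longrightarrow> a \<in> carrier R \<Longrightarrow> P (colon R I a) \<Longrightarrow> P (ideal_plus R I a) \<Longrightarrow> P I"
  shows "P I"
  using I
proof (rule ideal_noeth_induct)
  fix I assume I: "ideal I R" and IH: "\<And>J. ideal J R \<Longrightarrow> I \<subset> J \<Longrightarrow> P J"
  consider "I = carrier R" | "primeideal I R"
    | a b where "a \<in> carrier R" "b \<in> carrier R" "a \<otimes> b \<in> I" "a \<notin> I" "b \<notin> I"
    using primeidealI'[OF I] ideal.one_imp_carrier[OF I] by metis
  then show "P I"
  proof cases
    case 3
    have "I \<subset> colon R I a" using 3 colon_sub[OF I] m_comm by (auto simp: colon_def)
    moreover have "I \<subset> ideal_plus R I a" using 3 ideal_plus_sub[OF I] ideal_plus_mem[OF I] by blast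
    ultimately show ?thesis using split[OF I 3(1)] IH colon_ideal[OF I 3(1)] ideal_plus_ideal[OF I 3(1)] by blast
  qed (use triv prime IH in auto)
qed

lemma ideal_gens:
  assumes I: "ideal I R"
  obtains m g where "\<And>i. g i \<in> I"
    "\<And>x. x \<in> I \<Longrightarrow> \<exists>c. (\<forall>i. c i \<in> carrier R) \<and> x = lc (regm R) m c g"
proof -
  interpret r: module R "regm R" by (rule regm_module)
  obtain A where A: "A \<subseteq> carrier R" "finite A" "I = Idl A" using finetely_gen[OF I] by blast
  obtain xs where xs: "set xs = A" using A(2) finite_list by blast
  define g where "g i = (if i < length xs then xs ! i else \<zero>)" for i
  have gI: "g i \<in> I" for i
    using genideal_self[OF A(1)] A(3) xs ideal_zero[OF I] by (auto simp: g_def)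
  then have g: "g i \<in> carrier R" for i using ideal_sub[OF I] by blast
  let ?B = "{lc (regm R) (length xs) c g | c. \<forall>i. c i \<in> carrier R}"
  have "ideal ?B R"
  proof (rule cring_idealI)
    show "?B \<subseteq> carrier R" using g by auto
    have "lc (regm R) (length xs) (\<lambda>_. \<zero>) g = \<zero>" using g r.lc_zero_left[of "length xs" "\<lambda>_. \<zero>" g] by simp
    then show "\<zero> \<in> ?B" by (intro CollectI exI[of _ "\<lambda>_. \<zero>"]) simp
    fix x assume "x \<in> ?B"
    then obtain c where c: "\<forall>i. c i \<in> carrier R" "x = lc (regm R) (length xs) c g" by blast
    { fix y assume "y \<in> ?B"
      then obtain d where d: "\<forall>i. d i \<in> carrier R" "y = lc (regm R) (length xs) d g" by blast
      have "x \<oplus> y = lc (regm R) (length xs) (\<lambda>i. c i \<oplus> d i) g"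
        using r.lc_add_left[of c d g] c d g by simp
      then show "x \<oplus> y \<in> ?B" using c d by (auto intro!: exI[of _ "\<lambda>i. c i \<oplus> d i"]) }
    fix u assume u: "u \<in> carrier R"
    have "u \<otimes> x = lc (regm R) (length xs) (\<lambda>i. u \<otimes> c i) g"
      using r.lc_smult_left[of u c g] u c g by simp
    then show "u \<otimes> x \<in> ?B" using u c by (auto intro!: exI[of _ "\<lambda>i. u \<otimes> c i"])
  qed
  moreover have "A \<subseteq> ?B"
  proof
    fix x assume "x \<in> A"
    then obtain k where k: "k < length xs" "x = xs ! k" using xs by (metis in_set_conv_nth)
    then have "x = lc (regm R) (length xs) (\<lambda>l. if l = k then \<one> else \<zero>) g"
      using g r.lc_unit_left[of g "length xs" k] by (simp add: g_def)
    then show "x \<in> ?B" by (auto intro!: exI[of _ "\<lambda>l. if l = k then \<one> else \<zero>"])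
  qed
  ultimately have "I \<subseteq> ?B" using genideal_minimal A(3) by blast
  then show thesis using that[of g "length xs"] gI by blast
qed

text \<open>Submodules of a free module of rank \<open>n\<close> are finitely generated: lift
  generators of the ideal of last coordinates and add generators of the part whose last coordinate
  is zero. Members of \<open>K\<close> are functions on all of \<open>nat\<close>, hence equality
  only below \<open>n\<close>.\<close>

lemma vec_gens:
  fixes n :: nat
  assumes "\<And>z l. z \<in> K \<Longrightarrow> z l \<in> carrier R" "(\<lambda>_. \<zero>) \<in> K"
    "\<And>z y. z \<in> K \<Longrightarrow> y \<in> K \<Longrightarrow> (\<lambda>l. z l \<oplus> y l) \<in> K"
    "\<And>r z. r \<in> carrier R \<Longrightarrow> z \<in> K \<Longrightarrow> (\<lambda>l. r \<otimes> z l) \<in> K"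
  shows "\<exists>m g. (\<forall>i. g i \<in> K) \<and>
    (\<forall>z\<in>K. \<exists>c. (\<forall>i. c i \<in> carrier R) \<and> (\<forall>l<n. z l = lc (regm R) m c (\<lambda>i. g i l)))"
  using assms
proof (induction n arbitrary: K)
  case 0
  then show ?case by (intro exI[of _ 0] exI[of _ "\<lambda>_ _. \<zero>"]) (auto intro: exI[of _ "\<lambda>_. \<zero>"])
next
  case (Suc n)
  interpret r: module R "regm R" by (rule regm_module)
  note K = Suc.prems
  have lcK: "(\<lambda>l. lc (regm R) m c (\<lambda>i. y i l)) \<in> K" if "\<And>i. c i \<in> carrier R" "\<And>i. y i \<in> K" for m c y
    using that by (induction m) (auto simp: K)
  let ?I = "(\<lambda>z. z n) ` K"
  have I: "ideal ?I R"
  proof (rule cring_idealI)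
    show "\<zero> \<in> ?I" using K(2) by (auto intro: image_eqI[of _ _ "\<lambda>_. \<zero>"])
    fix x assume "x \<in> ?I"
    then obtain z where z: "z \<in> K" "x = z n" by blast
    { fix y assume "y \<in> ?I"
      then obtain w where w: "w \<in> K" "y = w n" by blast
      then show "x \<oplus> y \<in> ?I" using K(3)[of z w] z by (auto intro: image_eqI[of _ _ "\<lambda>l. z l \<oplus> w l"]) }
    fix u assume "u \<in> carrier R"
    then show "u \<otimes> x \<in> ?I" using K(4)[of u z] z by (auto intro: image_eqI[of _ _ "\<lambda>l. u \<otimes> z l"])
  qed (use K(1) in auto)
  obtain m1 h where h: "\<And>i. h i \<in> ?I" and
    hg: "\<And>x. x \<in> ?I \<Longrightarrow> \<exists>c. (\<forall>i. c i \<in> carrier R) \<and> x = lc (regm R) m1 c h"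
    using ideal_gens[OF I] by metis
  have "\<forall>i. \<exists>y. y \<in> K \<and> h i = y n" using h by blast
  then obtain y where y: "\<And>i. y i \<in> K" "\<And>i. h i = y i n" by metis
  let ?K = "{z \<in> K. z n = \<zero>}"
  have "\<exists>m g. (\<forall>i. g i \<in> ?K) \<and>
    (\<forall>z\<in>?K. \<exists>c. (\<forall>i. c i \<in> carrier R) \<and> (\<forall>l<n. z l = lc (regm R) m c (\<lambda>i. g i l)))"
    by (rule Suc.IH) (use K in auto)
  then obtain m2 g where g: "\<And>i. g i \<in> ?K" and
    gg: "\<And>z. z \<in> ?K \<Longrightarrow> \<exists>c. (\<forall>i. c i \<in> carrier R) \<and> (\<forall>l<n. z l = lc (regm R) m2 c (\<lambda>i. g i l))"
    by blast
  define G where "G i = (if i < m1 then y i else g (i - m1))" for i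
  have "\<exists>c. (\<forall>i. c i \<in> carrier R) \<and> (\<forall>l<Suc n. z l = lc (regm R) (m1 + m2) c (\<lambda>i. G i l))" if z: "z \<in> K" for z
  proof -
    obtain c where c: "\<forall>i. c i \<in> carrier R" "z n = lc (regm R) m1 c h" using hg z by blast
    let ?w = "\<lambda>l. lc (regm R) m1 c (\<lambda>i. y i l)"
    have w: "?w \<in> K" using lcK c y by blast
    have wc: "?w l \<in> carrier R" for l using w K(1) by blast
    \<comment> \<open>Subtracting the lifts that match the last coordinate leaves an element of the
      part covered by the induction hypothesis.\<close>
    let ?z = "\<lambda>l. z l \<oplus> (\<ominus> \<one>) \<otimes> ?w l"
    have zc: "z l \<in> carrier R" for l using z K(1) by blast
    have "?w n = z n" unfolding c(2) by (rule lc_cong) (auto simp: y)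
    then have "?z \<in> ?K" using K(3)[OF z K(4)[OF _ w]] zc by (simp add: l_minus r_neg)
    then obtain d where d: "\<forall>i. d i \<in> carrier R" "\<forall>l<n. ?z l = lc (regm R) m2 d (\<lambda>i. g i l)"
      using gg by blast
    let ?e = "\<lambda>i. if i < m1 then c i else d (i - m1)"
    have cg: "g i l \<in> carrier R" "y i l \<in> carrier R" for i l using g y K(1) by auto
    have ap: "lc (regm R) (m1 + m2) ?e (\<lambda>i. G i l) = ?w l \<oplus> lc (regm R) m2 d (\<lambda>i. g i l)" for l
    proof -
      have "lc (regm R) m1 ?e (\<lambda>i. G i l) = ?w l" by (rule lc_cong) (auto simp: G_def)
      moreover have "lc (regm R) m2 (\<lambda>i. ?e (m1 + i)) (\<lambda>i. G (m1 + i) l) = lc (regm R) m2 d (\<lambda>i. g i l)"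
        by (rule lc_cong) (auto simp: G_def)
      ultimately show ?thesis using r.lc_append[of ?e "\<lambda>i. G i l" m1 m2] c d cg by (auto simp: G_def)
    qed
    have "z l = lc (regm R) (m1 + m2) ?e (\<lambda>i. G i l)" if "l < Suc n" for l
    proof (cases "l = n")
      case True
      have "lc (regm R) m2 d (\<lambda>i. g i n) = \<zero>" using r.lc_zero[of m2 d "\<lambda>i. g i n"] d g by auto
      then show ?thesis using ap[of n] True \<open>?w n = z n\<close> zc by simp
    next
      case False
      then have "lc (regm R) m2 d (\<lambda>i. g i l) = ?z l" using d that by simp
      then show ?thesis using ap[of l] zc[of l] wc[of l] by (simp add: l_minus a_ac r_neg1 r_neg)
    qed
    then show ?thesis using c d by (intro exI[of _ ?e]) auto
  qed
  moreover have "\<forall>i. G i \<in> K" using y g by (auto simp: G_def)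
  ultimately show ?case by blast
qed

end

subsection \<open>Krull's principal ideal theorem and prime avoidance\<close>

text \<open>The local ring of \<open>R/I\<close> at \<open>m\<close> is Artinian: a descending chain
  of ideals above \<open>I\<close> becomes stationary after localization. The index
  \<open>r0\<close> is uniform, while the denominator \<open>s\<close> may depend on
  \<open>r\<close> and \<open>x\<close>.\<close>

definition dcc_at :: "('a, 'r) ring_scheme \<Rightarrow> 'a set \<Rightarrow> 'a set \<Rightarrow> bool" where
  "dcc_at R m I \<longleftrightarrow> (\<forall>L :: nat \<Rightarrow> 'a set.
     (\<forall>r. ideal (L r) R \<and> I \<subseteq> L r \<and> L (Suc r) \<subseteq> L r) \<longrightarrow>
     (\<exists>r0. \<forall>r\<ge>r0. \<forall>x\<in>L r0. \<exists>s\<in>carrier R - m. s \<otimes>\<^bsub>R\<^esub> x \<in> L r))"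

context noeth_cring
begin

lemma ideal_plus_mono: "I \<subseteq> J \<Longrightarrow> ideal_plus R I a \<subseteq> ideal_plus R J a"
  unfolding ideal_plus_def by blast

lemma primeideal_pow:
  assumes "primeideal q R" "x \<in> carrier R" "x [^] (n::nat) \<in> q" shows "x \<in> q"
  using assms(3)
proof (induction n)
  case 0
  then show ?case using primeideal_one_compl[OF assms(1)] by simp
next
  case (Suc n)
  then show ?case using primeideal.I_prime[OF assms(1), of "x [^] n" x] assms(2) by auto
qed

text \<open>Devissage. Primes over \<open>colon R I a\<close> or \<open>ideal_plus R I a\<close> are
  primes over \<open>I\<close>, so the minimality of \<open>m\<close> is inherited. For prime
  \<open>I\<close> the local ring is a field or zero: a chain with a member inside \<open>m\<close>
  forces \<open>I = m\<close>, and otherwise every member contains an element outside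
  \<open>m\<close>.\<close>

lemma dcc_at_minimal_prime:
  assumes m: "primeideal m R" and I: "ideal I R"
    and min: "\<And>p. primeideal p R \<Longrightarrow> I \<subseteq> p \<Longrightarrow> p \<subseteq> m \<Longrightarrow> p = m"
  shows "dcc_at R m I"
proof -
  have one: "\<one> \<in> carrier R - m" by (rule primeideal_one_compl[OF m])
  have "(\<forall>p. primeideal p R \<longrightarrow> I \<subseteq> p \<longrightarrow> p \<subseteq> m \<longrightarrow> p = m) \<longrightarrow> dcc_at R m I"
    using I
  proof (rule ideal_prime_induct)
    show "(\<forall>p. primeideal p R \<longrightarrow> carrier R \<subseteq> p \<longrightarrow> p \<subseteq> m \<longrightarrow> p = m) \<longrightarrow> dcc_at R m (carrier R)"
      unfolding dcc_at_def using one by (metis DiffD1 ideal_sub subsetD monoid.m_closed monoid_axioms)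
  next
    fix I assume I: "primeideal I R"
    interpret I: primeideal I R by fact
    show "(\<forall>p. primeideal p R \<longrightarrow> I \<subseteq> p \<longrightarrow> p \<subseteq> m \<longrightarrow> p = m) \<longrightarrow> dcc_at R m I"
    proof
      assume h: "\<forall>p. primeideal p R \<longrightarrow> I \<subseteq> p \<longrightarrow> p \<subseteq> m \<longrightarrow> p = m"
      show "dcc_at R m I"
        unfolding dcc_at_def
      proof (intro allI impI)
        fix L :: "nat \<Rightarrow> 'a set"
        assume L: "\<forall>r. ideal (L r) R \<and> I \<subseteq> L r \<and> L (Suc r) \<subseteq> L r"
        show "\<exists>r0. \<forall>r\<ge>r0. \<forall>x\<in>L r0. \<exists>s\<in>carrier R - m. s \<otimes> x \<in> L r"
        proof (cases "\<exists>r. L r \<subseteq> m")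
          case True
          then obtain r0 where r0: "L r0 \<subseteq> m" by blast
          then have "I = m" using h I L by blast
          then show ?thesis using L r0 one ideal_sub by (metis l_one subsetD)
        next
          case False
          have "\<forall>r. \<forall>x\<in>L 0. \<exists>s\<in>carrier R - m. s \<otimes> x \<in> L r"
          proof (intro allI ballI)
            fix r x assume "x \<in> L 0"
            then have x: "x \<in> carrier R" using L ideal_sub by blast
            obtain s where "s \<in> L r" "s \<notin> m" using False by blast
            then show "\<exists>s\<in>carrier R - m. s \<otimes> x \<in> L r"
              using L ideal_sub ideal_mult_right x by blast
          qed
          then show ?thesis by blast
        qed
      qed
    qed
  next
    fix I a assume I: "ideal I R" and a: "a \<in> carrier R"
      and c: "(\<forall>p. primeideal p R \<longrightarrow> colon R I a \<subseteq> p \<longrightarrow> p \<subseteq> m \<longrightarrow> p = m) \<longrightarrow> dcc_at R m (colon R I a)"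
      and d: "(\<forall>p. primeideal p R \<longrightarrow> ideal_plus R I a \<subseteq> p \<longrightarrow> p \<subseteq> m \<longrightarrow> p = m) \<longrightarrow> dcc_at R m (ideal_plus R I a)"
    show "(\<forall>p. primeideal p R \<longrightarrow> I \<subseteq> p \<longrightarrow> p \<subseteq> m \<longrightarrow> p = m) \<longrightarrow> dcc_at R m I"
    proof
      assume h: "\<forall>p. primeideal p R \<longrightarrow> I \<subseteq> p \<longrightarrow> p \<subseteq> m \<longrightarrow> p = m"
      have c: "dcc_at R m (colon R I a)" and d: "dcc_at R m (ideal_plus R I a)"
        using c d h colon_sub[OF I a] ideal_plus_sub[OF I a] by (meson order_trans)+
      show "dcc_at R m I"
        unfolding dcc_at_def
      proof (intro allI impI)
        fix L :: "nat \<Rightarrow> 'a set"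
        assume L: "\<forall>r. ideal (L r) R \<and> I \<subseteq> L r \<and> L (Suc r) \<subseteq> L r"
        have anti: "L r \<subseteq> L k" if "k \<le> r" for k r using L that by (simp add: lift_Suc_antimono_le)
        have "\<exists>r0. \<forall>r\<ge>r0. \<forall>x\<in>colon R (L r0) a. \<exists>s\<in>carrier R - m. s \<otimes> x \<in> colon R (L r) a"
          using c[unfolded dcc_at_def] a L by (elim allE[of _ "\<lambda>r. colon R (L r) a"] mp)
            (auto simp: colon_ideal, auto simp: colon_def)
        then obtain r1 where r1: "\<And>r x. r \<ge> r1 \<Longrightarrow> x \<in> colon R (L r1) a \<Longrightarrow> \<exists>s\<in>carrier R - m. s \<otimes> x \<in> colon R (L r) a"
          by blast
        have "\<exists>r0. \<forall>r\<ge>r0. \<forall>x\<in>ideal_plus R (L r0) a. \<exists>s\<in>carrier R - m. s \<otimes> x \<in> ideal_plus R (L r) a"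
          using d[unfolded dcc_at_def] a L by (elim allE[of _ "\<lambda>r. ideal_plus R (L r) a"] mp)
            (simp add: ideal_plus_ideal ideal_plus_mono)
        then obtain r2 where r2: "\<And>r x. r \<ge> r2 \<Longrightarrow> x \<in> ideal_plus R (L r2) a \<Longrightarrow> \<exists>s\<in>carrier R - m. s \<otimes> x \<in> ideal_plus R (L r) a"
          by blast
        let ?r = "max r1 r2"
        have "\<exists>s\<in>carrier R - m. s \<otimes> x \<in> L r" if r: "r \<ge> ?r" and x: "x \<in> L ?r" for r x
        proof -
          have xR: "x \<in> carrier R" using x L ideal_sub by blast
          have "x \<in> ideal_plus R (L r2) a" using x anti[of r2 ?r] L ideal_plus_sub a by (meson max.cobounded2 subsetD)
          then obtain s where s: "s \<in> carrier R - m" "s \<otimes> x \<in> ideal_plus R (L r) a" using r2[of r x] r by auto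
          \<comment> \<open>Stationarity modulo \<open>a\<close> brings \<open>s x\<close> into
            \<open>L r\<close> up to a multiple \<open>e a\<close>. That multiple lies in
            \<open>L r1\<close>, so stationarity of the colon ideals takes care of
            \<open>e\<close>.\<close>
          then obtain l e where le: "l \<in> L r" "e \<in> carrier R" "s \<otimes> x = l \<oplus> e \<otimes> a" by (auto simp: ideal_plus_def)
          have lR: "l \<in> carrier R" using le L ideal_sub by blast
          have "e \<otimes> a = s \<otimes> x \<ominus> l" using le lR a s xR by (simp add: a_minus_def a_ac r_neg2 r_neg1)
          moreover have "s \<otimes> x \<ominus> l \<in> L ?r" using le(1) anti[OF r] L x s ideal_diff ideal_mult by (meson DiffD1 subsetD)
          ultimately have "e \<otimes> a \<in> L r1" using anti[of r1 ?r] by auto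
          then have "e \<in> colon R (L r1) a" using le by (simp add: colon_def)
          then obtain u where u: "u \<in> carrier R - m" "u \<otimes> e \<in> colon R (L r) a" using r1[of r e] r by auto
          then have ue: "(u \<otimes> e) \<otimes> a \<in> L r" by (simp add: colon_def)
          have "(u \<otimes> s) \<otimes> x = u \<otimes> l \<oplus> (u \<otimes> e) \<otimes> a"
            using u s xR le lR a by (simp add: m_assoc r_distr)
          moreover have "u \<otimes> l \<oplus> (u \<otimes> e) \<otimes> a \<in> L r" using ue u le L ideal_add ideal_mult by (meson DiffD1)
          ultimately show ?thesis using primeideal_mult_compl[OF m u(1) s(1)] by metis
        qed
        then show "\<exists>r0. \<forall>r\<ge>r0. \<forall>x\<in>L r0. \<exists>s\<in>carrier R - m. s \<otimes> x \<in> L r" by blast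
      qed
    qed
  qed
  then show ?thesis using min by blast
qed

text \<open>The symbolic powers of the usual proof are replaced by the ideals \<open>{a. y\<^sup>n a \<in> x\<^sup>r R + Q}\<close>, which are
  stable under division by \<open>y\<close>.\<close>

lemma principal_ideal_theorem:
  assumes Q: "primeideal Q R" and P: "primeideal P R" and m: "primeideal m R"
    and QP: "Q \<subset> P" and Pm: "P \<subseteq> m" and y: "y \<in> m" "y \<notin> P"
    and min: "\<And>p. primeideal p R \<Longrightarrow> ideal_plus R Q y \<subseteq> p \<Longrightarrow> p \<subseteq> m \<Longrightarrow> p = m"
  shows False
proof -
  interpret Q: primeideal Q R by fact
  interpret P: primeideal P R by fact
  interpret m: primeideal m R by fact
  interpret r: module R "regm R" by (rule regm_module)
  have yR: "y \<in> carrier R" using y by (simp add: m.Icarr)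
  obtain x where x: "x \<in> P" "x \<notin> Q" using QP by blast
  have xR: "x \<in> carrier R" using x by (simp add: P.Icarr)
  define X where "X k = {a \<in> carrier R. \<exists>n::nat. \<exists>c\<in>carrier R. y [^] n \<otimes> a \<ominus> x [^] k \<otimes> c \<in> Q}" for k :: nat
  have XR: "X k \<subseteq> carrier R" for k by (auto simp: X_def)
  have QX: "Q \<subseteq> X k" for k
  proof
    fix a assume a: "a \<in> Q"
    then have "y [^] (0::nat) \<otimes> a \<ominus> x [^] k \<otimes> \<zero> \<in> Q" using xR by (simp add: a_minus_def)
    then show "a \<in> X k" using a Q.Icarr[OF a] unfolding X_def by blast
  qed
  have XI: "ideal (X k) R" for k
  proof (rule cring_idealI)
    show "\<zero> \<in> X k" using QX[of k] Q.zero_closed by blast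
    fix a assume "a \<in> X k"
    then obtain n c where a: "a \<in> carrier R" "c \<in> carrier R" "y [^] (n::nat) \<otimes> a \<ominus> x [^] k \<otimes> c \<in> Q"
      by (auto simp: X_def)
    { fix b assume "b \<in> X k"
      then obtain n' c' where b: "b \<in> carrier R" "c' \<in> carrier R" "y [^] (n'::nat) \<otimes> b \<ominus> x [^] k \<otimes> c' \<in> Q"
        by (auto simp: X_def)
      let ?c = "y [^] n' \<otimes> c \<oplus> y [^] n \<otimes> c'"
      have "y [^] (n + n') \<otimes> (a \<oplus> b) \<ominus> x [^] k \<otimes> ?c =
        y [^] n' \<otimes> (y [^] n \<otimes> a \<ominus> x [^] k \<otimes> c) \<oplus> y [^] n \<otimes> (y [^] n' \<otimes> b \<ominus> x [^] k \<otimes> c')"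
        unfolding nat_pow_mult[OF yR, symmetric]
        using a(1,2) b(1,2) nat_pow_closed[OF xR, of k] nat_pow_closed[OF yR, of n] nat_pow_closed[OF yR, of n']
        by algebra
      also have "\<dots> \<in> Q" using a b yR by (simp add: Q.I_l_closed)
      finally show "a \<oplus> b \<in> X k" using a b yR unfolding X_def by blast }
    fix u assume u: "u \<in> carrier R"
    have "y [^] n \<otimes> (u \<otimes> a) \<ominus> x [^] k \<otimes> (u \<otimes> c) = u \<otimes> (y [^] n \<otimes> a \<ominus> x [^] k \<otimes> c)"
      using a(1,2) u xR yR nat_pow_closed[OF xR, of k] nat_pow_closed[OF yR, of n] by algebra
    also have "\<dots> \<in> Q" using a u by (simp add: Q.I_l_closed)
    finally show "u \<otimes> a \<in> X k" using a u unfolding X_def by blast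
  qed (rule XR)
  have Xdiv: "c \<in> X k" if cX: "c \<in> carrier R" "c \<otimes> y \<in> X k" for c k
  proof -
    obtain n d where "d \<in> carrier R" "y [^] (n::nat) \<otimes> (c \<otimes> y) \<ominus> x [^] k \<otimes> d \<in> Q"
      using cX(2) unfolding X_def by blast
    moreover have "y [^] n \<otimes> (c \<otimes> y) = y [^] (Suc n) \<otimes> c" using cX yR by (simp add: m_ac)
    ultimately have "d \<in> carrier R" "y [^] (Suc n) \<otimes> c \<ominus> x [^] k \<otimes> d \<in> Q" by simp_all
    then show ?thesis using cX(1) unfolding X_def by blast
  qed
  have Xanti: "X (Suc k) \<subseteq> X k" for k
  proof
    fix a assume "a \<in> X (Suc k)"
    then obtain n c where a: "a \<in> carrier R" "c \<in> carrier R" "y [^] (n::nat) \<otimes> a \<ominus> x [^] (Suc k) \<otimes> c \<in> Q"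
      by (auto simp: X_def)
    then have "y [^] n \<otimes> a \<ominus> x [^] k \<otimes> (x \<otimes> c) \<in> Q" using xR by (simp add: m_assoc)
    then show "a \<in> X k" using a xR unfolding X_def by blast
  qed
  have "dcc_at R m (ideal_plus R Q y)"
    by (rule dcc_at_minimal_prime[OF m ideal_plus_ideal[OF Q.is_ideal yR] min])
  moreover have "\<forall>k. ideal (ideal_plus R (X k) y) R \<and> ideal_plus R Q y \<subseteq> ideal_plus R (X k) y \<and>
      ideal_plus R (X (Suc k)) y \<subseteq> ideal_plus R (X k) y"
    using ideal_plus_ideal[OF XI yR] QX Xanti by (simp add: ideal_plus_mono)
  ultimately have "\<exists>r0. \<forall>r\<ge>r0. \<forall>z\<in>ideal_plus R (X r0) y. \<exists>s\<in>carrier R - m. s \<otimes> z \<in> ideal_plus R (X r) y"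
    unfolding dcc_at_def by (elim allE[of _ "\<lambda>k. ideal_plus R (X k) y"]) blast
  \<comment> \<open>Locally at \<open>m\<close> the ideals \<open>X k + yR\<close> and
    \<open>X (k + 1) + yR\<close> agree.\<close>
  then obtain k where k: "\<And>z. z \<in> ideal_plus R (X k) y \<Longrightarrow> \<exists>s\<in>carrier R - m. s \<otimes> z \<in> ideal_plus R (X (Suc k)) y"
    by (metis le_Suc_eq order_refl)
  obtain N g where g: "\<And>i. g i \<in> X k"
    and gen: "\<And>z. z \<in> X k \<Longrightarrow> \<exists>c. (\<forall>i. c i \<in> carrier R) \<and> z = lc (regm R) N c g"
    using ideal_gens[OF XI] by metis
  have gR: "g i \<in> carrier R" for i using g XR by blast
  \<comment> \<open>An element of \<open>X k\<close> is locally \<open>a + c y\<close> with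
    \<open>a\<close> in \<open>X (k + 1)\<close>. Then \<open>c y\<close> lies in
    \<open>X k\<close>, hence so does \<open>c\<close>. So \<open>X k = X (k + 1) + y X k\<close>
    locally, and Nakayama's lemma with \<open>y\<close> in \<open>m\<close> gives
    \<open>X k = X (k + 1)\<close>.\<close>
  have "\<exists>s c. s \<in> carrier R - m \<and> (\<forall>l. c l \<in> m) \<and> s \<otimes> g i \<ominus> lc (regm R) N c g \<in> X (Suc k)" for i
  proof -
    obtain s where s: "s \<in> carrier R - m" "s \<otimes> g i \<in> ideal_plus R (X (Suc k)) y"
      using k g ideal_plus_sub[OF XI yR] by blast
    then obtain a c where ac: "a \<in> X (Suc k)" "c \<in> carrier R" "s \<otimes> g i = a \<oplus> c \<otimes> y" by (auto simp: ideal_plus_def)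
    have aR: "a \<in> carrier R" using ac XR by blast
    have "c \<otimes> y = s \<otimes> g i \<ominus> a" using ac aR yR by (simp add: a_minus_def a_ac r_neg2 r_neg1)
    moreover have "s \<otimes> g i \<ominus> a \<in> X k" using s g ac(1) Xanti by (meson DiffD1 ideal_diff[OF XI] ideal_mult[OF XI] subsetD)
    ultimately have "c \<in> X k" using Xdiv ac by auto
    then obtain d where d: "\<And>i. d i \<in> carrier R" "c = lc (regm R) N d g" using gen by blast
    have "lc (regm R) N (\<lambda>l. y \<otimes> d l) g = y \<otimes> c" using r.lc_smult_left[of y d g N] d gR yR by simp
    then have "s \<otimes> g i \<ominus> lc (regm R) N (\<lambda>l. y \<otimes> d l) g = a"
      using ac aR yR d gR by (simp add: a_minus_def a_assoc m_comm r_neg)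
    then show ?thesis using s ac d y by (intro exI[of _ s] exI[of _ "\<lambda>l. y \<otimes> d l"]) (auto simp: m.I_r_closed)
  qed
  then obtain s c where sc: "\<And>i. s i \<in> carrier R - m" "\<And>i l. c i l \<in> m"
    "\<And>i. s i \<otimes> g i \<ominus> lc (regm R) N (c i) g \<in> X (Suc k)" by metis
  have "\<forall>i<N. \<exists>t\<in>carrier R - m. t \<odot>\<^bsub>regm R\<^esub> g i \<in> X (Suc k)"
    by (rule r.nakayama_at[OF m _ _ _ _ _ sc(2) sc(1)])
      (use sc(3) gR XR in \<open>auto simp: ideal_zero[OF XI] ideal_add[OF XI] ideal_mult[OF XI]\<close>)
  then obtain u where u: "u \<in> carrier R - m" "\<forall>i<N. u \<otimes> g i \<in> X (Suc k)"
    using prime_common[OF m, of N "\<lambda>i t. t \<otimes> g i \<in> X (Suc k)"] gR ideal_mult[OF XI] by (auto simp: m_assoc)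
  have "x [^] k \<in> X k"
  proof -
    have "y [^] (0::nat) \<otimes> x [^] k \<ominus> x [^] k \<otimes> \<one> \<in> Q" using xR by (simp add: a_minus_def r_neg)
    then show ?thesis using xR unfolding X_def by blast
  qed
  then obtain d where d: "\<And>i. d i \<in> carrier R" "x [^] k = lc (regm R) N d g" using gen by blast
  have "u \<otimes> x [^] k = lc (regm R) N d (\<lambda>i. u \<otimes> g i)" using r.lc_smult[of u d g] d u gR by simp
  also have "\<dots> \<in> X (Suc k)" by (rule ideal_lc[OF XI]) (use d u in auto)
  finally obtain n e where e: "e \<in> carrier R" "y [^] (n::nat) \<otimes> (u \<otimes> x [^] k) \<ominus> x [^] (Suc k) \<otimes> e \<in> Q"
    by (auto simp: X_def)
  have uR: "u \<in> carrier R" using u by blast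
  \<comment> \<open>Cancelling \<open>x^k\<close>, which is outside \<open>Q\<close>, puts
    \<open>y^n u\<close> into \<open>Q + xR\<close> and so into \<open>P\<close>; but
    \<open>y\<close> and \<open>u\<close> are outside \<open>P\<close>.\<close>
  have "y [^] n \<otimes> (u \<otimes> x [^] k) \<ominus> x [^] (Suc k) \<otimes> e = x [^] k \<otimes> (y [^] n \<otimes> u \<ominus> x \<otimes> e)"
    using e(1) uR xR nat_pow_closed[OF xR, of k] nat_pow_closed[OF yR, of n] by (simp, algebra)
  then have "x [^] k \<in> Q \<or> y [^] n \<otimes> u \<ominus> x \<otimes> e \<in> Q"
    using Q.I_prime e uR xR yR by simp
  then have "y [^] n \<otimes> u \<ominus> x \<otimes> e \<in> P" using primeideal_pow[OF Q xR] x QP by blast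
  then have "(y [^] n \<otimes> u \<ominus> x \<otimes> e) \<oplus> x \<otimes> e \<in> P" using x e by (simp add: P.I_r_closed)
  moreover have "(y [^] n \<otimes> u \<ominus> x \<otimes> e) \<oplus> x \<otimes> e = y [^] n \<otimes> u"
    using xR yR uR e by (simp add: a_minus_def a_assoc l_neg)
  ultimately have "y [^] n \<in> P \<or> u \<in> P" using P.I_prime yR uR by simp
  then show False using primeideal_pow[OF P yR] y u Pm by blast
qed

text \<open>\<open>S\<close> may contain more than the minimal primes; what counts is that every
  prime over \<open>I\<close> contains a member. In the splitting step such a prime contains
  \<open>a\<close> or else the whole colon ideal.\<close>

lemma finitely_many_minimal_primes:
  assumes I: "ideal I R"
  shows "\<exists>S. finite S \<and> (\<forall>p\<in>S. primeideal p R \<and> I \<subseteq> p) \<and> (\<forall>p. primeideal p R \<longrightarrow> I \<subseteq> p \<longrightarrow> (\<exists>p'\<in>S. p' \<subseteq> p))"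
  using I
proof (rule ideal_prime_induct)
  show "\<exists>S. finite S \<and> (\<forall>p\<in>S. primeideal p R \<and> carrier R \<subseteq> p) \<and> (\<forall>p. primeideal p R \<longrightarrow> carrier R \<subseteq> p \<longrightarrow> (\<exists>p'\<in>S. p' \<subseteq> p))"
    using primeideal_one_compl by (intro exI[of _ "{}"]) auto
next
  fix I assume I: "primeideal I R"
  then show "\<exists>S. finite S \<and> (\<forall>p\<in>S. primeideal p R \<and> I \<subseteq> p) \<and> (\<forall>p. primeideal p R \<longrightarrow> I \<subseteq> p \<longrightarrow> (\<exists>p'\<in>S. p' \<subseteq> p))"
    by (intro exI[of _ "{I}"]) auto
next
  fix I a assume I: "ideal I R" and a: "a \<in> carrier R"
    and c: "\<exists>S. finite S \<and> (\<forall>p\<in>S. primeideal p R \<and> colon R I a \<subseteq> p) \<and> (\<forall>p. primeideal p R \<longrightarrow> colon R I a \<subseteq> p \<longrightarrow> (\<exists>p'\<in>S. p' \<subseteq> p))"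
    and d: "\<exists>S. finite S \<and> (\<forall>p\<in>S. primeideal p R \<and> ideal_plus R I a \<subseteq> p) \<and> (\<forall>p. primeideal p R \<longrightarrow> ideal_plus R I a \<subseteq> p \<longrightarrow> (\<exists>p'\<in>S. p' \<subseteq> p))"
  from c obtain S where S: "finite S" "\<forall>p\<in>S. primeideal p R \<and> colon R I a \<subseteq> p"
    "\<forall>p. primeideal p R \<longrightarrow> colon R I a \<subseteq> p \<longrightarrow> (\<exists>p'\<in>S. p' \<subseteq> p)" by (elim exE conjE)
  from d obtain T where T: "finite T" "\<forall>p\<in>T. primeideal p R \<and> ideal_plus R I a \<subseteq> p"
    "\<forall>p. primeideal p R \<longrightarrow> ideal_plus R I a \<subseteq> p \<longrightarrow> (\<exists>p'\<in>T. p' \<subseteq> p)" by (elim exE conjE)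
  have pr: "\<forall>p\<in>S \<union> T. primeideal p R \<and> I \<subseteq> p"
    using S(2) T(2) colon_sub[OF I a] ideal_plus_sub[OF I a] by (meson UnE order_trans)
  have "\<exists>p'\<in>S \<union> T. p' \<subseteq> p" if p: "primeideal p R" "I \<subseteq> p" for p
  proof (cases "a \<in> p")
    case True
    then have "ideal_plus R I a \<subseteq> p" using ideal_plus_least[OF primeideal.axioms(1)[OF p(1)] p(2)] by blast
    then show ?thesis using T(3) p(1) by blast
  next
    case False
    then have "colon R I a \<subseteq> p" using primeideal.I_prime[OF p(1) _ a] p(2) by (auto simp: colon_def)
    then show ?thesis using S(3) p(1) by blast
  qed
  then show "\<exists>S. finite S \<and> (\<forall>p\<in>S. primeideal p R \<and> I \<subseteq> p) \<and> (\<forall>p. primeideal p R \<longrightarrow> I \<subseteq> p \<longrightarrow> (\<exists>p'\<in>S. p' \<subseteq> p))"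
    using S(1) T(1) pr by (intro exI[of _ "S \<union> T"]) simp
qed

lemma common_element_outside_prime:
  assumes P: "primeideal P R" and "finite S" "\<And>q. q \<in> S \<Longrightarrow> ideal q R \<and> \<not> q \<subseteq> P"
  shows "\<exists>w\<in>carrier R - P. \<forall>q\<in>S. w \<in> q"
  using assms(2,3)
proof (induction S rule: finite_induct)
  case empty
  then show ?case using primeideal_one_compl[OF P] by blast
next
  case (insert q S)
  then obtain w where w: "w \<in> carrier R - P" "\<forall>q\<in>S. w \<in> q" by blast
  obtain v where v: "v \<in> q" "v \<notin> P" using insert by blast
  have vR: "v \<in> carrier R" using v insert ideal_sub by blast
  have "v \<otimes> w \<in> carrier R - P" using primeideal_mult_compl[OF P] vR v w by blast
  moreover have "\<forall>q'\<in>insert q S. v \<otimes> w \<in> q'" using v w vR insert ideal_mult ideal_mult_right by auto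
  ultimately show ?case by blast
qed

text \<open>Once no prime of the set contains another, pick \<open>y\<close> avoiding all of them
  but \<open>P\<close>. If \<open>y\<close> lies in \<open>P\<close>, add \<open>z w\<close> with
  \<open>z\<close> in \<open>I\<close> outside \<open>P\<close> and \<open>w\<close> outside
  \<open>P\<close> but in all the others: only the residue at \<open>P\<close> changes.\<close>

lemma prime_avoidance:
  assumes "finite S" "\<And>p. p \<in> S \<Longrightarrow> primeideal p R \<and> \<not> I \<subseteq> p" and I: "ideal I R"
  shows "\<exists>y\<in>I. \<forall>p\<in>S. y \<notin> p"
  using assms(1,2)
proof (induction S rule: finite_psubset_induct)
  case (psubset S)
  show ?case
  proof (cases "\<exists>p\<in>S. \<exists>q\<in>S. q \<subset> p")
    case True
    then obtain p q where pq: "p \<in> S" "q \<in> S" "q \<subset> p" by blast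
    then obtain y where "y \<in> I" "\<forall>p\<in>S - {q}. y \<notin> p" using psubset.IH[of "S - {q}"] psubset.prems by blast
    then show ?thesis using pq by blast
  next
    case anti: False
    show ?thesis
    proof (cases "S = {}")
      case True
      then show ?thesis using ideal_zero[OF I] by blast
    next
      case False
      then obtain P where P: "P \<in> S" by blast
      then have P': "primeideal P R" using psubset.prems by blast
      obtain y where y: "y \<in> I" "\<forall>p\<in>S - {P}. y \<notin> p" using psubset.IH[of "S - {P}"] psubset.prems P by blast
      obtain z where z: "z \<in> I" "z \<notin> P" using psubset.prems P by blast
      obtain w where w: "w \<in> carrier R - P" "\<forall>q\<in>S - {P}. w \<in> q"
      proof -
        have "ideal q R \<and> \<not> q \<subseteq> P" if "q \<in> S - {P}" for q
          using that psubset.prems anti P primeideal.axioms(1) by blast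
        then show ?thesis using common_element_outside_prime[OF P', of "S - {P}"] psubset.hyps that by blast
      qed
      have R: "y \<in> carrier R" "z \<in> carrier R" "w \<in> carrier R" using y z w ideal_sub[OF I] by auto
      show ?thesis
      proof (cases "y \<in> P")
        case False
        then show ?thesis using y by blast
      next
        case True
        have zw: "z \<otimes> w \<in> carrier R - P" using primeideal_mult_compl[OF P'] z w R by blast
        have eq: "(y \<oplus> z \<otimes> w) \<ominus> y = z \<otimes> w" "(y \<oplus> z \<otimes> w) \<ominus> z \<otimes> w = y" using R by algebra+
        have "y \<oplus> z \<otimes> w \<notin> q" if q: "q \<in> S" for q
        proof
          have qi: "ideal q R" using q psubset.prems primeideal.axioms(1) by blast
          assume a: "y \<oplus> z \<otimes> w \<in> q"
          show False
          proof (cases "q = P")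
            case True
            then show ?thesis using ideal_diff[OF qi a, of y] \<open>y \<in> P\<close> eq zw by auto
          next
            case False
            then have "z \<otimes> w \<in> q" using w q R ideal_mult[OF qi] by blast
            then have "y \<in> q" using ideal_diff[OF qi a, of "z \<otimes> w"] eq(2) by simp
            then show ?thesis using y q False by blast
          qed
        qed
        moreover have "y \<oplus> z \<otimes> w \<in> I" using y z R by (simp add: ideal_add[OF I] ideal_mult_right[OF I])
        ultimately show ?thesis by blast
      qed
    qed
  qed
qed

text \<open>Suppose all primes strictly between contain \<open>t\<close>, and let \<open>S\<close>
  be a finite set of primes below all primes over \<open>Q + tR\<close>. Choose \<open>y\<close> in
  \<open>P'\<close> outside the members of \<open>S\<close> strictly inside \<open>P'\<close>, and
  \<open>m\<close> minimal over \<open>Q + yR\<close> inside \<open>P'\<close>. One of these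
  members, \<open>p\<close>, lies in \<open>m\<close>, and \<open>Q \<subset> p \<subset> m\<close>
  contradicts the principal ideal theorem.\<close>

lemma intermediate_prime_avoiding:
  assumes Q: "primeideal Q R" and P: "primeideal P R" and P': "primeideal P' R"
    and QP: "Q \<subset> P" "P \<subset> P'" and t: "t \<in> carrier R" "t \<notin> Q"
  shows "\<exists>q. primeideal q R \<and> Q \<subset> q \<and> q \<subset> P' \<and> t \<notin> q"
proof (rule ccontr)
  assume "\<not> ?thesis"
  then have all: "\<And>q. primeideal q R \<Longrightarrow> Q \<subset> q \<Longrightarrow> q \<subset> P' \<Longrightarrow> t \<in> q" by blast
  have Qi: "ideal Q R" and P'i: "ideal P' R" using Q P' primeideal.axioms(1) by auto
  obtain S where S: "finite S" "\<And>p. p \<in> S \<Longrightarrow> primeideal p R \<and> ideal_plus R Q t \<subseteq> p"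
    "\<And>p. primeideal p R \<Longrightarrow> ideal_plus R Q t \<subseteq> p \<Longrightarrow> \<exists>p'\<in>S. p' \<subseteq> p"
    using finitely_many_minimal_primes[OF ideal_plus_ideal[OF Qi t(1)]] by metis
  let ?S = "{p \<in> S. p \<subset> P'}"
  have QS: "Q \<subset> p \<and> t \<in> p" if "p \<in> S" for p
    using S(2)[OF that] ideal_plus_sub[OF Qi t(1)] ideal_plus_mem[OF Qi t(1)] t by blast
  obtain y where y: "y \<in> P'" "\<forall>p\<in>?S. y \<notin> p"
    using prime_avoidance[of ?S P'] S(1,2) P'i by auto
  have yR: "y \<in> carrier R" using y ideal_sub[OF P'i] by blast
  have Sle: "\<exists>p\<in>S. p \<subseteq> q" if "primeideal q R" "Q \<subset> q" "t \<in> q" for q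
    using S(3)[OF that(1)] ideal_plus_least[OF primeideal.axioms(1)[OF that(1)]] that by blast
  have "t \<in> P" using all P QP by blast
  then obtain p1 where p1: "p1 \<in> S" "p1 \<subseteq> P" using Sle[OF P QP(1)] by blast
  then have "p1 \<in> ?S" using QP by blast
  then have yQ: "y \<notin> Q" using y QS[OF p1(1)] by blast
  obtain T where T: "finite T" "\<And>p. p \<in> T \<Longrightarrow> primeideal p R \<and> ideal_plus R Q y \<subseteq> p"
    "\<And>p. primeideal p R \<Longrightarrow> ideal_plus R Q y \<subseteq> p \<Longrightarrow> \<exists>p'\<in>T. p' \<subseteq> p"
    using finitely_many_minimal_primes[OF ideal_plus_ideal[OF Qi yR]] by metis
  let ?T = "{p \<in> T. p \<subseteq> P'}"
  have "ideal_plus R Q y \<subseteq> P'" using ideal_plus_least[OF P'i] QP y by blast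
  then have "?T \<noteq> {}" using T(3)[OF P'] by blast
  moreover have "finite ?T" using T(1) by simp
  ultimately have "\<exists>m\<in>?T. \<forall>p\<in>?T. p \<subseteq> m \<longrightarrow> m = p" by (intro finite_has_minimal)
  then obtain m where m: "m \<in> ?T" and mmin: "\<forall>p\<in>?T. p \<subseteq> m \<longrightarrow> m = p" by (rule bexE)
  have mp: "primeideal m R" and ym: "ideal_plus R Q y \<subseteq> m" using m T(2) by auto
  have min: "p = m" if p: "primeideal p R" "ideal_plus R Q y \<subseteq> p" "p \<subseteq> m" for p
  proof -
    obtain p' where "p' \<in> T" "p' \<subseteq> p" using T(3)[OF p(1,2)] by blast
    moreover from this have "p' \<in> ?T" "p' \<subseteq> m" using m p(3) by auto
    ultimately have "p' = m" using bspec[OF mmin, of p'] by simp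
    then show ?thesis using \<open>p' \<subseteq> p\<close> p(3) by simp
  qed
  have yin: "y \<in> m" using ym ideal_plus_mem[OF Qi yR] by blast
  \<comment> \<open>For \<open>m = P'\<close> the member below \<open>P\<close> will do. Otherwise
    \<open>m\<close> is itself strictly between, so it contains \<open>t\<close>.\<close>
  have "\<exists>p\<in>?S. p \<subseteq> m"
  proof (cases "m = P'")
    case True
    then show ?thesis using \<open>p1 \<in> ?S\<close> by blast
  next
    case False
    then have "m \<subset> P'" using m by blast
    moreover have "Q \<subset> m" using ym ideal_plus_sub[OF Qi yR] yin yQ by blast
    ultimately have "t \<in> m" using all mp by blast
    then show ?thesis using Sle[OF mp \<open>Q \<subset> m\<close>] \<open>m \<subset> P'\<close> by blast
  qed
  then obtain p where p: "p \<in> ?S" "p \<subseteq> m" by blast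
  show False
    by (rule principal_ideal_theorem[OF Q _ mp _ p(2) yin _ min]) (use p S(2) QS y in auto)
qed

text \<open>The chain is rebuilt from the bottom, and strict inclusion in \<open>P (Suc d)\<close>
  leaves room for the next replacement. Nothing lies above the top prime of the chain to make room
  for its replacement, so one step is lost.\<close>

lemma prime_chain_avoiding:
  assumes "prime_chain R (Suc d) P" "t \<in> carrier R" "t \<notin> P 0"
  shows "\<exists>Q. prime_chain R d Q \<and> t \<notin> Q d \<and> Q d \<subset> P (Suc d)"
  using assms(1)
proof (induction d)
  case 0
  then show ?case using assms by (intro exI[of _ P]) (auto simp: prime_chain_def)
next
  case (Suc d)
  then have "prime_chain R (Suc d) P" by (auto simp: prime_chain_def)
  then obtain Q where Q: "prime_chain R d Q" "t \<notin> Q d" "Q d \<subset> P (Suc d)" using Suc.IH by blast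
  obtain q where q: "primeideal q R" "Q d \<subset> q" "q \<subset> P (Suc (Suc d))" "t \<notin> q"
    using intermediate_prime_avoiding[of "Q d" "P (Suc d)" "P (Suc (Suc d))" t] Q Suc.prems assms(2)
    by (auto simp: prime_chain_def)
  let ?Q = "\<lambda>i. if i \<le> d then Q i else q"
  have "prime_chain R (Suc d) ?Q"
    using Q(1) q by (auto simp: prime_chain_def le_Suc_eq less_Suc_eq)
  then show ?case using q by (intro exI[of _ ?Q]) simp
qed

end

subsection \<open>The set Assh\<close>

context noeth_cring
begin

section \<open>Primes of a quotient ring\<close>

context
  fixes p assumes p: "ideal p R"
begin

interpretation p: ideal p R by (rule p)

private abbreviation "h \<equiv> (\<lambda>x. p +> x)"

private lemma h_hom: "h \<in> ring_hom R (R Quot p)" by (rule p.rcos_ring_hom)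

private lemma h_carrier: "carrier (R Quot p) = h ` carrier R"
  by (auto simp: FactRing_def A_RCOSETS_def')

private lemma quot_cring: "cring (R Quot p)" by (rule p.quotient_is_cring[OF is_cring])

private lemma h_eq:
  assumes "x \<in> carrier R" "y \<in> carrier R" "h x = h y" shows "x \<ominus> y \<in> p"
  using assms p.a_rcos_module_minus[OF ring_axioms, of y x] p.a_rcos_self[of x] by simp

private lemma h_mem:
  assumes J: "ideal J R" "p \<subseteq> J" and x: "x \<in> carrier R" "h x \<in> h ` J" shows "x \<in> J"
proof -
  obtain j where j: "j \<in> J" "h x = h j" using x by blast
  then have "x \<ominus> j \<in> J" using h_eq[OF x(1) ideal_sub[OF J(1)]] J(2) by blast
  then have "(x \<ominus> j) \<oplus> j \<in> J" using ideal_add[OF J(1)] j by blast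
  then show ?thesis using x(1) ideal_sub[OF J(1) j(1)] by (simp add: a_minus_def a_assoc l_neg)
qed

private lemma primeideal_image:
  assumes J: "primeideal J R" "p \<subseteq> J" shows "primeideal (h ` J) (R Quot p)"
proof -
  interpret Q: cring "R Quot p" by (rule quot_cring)
  note Ji = primeideal.axioms(1)[OF J(1)]
  note Js = ideal_sub[OF Ji]
  show ?thesis
  proof (rule Q.primeidealI'[OF Q.cring_idealI])
    show "h ` J \<subseteq> carrier (R Quot p)" using Js by (auto simp: h_carrier)
    have "\<zero>\<^bsub>R Quot p\<^esub> = h \<zero>" using ring_hom_zero[OF h_hom ring_axioms Q.ring_axioms] by simp
    then show "\<zero>\<^bsub>R Quot p\<^esub> \<in> h ` J" using ideal_zero[OF Ji] by simp
    show "\<one>\<^bsub>R Quot p\<^esub> \<notin> h ` J"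
      using h_mem[OF Ji J(2) one_closed] ring_hom_one[OF h_hom] primeideal_one_compl[OF J(1)] by auto
  next
    fix x y assume "x \<in> h ` J" "y \<in> h ` J"
    then show "x \<oplus>\<^bsub>R Quot p\<^esub> y \<in> h ` J"
      using ring_hom_add[OF h_hom, symmetric] Js ideal_add[OF Ji] by (auto simp del: FactRing_simps)
  next
    fix r x assume "r \<in> carrier (R Quot p)" "x \<in> h ` J"
    then show "r \<otimes>\<^bsub>R Quot p\<^esub> x \<in> h ` J"
      using ring_hom_mult[OF h_hom, symmetric] Js ideal_mult[OF Ji] by (auto simp: h_carrier)
  next
    fix a b assume a: "a \<in> carrier (R Quot p)" "b \<in> carrier (R Quot p)" "a \<otimes>\<^bsub>R Quot p\<^esub> b \<in> h ` J" "a \<notin> h ` J"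
    then obtain x y where xy: "x \<in> carrier R" "y \<in> carrier R" "a = h x" "b = h y" by (auto simp: h_carrier)
    then have "h (x \<otimes> y) \<in> h ` J" using a(3) ring_hom_mult[OF h_hom] by metis
    then have "x \<otimes> y \<in> J" using h_mem[OF Ji J(2)] xy by simp
    then show "b \<in> h ` J" using primeideal.I_prime[OF J(1)] xy a(4) by blast
  qed
qed

private lemma primeideal_preimage:
  assumes J: "primeideal J (R Quot p)" shows "primeideal {x \<in> carrier R. h x \<in> J} R"
proof -
  interpret Q: cring "R Quot p" by (rule quot_cring)
  note Ji = primeideal.axioms(1)[OF J]
  show ?thesis
  proof (rule primeidealI'[OF cring_idealI])
    have "\<zero>\<^bsub>R Quot p\<^esub> = h \<zero>" using ring_hom_zero[OF h_hom ring_axioms Q.ring_axioms] by simp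
    then show "\<zero> \<in> {x \<in> carrier R. h x \<in> J}" using Q.ideal_zero[OF Ji] by simp
    show "\<one> \<notin> {x \<in> carrier R. h x \<in> J}"
      using ring_hom_one[OF h_hom] primeideal_one_compl[OF J] by auto
  next
    fix x y assume "x \<in> {x \<in> carrier R. h x \<in> J}" "y \<in> {x \<in> carrier R. h x \<in> J}"
    then show "x \<oplus> y \<in> {x \<in> carrier R. h x \<in> J}"
      using ring_hom_add[OF h_hom, of x y] Q.ideal_add[OF Ji] by simp
  next
    fix r x assume "r \<in> carrier R" "x \<in> {x \<in> carrier R. h x \<in> J}"
    then show "r \<otimes> x \<in> {x \<in> carrier R. h x \<in> J}"
      using ring_hom_mult[OF h_hom, of r x] Q.ideal_mult[OF Ji, of "h x" "h r"] by (simp add: h_carrier)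
  next
    fix a b assume "a \<in> carrier R" "b \<in> carrier R" "a \<otimes> b \<in> {x \<in> carrier R. h x \<in> J}" "a \<notin> {x \<in> carrier R. h x \<in> J}"
    then show "b \<in> {x \<in> carrier R. h x \<in> J}"
      using ring_hom_mult[OF h_hom, of a b] primeideal.I_prime[OF J, of "h a" "h b"] by (simp add: h_carrier)
  qed auto
qed

text \<open>Chains pull back along the projection and stay strict because it is surjective.\<close>

lemma krull_dim_quot_le: "krull_dim (R Quot p) \<le> krull_dim R"
proof -
  have "\<exists>P. prime_chain R n P" if P: "prime_chain (R Quot p) n P" for n P
  proof (intro exI)
    let ?P = "\<lambda>i. {x \<in> carrier R. h x \<in> P i}"
    have "?P i \<subset> ?P (Suc i)" if "i < n" for i
    proof -
      have "P i \<subset> P (Suc i)" using P that by (simp add: prime_chain_def)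
      moreover have pr: "primeideal (P (Suc i)) (R Quot p)" using P that by (simp add: prime_chain_def)
      have "P (Suc i) \<subseteq> h ` carrier R"
        unfolding h_carrier[symmetric] using ideal.Icarr[OF primeideal.axioms(1)[OF pr]] by (rule subsetI)
      ultimately show ?thesis by blast
    qed
    then show "prime_chain R n ?P" using P primeideal_preimage by (simp add: prime_chain_def)
  qed
  then show ?thesis unfolding krull_dim_def by (intro SUP_subset_mono) auto
qed

lemma prime_chain_quot:
  assumes P: "prime_chain R n P" "p \<subseteq> P 0"
  shows "prime_chain (R Quot p) n (\<lambda>i. h ` P i)"
proof -
  have pr: "primeideal (P i) R" if "i \<le> n" for i using P that by (simp add: prime_chain_def)
  have sub: "p \<subseteq> P i" if "i \<le> n" for i
    using that
  proof (induction i)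
    case (Suc i)
    moreover have "P i \<subset> P (Suc i)" using P(1) Suc.prems by (simp add: prime_chain_def)
    ultimately show ?case by auto
  qed (use P in auto)
  have "h ` P i \<subset> h ` P (Suc i)" if i: "i < n" for i
  proof -
    have "P i \<subset> P (Suc i)" using P(1) i by (simp add: prime_chain_def)
    then obtain x where x: "x \<in> P (Suc i)" "x \<notin> P i" by blast
    have "x \<in> carrier R" using x(1) ideal_sub primeideal.axioms(1)[OF pr[of "Suc i"]] i by simp
    then have "h x \<notin> h ` P i" using h_mem[OF primeideal.axioms(1)[OF pr] sub, of i x] x(2) i by auto
    then show ?thesis using x(1) \<open>P i \<subset> P (Suc i)\<close> by blast
  qed
  then show ?thesis using primeideal_image pr sub by (simp add: prime_chain_def)
qed

end

text \<open>A chain of maximal length \<open>d\<close> survives modulo its smallest prime, so the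
  quotient by \<open>P 0\<close> has dimension at least \<open>d\<close> and \<open>P 0\<close>
  belongs to \<open>Assh R\<close>. The first case is that of a ring without primes.\<close>

lemma krull_dim_cases:
  assumes "krull_dim R < \<infinity>"
  obtains "krull_dim R = -\<infinity>"
  | d P where "krull_dim R = ereal (real d)" "prime_chain R d P" "P 0 \<in> Assh R"
proof (cases "\<exists>n P. prime_chain R n P")
  case False
  then have "{n. \<exists>P. prime_chain R n P} = {}" by simp
  then have "krull_dim R = -\<infinity>" by (simp only: krull_dim_def) (simp add: bot_ereal_def)
  then show ?thesis by (rule that(1))
next
  case True
  let ?S = "{n. \<exists>P. prime_chain R n P}"
  have le: "ereal (real n) \<le> krull_dim R" if "n \<in> ?S" for n
    unfolding krull_dim_def using that by (intro SUP_upper) auto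
  obtain b :: real where b: "krull_dim R \<le> ereal b"
    using assms by (cases "krull_dim R") auto
  have "n \<le> nat \<lceil>b\<rceil>" if "n \<in> ?S" for n
  proof -
    have "real n \<le> b" using order_trans[OF le[OF that] b] by simp
    then show ?thesis by linarith
  qed
  then have fin: "finite ?S" by (meson finite_nat_set_iff_bounded_le)
  define d where "d = Max ?S"
  have d: "d \<in> ?S" using Max_in[OF fin] True unfolding d_def by blast
  have "krull_dim R \<le> ereal (real d)"
    unfolding krull_dim_def using Max_ge[OF fin] by (intro SUP_least) (simp add: d_def)
  then have kd: "krull_dim R = ereal (real d)" using le[OF d] by (rule antisym)
  obtain P where P: "prime_chain R d P" using d by blast
  have P0: "primeideal (P 0) R" using P by (simp add: prime_chain_def)
  note P0i = primeideal.axioms(1)[OF P0]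
  have "ereal (real d) \<le> krull_dim (R Quot (P 0))"
    unfolding krull_dim_def using prime_chain_quot[OF P0i P order_refl] by (intro SUP_upper) blast
  then have "P 0 \<in> Assh R" using krull_dim_quot_le[OF P0i] kd P0 by (simp add: Assh_def)
  then show ?thesis using that(2) kd P by blast
qed

text \<open>Operations on fractions are unions over representatives; this provides a representative
  to work with.\<close>

lemma frac_rel_refl:
  assumes p: "primeideal p R" and "a \<in> carrier R" "s \<in> carrier R - p"
  shows "(a, s) \<in> fraction R (carrier R - p) a s"
proof -
  have "\<one> \<otimes> (s \<otimes> a \<ominus> s \<otimes> a) = \<zero>" using assms by (simp add: a_minus_def r_neg)
  then have "\<exists>u\<in>carrier R - p. u \<otimes> (s \<otimes> a \<ominus> s \<otimes> a) = \<zero>" using primeideal_one_compl[OF p] by blast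
  then show ?thesis using assms by (simp add: fraction_def frac_rel_def)
qed

text \<open>If \<open>x/1\<close> were nonzero it would be a unit, and clearing denominators in
  \<open>x b / t = 1\<close> would put a product of two elements outside \<open>p\<close> into
  \<open>p\<close>.\<close>

lemma field_localization_annihilates_element:
  assumes p: "primeideal p R" and F: "field (localization_at R p)" and x: "x \<in> p"
  shows "\<exists>u\<in>carrier R - p. u \<otimes> x = \<zero>"
proof -
  let ?S = "carrier R - p"
  interpret p: primeideal p R by fact
  interpret F: field "localization_at R p" by fact
  have one: "\<one> \<in> ?S" by (rule primeideal_one_compl[OF p])
  show ?thesis
  proof (cases "fraction R ?S x \<one> = fraction R ?S \<zero> \<one>")
    case True
    then have "(x, \<one>) \<in> fraction R ?S \<zero> \<one>" using frac_rel_refl[OF p _ one] p.Icarr[OF x] by blast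
    then obtain u where u: "u \<in> ?S" "u \<otimes> (\<one> \<otimes> \<zero> \<ominus> \<one> \<otimes> x) = \<zero>" by (auto simp: fraction_def frac_rel_def)
    then have "\<ominus> (u \<otimes> x) = \<zero>" using p.Icarr[OF x] by (simp add: a_minus_def r_minus)
    then have "u \<otimes> x = \<zero>" using p.Icarr[OF x] u by (metis DiffD1 m_closed minus_minus minus_zero)
    then show ?thesis using u by blast
  next
    case False
    have "fraction R ?S x \<one> \<in> carrier (localization_at R p)"
      using p.Icarr[OF x] one by (auto simp: localization_at_def ring_of_fractions_def fraction_def intro!: quotientI)
    moreover have "fraction R ?S x \<one> \<noteq> \<zero>\<^bsub>localization_at R p\<^esub>"
      using False by (simp add: localization_at_def ring_of_fractions_def)
    ultimately have "fraction R ?S x \<one> \<in> Units (localization_at R p)" by (simp add: F.field_Units)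
    then obtain Y where Y: "Y \<in> carrier (localization_at R p)"
      "fraction R ?S x \<one> \<otimes>\<^bsub>localization_at R p\<^esub> Y = \<one>\<^bsub>localization_at R p\<^esub>"
      by (auto simp: Units_def)
    then obtain b t where bt: "b \<in> carrier R" "t \<in> ?S" "Y = fraction R ?S b t"
      by (auto simp: localization_at_def ring_of_fractions_def fraction_def quotient_def)
    have "(x, \<one>) \<in> fraction R ?S x \<one>" "(b, t) \<in> Y"
      using frac_rel_refl[OF p] one p.Icarr[OF x] bt by auto
    then have "fraction R ?S (x \<otimes> b) (\<one> \<otimes> t) \<subseteq> fraction R ?S \<one> \<one>"
      using Y(2) unfolding localization_at_def ring_of_fractions_def by fastforce
    moreover have "(x \<otimes> b, \<one> \<otimes> t) \<in> fraction R ?S (x \<otimes> b) (\<one> \<otimes> t)"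
      using frac_rel_refl[OF p] bt p.Icarr[OF x] by simp
    ultimately have "(x \<otimes> b, \<one> \<otimes> t) \<in> fraction R ?S \<one> \<one>" by blast
    then obtain u where u: "u \<in> ?S" "u \<otimes> ((\<one> \<otimes> t) \<otimes> \<one> \<ominus> \<one> \<otimes> (x \<otimes> b)) = \<zero>"
      by (auto simp: fraction_def frac_rel_def)
    have "u \<otimes> t = u \<otimes> ((\<one> \<otimes> t) \<otimes> \<one> \<ominus> \<one> \<otimes> (x \<otimes> b)) \<oplus> u \<otimes> (x \<otimes> b)"
      using DiffD1[OF u(1)] bt(1) DiffD1[OF bt(2)] p.Icarr[OF x] by algebra
    also have "\<dots> \<in> p" using u bt x p.Icarr[OF x] by (simp add: p.I_l_closed p.I_r_closed)
    finally show ?thesis using primeideal_mult_compl[OF p u(1) bt(2)] by blast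
  qed
qed

text \<open>As \<open>p\<close> is finitely generated, the vanishing of its localization is
  witnessed by a single \<open>u\<close>. This \<open>u\<close> carries the field hypothesis through
  the rest of the proof.\<close>

lemma field_localization_annihilates:
  assumes p: "primeideal p R" and F: "field (localization_at R p)"
  shows "\<exists>u\<in>carrier R - p. \<forall>x\<in>p. u \<otimes> x = \<zero>"
proof -
  let ?S = "carrier R - p"
  interpret p: primeideal p R by fact
  note ann = field_localization_annihilates_element[OF p F]
  obtain m g where g: "\<And>i. g i \<in> p"
    and gen: "\<And>x. x \<in> p \<Longrightarrow> \<exists>c. (\<forall>i. c i \<in> carrier R) \<and> x = lc (regm R) m c g"
    using ideal_gens[OF p.is_ideal] by metis
  have gR: "g i \<in> carrier R" for i using g p.Icarr by blast
  have "\<exists>u\<in>?S. \<forall>i<m. u \<otimes> g i = \<zero>"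
  proof (rule prime_common[OF p])
    show "\<exists>u\<in>?S. u \<otimes> g i = \<zero>" for i using ann[OF g] .
    fix i r t assume h: "r \<in> carrier R" "t \<in> carrier R" "t \<otimes> g i = \<zero>"
    have "(r \<otimes> t) \<otimes> g i = r \<otimes> (t \<otimes> g i)" by (rule m_assoc[OF h(1,2) gR])
    then show "(r \<otimes> t) \<otimes> g i = \<zero>" unfolding h(3) r_null[OF h(1)] .
  qed
  then obtain u where u: "u \<in> ?S" "\<forall>i<m. u \<otimes> g i = \<zero>" by (rule bexE)
  have "u \<otimes> x = \<zero>" if xp: "x \<in> p" for x
  proof -
    obtain c where c: "\<forall>i. c i \<in> carrier R" "x = lc (regm R) m c g" using gen[OF xp] by blast
    have "u \<otimes> x = lc (regm R) m c (\<lambda>i. u \<otimes> g i)"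
      using module.lc_smult[OF regm_module, of u c g m] c u gR by simp
    also have "\<dots> = \<zero>" using module.lc_zero[OF regm_module, of m c "\<lambda>i. u \<otimes> g i"] c u by simp
    finally show ?thesis .
  qed
  then show ?thesis using u by blast
qed

end

subsection \<open>Free resolutions\<close>

abbreviation bd :: "('a, 'r) ring_scheme \<Rightarrow> (nat \<Rightarrow> nat) \<Rightarrow> (nat \<Rightarrow> nat \<Rightarrow> nat \<Rightarrow> 'a) \<Rightarrow> nat \<Rightarrow> (nat \<Rightarrow> 'a) \<Rightarrow> nat \<Rightarrow> 'a" where
  "bd R r D j z k \<equiv> lc (regm R) (r (Suc j)) (D j k) z"

text \<open>A free complex with a module of rank \<open>r j\<close> in degree \<open>j\<close> and differentials given by the matrices
  \<open>D j\<close> from degree \<open>j + 1\<close> to degree \<open>j\<close>. Vectors are functions on all of \<open>nat\<close> of which only the values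
  below the rank matter.\<close>

definition free_resolution :: "('a, 'r) ring_scheme \<Rightarrow> (nat \<Rightarrow> nat) \<Rightarrow> (nat \<Rightarrow> nat \<Rightarrow> nat \<Rightarrow> 'a) \<Rightarrow> bool" where
  "free_resolution R r D \<longleftrightarrow> (\<forall>j k l. D j k l \<in> carrier R) \<and>
     (\<forall>j z. (\<forall>l. z l \<in> carrier R) \<longrightarrow> (\<forall>k<r j. bd R r D j (bd R r D (Suc j) z) k = \<zero>\<^bsub>R\<^esub>)) \<and>
     (\<forall>j z. (\<forall>l. z l \<in> carrier R) \<longrightarrow> (\<forall>k<r j. bd R r D j z k = \<zero>\<^bsub>R\<^esub>) \<longrightarrow>
        (\<exists>w. (\<forall>l. w l \<in> carrier R) \<and> (\<forall>l<r (Suc j). z l = bd R r D (Suc j) w l)))"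

definition resolves :: "('a, 'r) ring_scheme \<Rightarrow> 'a set \<Rightarrow> (nat \<Rightarrow> nat) \<Rightarrow> (nat \<Rightarrow> nat \<Rightarrow> nat \<Rightarrow> 'a) \<Rightarrow> bool" where
  "resolves R I r D \<longleftrightarrow> free_resolution R r D \<and> r 0 = 1 \<and>
     I = {bd R r D 0 w 0 | w. \<forall>l. w l \<in> carrier R}"

text \<open>\<open>Tor\<^sub>i(R/J, H\<^sub>0)\<close> vanishes at \<open>q\<close>, where \<open>H\<^sub>0\<close> is the module resolved by \<open>(r, D)\<close>.\<close>

definition tor_vanishes ::
  "('a, 'r) ring_scheme \<Rightarrow> 'a set \<Rightarrow> 'a set \<Rightarrow> (nat \<Rightarrow> nat) \<Rightarrow> (nat \<Rightarrow> nat \<Rightarrow> nat \<Rightarrow> 'a) \<Rightarrow> nat \<Rightarrow> bool" where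
  "tor_vanishes R q J r D i \<longleftrightarrow> (\<forall>z. (\<forall>l. z l \<in> carrier R) \<longrightarrow>
     (\<forall>j. i = Suc j \<longrightarrow> (\<forall>k<r j. bd R r D j z k \<in> J)) \<longrightarrow>
     (\<exists>s\<in>carrier R - q. \<exists>w. (\<forall>l. w l \<in> carrier R) \<and> (\<forall>l<r i. s \<otimes>\<^bsub>R\<^esub> z l \<ominus>\<^bsub>R\<^esub> bd R r D i w l \<in> J)))"

lemma free_resolutionD:
  assumes "free_resolution R r D"
  shows "D j k l \<in> carrier R"
    and "(\<And>l. z l \<in> carrier R) \<Longrightarrow> k < r j \<Longrightarrow> bd R r D j (bd R r D (Suc j) z) k = \<zero>\<^bsub>R\<^esub>"
    and "(\<And>l. z l \<in> carrier R) \<Longrightarrow> (\<And>k. k < r j \<Longrightarrow> bd R r D j z k = \<zero>\<^bsub>R\<^esub>) \<Longrightarrow>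
      \<exists>w. (\<forall>l. w l \<in> carrier R) \<and> (\<forall>l<r (Suc j). z l = bd R r D (Suc j) w l)"
  using assms unfolding free_resolution_def by blast+

lemma resolvesD:
  assumes "resolves R I r D"
  shows "free_resolution R r D" "r 0 = 1" "x \<in> I \<longleftrightarrow> (\<exists>w. (\<forall>l. w l \<in> carrier R) \<and> x = bd R r D 0 w 0)"
  using assms unfolding resolves_def by auto

lemma tor_vanishesD:
  assumes "tor_vanishes R q J r D i" "\<And>l. z l \<in> carrier R"
    "\<And>j k. i = Suc j \<Longrightarrow> k < r j \<Longrightarrow> bd R r D j z k \<in> J"
  shows "\<exists>s\<in>carrier R - q. \<exists>w. (\<forall>l. w l \<in> carrier R) \<and> (\<forall>l<r i. s \<otimes>\<^bsub>R\<^esub> z l \<ominus>\<^bsub>R\<^esub> bd R r D i w l \<in> J)"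
proof -
  have h: "(\<forall>l. z l \<in> carrier R) \<longrightarrow> (\<forall>j. i = Suc j \<longrightarrow> (\<forall>k<r j. bd R r D j z k \<in> J)) \<longrightarrow>
     (\<exists>s\<in>carrier R - q. \<exists>w. (\<forall>l. w l \<in> carrier R) \<and> (\<forall>l<r i. s \<otimes>\<^bsub>R\<^esub> z l \<ominus>\<^bsub>R\<^esub> bd R r D i w l \<in> J))"
    using assms(1) unfolding tor_vanishes_def by (rule spec)
  have a: "\<forall>l. z l \<in> carrier R" using assms(2) by simp
  have b: "\<forall>j. i = Suc j \<longrightarrow> (\<forall>k<r j. bd R r D j z k \<in> J)"
    by (intro allI impI) (rule assms(3))
  show ?thesis by (rule mp[OF mp[OF h a] b])
qed

lemma tor_vanishesI:
  assumes "\<And>z. (\<And>l. z l \<in> carrier R) \<Longrightarrow> (\<And>j k. i = Suc j \<Longrightarrow> k < r j \<Longrightarrow> bd R r D j z k \<in> J) \<Longrightarrow>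
    \<exists>s\<in>carrier R - q. \<exists>w. (\<forall>l. w l \<in> carrier R) \<and> (\<forall>l<r i. s \<otimes>\<^bsub>R\<^esub> z l \<ominus>\<^bsub>R\<^esub> bd R r D i w l \<in> J)"
  shows "tor_vanishes R q J r D i"
  using assms unfolding tor_vanishes_def by blast

lemma tor_vanishes_mono: "tor_vanishes R q' J r D i \<Longrightarrow> q \<subseteq> q' \<Longrightarrow> tor_vanishes R q J r D i"
proof (rule tor_vanishesI)
  fix z assume h: "tor_vanishes R q' J r D i" "q \<subseteq> q'" "\<And>l. z l \<in> carrier R"
    "\<And>j k. i = Suc j \<Longrightarrow> k < r j \<Longrightarrow> bd R r D j z k \<in> J"
  have sub: "carrier R - q' \<subseteq> carrier R - q" using h(2) by blast
  show "\<exists>s\<in>carrier R - q. \<exists>w. (\<forall>l. w l \<in> carrier R) \<and> (\<forall>l<r i. s \<otimes>\<^bsub>R\<^esub> z l \<ominus>\<^bsub>R\<^esub> bd R r D i w l \<in> J)"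
  proof (rule bexE[OF tor_vanishesD[OF h(1,3,4)]])
    fix s assume s: "s \<in> carrier R - q'"
      and w: "\<exists>w. (\<forall>l. w l \<in> carrier R) \<and> (\<forall>l<r i. s \<otimes>\<^bsub>R\<^esub> z l \<ominus>\<^bsub>R\<^esub> bd R r D i w l \<in> J)"
    show ?thesis by (intro bexI[of _ s]) (rule w, rule subsetD[OF sub s])
  qed
qed

context cring
begin

lemmas lcR_add = module.lc_add[OF regm_module, simplified]
lemmas lcR_smult = module.lc_smult[OF regm_module, simplified]
lemmas lcR_minus = module.lc_minus[OF regm_module, simplified]
lemmas lcR_diff = module.lc_diff[OF regm_module, simplified]
lemmas lcR_zero = module.lc_zero[OF regm_module, simplified]
lemmas lcR_zero_left = module.lc_zero_left[OF regm_module, simplified]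
lemmas lcR_add_left = module.lc_add_left[OF regm_module, simplified]
lemmas lcR_smult_left = module.lc_smult_left[OF regm_module, simplified]
lemmas lcR_minus_left = module.lc_minus_left[OF regm_module, simplified]
lemmas lcR_append = module.lc_append[OF regm_module, simplified]
lemmas lcR_unit_left = module.lc_unit_left[OF regm_module, simplified]
lemmas lcR_lc = module.lc_lc[OF regm_module, simplified]

text \<open>The complex condition at the \<open>l\<close>-th unit vector, as an identity of matrix
  entries.\<close>

lemma free_resolution_matrix:
  assumes F: "free_resolution R r D" and k: "k < r j" and l: "l < r (Suc (Suc j))"
  shows "bd R r D j (\<lambda>m. D (Suc j) m l) k = \<zero>"
proof -
  note c = free_resolutionD(1)[OF F]
  have "bd R r D (Suc j) (\<lambda>i. if i = l then \<one> else \<zero>) m = D (Suc j) m l" for m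
    using l lc_unit_right[OF c] by simp
  then show ?thesis using free_resolutionD(2)[OF F _ k, of "\<lambda>i. if i = l then \<one> else \<zero>"] by simp
qed

end

context noeth_cring
begin

text \<open>Dependent choice of matrices: \<open>vec_gens\<close> gives generators of the kernel of
  one matrix, and these are the columns of the next. A state \<open>(n, m, A)\<close> holds the two
  ranks and the matrix; \<open>Q\<close> matches the kernel with the next image.\<close>

lemma resolution_exists:
  assumes I: "ideal I R"
  shows "\<exists>r D. resolves R I r D"
proof -
  obtain m1 h where h: "\<And>i. h i \<in> I"
    and hg: "\<And>x. x \<in> I \<Longrightarrow> \<exists>c. (\<forall>i. c i \<in> carrier R) \<and> x = lc (regm R) m1 c h"
    using ideal_gens[OF I] by metis
  have hR: "h i \<in> carrier R" for i using h ideal_sub[OF I] by blast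
  define P :: "nat \<Rightarrow> nat \<times> nat \<times> (nat \<Rightarrow> nat \<Rightarrow> 'a) \<Rightarrow> bool" where
    "P = (\<lambda>j (n, m, A). (\<forall>k l. A k l \<in> carrier R) \<and>
       (j = 0 \<longrightarrow> n = 1 \<and> I = {lc (regm R) m (A 0) w | w. \<forall>l. w l \<in> carrier R}))"
  define Q :: "nat \<Rightarrow> nat \<times> nat \<times> (nat \<Rightarrow> nat \<Rightarrow> 'a) \<Rightarrow> nat \<times> nat \<times> (nat \<Rightarrow> nat \<Rightarrow> 'a) \<Rightarrow> bool" where
    "Q = (\<lambda>j (n, m, A) (n', m', A'). n' = m \<and> (\<forall>z. (\<forall>l. z l \<in> carrier R) \<longrightarrow>
       (\<forall>k<n. lc (regm R) m (A k) z = \<zero>) =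
       (\<exists>w. (\<forall>l. w l \<in> carrier R) \<and> (\<forall>l<m. z l = lc (regm R) m' (A' l) w))))"
  have "\<exists>f. \<forall>j. P j (f j) \<and> Q j (f j) (f (Suc j))"
  proof (rule dependent_nat_choice)
    have "x \<in> I \<longleftrightarrow> (\<exists>w. x = lc (regm R) m1 h w \<and> (\<forall>l. w l \<in> carrier R))" for x
    proof
      assume "x \<in> I"
      then obtain c where c: "\<forall>i. c i \<in> carrier R" "x = lc (regm R) m1 c h" using hg by blast
      then have "x = lc (regm R) m1 h c" using lc_regm_comm[of c h m1] hR by simp
      then show "\<exists>w. x = lc (regm R) m1 h w \<and> (\<forall>l. w l \<in> carrier R)" using c by blast
    next
      assume "\<exists>w. x = lc (regm R) m1 h w \<and> (\<forall>l. w l \<in> carrier R)"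
      then obtain w where w: "x = lc (regm R) m1 h w" "\<forall>l. w l \<in> carrier R" by blast
      then have "x = lc (regm R) m1 w h" using lc_regm_comm[of h w m1] hR by simp
      then show "x \<in> I" using ideal_lc[OF I] w h by simp
    qed
    then have "P 0 (1, m1, \<lambda>_. h)" using hR by (auto simp: P_def)
    then show "\<exists>x. P 0 x" by blast
  next
    fix x j assume Px: "P j x"
    obtain n m A where x: "x = (n, m, A)" by (cases x)
    have A: "A k l \<in> carrier R" for k l using Px x by (simp add: P_def)
    let ?K = "{z. (\<forall>l. z l \<in> carrier R) \<and> (\<forall>k<n. lc (regm R) m (A k) z = \<zero>)}"
    have "\<exists>m' g. (\<forall>i. g i \<in> ?K) \<and>
      (\<forall>z\<in>?K. \<exists>c. (\<forall>i. c i \<in> carrier R) \<and> (\<forall>l<m. z l = lc (regm R) m' c (\<lambda>i. g i l)))"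
      by (rule vec_gens) (use A in \<open>auto simp: lcR_add lcR_smult lcR_zero\<close>)
    then obtain m' g where g: "\<And>i. g i \<in> ?K"
      and gen: "\<And>z. z \<in> ?K \<Longrightarrow> \<exists>c. (\<forall>i. c i \<in> carrier R) \<and> (\<forall>l<m. z l = lc (regm R) m' c (\<lambda>i. g i l))"
      by blast
    have gR: "g i l \<in> carrier R" for i l using g by blast
    have gz: "k < n \<Longrightarrow> lc (regm R) m (A k) (g i) = \<zero>" for i k using g by blast
    let ?A = "\<lambda>l i. g i l"
    have "(\<forall>k<n. lc (regm R) m (A k) z = \<zero>) \<longleftrightarrow>
       (\<exists>w. (\<forall>l. w l \<in> carrier R) \<and> (\<forall>l<m. z l = lc (regm R) m' (?A l) w))" (is "?L \<longleftrightarrow> ?Rr")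
      if z: "\<forall>l. z l \<in> carrier R" for z :: "nat \<Rightarrow> 'a"
    proof
      assume ?L
      then have "z \<in> ?K" using z by blast
      then obtain c where c: "\<forall>i. c i \<in> carrier R" "\<forall>l<m. z l = lc (regm R) m' c (\<lambda>i. g i l)" using gen by blast
      then have "\<forall>l<m. z l = lc (regm R) m' (?A l) c" using lc_regm_comm[of c "?A _" m'] gR by simp
      then show ?Rr using c by blast
    next
      assume ?Rr
      then obtain w where w: "\<forall>l. w l \<in> carrier R" "\<forall>l<m. z l = lc (regm R) m' (?A l) w" by blast
      have "lc (regm R) m (A k) z = \<zero>" if k: "k < n" for k
      proof -
        have "lc (regm R) m (A k) z = lc (regm R) m (A k) (\<lambda>l. lc (regm R) m' (?A l) w)"
          by (rule lc_cong) (use w in auto)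
        also have "\<dots> = lc (regm R) m' (\<lambda>i. lc (regm R) m (A k) (\<lambda>l. ?A l i)) w"
          by (rule lcR_lc) (use A gR w in auto)
        also have "\<dots> = \<zero>" by (rule lcR_zero_left) (use gz k w in auto)
        finally show ?thesis .
      qed
      then show ?L by blast
    qed
    then have "P (Suc j) (m, m', ?A) \<and> Q j x (m, m', ?A)" using x gR by (simp add: P_def Q_def)
    then show "\<exists>y. P (Suc j) y \<and> Q j x y" by blast
  qed
  then obtain f where f: "\<And>j. P j (f j)" "\<And>j. Q j (f j) (f (Suc j))" by blast
  define r D where "r j = fst (f j)" and "D j = snd (snd (f j))" for j
  have fj: "f j = (r j, r (Suc j), D j)" for j
    using f(2)[of j] by (cases "f j"; cases "f (Suc j)") (auto simp: r_def D_def Q_def)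
  have D: "D j k l \<in> carrier R" for j k l using f(1)[of j] by (simp add: fj P_def)
  have ex: "(\<forall>k<r j. bd R r D j z k = \<zero>) \<longleftrightarrow>
       (\<exists>w. (\<forall>l. w l \<in> carrier R) \<and> (\<forall>l<r (Suc j). z l = bd R r D (Suc j) w l))"
    if "\<forall>l. z l \<in> carrier R" for j and z :: "nat \<Rightarrow> 'a"
    using f(2)[of j] that by (simp add: fj Q_def)
  have "free_resolution R r D"
    unfolding free_resolution_def
  proof (intro conjI allI impI)
    fix j k and z :: "nat \<Rightarrow> 'a" assume z: "\<forall>l. z l \<in> carrier R" and k: "k < r j"
    have "\<forall>l. bd R r D (Suc j) z l \<in> carrier R" using z D by simp
    from ex[OF this] show "bd R r D j (bd R r D (Suc j) z) k = \<zero>" using z k by blast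
  next
    fix j and z :: "nat \<Rightarrow> 'a" assume z: "\<forall>l. z l \<in> carrier R" and k: "\<forall>k<r j. bd R r D j z k = \<zero>"
    from ex[OF z] k show "\<exists>w. (\<forall>l. w l \<in> carrier R) \<and> (\<forall>l<r (Suc j). z l = bd R r D (Suc j) w l)" by blast
  qed (rule D)
  then have "resolves R I r D" using f(1)[of 0] by (simp add: resolves_def fj P_def)
  then show ?thesis by blast
qed

text \<open>The comparison theorem for the map from \<open>R/(I:a)\<close> to \<open>R/I\<close>
  given by multiplication by \<open>a\<close>: it lifts to a chain map of the resolutions, chosen
  column by column in each degree.\<close>

lemma lift_exists:
  assumes I: "ideal I R" and a: "a \<in> carrier R"
    and F: "resolves R I r D" and F': "resolves R (colon R I a) r' D'"
  shows "\<exists>\<phi>. (\<forall>j k l. \<phi> j k l \<in> carrier R) \<and> \<phi> 0 0 0 = a \<and>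
    (\<forall>j z k. (\<forall>l. z l \<in> carrier R) \<longrightarrow> k < r j \<longrightarrow>
      bd R r D j (\<lambda>m. lc (regm R) (r' (Suc j)) (\<phi> (Suc j) m) z) k = lc (regm R) (r' j) (\<phi> j k) (bd R r' D' j z))"
proof -
  note f = resolvesD(1)[OF F] and f' = resolvesD(1)[OF F']
  note D = free_resolutionD(1)[OF f] and D' = free_resolutionD(1)[OF f']
  \<comment> \<open>The last clause makes the next choice possible: the columns of
    \<open>\<phi>\<close> composed with \<open>D' j\<close> are boundaries.\<close>
  define P :: "nat \<Rightarrow> (nat \<Rightarrow> nat \<Rightarrow> 'a) \<Rightarrow> bool" where
    "P j \<phi> \<longleftrightarrow> (\<forall>k l. \<phi> k l \<in> carrier R) \<and> (j = 0 \<longrightarrow> \<phi> 0 0 = a) \<and>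
       (\<forall>l<r' (Suc j). \<exists>w. (\<forall>i. w i \<in> carrier R) \<and>
          (\<forall>k<r j. lc (regm R) (r' j) (\<phi> k) (\<lambda>m. D' j m l) = bd R r D j w k))" for j \<phi>
  define Q :: "nat \<Rightarrow> (nat \<Rightarrow> nat \<Rightarrow> 'a) \<Rightarrow> (nat \<Rightarrow> nat \<Rightarrow> 'a) \<Rightarrow> bool" where
    "Q j \<phi> \<psi> \<longleftrightarrow> (\<forall>l<r' (Suc j). \<forall>k<r j. lc (regm R) (r' j) (\<phi> k) (\<lambda>m. D' j m l) = bd R r D j (\<lambda>m. \<psi> m l) k)" for j \<phi> \<psi>
  have "\<exists>f. \<forall>j. P j (f j) \<and> Q j (f j) (f (Suc j))"
  proof (rule dependent_nat_choice)
    have "\<exists>w. (\<forall>i. w i \<in> carrier R) \<and> a \<otimes> D' 0 0 l = bd R r D 0 w 0" if l: "l < r' (Suc 0)" for l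
    proof -
      have "bd R r' D' 0 (\<lambda>i. if i = l then \<one> else \<zero>) 0 = D' 0 0 l" using l lc_unit_right[OF D'] by simp
      then have "D' 0 0 l \<in> colon R I a"
        unfolding resolvesD(3)[OF F'] by (intro exI[of _ "\<lambda>i. if i = l then \<one> else \<zero>"]) auto
      then have "a \<otimes> D' 0 0 l \<in> I" using a D' by (simp add: colon_def m_comm)
      then show ?thesis unfolding resolvesD(3)[OF F] by blast
    qed
    then have "P 0 (\<lambda>_ _. a)" using a D' by (auto simp: P_def resolvesD(2)[OF F] resolvesD(2)[OF F'])
    then show "\<exists>x. P 0 x" by blast
  next
    fix \<phi> j assume P: "P j \<phi>"
    have \<phi>: "\<phi> k l \<in> carrier R" for k l using P by (simp add: P_def)
    have "\<forall>l. \<exists>w. (\<forall>i. w i \<in> carrier R) \<and>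
          (l < r' (Suc j) \<longrightarrow> (\<forall>k<r j. lc (regm R) (r' j) (\<phi> k) (\<lambda>m. D' j m l) = bd R r D j w k))"
      using P unfolding P_def by (metis zero_closed)
    then obtain w where w: "\<And>l i. w l i \<in> carrier R"
      "\<And>l k. l < r' (Suc j) \<Longrightarrow> k < r j \<Longrightarrow> lc (regm R) (r' j) (\<phi> k) (\<lambda>m. D' j m l) = bd R r D j (w l) k"
      by metis
    let ?\<psi> = "\<lambda>m l. w l m"
    have "\<exists>v. (\<forall>i. v i \<in> carrier R) \<and>
          (\<forall>k<r (Suc j). lc (regm R) (r' (Suc j)) (?\<psi> k) (\<lambda>m. D' (Suc j) m l) = bd R r D (Suc j) v k)"
      if l: "l < r' (Suc (Suc j))" for l
    proof (rule free_resolutionD(3)[OF f])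
      let ?x = "\<lambda>m. D' (Suc j) m l"
      show "lc (regm R) (r' (Suc j)) (?\<psi> i) ?x \<in> carrier R" for i using w D' by simp
      fix k assume k: "k < r j"
      have "bd R r D j (\<lambda>m. lc (regm R) (r' (Suc j)) (?\<psi> m) ?x) k
        = lc (regm R) (r' (Suc j)) (\<lambda>i. bd R r D j (\<lambda>m. ?\<psi> m i) k) ?x"
        by (rule lcR_lc) (use w D D' in auto)
      also have "\<dots> = lc (regm R) (r' (Suc j)) (\<lambda>i. lc (regm R) (r' j) (\<phi> k) (\<lambda>m. D' j m i)) ?x"
        by (rule lc_cong) (use w(2) k in auto)
      also have "\<dots> = lc (regm R) (r' j) (\<phi> k) (\<lambda>m. bd R r' D' j ?x m)"
        by (rule lcR_lc[symmetric]) (use \<phi> D' in auto)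
      also have "\<dots> = \<zero>" by (rule lcR_zero) (use \<phi> free_resolution_matrix[OF f' _ l] in auto)
      finally show "bd R r D j (\<lambda>m. lc (regm R) (r' (Suc j)) (?\<psi> m) ?x) k = \<zero>" .
    qed
    then have "P (Suc j) ?\<psi> \<and> Q j \<phi> ?\<psi>" using w by (simp add: P_def Q_def)
    then show "\<exists>\<psi>. P (Suc j) \<psi> \<and> Q j \<phi> \<psi>" by blast
  qed
  then obtain \<phi> where PQ: "\<And>j. P j (\<phi> j)" "\<And>j. Q j (\<phi> j) (\<phi> (Suc j))" by blast
  have \<phi>: "\<phi> j k l \<in> carrier R" for j k l using PQ(1)[of j] by (simp add: P_def)
  have "bd R r D j (\<lambda>m. lc (regm R) (r' (Suc j)) (\<phi> (Suc j) m) z) k = lc (regm R) (r' j) (\<phi> j k) (bd R r' D' j z)"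
    if z: "\<forall>l. z l \<in> carrier R" and k: "k < r j" for j and z :: "nat \<Rightarrow> 'a" and k
  proof -
    have "bd R r D j (\<lambda>m. lc (regm R) (r' (Suc j)) (\<phi> (Suc j) m) z) k
        = lc (regm R) (r' (Suc j)) (\<lambda>i. bd R r D j (\<lambda>m. \<phi> (Suc j) m i) k) z"
      by (rule lcR_lc) (use z D \<phi> in auto)
    also have "\<dots> = lc (regm R) (r' (Suc j)) (\<lambda>i. lc (regm R) (r' j) (\<phi> j k) (\<lambda>m. D' j m i)) z"
      by (rule lc_cong) (use PQ(2)[of j] k in \<open>auto simp: Q_def\<close>)
    also have "\<dots> = lc (regm R) (r' j) (\<phi> j k) (\<lambda>m. bd R r' D' j z m)"
      by (rule lcR_lc[symmetric]) (use z D' \<phi> in auto)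
    finally show ?thesis .
  qed
  then show ?thesis using \<phi> PQ(1)[of 0] unfolding P_def by blast
qed

text \<open>\<open>s\<close> annihilates \<open>R/I\<close>, so multiplication by \<open>s\<close>
  on the resolution lifts the zero map and equals \<open>D h + h D\<close> for a homotopy
  \<open>h\<close>. In each degree the columns of the remaining defect are cycles, and exactness
  gives the next part of \<open>h\<close>.\<close>

lemma nullhomotopy:
  assumes I: "ideal I R" and s: "s \<in> I" and F: "resolves R I r D"
  shows "\<exists>h. (\<forall>j k l. h j k l \<in> carrier R) \<and>
    (\<forall>z. (\<forall>l. z l \<in> carrier R) \<longrightarrow> s \<otimes> z 0 = bd R r D 0 (\<lambda>m. lc (regm R) (r 0) (h 0 m) z) 0) \<and>
    (\<forall>j z m. (\<forall>l. z l \<in> carrier R) \<longrightarrow> m < r (Suc j) \<longrightarrow>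
      s \<otimes> z m = bd R r D (Suc j) (\<lambda>m. lc (regm R) (r (Suc j)) (h (Suc j) m) z) m \<oplus> lc (regm R) (r j) (h j m) (bd R r D j z))"
proof -
  note f = resolvesD(1)[OF F]
  note D = free_resolutionD(1)[OF f]
  have sR: "s \<in> carrier R" using s ideal_sub[OF I] by blast
  \<comment> \<open>The matrix of multiplication by \<open>s\<close>.\<close>
  let ?\<delta> = "\<lambda>m l. if m = l then s else \<zero>"
  have \<delta>: "lc (regm R) n c (\<lambda>m. ?\<delta> m l) = (if l < n then s \<otimes> c l else \<zero>)" if c: "\<And>i. c i \<in> carrier R" for n c l
  proof -
    have "lc (regm R) n c (\<lambda>m. ?\<delta> m l) = lc (regm R) n c (\<lambda>m. s \<otimes> (if m = l then \<one> else \<zero>))"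
      by (rule lc_cong) (use sR in auto)
    also have "\<dots> = s \<otimes> lc (regm R) n c (\<lambda>m. if m = l then \<one> else \<zero>)" by (rule lcR_smult) (use c sR in auto)
    finally show ?thesis using lc_unit_right[OF c, where n = n and k = l] sR by simp
  qed
  have \<delta>': "lc (regm R) n (?\<delta> m) z = (if m < n then s \<otimes> z m else \<zero>)" if z: "\<And>i. z i \<in> carrier R" for n z m
  proof -
    have "lc (regm R) n (?\<delta> m) z = lc (regm R) n z (\<lambda>l. ?\<delta> l m)"
      using lc_regm_comm[of "?\<delta> m" z n] sR z by (simp add: eq_commute[of m])
    then show ?thesis using \<delta>[OF z] by simp
  qed
  define P :: "nat \<Rightarrow> (nat \<Rightarrow> nat \<Rightarrow> 'a) \<Rightarrow> bool" where
    "P j h \<longleftrightarrow> (\<forall>k l. h k l \<in> carrier R) \<and> (j = 0 \<longrightarrow> bd R r D 0 (\<lambda>m. h m 0) 0 = s) \<and>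
       (\<forall>l<r (Suc j). \<exists>w. (\<forall>i. w i \<in> carrier R) \<and>
          (\<forall>m<r (Suc j). ?\<delta> m l \<ominus> lc (regm R) (r j) (h m) (\<lambda>k. D j k l) = bd R r D (Suc j) w m))" for j h
  define Q :: "nat \<Rightarrow> (nat \<Rightarrow> nat \<Rightarrow> 'a) \<Rightarrow> (nat \<Rightarrow> nat \<Rightarrow> 'a) \<Rightarrow> bool" where
    "Q j h h' \<longleftrightarrow> (\<forall>l<r (Suc j). \<forall>m<r (Suc j).
       ?\<delta> m l \<ominus> lc (regm R) (r j) (h m) (\<lambda>k. D j k l) = bd R r D (Suc j) (\<lambda>i. h' i l) m)" for j h h'
  have "\<exists>f. \<forall>j. P j (f j) \<and> Q j (f j) (f (Suc j))"
  proof (rule dependent_nat_choice)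
    \<comment> \<open>\<open>I\<close> is the image of the first differential, so \<open>s\<close>
      is the boundary of some \<open>w\<close>; this is the single column of the homotopy in degree
      0.\<close>
    obtain w where w: "\<And>l. w l \<in> carrier R" "s = bd R r D 0 w 0" using s resolvesD(3)[OF F] by blast
    have "\<exists>v. (\<forall>i. v i \<in> carrier R) \<and>
          (\<forall>m<r (Suc 0). ?\<delta> m l \<ominus> w m \<otimes> D 0 0 l = bd R r D (Suc 0) v m)" if l: "l < r (Suc 0)" for l
    proof (rule free_resolutionD(3)[OF f])
      show "?\<delta> m l \<ominus> w m \<otimes> D 0 0 l \<in> carrier R" for m using sR w D by simp
      fix k assume "k < r 0"
      then have k: "k = 0" using resolvesD(2)[OF F] by simp
      have "bd R r D 0 (\<lambda>m. ?\<delta> m l \<ominus> w m \<otimes> D 0 0 l) 0 = bd R r D 0 (\<lambda>m. ?\<delta> m l) 0 \<ominus> bd R r D 0 (\<lambda>m. w m \<otimes> D 0 0 l) 0"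
        by (rule lcR_diff) (use sR w D in auto)
      also have "bd R r D 0 (\<lambda>m. ?\<delta> m l) 0 = s \<otimes> D 0 0 l" using \<delta>[OF D] l by simp
      also have "bd R r D 0 (\<lambda>m. w m \<otimes> D 0 0 l) 0 = bd R r D 0 (\<lambda>m. D 0 0 l \<otimes> w m) 0"
        by (rule lc_cong) (use w D in \<open>auto simp: m_comm\<close>)
      also have "\<dots> = D 0 0 l \<otimes> bd R r D 0 w 0" by (rule lcR_smult) (use w D in auto)
      finally show "bd R r D 0 (\<lambda>m. ?\<delta> m l \<ominus> w m \<otimes> D 0 0 l) k = \<zero>"
        using k w(2)[symmetric] sR D by (simp add: a_minus_def m_comm r_neg)
    qed
    then have "P 0 (\<lambda>m _. w m)" using w D by (auto simp: P_def resolvesD(2)[OF F])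
    then show "\<exists>x. P 0 x" by blast
  next
    fix h j assume P: "P j h"
    have h: "h k l \<in> carrier R" for k l using P by (simp add: P_def)
    have "\<forall>l. \<exists>w. (\<forall>i. w i \<in> carrier R) \<and> (l < r (Suc j) \<longrightarrow>
          (\<forall>m<r (Suc j). ?\<delta> m l \<ominus> lc (regm R) (r j) (h m) (\<lambda>k. D j k l) = bd R r D (Suc j) w m))"
      using P unfolding P_def by (metis zero_closed)
    then obtain w where w: "\<And>l i. w l i \<in> carrier R"
      "\<And>l m. l < r (Suc j) \<Longrightarrow> m < r (Suc j) \<Longrightarrow> ?\<delta> m l \<ominus> lc (regm R) (r j) (h m) (\<lambda>k. D j k l) = bd R r D (Suc j) (w l) m"
      by metis
    let ?h = "\<lambda>m l. w l m"
    have "\<exists>v. (\<forall>i. v i \<in> carrier R) \<and>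
          (\<forall>m<r (Suc (Suc j)). ?\<delta> m l \<ominus> lc (regm R) (r (Suc j)) (?h m) (\<lambda>k. D (Suc j) k l) = bd R r D (Suc (Suc j)) v m)"
      if l: "l < r (Suc (Suc j))" for l
    proof (rule free_resolutionD(3)[OF f])
      let ?x = "\<lambda>k. D (Suc j) k l"
      show "?\<delta> m l \<ominus> lc (regm R) (r (Suc j)) (?h m) ?x \<in> carrier R" for m using sR w D by simp
      fix k assume k: "k < r (Suc j)"
      have "bd R r D (Suc j) (\<lambda>m. ?\<delta> m l \<ominus> lc (regm R) (r (Suc j)) (?h m) ?x) k
        = bd R r D (Suc j) (\<lambda>m. ?\<delta> m l) k \<ominus> bd R r D (Suc j) (\<lambda>m. lc (regm R) (r (Suc j)) (?h m) ?x) k"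
        by (rule lcR_diff) (use sR w D in auto)
      also have "bd R r D (Suc j) (\<lambda>m. ?\<delta> m l) k = s \<otimes> ?x k" using \<delta>[OF D] l by simp
      also have "bd R r D (Suc j) (\<lambda>m. lc (regm R) (r (Suc j)) (?h m) ?x) k
        = lc (regm R) (r (Suc j)) (\<lambda>i. bd R r D (Suc j) (\<lambda>m. ?h m i) k) ?x"
        by (rule lcR_lc) (use w D in auto)
      also have "\<dots> = lc (regm R) (r (Suc j)) (\<lambda>i. ?\<delta> k i \<oplus> \<ominus> lc (regm R) (r j) (h k) (\<lambda>k'. D j k' i)) ?x"
        by (rule lc_cong) (use w(2)[symmetric] k in \<open>auto simp: a_minus_def\<close>)
      also have "\<dots> = lc (regm R) (r (Suc j)) (?\<delta> k) ?x \<oplus> lc (regm R) (r (Suc j)) (\<lambda>i. \<ominus> lc (regm R) (r j) (h k) (\<lambda>k'. D j k' i)) ?x"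
        by (rule lcR_add_left) (use sR h D in auto)
      also have "lc (regm R) (r (Suc j)) (\<lambda>i. \<ominus> lc (regm R) (r j) (h k) (\<lambda>k'. D j k' i)) ?x
        = \<ominus> lc (regm R) (r (Suc j)) (\<lambda>i. lc (regm R) (r j) (h k) (\<lambda>k'. D j k' i)) ?x"
        by (rule lcR_minus_left) (use h D in auto)
      also have "lc (regm R) (r (Suc j)) (\<lambda>i. lc (regm R) (r j) (h k) (\<lambda>k'. D j k' i)) ?x
        = lc (regm R) (r j) (h k) (\<lambda>k'. bd R r D j ?x k')"
        by (rule lcR_lc[symmetric]) (use h D in auto)
      also have "\<dots> = \<zero>" by (rule lcR_zero) (use h free_resolution_matrix[OF f _ l] in auto)
      also have "lc (regm R) (r (Suc j)) (?\<delta> k) ?x = s \<otimes> ?x k" using \<delta>'[OF D] k by simp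
      finally show "bd R r D (Suc j) (\<lambda>m. ?\<delta> m l \<ominus> lc (regm R) (r (Suc j)) (?h m) ?x) k = \<zero>"
        using sR D by (simp add: a_minus_def r_neg)
    qed
    then have "P (Suc j) ?h \<and> Q j h ?h" using w by (simp add: P_def Q_def)
    then show "\<exists>h'. P (Suc j) h' \<and> Q j h h'" by blast
  qed
  then obtain h where PQ: "\<And>j. P j (h j)" "\<And>j. Q j (h j) (h (Suc j))" by blast
  have h: "h j k l \<in> carrier R" for j k l using PQ(1)[of j] by (simp add: P_def)
  have "s \<otimes> z 0 = bd R r D 0 (\<lambda>m. lc (regm R) (r 0) (h 0 m) z) 0" if z: "\<forall>l. z l \<in> carrier R" for z :: "nat \<Rightarrow> 'a"
  proof -
    have "bd R r D 0 (\<lambda>m. lc (regm R) (r 0) (h 0 m) z) 0 = bd R r D 0 (\<lambda>m. z 0 \<otimes> h 0 m 0) 0"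
      by (rule lc_cong) (use z h in \<open>auto simp: resolvesD(2)[OF F] m_comm\<close>)
    also have "\<dots> = z 0 \<otimes> bd R r D 0 (\<lambda>m. h 0 m 0) 0" by (rule lcR_smult) (use z h D in auto)
    also have "\<dots> = s \<otimes> z 0" using PQ(1)[of 0] z sR by (simp add: P_def m_comm)
    finally show ?thesis ..
  qed
  moreover have "s \<otimes> z m = bd R r D (Suc j) (\<lambda>m. lc (regm R) (r (Suc j)) (h (Suc j) m) z) m \<oplus> lc (regm R) (r j) (h j m) (bd R r D j z)"
    if z: "\<forall>l. z l \<in> carrier R" and m: "m < r (Suc j)" for j and z :: "nat \<Rightarrow> 'a" and m
  proof -
    let ?g = "\<lambda>i. lc (regm R) (r j) (h j m) (\<lambda>k. D j k i)"
    have "bd R r D (Suc j) (\<lambda>m. lc (regm R) (r (Suc j)) (h (Suc j) m) z) m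
        = lc (regm R) (r (Suc j)) (\<lambda>i. bd R r D (Suc j) (\<lambda>m. h (Suc j) m i) m) z"
      by (rule lcR_lc) (use h D z in auto)
    also have "\<dots> = lc (regm R) (r (Suc j)) (\<lambda>i. ?\<delta> m i \<oplus> \<ominus> ?g i) z"
      by (rule lc_cong) (use PQ(2)[of j] m in \<open>auto simp: Q_def a_minus_def\<close>)
    also have "\<dots> = lc (regm R) (r (Suc j)) (?\<delta> m) z \<oplus> lc (regm R) (r (Suc j)) (\<lambda>i. \<ominus> ?g i) z"
      by (rule lcR_add_left) (use sR h D z in auto)
    also have "lc (regm R) (r (Suc j)) (\<lambda>i. \<ominus> ?g i) z = \<ominus> lc (regm R) (r (Suc j)) ?g z"
      by (rule lcR_minus_left) (use h D z in auto)
    also have "lc (regm R) (r (Suc j)) ?g z = lc (regm R) (r j) (h j m) (\<lambda>k. bd R r D j z k)"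
      by (rule lcR_lc[symmetric]) (use h D z in auto)
    also have "lc (regm R) (r (Suc j)) (?\<delta> m) z = s \<otimes> z m" using \<delta>' z m by simp
    finally show ?thesis using z h D sR by (simp add: a_assoc l_neg)
  qed
  ultimately show ?thesis using h by blast
qed

text \<open>Modulo \<open>J\<close> the null-homotopy of multiplication by \<open>s\<close> turns
  \<open>s\<close> times a cycle into a boundary, and \<open>s\<close> is outside
  \<open>q\<close>.\<close>

lemma tor_vanishes_annihilator:
  assumes I: "ideal I R" and F: "resolves R I r D" and J: "ideal J R" and s: "s \<in> I" "s \<notin> q"
  shows "tor_vanishes R q J r D i"
proof (rule tor_vanishesI)
  fix z assume z: "\<And>l. z l \<in> carrier R" and zJ: "\<And>j k. i = Suc j \<Longrightarrow> k < r j \<Longrightarrow> bd R r D j z k \<in> J"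
  note D = free_resolutionD(1)[OF resolvesD(1)[OF F]]
  have sR: "s \<in> carrier R" using s ideal_sub[OF I] by blast
  obtain h where h: "\<And>j k l. h j k l \<in> carrier R"
    "\<And>z. (\<forall>l. z l \<in> carrier R) \<Longrightarrow> s \<otimes> z 0 = bd R r D 0 (\<lambda>m. lc (regm R) (r 0) (h 0 m) z) 0"
    "\<And>j z m. (\<forall>l. z l \<in> carrier R) \<Longrightarrow> m < r (Suc j) \<Longrightarrow>
      s \<otimes> z m = bd R r D (Suc j) (\<lambda>m. lc (regm R) (r (Suc j)) (h (Suc j) m) z) m \<oplus> lc (regm R) (r j) (h j m) (bd R r D j z)"
    using nullhomotopy[OF I s(1) F] by blast
  let ?w = "\<lambda>m. lc (regm R) (r i) (h i m) z"
  have w: "?w m \<in> carrier R" for m using h z by simp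
  have "s \<otimes> z l \<ominus> bd R r D i ?w l \<in> J" if l: "l < r i" for l
  proof (cases i)
    case 0
    then have "l = 0" using l resolvesD(2)[OF F] by simp
    moreover have "s \<otimes> z 0 = bd R r D i ?w 0" using h(2) z 0 by simp
    ultimately show ?thesis using sR z ideal_zero[OF J] by (metis m_closed a_minus_def r_neg)
  next
    case (Suc j)
    let ?b = "lc (regm R) (r j) (h j l) (bd R r D j z)"
    have "s \<otimes> z l = bd R r D i ?w l \<oplus> ?b" using h(3)[of z l j] z l Suc by simp
    moreover have "bd R r D i ?w l \<in> carrier R" using w D by simp
    moreover have "?b \<in> carrier R" using h z D by simp
    ultimately have "s \<otimes> z l \<ominus> bd R r D i ?w l = ?b" by (simp add: a_minus_def a_ac r_neg1 r_neg2 r_neg)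
    moreover have "?b \<in> J" by (rule ideal_lc[OF J h(1) zJ[OF Suc]])
    ultimately show ?thesis by simp
  qed
  then show "\<exists>s\<in>carrier R - q. \<exists>w. (\<forall>l. w l \<in> carrier R) \<and> (\<forall>l<r i. s \<otimes> z l \<ominus> bd R r D i w l \<in> J)"
    using sR s w by (intro bexI[of _ s] exI[of _ ?w]) simp_all
qed

end

subsection \<open>Mapping cones of free resolutions\<close>

text \<open>Degree \<open>j\<close> of the cone of \<open>\<phi>\<close>, a map from the complex
  with ranks \<open>r'\<close> to the one with ranks \<open>r\<close>: coordinates below
  \<open>r j\<close> belong to the target, the others to degree \<open>j - 1\<close> of the
  source.\<close>

definition cone_rank :: "(nat \<Rightarrow> nat) \<Rightarrow> (nat \<Rightarrow> nat) \<Rightarrow> nat \<Rightarrow> nat" where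
  "cone_rank r r' j = r j + (case j of 0 \<Rightarrow> 0 | Suc i \<Rightarrow> r' i)"

text \<open>The block matrix with rows \<open>(D, \<phi>)\<close> and
  \<open>(0, - D')\<close>.\<close>

definition cone_mat :: "('a, 'r) ring_scheme \<Rightarrow> (nat \<Rightarrow> nat) \<Rightarrow> (nat \<Rightarrow> nat \<Rightarrow> nat \<Rightarrow> 'a) \<Rightarrow>
    (nat \<Rightarrow> nat \<Rightarrow> nat \<Rightarrow> 'a) \<Rightarrow> (nat \<Rightarrow> nat \<Rightarrow> nat \<Rightarrow> 'a) \<Rightarrow> nat \<Rightarrow> nat \<Rightarrow> nat \<Rightarrow> 'a" where
  "cone_mat R r D D' \<phi> j k l =
     (if k < r j then (if l < r (Suc j) then D j k l else \<phi> j k (l - r (Suc j)))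
      else (if l < r (Suc j) then \<zero>\<^bsub>R\<^esub> else \<ominus>\<^bsub>R\<^esub> D' (j - 1) (k - r j) (l - r (Suc j))))"

text \<open>There are two instances: the chain map from \<open>lift_exists\<close>, and
  multiplication by \<open>a\<close> on one resolution when \<open>a\<close> is a nonzerodivisor
  modulo \<open>I\<close>.\<close>

locale resolution_lift = noeth_cring R for R (structure) +
  fixes I :: "'a set" and a :: 'a and r D r' D' \<phi>
  assumes I: "ideal I R" and a: "a \<in> carrier R"
    and F: "resolves R I r D" and F': "resolves R (colon R I a) r' D'"
    and phi: "\<phi> j k l \<in> carrier R" and phi0: "\<phi> 0 0 0 = a"
    and comm: "(\<And>l. z l \<in> carrier R) \<Longrightarrow> k < r j \<Longrightarrow>
      bd R r D j (\<lambda>m. lc (regm R) (r' (Suc j)) (\<phi> (Suc j) m) z) k = lc (regm R) (r' j) (\<phi> j k) (bd R r' D' j z)"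
begin

abbreviation "C \<equiv> cone_rank r r'"
abbreviation "N \<equiv> cone_mat R r D D' \<phi>"

lemmas f = resolvesD(1)[OF F] and f' = resolvesD(1)[OF F']
lemmas DR [simp] = free_resolutionD(1)[OF f] and DR' [simp] = free_resolutionD(1)[OF f']
declare phi [simp]

lemma C_simps [simp]: "C 0 = r 0" "C (Suc j) = r (Suc j) + r' j" by (simp_all add: cone_rank_def)

lemma NR [simp]: "N j k l \<in> carrier R" by (simp add: cone_mat_def)

lemma bd_cone_low:
  assumes z: "\<And>l. z l \<in> carrier R" and k: "k < r j"
  shows "bd R C N j z k = bd R r D j z k \<oplus> lc (regm R) (r' j) (\<phi> j k) (\<lambda>i. z (r (Suc j) + i))"
proof -
  have "bd R C N j z k = lc (regm R) (r (Suc j)) (N j k) z \<oplus>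
      lc (regm R) (r' j) (\<lambda>i. N j k (r (Suc j) + i)) (\<lambda>i. z (r (Suc j) + i))"
    unfolding C_simps by (rule lcR_append) (use z in auto)
  also have "lc (regm R) (r (Suc j)) (N j k) z = bd R r D j z k"
    by (rule lc_cong) (use k in \<open>auto simp: cone_mat_def\<close>)
  also have "lc (regm R) (r' j) (\<lambda>i. N j k (r (Suc j) + i)) (\<lambda>i. z (r (Suc j) + i))
      = lc (regm R) (r' j) (\<phi> j k) (\<lambda>i. z (r (Suc j) + i))"
    by (rule lc_cong) (use k in \<open>auto simp: cone_mat_def\<close>)
  finally show ?thesis .
qed

lemma bd_cone_high:
  assumes z: "\<And>l. z l \<in> carrier R"
  shows "bd R C N (Suc i) z (r (Suc i) + k) = \<ominus> bd R r' D' i (\<lambda>l. z (r (Suc (Suc i)) + l)) k"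
proof -
  let ?k = "r (Suc i) + k"
  have "bd R C N (Suc i) z ?k = lc (regm R) (r (Suc (Suc i))) (N (Suc i) ?k) z \<oplus>
      lc (regm R) (r' (Suc i)) (\<lambda>l. N (Suc i) ?k (r (Suc (Suc i)) + l)) (\<lambda>l. z (r (Suc (Suc i)) + l))"
    unfolding C_simps by (rule lcR_append) (use z in auto)
  also have "lc (regm R) (r (Suc (Suc i))) (N (Suc i) ?k) z = \<zero>"
    by (rule lcR_zero_left) (use z in \<open>auto simp: cone_mat_def\<close>)
  also have "lc (regm R) (r' (Suc i)) (\<lambda>l. N (Suc i) ?k (r (Suc (Suc i)) + l)) (\<lambda>l. z (r (Suc (Suc i)) + l))
    = lc (regm R) (r' (Suc i)) (\<lambda>l. \<ominus> D' i k l) (\<lambda>l. z (r (Suc (Suc i)) + l))"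
    by (rule lc_cong) (auto simp: cone_mat_def)
  also have "\<dots> = \<ominus> bd R r' D' i (\<lambda>l. z (r (Suc (Suc i)) + l)) k"
    by (rule lcR_minus_left) (use z in auto)
  finally show ?thesis using z by simp
qed

lemma bd_cone_cone:
  assumes z: "\<And>l. z l \<in> carrier R" and k: "k < C j"
  shows "bd R C N j (bd R C N (Suc j) z) k = \<zero>"
proof -
  let ?z2 = "\<lambda>i. z (r (Suc (Suc j)) + i)" and ?y = "bd R C N (Suc j) z"
  have y: "?y l \<in> carrier R" for l using lc_regm_closed[OF NR z] .
  have yhigh: "?y (r (Suc j) + i) = \<ominus> bd R r' D' j ?z2 i" for i by (rule bd_cone_high[OF z])
  show ?thesis
  proof (cases "k < r j")
    case True
    have "bd R r D j ?y k = bd R r D j (\<lambda>m. bd R r D (Suc j) z m \<oplus> lc (regm R) (r' (Suc j)) (\<phi> (Suc j) m) ?z2) k"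
      by (rule lc_cong) (use bd_cone_low[OF z] in auto)
    also have "\<dots> = bd R r D j (bd R r D (Suc j) z) k \<oplus> bd R r D j (\<lambda>m. lc (regm R) (r' (Suc j)) (\<phi> (Suc j) m) ?z2) k"
      by (rule lcR_add) (use z in auto)
    also have "\<dots> = lc (regm R) (r' j) (\<phi> j k) (bd R r' D' j ?z2)"
      using free_resolutionD(2)[OF f z True] comm[of ?z2, OF _ True] z by simp
    finally have 1: "bd R r D j ?y k = lc (regm R) (r' j) (\<phi> j k) (bd R r' D' j ?z2)" .
    have 2: "lc (regm R) (r' j) (\<phi> j k) (\<lambda>i. ?y (r (Suc j) + i)) = \<ominus> lc (regm R) (r' j) (\<phi> j k) (bd R r' D' j ?z2)"
      unfolding yhigh by (rule lcR_minus) (use z in auto)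
    show ?thesis unfolding bd_cone_low[OF y True] 1 2 using z by (simp add: r_neg)
  next
    case False
    then obtain i where i: "j = Suc i" using k by (cases j) auto
    obtain k' where k': "k = r j + k'" using False by (metis le_Suc_ex not_less)
    have "bd R C N j ?y k = \<ominus> bd R r' D' i (\<lambda>l. ?y (r (Suc j) + l)) k'"
      unfolding i k' by (rule bd_cone_high) (rule y[unfolded i])
    also have "bd R r' D' i (\<lambda>l. ?y (r (Suc j) + l)) k' = \<ominus> bd R r' D' i (bd R r' D' j ?z2) k'"
      unfolding yhigh by (rule lcR_minus) (use z in auto)
    also have "bd R r' D' i (bd R r' D' j ?z2) k' = \<zero>"
      unfolding i by (rule free_resolutionD(2)[OF f']) (use z k i k' in auto)
    finally show ?thesis by simp
  qed
qed

text \<open>The source part of a cycle is a boundary \<open>D' v\<close>; the target part corrected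
  by \<open>\<phi> v\<close> is then a cycle of a resolution. In the lowest degree the source part
  is a boundary because its product with \<open>a\<close> lies in \<open>I\<close>, that is, because
  multiplication by \<open>a\<close> embeds \<open>R/(I:a)\<close> into \<open>R/I\<close>.\<close>

lemma cone_exact:
  assumes z: "\<And>l. z l \<in> carrier R" and cyc: "\<And>k. k < C j \<Longrightarrow> bd R C N j z k = \<zero>"
  shows "\<exists>w. (\<forall>l. w l \<in> carrier R) \<and> (\<forall>l<C (Suc j). z l = bd R C N (Suc j) w l)"
proof -
  let ?z2 = "\<lambda>i. z (r (Suc j) + i)"
  have low: "bd R r D j z k \<oplus> lc (regm R) (r' j) (\<phi> j k) ?z2 = \<zero>" if k: "k < r j" for k
    using cyc[of k] bd_cone_low[OF z k] k by (simp add: cone_rank_def)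
  have "\<exists>v. (\<forall>l. v l \<in> carrier R) \<and> (\<forall>i<r' j. ?z2 i = bd R r' D' j v i)"
  proof (cases j)
    case 0
    have r0: "r 0 = 1" "r' 0 = 1" using resolvesD(2)[OF F] resolvesD(2)[OF F'] by auto
    have "bd R r D 0 z 0 \<oplus> a \<otimes> z (r 1) = \<zero>"
      using low[of 0] 0 r0 phi0 a z by simp
    then have "z (r 1) \<otimes> a = \<ominus> bd R r D 0 z 0" using z a by (simp add: m_comm minus_equality a_comm sum_zero_eq_neg)
    also have "\<dots> \<in> I" using resolvesD(3)[OF F, of "bd R r D 0 z 0"] z by (auto intro!: ideal_minus[OF I])
    finally have "z (r 1) \<in> colon R I a" using z by (simp add: colon_def)
    then obtain v where "\<forall>l. v l \<in> carrier R" "z (r 1) = bd R r' D' 0 v 0"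
      unfolding resolvesD(3)[OF F'] by blast
    then show ?thesis using 0 r0 by (intro exI[of _ v]) simp
  next
    case (Suc i)
    show ?thesis unfolding Suc
    proof (rule free_resolutionD(3)[OF f'])
      fix k assume k: "k < r' i"
      have "\<ominus> bd R r' D' i (\<lambda>l. z (r (Suc (Suc i)) + l)) k = \<zero>"
        using cyc[of "r j + k"] bd_cone_high[OF z, of i k] Suc k by simp
      then show "bd R r' D' i (\<lambda>l. z (r (Suc (Suc i)) + l)) k = \<zero>"
        using z by (metis DR' lc_regm_closed minus_minus minus_zero)
    qed (rule z)
  qed
  then obtain v where v: "\<And>l. v l \<in> carrier R" "\<And>i. i < r' j \<Longrightarrow> ?z2 i = bd R r' D' j v i" by blast
  let ?\<Phi> = "\<lambda>m. lc (regm R) (r' (Suc j)) (\<phi> (Suc j) m) v"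
  have \<Phi>: "?\<Phi> m \<in> carrier R" for m using v(1) by simp
  have "\<exists>w1. (\<forall>l. w1 l \<in> carrier R) \<and> (\<forall>l<r (Suc j). z l \<oplus> ?\<Phi> l = bd R r D (Suc j) w1 l)"
  proof (rule free_resolutionD(3)[OF f])
    show "z l \<oplus> ?\<Phi> l \<in> carrier R" for l using z \<Phi> by simp
    fix k assume k: "k < r j"
    have "bd R r D j (\<lambda>l. z l \<oplus> ?\<Phi> l) k = bd R r D j z k \<oplus> bd R r D j ?\<Phi> k"
      by (rule lcR_add) (use z \<Phi> in auto)
    also have "bd R r D j ?\<Phi> k = lc (regm R) (r' j) (\<phi> j k) (bd R r' D' j v)" by (rule comm[OF v(1) k])
    also have "\<dots> = lc (regm R) (r' j) (\<phi> j k) ?z2" by (rule lc_cong) (use v(2) in auto)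
    finally show "bd R r D j (\<lambda>l. z l \<oplus> ?\<Phi> l) k = \<zero>" using low[OF k] by simp
  qed
  then obtain w1 where w1: "\<And>l. w1 l \<in> carrier R" "\<And>l. l < r (Suc j) \<Longrightarrow> z l \<oplus> ?\<Phi> l = bd R r D (Suc j) w1 l" by blast
  \<comment> \<open>The sign compensates for the block \<open>- D'\<close> and cancels the
    correction by \<open>\<phi> v\<close>.\<close>
  let ?w = "\<lambda>l. if l < r (Suc (Suc j)) then w1 l else \<ominus> v (l - r (Suc (Suc j)))"
  have w: "?w l \<in> carrier R" for l using w1 v by simp
  have "z l = bd R C N (Suc j) ?w l" if l: "l < C (Suc j)" for l
  proof (cases "l < r (Suc j)")
    case True
    have "bd R C N (Suc j) ?w l = bd R r D (Suc j) ?w l \<oplus> lc (regm R) (r' (Suc j)) (\<phi> (Suc j) l) (\<lambda>i. ?w (r (Suc (Suc j)) + i))"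
      by (rule bd_cone_low[OF w True])
    also have "bd R r D (Suc j) ?w l = bd R r D (Suc j) w1 l" by (rule lc_cong) auto
    also have "lc (regm R) (r' (Suc j)) (\<phi> (Suc j) l) (\<lambda>i. ?w (r (Suc (Suc j)) + i)) = lc (regm R) (r' (Suc j)) (\<phi> (Suc j) l) (\<lambda>i. \<ominus> v i)"
      by (rule lc_cong) auto
    also have "\<dots> = \<ominus> ?\<Phi> l" by (rule lcR_minus) (use v in auto)
    also have "bd R r D (Suc j) w1 l = z l \<oplus> ?\<Phi> l" using w1(2)[OF True] by simp
    finally show ?thesis using z[of l] \<Phi>[of l] by (simp add: a_assoc r_neg)
  next
    case False
    then obtain i where i: "l = r (Suc j) + i" by (metis le_Suc_ex not_less)
    have "bd R C N (Suc j) ?w l = \<ominus> bd R r' D' j (\<lambda>l. ?w (r (Suc (Suc j)) + l)) i"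
      unfolding i by (rule bd_cone_high[OF w])
    also have "bd R r' D' j (\<lambda>l. ?w (r (Suc (Suc j)) + l)) i = bd R r' D' j (\<lambda>l. \<ominus> v l) i"
      by (rule lc_cong) auto
    also have "\<dots> = \<ominus> bd R r' D' j v i" by (rule lcR_minus) (use v in auto)
    finally show ?thesis using v l i by simp
  qed
  then show ?thesis using w by (intro exI[of _ ?w]) simp
qed

text \<open>The cone of the injection of \<open>R/(I:a)\<close> into \<open>R/I\<close> resolves its
  cokernel \<open>R/(I+Ra)\<close>.\<close>

lemma cone_resolves: "resolves R (ideal_plus R I a) C N"
proof -
  have "free_resolution R C N"
    unfolding free_resolution_def
  proof (intro conjI allI impI)
    fix j k and z :: "nat \<Rightarrow> 'a" assume "\<forall>l. z l \<in> carrier R" "k < C j"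
    then show "bd R C N j (bd R C N (Suc j) z) k = \<zero>" using bd_cone_cone by blast
  next
    fix j and z :: "nat \<Rightarrow> 'a" assume z: "\<forall>l. z l \<in> carrier R" and k: "\<forall>k<C j. bd R C N j z k = \<zero>"
    show "\<exists>w. (\<forall>l. w l \<in> carrier R) \<and> (\<forall>l<C (Suc j). z l = bd R C N (Suc j) w l)"
      by (rule cone_exact) (use z k in auto)
  qed (rule NR)
  moreover have r0: "r 0 = 1" "r' 0 = 1" using resolvesD(2)[OF F] resolvesD(2)[OF F'] by auto
  have b: "bd R C N 0 w 0 = bd R r D 0 w 0 \<oplus> w (r 1) \<otimes> a" if "\<And>l. w l \<in> carrier R" for w
    using bd_cone_low[OF that, of 0 0] r0 that phi0 a by (simp add: m_comm)
  have "x \<in> ideal_plus R I a \<longleftrightarrow> (\<exists>w. (\<forall>l. w l \<in> carrier R) \<and> x = bd R C N 0 w 0)" for x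
  proof
    assume "x \<in> ideal_plus R I a"
    then obtain i t where it: "i \<in> I" "t \<in> carrier R" "x = i \<oplus> t \<otimes> a" by (auto simp: ideal_plus_def)
    obtain w where w: "\<forall>l. w l \<in> carrier R" "i = bd R r D 0 w 0" using it resolvesD(3)[OF F] by blast
    let ?w = "\<lambda>l. if l < r 1 then w l else t"
    have "bd R r D 0 ?w 0 = i" unfolding w(2) by (rule lc_cong) auto
    then have "x = bd R C N 0 ?w 0" using b[of ?w] w it by simp
    then show "\<exists>w. (\<forall>l. w l \<in> carrier R) \<and> x = bd R C N 0 w 0" using w it by (intro exI[of _ ?w]) simp
  next
    assume "\<exists>w. (\<forall>l. w l \<in> carrier R) \<and> x = bd R C N 0 w 0"
    then obtain w where w: "\<forall>l. w l \<in> carrier R" "x = bd R C N 0 w 0" by blast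
    then have "x = bd R r D 0 w 0 \<oplus> w (r 1) \<otimes> a" using b[of w] by simp
    moreover have "bd R r D 0 w 0 \<in> I" unfolding resolvesD(3)[OF F] using w by blast
    ultimately show "x \<in> ideal_plus R I a" using w ideal_plusI by simp
  qed
  ultimately show ?thesis using r0 unfolding resolves_def by auto
qed

text \<open>The two exact sequences \<open>H\<^sub>i(F') \<rightarrow> H\<^sub>i(F) \<rightarrow> H\<^sub>i(cone)\<close> and \<open>H\<^sub>i\<^sub>+\<^sub>1(cone) \<rightarrow> H\<^sub>i(F') \<rightarrow> H\<^sub>i(F)\<close> of
  the mapping cone, tensored with \<open>R/J\<close>.\<close>

lemma tor_vanishes_of_cone:
  assumes q: "primeideal q R" and J: "ideal J R"
    and V': "tor_vanishes R q J r' D' i" and V: "tor_vanishes R q J C N i"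
  shows "tor_vanishes R q J r D i"
proof (rule tor_vanishesI)
  fix z assume z: "\<And>l. z l \<in> carrier R" and zJ: "\<And>j k. i = Suc j \<Longrightarrow> k < r j \<Longrightarrow> bd R r D j z k \<in> J"
  \<comment> \<open>Extended by a zero source part, \<open>z\<close> becomes a cycle of the cone
    modulo \<open>J\<close>.\<close>
  let ?z = "\<lambda>l. if l < r i then z l else \<zero>"
  have z': "?z l \<in> carrier R" for l using z by simp
  have cz: "bd R C N j ?z k \<in> J" if i: "i = Suc j" and k: "k < C j" for j k
  proof (cases "k < r j")
    case True
    have "lc (regm R) (r' j) (\<phi> j k) (\<lambda>l. ?z (r (Suc j) + l)) = \<zero>"
      by (rule lcR_zero) (use i in auto)
    moreover have "bd R r D j ?z k = bd R r D j z k" by (rule lc_cong) (use i in auto)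
    ultimately have "bd R C N j ?z k = bd R r D j z k" using bd_cone_low[OF z' True] z by simp
    then show ?thesis using zJ[OF i True] by simp
  next
    case False
    then obtain h where h: "j = Suc h" using k by (cases j) auto
    obtain k' where k': "k = r j + k'" using False by (metis le_Suc_ex not_less)
    have "bd R r' D' h (\<lambda>l. ?z (r (Suc (Suc h)) + l)) k' = \<zero>"
      by (rule lcR_zero) (use i h in auto)
    then have "bd R C N j ?z k = \<zero>" using bd_cone_high[OF z', of h k'] h k' by simp
    then show ?thesis using ideal_zero[OF J] by simp
  qed
  obtain s w where s: "s \<in> carrier R - q" and w: "\<And>l. w l \<in> carrier R"
    and sw: "\<And>l. l < C i \<Longrightarrow> s \<otimes> ?z l \<ominus> bd R C N i w l \<in> J"
    using tor_vanishesD[OF V z' cz] by blast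
  let ?w2 = "\<lambda>l. w (r (Suc i) + l)"
  have w2: "?w2 l \<in> carrier R" for l using w by simp
  have sR: "s \<in> carrier R" using s by blast
  \<comment> \<open>The source part of the bounding chain is a cycle modulo \<open>J\<close>, since
    the source part of \<open>?z\<close> is zero.\<close>
  have cw: "bd R r' D' j ?w2 k \<in> J" if i: "i = Suc j" and k: "k < r' j" for j k
  proof -
    have "s \<otimes> \<zero> \<ominus> (\<ominus> bd R r' D' j ?w2 k) \<in> J"
      using sw[of "r i + k"] k i bd_cone_high[OF w, of j k] by simp
    moreover have "bd R r' D' j ?w2 k \<in> carrier R" using w by simp
    ultimately show ?thesis using sR by (simp add: a_minus_def)
  qed
  obtain t v where t: "t \<in> carrier R - q" and v: "\<And>l. v l \<in> carrier R"
    and tv: "\<And>l. l < r' i \<Longrightarrow> t \<otimes> ?w2 l \<ominus> bd R r' D' i v l \<in> J"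
    using tor_vanishesD[OF V' w2 cw] by blast
  have tR: "t \<in> carrier R" using t by blast
  \<comment> \<open>Modulo \<open>J\<close> the source part times \<open>t\<close> is
    \<open>D' v\<close>; \<open>\<phi>\<close> carries it to the boundary of
    \<open>\<phi> v\<close>, which is therefore added to \<open>t w\<close>.\<close>
  let ?u = "\<lambda>l. t \<otimes> w l \<oplus> lc (regm R) (r' (Suc i)) (\<phi> (Suc i) l) v"
  have u: "?u l \<in> carrier R" for l using w v tR by simp
  have "(t \<otimes> s) \<otimes> z l \<ominus> bd R r D i ?u l \<in> J" if l: "l < r i" for l
  proof -
    let ?A = "bd R r D i w l" and ?B = "lc (regm R) (r' i) (\<phi> i l) ?w2" and ?E = "lc (regm R) (r' i) (\<phi> i l) (bd R r' D' i v)"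
    have c: "?A \<in> carrier R" "?B \<in> carrier R" "?E \<in> carrier R" using w v by simp_all
    have "bd R r D i ?u l = bd R r D i (\<lambda>l. t \<otimes> w l) l \<oplus> bd R r D i (\<lambda>m. lc (regm R) (r' (Suc i)) (\<phi> (Suc i) m) v) l"
      by (rule lcR_add) (use w v tR in auto)
    also have "bd R r D i (\<lambda>l. t \<otimes> w l) l = t \<otimes> ?A" by (rule lcR_smult) (use w tR in auto)
    also have "bd R r D i (\<lambda>m. lc (regm R) (r' (Suc i)) (\<phi> (Suc i) m) v) l = ?E" by (rule comm[OF v l])
    finally have 1: "bd R r D i ?u l = t \<otimes> ?A \<oplus> ?E" .
    have "l < C i" using l by (simp add: cone_rank_def)
    then have 2: "s \<otimes> z l \<ominus> (?A \<oplus> ?B) \<in> J" using sw[of l] bd_cone_low[OF w l] l by simp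
    have "t \<otimes> ?B \<ominus> ?E = lc (regm R) (r' i) (\<phi> i l) (\<lambda>m. t \<otimes> ?w2 m \<ominus> bd R r' D' i v m)"
    proof -
      have "lc (regm R) (r' i) (\<phi> i l) (\<lambda>m. t \<otimes> ?w2 m \<ominus> bd R r' D' i v m)
        = lc (regm R) (r' i) (\<phi> i l) (\<lambda>m. t \<otimes> ?w2 m) \<ominus> ?E"
        by (rule lcR_diff) (use w v tR in auto)
      also have "lc (regm R) (r' i) (\<phi> i l) (\<lambda>m. t \<otimes> ?w2 m) = t \<otimes> ?B" by (rule lcR_smult) (use w tR in auto)
      finally show ?thesis ..
    qed
    moreover have "\<dots> \<in> J" by (rule ideal_lc[OF J phi tv])
    ultimately have 3: "t \<otimes> ?B \<ominus> ?E \<in> J" by simp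
    have "(t \<otimes> s) \<otimes> Z \<ominus> (t \<otimes> A \<oplus> E) = t \<otimes> (s \<otimes> Z \<ominus> (A \<oplus> B)) \<oplus> (t \<otimes> B \<ominus> E)"
      if "Z \<in> carrier R" "A \<in> carrier R" "B \<in> carrier R" "E \<in> carrier R" for A B E Z
      using that tR sR by algebra
    then have "(t \<otimes> s) \<otimes> z l \<ominus> (t \<otimes> ?A \<oplus> ?E) = t \<otimes> (s \<otimes> z l \<ominus> (?A \<oplus> ?B)) \<oplus> (t \<otimes> ?B \<ominus> ?E)"
      using z[of l] c by blast
    also have "\<dots> \<in> J" by (rule ideal_add[OF J ideal_mult[OF J 2 tR] 3])
    finally show ?thesis unfolding 1 .
  qed
  then show "\<exists>s\<in>carrier R - q. \<exists>w. (\<forall>l. w l \<in> carrier R) \<and> (\<forall>l<r i. s \<otimes> z l \<ominus> bd R r D i w l \<in> J)"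
    using primeideal_mult_compl[OF q t s] u by (intro bexI[of _ "t \<otimes> s"] exI[of _ ?u]) simp_all
qed

end

text \<open>As \<open>colon R I a = I\<close>, multiplication by \<open>a\<close> on the resolution
  is a lift as in \<open>resolution_lift\<close>. It vanishes modulo \<open>J\<close>, so every
  cycle modulo \<open>J\<close> is the source part of a cone cycle one degree higher. This trades
  degree \<open>i + 1\<close> for \<open>R/(I+Ra)\<close> against degree \<open>i\<close> for
  \<open>R/I\<close>.\<close>

lemma (in noeth_cring) tor_vanishes_multiplication_cone:
  assumes I: "ideal I R" and a: "a \<in> carrier R" and F: "resolves R I r D" and aI: "colon R I a = I"
    and J: "ideal J R" "a \<in> J"
    and V: "\<And>r' D'. resolves R (ideal_plus R I a) r' D' \<Longrightarrow> tor_vanishes R q J r' D' (Suc i)"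
  shows "tor_vanishes R q J r D i"
proof (rule tor_vanishesI)
  fix z assume z: "\<And>l. z l \<in> carrier R" and zJ: "\<And>j k. i = Suc j \<Longrightarrow> k < r j \<Longrightarrow> bd R r D j z k \<in> J"
  define \<phi> :: "nat \<Rightarrow> nat \<Rightarrow> nat \<Rightarrow> 'a" where "\<phi> = (\<lambda>j k l. if l = k then a else \<zero>)"
  note DR = free_resolutionD(1)[OF resolvesD(1)[OF F]]
  have ph: "lc (regm R) n (\<phi> j k) y = (if k < n then a \<otimes> y k else \<zero>)" if y: "\<And>l. y l \<in> carrier R" for n j k y
  proof -
    have "lc (regm R) n (\<phi> j k) y = lc (regm R) n (\<lambda>l. a \<otimes> (if l = k then \<one> else \<zero>)) y"
      by (rule lc_cong) (use a in \<open>auto simp: \<phi>_def\<close>)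
    also have "\<dots> = a \<otimes> lc (regm R) n (\<lambda>l. if l = k then \<one> else \<zero>) y" by (rule lcR_smult_left) (use a y in auto)
    finally show ?thesis using lcR_unit_left[OF y, where n = n and k = k] a by simp
  qed
  interpret L: resolution_lift R I a r D r D \<phi>
  proof (rule resolution_lift.intro[OF noeth_cring_axioms resolution_lift_axioms.intro])
    show "ideal I R" "a \<in> carrier R" "resolves R I r D" by fact+
    show "resolves R (colon R I a) r D" using F aI by simp
    show "\<phi> j k l \<in> carrier R" for j k l using a by (simp add: \<phi>_def)
    show "\<phi> 0 0 0 = a" by (simp add: \<phi>_def)
    fix k j and y :: "nat \<Rightarrow> 'a" assume y: "\<And>l. y l \<in> carrier R" and k: "k < r j"
    have "bd R r D j (\<lambda>m. lc (regm R) (r (Suc j)) (\<phi> (Suc j) m) y) k = bd R r D j (\<lambda>m. a \<otimes> y m) k"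
      by (rule lc_cong) (use ph[OF y] in auto)
    also have "\<dots> = a \<otimes> bd R r D j y k" by (rule lcR_smult) (use a y DR in auto)
    also have "\<dots> = lc (regm R) (r j) (\<phi> j k) (bd R r D j y)" using ph[of "bd R r D j y" "r j" j k] k y DR by simp
    finally show "bd R r D j (\<lambda>m. lc (regm R) (r (Suc j)) (\<phi> (Suc j) m) y) k = lc (regm R) (r j) (\<phi> j k) (bd R r D j y)" .
  qed
  let ?z = "\<lambda>l. if l < r (Suc i) then \<zero> else z (l - r (Suc i))"
  have z': "?z l \<in> carrier R" for l using z by simp
  have cz: "bd R L.C L.N j ?z k \<in> J" if j: "Suc i = Suc j" and k: "k < L.C j" for j k
  proof (cases "k < r j")
    case True
    have "bd R r D j ?z k = \<zero>" by (rule lcR_zero) (use j DR in auto)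
    moreover have "lc (regm R) (r j) (\<phi> j k) (\<lambda>l. ?z (r (Suc j) + l)) = a \<otimes> z k"
      using ph[of "\<lambda>l. ?z (r (Suc j) + l)" "r j" j k] z True j by simp
    ultimately have "bd R L.C L.N j ?z k = a \<otimes> z k" using L.bd_cone_low[OF z' True] z a by simp
    then show ?thesis using ideal_mult_right[OF J(1,2) z] by simp
  next
    case False
    then obtain h where h: "j = Suc h" using k by (cases j) auto
    obtain k' where k': "k = r j + k'" using False by (metis le_Suc_ex not_less)
    have "bd R r D h (\<lambda>l. ?z (r (Suc (Suc h)) + l)) k' = bd R r D h z k'"
      by (rule lc_cong) (use h j in auto)
    then have "bd R L.C L.N j ?z k = \<ominus> bd R r D h z k'" using L.bd_cone_high[OF z', of h k'] h k' by simp
    then show ?thesis using ideal_minus[OF J(1) zJ[of h k']] j h k' k by simp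
  qed
  obtain s w where s: "s \<in> carrier R - q" and w: "\<And>l. w l \<in> carrier R"
    and sw: "\<And>l. l < L.C (Suc i) \<Longrightarrow> s \<otimes> ?z l \<ominus> bd R L.C L.N (Suc i) w l \<in> J"
    using tor_vanishesD[OF V[OF L.cone_resolves] z' cz] by blast
  let ?w = "\<lambda>l. \<ominus> w (r (Suc (Suc i)) + l)"
  have "s \<otimes> z l \<ominus> bd R r D i ?w l \<in> J" if l: "l < r i" for l
  proof -
    have "bd R r D i ?w l = \<ominus> bd R r D i (\<lambda>l. w (r (Suc (Suc i)) + l)) l" by (rule lcR_minus) (use w DR in auto)
    then show ?thesis using sw[of "r (Suc i) + l"] l L.bd_cone_high[OF w, of i l] by simp
  qed
  then show "\<exists>s\<in>carrier R - q. \<exists>w. (\<forall>l. w l \<in> carrier R) \<and> (\<forall>l<r i. s \<otimes> z l \<ominus> bd R r D i w l \<in> J)"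
    using s w by (intro bexI[of _ s] exI[of _ ?w]) simp_all
qed

subsection \<open>A nonvanishing theorem for Tor\<close>

text \<open>All sequences over \<open>R\<close>: vectors of every rank lie in one module, so
  \<open>nakayama_at\<close> applies to cycles modulo boundaries.\<close>

definition vec_module :: "('a, 'r) ring_scheme \<Rightarrow> ('a, nat \<Rightarrow> 'a) module" where
  "vec_module R = \<lparr>carrier = {z. \<forall>l. z l \<in> carrier R}, mult = undefined, one = undefined,
     zero = (\<lambda>_. \<zero>\<^bsub>R\<^esub>), add = (\<lambda>z y l. z l \<oplus>\<^bsub>R\<^esub> y l), smult = (\<lambda>r z l. r \<otimes>\<^bsub>R\<^esub> z l)\<rparr>"

lemma vec_module_simps [simp]:
  "carrier (vec_module R) = {z. \<forall>l. z l \<in> carrier R}" "zero (vec_module R) = (\<lambda>_. \<zero>\<^bsub>R\<^esub>)"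
  "add (vec_module R) = (\<lambda>z y l. z l \<oplus>\<^bsub>R\<^esub> y l)" "smult (vec_module R) = (\<lambda>r z l. r \<otimes>\<^bsub>R\<^esub> z l)"
  by (simp_all add: vec_module_def)

lemma lc_vec_module: "lc (vec_module R) m c g = (\<lambda>l. lc (regm R) m c (\<lambda>i. g i l))"
  by (induction m) auto

context cring
begin

lemma vec_module: "module R (vec_module R)"
proof (rule moduleI)
  show "abelian_group (vec_module R)"
  proof (rule abelian_groupI)
    fix x assume "x \<in> carrier (vec_module R)"
    then show "\<exists>y\<in>carrier (vec_module R). y \<oplus>\<^bsub>vec_module R\<^esub> x = \<zero>\<^bsub>vec_module R\<^esub>"
      by (intro bexI[of _ "\<lambda>l. \<ominus> x l"]) (auto simp: l_neg)
  qed (auto simp: a_ac)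
qed (auto simp: m_ac l_distr r_distr intro: is_cring)

lemma vec_module_minus:
  assumes "\<And>l. x l \<in> carrier R" "\<And>l. y l \<in> carrier R"
  shows "x \<ominus>\<^bsub>vec_module R\<^esub> y = (\<lambda>l. x l \<ominus> y l)"
proof -
  interpret v: module R "vec_module R" by (rule vec_module)
  have "\<ominus>\<^bsub>vec_module R\<^esub> y = (\<lambda>l. \<ominus> y l)"
    by (rule v.M.minus_equality) (use assms in \<open>auto simp: l_neg\<close>)
  then show ?thesis by (simp add: a_minus_def)
qed

end

section \<open>Dependence of Tor on \<open>R/J\<close>, and descent along a chain of primes\<close>

context noeth_cring
begin

text \<open>\<open>x\<close> is a nonzerodivisor modulo the prime \<open>J\<close>, so the exact
  sequence for \<open>R/J \<rightarrow> R/J \<rightarrow> R/(J+xR)\<close> shows that at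
  \<open>q\<close> Tor with \<open>R/J\<close> equals \<open>x\<close> times itself. It is finitely
  generated and \<open>x\<close> lies in \<open>q\<close>, so Nakayama's lemma kills it.\<close>

lemma tor_nakayama:
  assumes q: "primeideal q R" and F: "free_resolution R r D" and J: "primeideal J R"
    and x: "x \<in> q" "x \<notin> J" and V: "tor_vanishes R q (ideal_plus R J x) r D i"
  shows "tor_vanishes R q J r D i"
proof -
  interpret v: module R "vec_module R" by (rule vec_module)
  note D = free_resolutionD(1)[OF F]
  note Ji = primeideal.axioms(1)[OF J] and qi = primeideal.axioms(1)[OF q]
  have xR: "x \<in> carrier R" using x ideal_sub[OF qi] by blast
  \<comment> \<open>\<open>?Z\<close> consists of the cycles modulo \<open>J\<close> and
    \<open>?B\<close> below of the boundaries modulo \<open>J\<close>; their quotient is the Tor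
    module in question.\<close>
  let ?Z = "{z. (\<forall>l. z l \<in> carrier R) \<and> (\<forall>j. i = Suc j \<longrightarrow> (\<forall>k<r j. bd R r D j z k \<in> J))}"
  have "\<exists>m g. (\<forall>i. g i \<in> ?Z) \<and>
      (\<forall>z\<in>?Z. \<exists>c. (\<forall>i. c i \<in> carrier R) \<and> (\<forall>l<r i. z l = lc (regm R) m c (\<lambda>i. g i l)))"
    by (rule vec_gens) (use D in \<open>auto simp: lcR_add lcR_smult lcR_zero ideal_zero[OF Ji] ideal_add[OF Ji] ideal_mult[OF Ji]\<close>)
  then obtain m g where g: "\<And>i. g i \<in> ?Z"
    and gen: "\<And>z. z \<in> ?Z \<Longrightarrow> \<exists>c. (\<forall>i. c i \<in> carrier R) \<and> (\<forall>l<r i. z l = lc (regm R) m c (\<lambda>i. g i l))"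
    by blast
  have gR: "g h l \<in> carrier R" for h l using g by blast
  let ?B = "{b. (\<forall>l. b l \<in> carrier R) \<and> (\<exists>w. (\<forall>l. w l \<in> carrier R) \<and> (\<forall>l<r i. b l \<ominus> bd R r D i w l \<in> J))}"
  have B0: "\<zero>\<^bsub>vec_module R\<^esub> \<in> ?B"
    using D by (auto intro!: exI[of _ "\<lambda>_. \<zero>"] simp: lcR_zero a_minus_def ideal_zero[OF Ji])
  have Badd: "x \<oplus>\<^bsub>vec_module R\<^esub> y \<in> ?B" if xB: "x \<in> ?B" and yB: "y \<in> ?B" for x y
  proof -
    obtain w where w: "\<forall>l. w l \<in> carrier R" "\<forall>l<r i. x l \<ominus> bd R r D i w l \<in> J" using xB by blast
    obtain u where u: "\<forall>l. u l \<in> carrier R" "\<forall>l<r i. y l \<ominus> bd R r D i u l \<in> J" using yB by blast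
    have xy: "\<forall>l. x l \<in> carrier R" "\<forall>l. y l \<in> carrier R" using xB yB by auto
    have "(x l \<oplus> y l) \<ominus> bd R r D i (\<lambda>l. w l \<oplus> u l) l \<in> J" if l: "l < r i" for l
    proof -
      have e: "(a \<oplus> b) \<ominus> (c \<oplus> d) = (a \<ominus> c) \<oplus> (b \<ominus> d)"
        if "a \<in> carrier R" "b \<in> carrier R" "c \<in> carrier R" "d \<in> carrier R" for a b c d using that by algebra
      have "bd R r D i (\<lambda>l. w l \<oplus> u l) l = bd R r D i w l \<oplus> bd R r D i u l"
        by (rule lcR_add) (use w u D in auto)
      then show ?thesis using e[of "x l" "y l" "bd R r D i w l" "bd R r D i u l"] xy w u D l
        by (simp add: ideal_add[OF Ji])
    qed
    then show ?thesis using w u xy by (auto intro!: exI[of _ "\<lambda>l. w l \<oplus> u l"])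
  qed
  have Bmult: "u \<odot>\<^bsub>vec_module R\<^esub> x \<in> ?B" if u: "u \<in> carrier R" and xB: "x \<in> ?B" for u x
  proof -
    obtain w where w: "\<forall>l. w l \<in> carrier R" "\<forall>l<r i. x l \<ominus> bd R r D i w l \<in> J" using xB by blast
    have xy: "\<forall>l. x l \<in> carrier R" using xB by auto
    have "u \<otimes> x l \<ominus> bd R r D i (\<lambda>l. u \<otimes> w l) l \<in> J" if l: "l < r i" for l
    proof -
      have e: "u \<otimes> a \<ominus> u \<otimes> b = u \<otimes> (a \<ominus> b)" if "a \<in> carrier R" "b \<in> carrier R" for a b
        using that u by algebra
      have "bd R r D i (\<lambda>l. u \<otimes> w l) l = u \<otimes> bd R r D i w l" by (rule lcR_smult) (use w u D in auto)
      then show ?thesis using e[of "x l" "bd R r D i w l"] xy w u D l by (simp add: ideal_mult[OF Ji])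
    qed
    then show ?thesis using w u xy by (auto intro!: exI[of _ "\<lambda>l. u \<otimes> w l"])
  qed
  define P where "P h s c \<longleftrightarrow> s \<in> carrier R - q \<and> (\<forall>l. c l \<in> q) \<and>
    s \<odot>\<^bsub>vec_module R\<^esub> g h \<ominus>\<^bsub>vec_module R\<^esub> lc (vec_module R) m c g \<in> ?B" for h s c
  have "\<exists>s c. P h s c" for h
  proof -
    have cyc: "bd R r D j (g h) k \<in> ideal_plus R J x" if "i = Suc j" "k < r j" for j k
      using g[of h] that ideal_plus_sub[OF Ji xR] by blast
    obtain s w where s: "s \<in> carrier R - q" and w: "\<And>l. w l \<in> carrier R"
      and sw: "\<And>l. l < r i \<Longrightarrow> s \<otimes> g h l \<ominus> bd R r D i w l \<in> ideal_plus R J x"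
      using tor_vanishesD[OF V gR cyc] by blast
    have sR: "s \<in> carrier R" using s by blast
    have "\<forall>l. \<exists>a y. a \<in> J \<and> y \<in> carrier R \<and> (l < r i \<longrightarrow> s \<otimes> g h l \<ominus> bd R r D i w l = a \<oplus> y \<otimes> x)"
    proof
      fix l show "\<exists>a y. a \<in> J \<and> y \<in> carrier R \<and> (l < r i \<longrightarrow> s \<otimes> g h l \<ominus> bd R r D i w l = a \<oplus> y \<otimes> x)"
      proof (cases "l < r i")
        case True
        then show ?thesis using sw[of l] unfolding ideal_plus_def by blast
      next
        case False
        then show ?thesis using ideal_zero[OF Ji] by blast
      qed
    qed
    then obtain a y where a: "\<And>l. a l \<in> J" and y: "\<And>l. y l \<in> carrier R"
      and ay: "\<And>l. l < r i \<Longrightarrow> s \<otimes> g h l \<ominus> bd R r D i w l = a l \<oplus> y l \<otimes> x" by metis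
    have aR: "a l \<in> carrier R" for l using a ideal_sub[OF Ji] by blast
    have ay': "s \<otimes> g h l = bd R r D i w l \<oplus> (a l \<oplus> x \<otimes> y l)" if l: "l < r i" for l
    proof -
      have e: "S = W \<oplus> (S \<ominus> W)" if "S \<in> carrier R" "W \<in> carrier R" for S W using that by algebra
      have W: "bd R r D i w l \<in> carrier R" using w D by simp
      show ?thesis using e[of "s \<otimes> g h l", OF _ W] ay[OF l] sR gR y xR by (simp add: m_comm)
    qed
    \<comment> \<open>\<open>y\<close> is again a cycle modulo \<open>J\<close>: \<open>x\<close>
      times its boundary lies in the prime \<open>J\<close>, and \<open>x\<close> does not.\<close>
    have "bd R r D j y k \<in> J" if ij: "i = Suc j" and k: "k < r j" for j k
    proof -
      have "bd R r D j (\<lambda>l. s \<otimes> g h l) k = bd R r D j (\<lambda>l. bd R r D i w l \<oplus> (a l \<oplus> x \<otimes> y l)) k"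
        by (rule lc_cong) (use ay' ij in auto)
      also have "\<dots> = bd R r D j (bd R r D i w) k \<oplus> bd R r D j (\<lambda>l. a l \<oplus> x \<otimes> y l) k"
        by (rule lcR_add) (use w aR y xR D in auto)
      also have "bd R r D j (\<lambda>l. a l \<oplus> x \<otimes> y l) k = bd R r D j a k \<oplus> bd R r D j (\<lambda>l. x \<otimes> y l) k"
        by (rule lcR_add) (use aR y xR D in auto)
      also have "bd R r D j (\<lambda>l. x \<otimes> y l) k = x \<otimes> bd R r D j y k" by (rule lcR_smult) (use y xR D in auto)
      also have "bd R r D j (bd R r D i w) k = \<zero>" unfolding ij by (rule free_resolutionD(2)[OF F w k])
      also have "bd R r D j (\<lambda>l. s \<otimes> g h l) k = s \<otimes> bd R r D j (g h) k" by (rule lcR_smult) (use gR sR D in auto)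
      finally have eq: "s \<otimes> bd R r D j (g h) k = \<zero> \<oplus> (bd R r D j a k \<oplus> x \<otimes> bd R r D j y k)" .
      have c: "bd R r D j a k \<in> carrier R" "bd R r D j y k \<in> carrier R" using aR y D by simp_all
      have aJ: "bd R r D j a k \<in> J" by (rule ideal_lc[OF Ji D a])
      have "bd R r D j (g h) k \<in> J" using g[of h] ij k by blast
      then have "s \<otimes> bd R r D j (g h) k \<in> J" using ideal_mult[OF Ji] sR by blast
      then have d: "s \<otimes> bd R r D j (g h) k \<ominus> bd R r D j a k \<in> J" by (rule ideal_diff[OF Ji _ aJ])
      have e: "\<zero> \<oplus> (A \<oplus> x \<otimes> Y) \<ominus> A = x \<otimes> Y" if "A \<in> carrier R" "Y \<in> carrier R" for A Y
        using that xR by algebra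
      have "x \<otimes> bd R r D j y k \<in> J" using d unfolding eq e[OF c] .
      then show ?thesis using primeideal.I_prime[OF J xR c(2)] x by blast
    qed
    then have "y \<in> ?Z" using y by blast
    from gen[OF this] obtain d where d: "\<And>i. d i \<in> carrier R" "\<And>l. l < r i \<Longrightarrow> y l = lc (regm R) m d (\<lambda>i. g i l)" by blast
    \<comment> \<open>Writing \<open>y\<close> in the generators produces coefficients that are
      multiples of \<open>x\<close>, hence in \<open>q\<close> as Nakayama's lemma requires.\<close>
    let ?c = "\<lambda>l. x \<otimes> d l"
    have cq: "?c l \<in> q" for l using x d ideal_mult_right[OF qi] by blast
    have cR: "?c l \<in> carrier R" for l using xR d by simp
    have lcc: "lc (regm R) m ?c (\<lambda>i. g i l) \<in> carrier R" for l using cR gR by simp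
    have "s \<otimes> g h l \<ominus> lc (regm R) m ?c (\<lambda>i. g i l) \<ominus> bd R r D i w l \<in> J" if l: "l < r i" for l
    proof -
      have "lc (regm R) m ?c (\<lambda>i. g i l) = x \<otimes> y l"
        using lcR_smult_left[OF xR, of d "\<lambda>i. g i l" m] d gR l by simp
      moreover have "W \<oplus> (A \<oplus> Y) \<ominus> Y \<ominus> W = A" if "W \<in> carrier R" "A \<in> carrier R" "Y \<in> carrier R" for W A Y
        using that by algebra
      moreover have "bd R r D i w l \<in> carrier R" using w D by simp
      ultimately have "s \<otimes> g h l \<ominus> lc (regm R) m ?c (\<lambda>i. g i l) \<ominus> bd R r D i w l = a l"
        using ay'[OF l] aR y xR by simp
      then show ?thesis using a by simp
    qed
    then have inB: "(\<lambda>l. s \<otimes> g h l \<ominus> lc (regm R) m ?c (\<lambda>i. g i l)) \<in> ?B"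
      using w sR gR lcc by auto
    have "s \<odot>\<^bsub>vec_module R\<^esub> g h \<ominus>\<^bsub>vec_module R\<^esub> lc (vec_module R) m ?c g \<in> ?B"
      using inB sR gR lcc by (simp add: lc_vec_module vec_module_minus)
    with s cq have "P h s ?c" unfolding P_def by (intro conjI allI)
    then show ?thesis by blast
  qed
  then obtain s c where P: "\<And>h. P h (s h) (c h)" by metis
  have sc: "s h \<in> carrier R - q" "c h l \<in> q"
    "s h \<odot>\<^bsub>vec_module R\<^esub> g h \<ominus>\<^bsub>vec_module R\<^esub> lc (vec_module R) m (c h) g \<in> ?B" for h l
    using P[of h, unfolded P_def, THEN conjunct1] P[of h, unfolded P_def, THEN conjunct2, THEN conjunct1, THEN spec]
      P[of h, unfolded P_def, THEN conjunct2, THEN conjunct2] by this+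
  have gv: "g h \<in> carrier (vec_module R)" for h using gR by simp
  have Bsub: "?B \<subseteq> carrier (vec_module R)" by auto
  have "\<forall>h<m. \<exists>t\<in>carrier R - q. t \<odot>\<^bsub>vec_module R\<^esub> g h \<in> ?B"
    by (rule v.nakayama_at[OF q Bsub B0 Badd Bmult gv sc(2) sc(1) sc(3)])
  then have "\<exists>t\<in>carrier R - q. \<forall>h<m. t \<odot>\<^bsub>vec_module R\<^esub> g h \<in> ?B"
  proof (intro prime_common[OF q])
    fix h assume "\<forall>h<m. \<exists>t\<in>carrier R - q. t \<odot>\<^bsub>vec_module R\<^esub> g h \<in> ?B" "h < m"
    then show "\<exists>t\<in>carrier R - q. t \<odot>\<^bsub>vec_module R\<^esub> g h \<in> ?B" by blast
  next
    fix h u t assume h: "u \<in> carrier R" "t \<in> carrier R" "t \<odot>\<^bsub>vec_module R\<^esub> g h \<in> ?B"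
    show "(u \<otimes> t) \<odot>\<^bsub>vec_module R\<^esub> g h \<in> ?B"
      unfolding v.smult_assoc1[OF h(1,2) gv] by (rule Bmult[OF h(1,3)])
  qed
  then obtain t where t: "t \<in> carrier R - q" and tg: "\<And>h. h < m \<Longrightarrow> t \<odot>\<^bsub>vec_module R\<^esub> g h \<in> ?B" by blast
  have tR: "t \<in> carrier R" using t by blast
  show ?thesis
  proof (rule tor_vanishesI)
    fix z assume z: "\<And>l. z l \<in> carrier R" and zJ: "\<And>j k. i = Suc j \<Longrightarrow> k < r j \<Longrightarrow> bd R r D j z k \<in> J"
    then have "z \<in> ?Z" by blast
    from gen[OF this] obtain d where d: "\<And>i. d i \<in> carrier R" "\<And>l. l < r i \<Longrightarrow> z l = lc (regm R) m d (\<lambda>i. g i l)" by blast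
    have "lc (vec_module R) m d (\<lambda>h. t \<odot>\<^bsub>vec_module R\<^esub> g h) \<in> ?B"
      by (rule lc_mem[OF B0 Badd Bmult]) (use d tg in auto)
    then obtain w where w: "\<And>l. w l \<in> carrier R"
      "\<And>l. l < r i \<Longrightarrow> lc (vec_module R) m d (\<lambda>h. t \<odot>\<^bsub>vec_module R\<^esub> g h) l \<ominus> bd R r D i w l \<in> J" by blast
    have "lc (vec_module R) m d (\<lambda>h. t \<odot>\<^bsub>vec_module R\<^esub> g h) l = t \<otimes> z l" if l: "l < r i" for l
      using lcR_smult[OF tR, of d "\<lambda>i. g i l" m] d l gR by (simp add: lc_vec_module)
    then show "\<exists>s\<in>carrier R - q. \<exists>w. (\<forall>l. w l \<in> carrier R) \<and> (\<forall>l<r i. s \<otimes> z l \<ominus> bd R r D i w l \<in> J)"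
      using w t by (intro bexI[of _ t] exI[of _ w]) auto
  qed
qed

text \<open>The middle term of the exact sequence for
  \<open>R/(J:a) \<rightarrow> R/J \<rightarrow> R/(J+Ra)\<close>. The error \<open>a y\<close> left
  by bounding modulo the larger ideal has \<open>y\<close> a cycle modulo
  \<open>colon R J a\<close>, and bounding \<open>y\<close> there removes it.\<close>

lemma tor_vanishes_split:
  assumes q: "primeideal q R" and F: "free_resolution R r D" and J: "ideal J R" and a: "a \<in> carrier R"
    and V1: "tor_vanishes R q (colon R J a) r D i" and V2: "tor_vanishes R q (ideal_plus R J a) r D i"
  shows "tor_vanishes R q J r D i"
proof (rule tor_vanishesI)
  fix z assume z: "\<And>l. z l \<in> carrier R" and zJ: "\<And>j k. i = Suc j \<Longrightarrow> k < r j \<Longrightarrow> bd R r D j z k \<in> J"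
  note D = free_resolutionD(1)[OF F]
  have cyc: "bd R r D j z k \<in> ideal_plus R J a" if "i = Suc j" "k < r j" for j k
    using zJ[OF that] ideal_plus_sub[OF J a] by blast
  obtain s w where s: "s \<in> carrier R - q" and w: "\<And>l. w l \<in> carrier R"
    and sw: "\<And>l. l < r i \<Longrightarrow> s \<otimes> z l \<ominus> bd R r D i w l \<in> ideal_plus R J a"
    using tor_vanishesD[OF V2 z cyc] by blast
  have sR: "s \<in> carrier R" using s by blast
  have "\<forall>l. \<exists>b y. b \<in> J \<and> y \<in> carrier R \<and> (l < r i \<longrightarrow> s \<otimes> z l \<ominus> bd R r D i w l = b \<oplus> y \<otimes> a)"
  proof
    fix l show "\<exists>b y. b \<in> J \<and> y \<in> carrier R \<and> (l < r i \<longrightarrow> s \<otimes> z l \<ominus> bd R r D i w l = b \<oplus> y \<otimes> a)"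
    proof (cases "l < r i")
      case True
      then show ?thesis using sw[of l] unfolding ideal_plus_def by blast
    next
      case False
      then show ?thesis using ideal_zero[OF J] by blast
    qed
  qed
  then obtain b y where b: "\<And>l. b l \<in> J" and y: "\<And>l. y l \<in> carrier R"
    and ay: "\<And>l. l < r i \<Longrightarrow> s \<otimes> z l \<ominus> bd R r D i w l = b l \<oplus> y l \<otimes> a" by metis
  have bR: "b l \<in> carrier R" for l using b ideal_sub[OF J] by blast
  have W: "bd R r D i w l \<in> carrier R" for l using w D by simp
  have ay': "s \<otimes> z l = bd R r D i w l \<oplus> (b l \<oplus> a \<otimes> y l)" if l: "l < r i" for l
  proof -
    have e: "S = W \<oplus> (S \<ominus> W)" if "S \<in> carrier R" "W \<in> carrier R" for S W using that by algebra
    show ?thesis using e[of "s \<otimes> z l", OF _ W[of l]] ay[OF l] sR z y a by (simp add: m_comm)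
  qed
  have cy: "bd R r D j y k \<in> colon R J a" if ij: "i = Suc j" and k: "k < r j" for j k
  proof -
    have "bd R r D j (\<lambda>l. s \<otimes> z l) k = bd R r D j (\<lambda>l. bd R r D i w l \<oplus> (b l \<oplus> a \<otimes> y l)) k"
      by (rule lc_cong) (use ay' ij in auto)
    also have "\<dots> = bd R r D j (bd R r D i w) k \<oplus> bd R r D j (\<lambda>l. b l \<oplus> a \<otimes> y l) k"
      by (rule lcR_add) (use w bR y a D in auto)
    also have "bd R r D j (\<lambda>l. b l \<oplus> a \<otimes> y l) k = bd R r D j b k \<oplus> bd R r D j (\<lambda>l. a \<otimes> y l) k"
      by (rule lcR_add) (use bR y a D in auto)
    also have "bd R r D j (\<lambda>l. a \<otimes> y l) k = a \<otimes> bd R r D j y k" by (rule lcR_smult) (use y a D in auto)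
    also have "bd R r D j (bd R r D i w) k = \<zero>" unfolding ij by (rule free_resolutionD(2)[OF F w k])
    also have "bd R r D j (\<lambda>l. s \<otimes> z l) k = s \<otimes> bd R r D j z k" by (rule lcR_smult) (use z sR D in auto)
    finally have eq: "s \<otimes> bd R r D j z k = \<zero> \<oplus> (bd R r D j b k \<oplus> a \<otimes> bd R r D j y k)" .
    have c: "bd R r D j b k \<in> carrier R" "bd R r D j y k \<in> carrier R" using bR y D by simp_all
    have bJ: "bd R r D j b k \<in> J" by (rule ideal_lc[OF J D b])
    have "s \<otimes> bd R r D j z k \<in> J" by (rule ideal_mult[OF J zJ[OF ij k] sR])
    then have d: "s \<otimes> bd R r D j z k \<ominus> bd R r D j b k \<in> J" by (rule ideal_diff[OF J _ bJ])
    have e: "\<zero> \<oplus> (A \<oplus> a \<otimes> Y) \<ominus> A = Y \<otimes> a" if "A \<in> carrier R" "Y \<in> carrier R" for A Y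
      using that a by algebra
    have "bd R r D j y k \<otimes> a \<in> J" using d unfolding eq e[OF c] .
    then show ?thesis using c by (simp add: colon_def)
  qed
  obtain t v where t: "t \<in> carrier R - q" and v: "\<And>l. v l \<in> carrier R"
    and tv: "\<And>l. l < r i \<Longrightarrow> t \<otimes> y l \<ominus> bd R r D i v l \<in> colon R J a"
    using tor_vanishesD[OF V1 y cy] by blast
  have tR: "t \<in> carrier R" using t by blast
  let ?u = "\<lambda>l. t \<otimes> w l \<oplus> a \<otimes> v l"
  have "(t \<otimes> s) \<otimes> z l \<ominus> bd R r D i ?u l \<in> J" if l: "l < r i" for l
  proof -
    have "bd R r D i ?u l = bd R r D i (\<lambda>l. t \<otimes> w l) l \<oplus> bd R r D i (\<lambda>l. a \<otimes> v l) l"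
      by (rule lcR_add) (use w v tR a D in auto)
    also have "bd R r D i (\<lambda>l. t \<otimes> w l) l = t \<otimes> bd R r D i w l" by (rule lcR_smult) (use w tR D in auto)
    also have "bd R r D i (\<lambda>l. a \<otimes> v l) l = a \<otimes> bd R r D i v l" by (rule lcR_smult) (use v a D in auto)
    finally have 1: "bd R r D i ?u l = t \<otimes> bd R r D i w l \<oplus> a \<otimes> bd R r D i v l" .
    have e: "(t \<otimes> s) \<otimes> Z \<ominus> (t \<otimes> A \<oplus> a \<otimes> V) = t \<otimes> B \<oplus> (t \<otimes> Y \<ominus> V) \<otimes> a"
      if h: "Z \<in> carrier R" "A \<in> carrier R" "B \<in> carrier R" "V \<in> carrier R" "Y \<in> carrier R" "s \<otimes> Z = A \<oplus> (B \<oplus> a \<otimes> Y)" for A B Y V Z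
    proof -
      have "(t \<otimes> s) \<otimes> Z = t \<otimes> (A \<oplus> (B \<oplus> a \<otimes> Y))" using h(1,6) tR sR by (simp add: m_assoc)
      then show ?thesis using h(2-5) tR a by (simp only:) algebra
    qed
    have "bd R r D i v l \<in> carrier R" using v D by simp
    then have "(t \<otimes> s) \<otimes> z l \<ominus> bd R r D i ?u l = t \<otimes> b l \<oplus> (t \<otimes> y l \<ominus> bd R r D i v l) \<otimes> a"
      unfolding 1 using e[OF z W bR _ y ay'[OF l]] by blast
    moreover have "(t \<otimes> y l \<ominus> bd R r D i v l) \<otimes> a \<in> J" using tv[OF l] by (simp add: colon_def)
    ultimately show ?thesis using ideal_add[OF J ideal_mult[OF J b tR]] by simp
  qed
  then show "\<exists>s\<in>carrier R - q. \<exists>w. (\<forall>l. w l \<in> carrier R) \<and> (\<forall>l<r i. s \<otimes> z l \<ominus> bd R r D i w l \<in> J)"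
    using primeideal_mult_compl[OF q t s] w v tR a by (intro bexI[of _ "t \<otimes> s"] exI[of _ ?u]) simp_all
qed

text \<open>Devissage on \<open>J\<close>, starting from \<open>R/q\<close>. A prime
  \<open>J\<close> that is not contained in \<open>q\<close> contributes nothing at
  \<open>q\<close>; for a prime strictly inside \<open>q\<close> some \<open>x\<close> in
  \<open>q\<close> lies outside \<open>J\<close>, and Nakayama's lemma reduces to the larger ideal
  \<open>J + xR\<close>.\<close>

lemma tor_rigidity:
  assumes q: "primeideal q R" and F: "free_resolution R r D" and J: "ideal J R"
    and V: "tor_vanishes R q q r D i"
  shows "tor_vanishes R q J r D i"
proof -
  note D = free_resolutionD(1)[OF F]
  have trivial: "tor_vanishes R q J r D i" if J: "ideal J R" and s: "s \<in> J" "s \<notin> q" for J s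
  proof (rule tor_vanishesI)
    fix z :: "nat \<Rightarrow> 'a" assume z: "\<And>l. z l \<in> carrier R"
    have sR: "s \<in> carrier R" using s ideal_sub[OF J] by blast
    have "s \<otimes> z l \<ominus> bd R r D i (\<lambda>_. \<zero>) l \<in> J" for l
    proof -
      have "bd R r D i (\<lambda>_. \<zero>) l = \<zero>" by (rule lcR_zero) (use D in auto)
      then show ?thesis using ideal_mult_right[OF J s(1) z[of l]] sR z by (simp add: a_minus_def)
    qed
    then show "\<exists>s\<in>carrier R - q. \<exists>w. (\<forall>l. w l \<in> carrier R) \<and> (\<forall>l<r i. s \<otimes> z l \<ominus> bd R r D i w l \<in> J)"
      using sR s by (intro bexI[of _ s] exI[of _ "\<lambda>_. \<zero>"]) simp_all
  qed
  show ?thesis using J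
  proof (rule ideal_prime_induct)
    show "tor_vanishes R q (carrier R) r D i"
      using trivial[OF oneideal, of \<one>] primeideal_one_compl[OF q] by blast
  next
    fix J assume J: "primeideal J R" and IH: "\<And>K. ideal K R \<Longrightarrow> J \<subset> K \<Longrightarrow> tor_vanishes R q K r D i"
    note Ji = primeideal.axioms(1)[OF J]
    consider s where "s \<in> J" "s \<notin> q" | "J = q" | x where "x \<in> q" "x \<notin> J" by blast
    then show "tor_vanishes R q J r D i"
    proof cases
      case 1
      then show ?thesis by (rule trivial[OF Ji])
    next
      case 2
      then show ?thesis using V by simp
    next
      case 3
      then have xR: "x \<in> carrier R" using ideal_sub primeideal.axioms(1)[OF q] by blast
      have "J \<subset> ideal_plus R J x" using ideal_plus_sub[OF Ji xR] ideal_plus_mem[OF Ji xR] 3 by blast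
      then have "tor_vanishes R q (ideal_plus R J x) r D i" by (rule IH[OF ideal_plus_ideal[OF Ji xR]])
      then show ?thesis by (rule tor_nakayama[OF q F J 3])
    qed
  next
    fix J a assume "ideal J R" "a \<in> carrier R" "tor_vanishes R q (colon R J a) r D i" "tor_vanishes R q (ideal_plus R J a) r D i"
    then show "tor_vanishes R q J r D i" by (rule tor_vanishes_split[OF q F])
  qed
qed

text \<open>Devissage on \<open>I\<close>. If \<open>q' \<subseteq> I\<close>, then
  \<open>R/I\<close> vanishes at the strictly smaller \<open>q\<close>. Otherwise some
  \<open>x\<close> in \<open>q'\<close> is a nonzerodivisor modulo the prime \<open>I\<close> and
  zero in \<open>R/q'\<close>, so vanishing in degree \<open>i + 1\<close> for \<open>I + xR\<close>
  gives vanishing in degree \<open>i\<close> against \<open>R/q'\<close>; rigidity extends this to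
  all \<open>J\<close>.\<close>

lemma tor_descent:
  assumes q: "primeideal q R" and q': "primeideal q' R" and qq: "q \<subset> q'"
    and V: "\<And>I r D J. ideal I R \<Longrightarrow> resolves R I r D \<Longrightarrow> ideal J R \<Longrightarrow> tor_vanishes R q' J r D (Suc i)"
    and I: "ideal I R" and F: "resolves R I r D" and J: "ideal J R"
  shows "tor_vanishes R q J r D i"
proof -
  note q'i = primeideal.axioms(1)[OF q']
  have "\<forall>r D J. resolves R I r D \<longrightarrow> ideal J R \<longrightarrow> tor_vanishes R q J r D i"
    using I
  proof (rule ideal_prime_induct)
    show "\<forall>r D J. resolves R (carrier R) r D \<longrightarrow> ideal J R \<longrightarrow> tor_vanishes R q J r D i"
      using tor_vanishes_annihilator[OF oneideal _ _ one_closed] primeideal_one_compl[OF q] by blast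
  next
    fix I assume I: "primeideal I R"
    note Ii = primeideal.axioms(1)[OF I]
    show "\<forall>r D J. resolves R I r D \<longrightarrow> ideal J R \<longrightarrow> tor_vanishes R q J r D i"
    proof (intro allI impI)
      fix r D J assume F: "resolves R I r D" and J: "ideal J R"
      show "tor_vanishes R q J r D i"
      proof (cases "q' \<subseteq> I")
        case True
        then obtain s where "s \<in> I" "s \<notin> q" using qq by blast
        then show ?thesis by (rule tor_vanishes_annihilator[OF Ii F J])
      next
        case False
        then obtain x where x: "x \<in> q'" "x \<notin> I" by blast
        have xR: "x \<in> carrier R" using x ideal_sub[OF q'i] by blast
        have "colon R I x = I"
          using colon_sub[OF Ii xR] primeideal.I_prime[OF I _ xR] x(2) by (auto simp: colon_def)
        then have "tor_vanishes R q' q' r D i"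
          using tor_vanishes_multiplication_cone[OF Ii xR F _ q'i x(1)] V[OF ideal_plus_ideal[OF Ii xR] _ q'i] by blast
        then have "tor_vanishes R q' J r D i" by (rule tor_rigidity[OF q' resolvesD(1)[OF F] J])
        then show ?thesis by (rule tor_vanishes_mono) (use qq in blast)
      qed
    qed
  next
    fix I a assume I: "ideal I R" and a: "a \<in> carrier R"
      and c: "\<forall>r D J. resolves R (colon R I a) r D \<longrightarrow> ideal J R \<longrightarrow> tor_vanishes R q J r D i"
      and p: "\<forall>r D J. resolves R (ideal_plus R I a) r D \<longrightarrow> ideal J R \<longrightarrow> tor_vanishes R q J r D i"
    obtain r' D' where F': "resolves R (colon R I a) r' D'" using resolution_exists[OF colon_ideal[OF I a]] by blast
    show "\<forall>r D J. resolves R I r D \<longrightarrow> ideal J R \<longrightarrow> tor_vanishes R q J r D i"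
    proof (intro allI impI)
      fix r D J assume F: "resolves R I r D" and J: "ideal J R"
      obtain \<phi> where \<phi>: "\<forall>j k l. \<phi> j k l \<in> carrier R" "\<phi> 0 0 0 = a"
        "\<forall>j z k. (\<forall>l. z l \<in> carrier R) \<longrightarrow> k < r j \<longrightarrow>
          bd R r D j (\<lambda>m. lc (regm R) (r' (Suc j)) (\<phi> (Suc j) m) z) k = lc (regm R) (r' j) (\<phi> j k) (bd R r' D' j z)"
        using lift_exists[OF I a F F'] by blast
      interpret L: resolution_lift R I a r D r' D' \<phi>
        by (rule resolution_lift.intro[OF noeth_cring_axioms resolution_lift_axioms.intro])
          (use I a F F' \<phi> in auto)
      show "tor_vanishes R q J r D i"
        using L.tor_vanishes_of_cone[OF q J] c F' p L.cone_resolves J by blast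
    qed
  qed
  then show ?thesis using F J by blast
qed

text \<open>Otherwise descent along the chain makes degree 0 vanish at \<open>Q 0\<close>; but Tor
  in degree 0 of \<open>R/Q 0\<close> with itself is there the residue field.\<close>

lemma tor_nonvanishing:
  assumes Q: "prime_chain R n Q"
  shows "\<exists>I r D J. ideal I R \<and> resolves R I r D \<and> ideal J R \<and> \<not> tor_vanishes R (Q n) J r D n"
proof (rule ccontr)
  assume "\<not> ?thesis"
  then have top: "\<And>I r D J. ideal I R \<Longrightarrow> resolves R I r D \<Longrightarrow> ideal J R \<Longrightarrow> tor_vanishes R (Q n) J r D n" by blast
  have pr: "primeideal (Q i) R" if "i \<le> n" for i using Q that by (simp add: prime_chain_def)
  have "\<forall>I r D J. ideal I R \<longrightarrow> resolves R I r D \<longrightarrow> ideal J R \<longrightarrow> tor_vanishes R (Q 0) J r D 0"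
  proof (rule inc_induct[of 0 n])
    fix i assume i: "i < n" and IH: "\<forall>I r D J. ideal I R \<longrightarrow> resolves R I r D \<longrightarrow> ideal J R \<longrightarrow> tor_vanishes R (Q (Suc i)) J r D (Suc i)"
    have "Q i \<subset> Q (Suc i)" using Q i by (simp add: prime_chain_def)
    then show "\<forall>I r D J. ideal I R \<longrightarrow> resolves R I r D \<longrightarrow> ideal J R \<longrightarrow> tor_vanishes R (Q i) J r D i"
      using tor_descent[OF pr pr, of i "Suc i" i] i IH by simp
  qed (use top in auto)
  moreover have P: "primeideal (Q 0) R" by (rule pr) simp
  note Pi = primeideal.axioms(1)[OF P]
  obtain r D where F: "resolves R (Q 0) r D" using resolution_exists[OF Pi] by blast
  ultimately have V: "tor_vanishes R (Q 0) (Q 0) r D 0" using Pi by blast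
  \<comment> \<open>The constant vector 1 is a cycle, as degree 0 carries no condition; bounding it
    puts some \<open>s\<close> outside \<open>Q 0\<close> into \<open>Q 0\<close>.\<close>
  have "\<exists>s\<in>carrier R - Q 0. \<exists>w. (\<forall>l. w l \<in> carrier R) \<and> (\<forall>l<r 0. s \<otimes> \<one> \<ominus> bd R r D 0 w l \<in> Q 0)"
    by (rule tor_vanishesD[OF V]) auto
  then obtain s w where s: "s \<in> carrier R - Q 0" and w: "\<forall>l. w l \<in> carrier R" "s \<otimes> \<one> \<ominus> bd R r D 0 w 0 \<in> Q 0"
    using resolvesD(2)[OF F] by auto
  have b: "bd R r D 0 w 0 \<in> Q 0" using resolvesD(3)[OF F] w by blast
  then have bR: "bd R r D 0 w 0 \<in> carrier R" using ideal_sub[OF Pi] by blast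
  have "(s \<otimes> \<one> \<ominus> bd R r D 0 w 0) \<oplus> bd R r D 0 w 0 \<in> Q 0" by (rule ideal_add[OF Pi w(2) b])
  moreover have "(s \<otimes> \<one> \<ominus> bd R r D 0 w 0) \<oplus> bd R r D 0 w 0 = s" using s bR by (simp add: a_minus_def a_assoc l_neg)
  ultimately show False using s by simp
qed

end

subsection \<open>Complexes tensored with a free complex\<close>

text \<open>Mapping cones occur only as targets of morphisms, and for targets this weaker notion is
  enough; sources are bounded complexes.\<close>

definition is_complex :: "('a, 'r) ring_scheme \<Rightarrow> ('a, 'm) cochain \<Rightarrow> bool" where
  "is_complex R X \<longleftrightarrow> (\<forall>p. module R (ob X p)) \<and> (\<forall>p. df X p \<in> mod_hom R (ob X p) (ob X (p + 1))) \<and>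
     (\<forall>p. \<forall>x\<in>carrier (ob X p). df X (p + 1) (df X p x) = \<zero>\<^bsub>ob X (p + 1 + 1)\<^esub>)"

lemma bounded_is_complex: "X \<in> bounded_complexes R \<Longrightarrow> is_complex R X"
  by (auto simp: bounded_complexes_def is_complex_def fg_module_def)

lemma is_complexD:
  assumes "is_complex R X"
  shows "module R (ob X p)" "df X p \<in> mod_hom R (ob X p) (ob X (p + 1))"
    "x \<in> carrier (ob X p) \<Longrightarrow> df X (p + 1) (df X p x) = \<zero>\<^bsub>ob X (p + 1 + 1)\<^esub>"
  using assms by (auto simp: is_complex_def)

lemma mod_homD:
  assumes "f \<in> mod_hom R M N"
  shows "x \<in> carrier M \<Longrightarrow> f x \<in> carrier N"
    "x \<in> carrier M \<Longrightarrow> y \<in> carrier M \<Longrightarrow> f (x \<oplus>\<^bsub>M\<^esub> y) = f x \<oplus>\<^bsub>N\<^esub> f y"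
    "r \<in> carrier R \<Longrightarrow> x \<in> carrier M \<Longrightarrow> f (r \<odot>\<^bsub>M\<^esub> x) = r \<odot>\<^bsub>N\<^esub> f x"
  using assms by (auto simp: mod_hom_def)

lemma mod_hom_zero:
  assumes "module R M" "module R N" "f \<in> mod_hom R M N"
  shows "f \<zero>\<^bsub>M\<^esub> = \<zero>\<^bsub>N\<^esub>"
  using lc_hom[OF assms, of "\<lambda>_. \<zero>\<^bsub>R\<^esub>" "\<lambda>_. \<zero>\<^bsub>M\<^esub>" 0] assms
  by (simp add: module_def cring.cring_simprules abelian_group_def abelian_monoid.zero_closed)

lemma mod_hom_minus:
  assumes M: "module R M" and N: "module R N" and f: "f \<in> mod_hom R M N" and x: "x \<in> carrier M"
  shows "f (\<ominus>\<^bsub>M\<^esub> x) = \<ominus>\<^bsub>N\<^esub> f x"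
proof -
  interpret M: module R M by fact
  interpret N: module R N by fact
  have "f (\<ominus>\<^bsub>M\<^esub> x) = f ((\<ominus>\<^bsub>R\<^esub> \<one>\<^bsub>R\<^esub>) \<odot>\<^bsub>M\<^esub> x)" using x by (simp add: M.smult_l_minus)
  also have "\<dots> = (\<ominus>\<^bsub>R\<^esub> \<one>\<^bsub>R\<^esub>) \<odot>\<^bsub>N\<^esub> f x" using mod_homD(3)[OF f] x by simp
  finally show ?thesis using mod_homD(1)[OF f] x by (simp add: N.smult_l_minus)
qed

lemma mod_hom_diff:
  assumes M: "module R M" and N: "module R N" and f: "f \<in> mod_hom R M N"
    and x: "x \<in> carrier M" and y: "y \<in> carrier M"
  shows "f (x \<ominus>\<^bsub>M\<^esub> y) = f x \<ominus>\<^bsub>N\<^esub> f y"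
proof -
  interpret M: module R M by fact
  show ?thesis using mod_homD(2)[OF f] mod_hom_minus[OF M N f] x y by (simp add: a_minus_def)
qed

lemma chain_mapD:
  assumes "f \<in> chain_maps R X Y"
  shows "f p \<in> mod_hom R (ob X p) (ob Y p)"
    "x \<in> carrier (ob X p) \<Longrightarrow> f (p + 1) (df X p x) = df Y p (f p x)"
  using assms by (auto simp: chain_maps_def)

lemma chain_map_pred:
  "f \<in> chain_maps R X Y \<Longrightarrow> x \<in> carrier (ob X (p - 1)) \<Longrightarrow> f p (df X (p - 1) x) = df Y (p - 1) (f (p - 1) x)"
  using chain_mapD(2)[of f R X Y x "p - 1"] by simp

lemma is_complex_pred:
  assumes "is_complex R X"
  shows "df X (p - 1) \<in> mod_hom R (ob X (p - 1)) (ob X p)"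
    "x \<in> carrier (ob X (p - 1)) \<Longrightarrow> df X p (df X (p - 1) x) = \<zero>\<^bsub>ob X (p + 1)\<^esub>"
  using is_complexD(2)[OF assms, of "p - 1"] is_complexD(3)[OF assms, of x "p - 1"] by simp_all

lemma a_r_coset_iff: "x \<in> H +>\<^bsub>G\<^esub> y \<longleftrightarrow> (\<exists>h\<in>H. x = h \<oplus>\<^bsub>G\<^esub> y)"
  by (auto simp: a_r_coset_def r_coset_def)

lemma coboundaries_coset:
  assumes X: "is_complex R X" and b: "b \<in> coboundaries X p" and y: "y \<in> carrier (ob X p)"
  shows "coboundaries X p +>\<^bsub>ob X p\<^esub> (b \<oplus>\<^bsub>ob X p\<^esub> y) = coboundaries X p +>\<^bsub>ob X p\<^esub> y"
proof -
  interpret M: module R "ob X p" by (rule is_complexD(1)[OF X])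
  interpret L: module R "ob X (p - 1)" by (rule is_complexD(1)[OF X])
  note d = is_complex_pred(1)[OF X, of p]
  obtain v where v: "v \<in> carrier (ob X (p - 1))" "b = df X (p - 1) v" using b by (auto simp: coboundaries_def)
  have bc: "b \<in> carrier (ob X p)" using v mod_homD(1)[OF d] by simp
  show ?thesis
  proof (rule equalityI; rule subsetI)
    fix x assume "x \<in> coboundaries X p +>\<^bsub>ob X p\<^esub> (b \<oplus>\<^bsub>ob X p\<^esub> y)"
    then obtain u where u: "u \<in> carrier (ob X (p - 1))" "x = df X (p - 1) u \<oplus>\<^bsub>ob X p\<^esub> (b \<oplus>\<^bsub>ob X p\<^esub> y)"
      by (auto simp: a_r_coset_iff coboundaries_def)
    have "x = df X (p - 1) (u \<oplus>\<^bsub>ob X (p - 1)\<^esub> v) \<oplus>\<^bsub>ob X p\<^esub> y"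
      using u v y bc mod_homD(1,2)[OF d] by (simp add: M.a_assoc)
    then show "x \<in> coboundaries X p +>\<^bsub>ob X p\<^esub> y" using u v by (auto simp: a_r_coset_iff coboundaries_def)
  next
    fix x assume "x \<in> coboundaries X p +>\<^bsub>ob X p\<^esub> y"
    then obtain u where u: "u \<in> carrier (ob X (p - 1))" "x = df X (p - 1) u \<oplus>\<^bsub>ob X p\<^esub> y"
      by (auto simp: a_r_coset_iff coboundaries_def)
    have "x = df X (p - 1) (u \<ominus>\<^bsub>ob X (p - 1)\<^esub> v) \<oplus>\<^bsub>ob X p\<^esub> (b \<oplus>\<^bsub>ob X p\<^esub> y)"
      using u v y bc mod_homD(1)[OF d] mod_hom_diff[OF L.module_axioms M.module_axioms d]
      by (simp add: a_minus_def M.a_assoc M.r_neg1)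
    then show "x \<in> coboundaries X p +>\<^bsub>ob X p\<^esub> (b \<oplus>\<^bsub>ob X p\<^esub> y)"
      using u v by (auto simp: a_r_coset_iff coboundaries_def intro!: bexI[of _ "u \<ominus>\<^bsub>ob X (p - 1)\<^esub> v"])
  qed
qed

text \<open>The union over representatives collapses, because cohomologous representatives have the
  same coset as image.\<close>

lemma cohomology_map_coset:
  assumes X: "is_complex R X" and Y: "is_complex R Y" and f: "f \<in> chain_maps R X Y"
    and x: "x \<in> carrier (ob X p)"
  shows "cohomology_map Y f p (coboundaries X p +>\<^bsub>ob X p\<^esub> x) = coboundaries Y p +>\<^bsub>ob Y p\<^esub> f p x"
proof -
  interpret X: module R "ob X p" by (rule is_complexD(1)[OF X])
  interpret L: module R "ob X (p - 1)" by (rule is_complexD(1)[OF X])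
  note d = is_complex_pred(1)[OF X, of p] and fp = chain_mapD(1)[OF f, of p] and fq = chain_mapD(1)[OF f, of "p - 1"]
  have eq: "coboundaries Y p +>\<^bsub>ob Y p\<^esub> f p z = coboundaries Y p +>\<^bsub>ob Y p\<^esub> f p x"
    if "z \<in> coboundaries X p +>\<^bsub>ob X p\<^esub> x" for z
  proof -
    obtain u where u: "u \<in> carrier (ob X (p - 1))" "z = df X (p - 1) u \<oplus>\<^bsub>ob X p\<^esub> x"
      using \<open>z \<in> _\<close> by (auto simp: a_r_coset_iff coboundaries_def)
    have "f p z = df Y (p - 1) (f (p - 1) u) \<oplus>\<^bsub>ob Y p\<^esub> f p x"
      using u x mod_homD(1)[OF d] mod_homD(2)[OF fp] chain_map_pred[OF f] by simp
    moreover have "df Y (p - 1) (f (p - 1) u) \<in> coboundaries Y p" using u mod_homD(1)[OF fq] by (simp add: coboundaries_def)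
    ultimately show ?thesis using coboundaries_coset[OF Y] mod_homD(1)[OF fp x] by simp
  qed
  have "x = df X (p - 1) \<zero>\<^bsub>ob X (p - 1)\<^esub> \<oplus>\<^bsub>ob X p\<^esub> x"
    using x mod_hom_zero[OF L.module_axioms X.module_axioms d] by simp
  then have "x \<in> coboundaries X p +>\<^bsub>ob X p\<^esub> x" by (auto simp: a_r_coset_iff coboundaries_def)
  then show ?thesis unfolding cohomology_map_def using eq by blast
qed

lemma coset_self:
  assumes X: "is_complex R X" and x: "x \<in> carrier (ob X p)"
  shows "x \<in> coboundaries X p +>\<^bsub>ob X p\<^esub> x" and "\<zero>\<^bsub>ob X p\<^esub> \<in> coboundaries X p"
proof -
  interpret X: module R "ob X p" by (rule is_complexD(1)[OF X])
  interpret L: module R "ob X (p - 1)" by (rule is_complexD(1)[OF X])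
  have "df X (p - 1) \<zero>\<^bsub>ob X (p - 1)\<^esub> = \<zero>\<^bsub>ob X p\<^esub>"
    using mod_hom_zero[OF L.module_axioms X.module_axioms is_complex_pred(1)[OF X, of p]] .
  then show z: "\<zero>\<^bsub>ob X p\<^esub> \<in> coboundaries X p" unfolding coboundaries_def by (metis L.M.zero_closed imageI)
  show "x \<in> coboundaries X p +>\<^bsub>ob X p\<^esub> x" unfolding a_r_coset_iff using x by (intro bexI[OF _ z]) simp
qed

lemma quasi_iso_inj:
  assumes X: "is_complex R X" and Y: "is_complex R Y" and s: "s \<in> quasi_isos R X Y"
    and x: "x \<in> carrier (ob X p)" "df X p x = \<zero>\<^bsub>ob X (p + 1)\<^esub>"
    and y: "y \<in> carrier (ob Y (p - 1))" "s p x = df Y (p - 1) y"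
  shows "\<exists>v\<in>carrier (ob X (p - 1)). x = df X (p - 1) v"
proof -
  interpret X: module R "ob X p" by (rule is_complexD(1)[OF X])
  interpret X1: module R "ob X (p + 1)" by (rule is_complexD(1)[OF X])
  interpret Y: module R "ob Y p" by (rule is_complexD(1)[OF Y])
  have sc: "s \<in> chain_maps R X Y" and inj: "inj_on (cohomology_map Y s p) (cohomology X p)"
    using s by (auto simp: quasi_isos_def bij_betw_def)
  note sp = chain_mapD(1)[OF sc, of p]
  let ?B = "coboundaries X p"
  have dz: "df X p \<zero>\<^bsub>ob X p\<^esub> = \<zero>\<^bsub>ob X (p + 1)\<^esub>"
    by (rule mod_hom_zero[OF X.module_axioms X1.module_axioms is_complexD(2)[OF X]])
  have "?B +>\<^bsub>ob X p\<^esub> x \<in> cohomology X p" "?B +>\<^bsub>ob X p\<^esub> \<zero>\<^bsub>ob X p\<^esub> \<in> cohomology X p"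
    using x dz by (auto simp: cohomology_def cocycles_def)
  moreover have "cohomology_map Y s p (?B +>\<^bsub>ob X p\<^esub> x) = cohomology_map Y s p (?B +>\<^bsub>ob X p\<^esub> \<zero>\<^bsub>ob X p\<^esub>)"
  proof -
    have sx: "s p x = s p x \<oplus>\<^bsub>ob Y p\<^esub> \<zero>\<^bsub>ob Y p\<^esub>" using mod_homD(1)[OF sp x(1)] by simp
    have "s p x \<in> coboundaries Y p" using y by (simp add: coboundaries_def)
    then have "coboundaries Y p +>\<^bsub>ob Y p\<^esub> s p x = coboundaries Y p +>\<^bsub>ob Y p\<^esub> \<zero>\<^bsub>ob Y p\<^esub>"
      by (subst sx) (rule coboundaries_coset[OF Y], auto)
    then show ?thesis unfolding cohomology_map_coset[OF X Y sc x(1)] cohomology_map_coset[OF X Y sc X.M.zero_closed]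
        mod_hom_zero[OF X.module_axioms Y.module_axioms sp] .
  qed
  ultimately have "?B +>\<^bsub>ob X p\<^esub> x = ?B +>\<^bsub>ob X p\<^esub> \<zero>\<^bsub>ob X p\<^esub>" using inj by (meson inj_onD)
  then have "x \<in> ?B +>\<^bsub>ob X p\<^esub> \<zero>\<^bsub>ob X p\<^esub>" using coset_self(1)[OF X x(1)] by simp
  then obtain v where "v \<in> carrier (ob X (p - 1))" "x = df X (p - 1) v \<oplus>\<^bsub>ob X p\<^esub> \<zero>\<^bsub>ob X p\<^esub>"
    by (auto simp: a_r_coset_iff coboundaries_def)
  then show ?thesis using mod_homD(1)[OF is_complex_pred(1)[OF X, of p]] by auto
qed

lemma quasi_iso_surj:
  assumes X: "is_complex R X" and Y: "is_complex R Y" and s: "s \<in> quasi_isos R X Y"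
    and y: "y \<in> carrier (ob Y p)" "df Y p y = \<zero>\<^bsub>ob Y (p + 1)\<^esub>"
  shows "\<exists>x\<in>carrier (ob X p). \<exists>v\<in>carrier (ob Y (p - 1)). df X p x = \<zero>\<^bsub>ob X (p + 1)\<^esub> \<and>
    y = s p x \<oplus>\<^bsub>ob Y p\<^esub> df Y (p - 1) v"
proof -
  interpret Y: module R "ob Y p" by (rule is_complexD(1)[OF Y])
  have sc: "s \<in> chain_maps R X Y" and surj: "cohomology Y p = cohomology_map Y s p ` cohomology X p"
    using s by (auto simp: quasi_isos_def bij_betw_def)
  note sp = chain_mapD(1)[OF sc, of p]
  have "coboundaries Y p +>\<^bsub>ob Y p\<^esub> y \<in> cohomology Y p" using y by (auto simp: cohomology_def cocycles_def)
  then obtain x where x: "x \<in> cocycles X p"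
    "coboundaries Y p +>\<^bsub>ob Y p\<^esub> y = cohomology_map Y s p (coboundaries X p +>\<^bsub>ob X p\<^esub> x)"
    unfolding surj by (auto simp: cohomology_def)
  have xc: "x \<in> carrier (ob X p)" "df X p x = \<zero>\<^bsub>ob X (p + 1)\<^esub>" using x by (auto simp: cocycles_def)
  have "y \<in> coboundaries Y p +>\<^bsub>ob Y p\<^esub> s p x"
    using coset_self(1)[OF Y y(1)] unfolding x(2) cohomology_map_coset[OF X Y sc xc(1)] .
  then obtain v where v: "v \<in> carrier (ob Y (p - 1))" "y = df Y (p - 1) v \<oplus>\<^bsub>ob Y p\<^esub> s p x"
    by (auto simp: a_r_coset_iff coboundaries_def)
  then have "y = s p x \<oplus>\<^bsub>ob Y p\<^esub> df Y (p - 1) v"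
    using mod_homD(1)[OF is_complex_pred(1)[OF Y, of p]] mod_homD(1)[OF sp xc(1)] by (simp add: Y.M.a_comm)
  then show ?thesis using xc v by blast
qed

lemma id_quasi_iso:
  assumes X: "is_complex R X" shows "(\<lambda>n x. x) \<in> quasi_isos R X X"
proof -
  have c: "(\<lambda>n x. x) \<in> chain_maps R X X" by (auto simp: chain_maps_def mod_hom_def)
  have "cohomology_map X (\<lambda>n x. x) p c = c" if "c \<in> cohomology X p" for p c
    using that cohomology_map_coset[OF X X c, of _ p] by (auto simp: cohomology_def cocycles_def)
  then have "bij_betw (cohomology_map X (\<lambda>n x. x) p) (cohomology X p) (cohomology X p)" for p
    using bij_betw_cong[of "cohomology X p" "cohomology_map X (\<lambda>n x. x) p" id] by simp
  then show ?thesis using c by (simp add: quasi_isos_def)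
qed

text \<open>Acyclicity of the cone of \<open>s\<close> in terms of elements: injectivity on
  cohomology provides a first \<open>v0\<close>, and surjectivity accounts for the cocycle
  \<open>x - s v0\<close> that remains.\<close>

lemma quasi_iso_cone_acyclic:
  assumes X: "is_complex R X" and Y: "is_complex R Y" and s: "s \<in> quasi_isos R X Y"
    and u: "u \<in> carrier (ob X p)" "df X p u = \<zero>\<^bsub>ob X (p + 1)\<^esub>"
    and x: "x \<in> carrier (ob Y (p - 1))" "s p u = df Y (p - 1) x"
  shows "\<exists>v\<in>carrier (ob X (p - 1)). \<exists>x'\<in>carrier (ob Y (p - 2)). u = df X (p - 1) v \<and>
    x = s (p - 1) v \<oplus>\<^bsub>ob Y (p - 1)\<^esub> df Y (p - 2) x'"
proof -
  interpret X: module R "ob X p" by (rule is_complexD(1)[OF X])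
  interpret X1: module R "ob X (p - 1)" by (rule is_complexD(1)[OF X])
  interpret Y: module R "ob Y p" by (rule is_complexD(1)[OF Y])
  interpret Y1: module R "ob Y (p - 1)" by (rule is_complexD(1)[OF Y])
  have sc: "s \<in> chain_maps R X Y" using s by (simp add: quasi_isos_def)
  note sq = chain_mapD(1)[OF sc, of "p - 1"]
  note dX = is_complex_pred(1)[OF X, of p] and dY = is_complex_pred(1)[OF Y, of p]
  obtain v0 where v0: "v0 \<in> carrier (ob X (p - 1))" "u = df X (p - 1) v0"
    using quasi_iso_inj[OF X Y s u x] by blast
  have sv: "s (p - 1) v0 \<in> carrier (ob Y (p - 1))" using mod_homD(1)[OF sq v0(1)] .
  let ?c = "x \<ominus>\<^bsub>ob Y (p - 1)\<^esub> s (p - 1) v0"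
  have "df Y (p - 1) ?c = df Y (p - 1) x \<ominus>\<^bsub>ob Y p\<^esub> df Y (p - 1) (s (p - 1) v0)"
    by (rule mod_hom_diff[OF Y1.module_axioms Y.module_axioms dY x(1) sv])
  also have "df Y (p - 1) (s (p - 1) v0) = df Y (p - 1) x" using chain_map_pred[OF sc v0(1)] v0(2) x(2) by simp
  finally have "df Y (p - 1) ?c = \<zero>\<^bsub>ob Y p\<^esub>" using mod_homD(1)[OF dY x(1)] by (simp add: a_minus_def Y.M.r_neg)
  then have "\<exists>c1\<in>carrier (ob X (p - 1)). \<exists>x'\<in>carrier (ob Y (p - 1 - 1)). df X (p - 1) c1 = \<zero>\<^bsub>ob X (p - 1 + 1)\<^esub> \<and>
    ?c = s (p - 1) c1 \<oplus>\<^bsub>ob Y (p - 1)\<^esub> df Y (p - 1 - 1) x'"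
    using x sv by (intro quasi_iso_surj[OF X Y s]) simp_all
  then obtain c1 x' where c1: "c1 \<in> carrier (ob X (p - 1))" "x' \<in> carrier (ob Y (p - 2))"
    "df X (p - 1) c1 = \<zero>\<^bsub>ob X p\<^esub>" "?c = s (p - 1) c1 \<oplus>\<^bsub>ob Y (p - 1)\<^esub> df Y (p - 2) x'"
    by auto
  let ?v = "v0 \<oplus>\<^bsub>ob X (p - 1)\<^esub> c1"
  have dx': "df Y (p - 2) x' \<in> carrier (ob Y (p - 1))"
    using mod_homD(1)[OF is_complexD(2)[OF Y, of "p - 2"] c1(2)] by simp
  have sc1: "s (p - 1) c1 \<in> carrier (ob Y (p - 1))" using mod_homD(1)[OF sq c1(1)] .
  have "u = df X (p - 1) ?v" using v0 c1 mod_homD(1,2)[OF dX] by simp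
  moreover have "x = s (p - 1) ?v \<oplus>\<^bsub>ob Y (p - 1)\<^esub> df Y (p - 2) x'"
  proof -
    have "x = s (p - 1) v0 \<oplus>\<^bsub>ob Y (p - 1)\<^esub> ?c" using x(1) sv by (simp add: a_minus_def Y1.M.a_ac Y1.M.r_neg1 Y1.M.r_neg2 Y1.M.r_neg)
    also have "\<dots> = s (p - 1) ?v \<oplus>\<^bsub>ob Y (p - 1)\<^esub> df Y (p - 2) x'"
      unfolding c1(4) using v0(1) c1(1) mod_homD(2)[OF sq] sv sc1 dx' by (simp add: Y1.M.a_assoc)
    finally show ?thesis .
  qed
  ultimately show ?thesis using v0(1) c1(1,2) X1.M.a_closed by blast
qed

text \<open>Cocycles of total degree 0 in the tensor product of \<open>X\<close> with the truncation
  of the free complex to indices at least \<open>a\<close>: \<open>z p k\<close> is the coefficient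
  of the \<open>k\<close>-th basis vector of index \<open>p\<close>. Homological index and
  cohomological degree cancel, and the sign of the total differential is absorbed by writing the
  condition as an equation.\<close>

definition tensor_cocycle :: "(int \<Rightarrow> nat) \<Rightarrow> (int \<Rightarrow> nat \<Rightarrow> nat \<Rightarrow> 'a) \<Rightarrow> int \<Rightarrow> ('a, 'm) cochain \<Rightarrow>
    (int \<Rightarrow> nat \<Rightarrow> 'm) \<Rightarrow> bool" where
  "tensor_cocycle n D a X z \<longleftrightarrow> (\<forall>p k. z p k \<in> carrier (ob X p)) \<and>
     (\<forall>p\<ge>a. \<forall>k<n p. df X p (z p k) = lc (ob X (p + 1)) (n (p + 1)) (D p k) (z (p + 1)))"

text \<open>Here \<open>w\<close> has total degree -1: \<open>w p\<close> holds coefficients in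
  \<open>ob X p\<close> at the basis vectors of index \<open>p + 1\<close>. The plus sign fits
  \<open>tensor_cocycle\<close>, as \<open>df\<close> and the matrix \<open>D\<close> then have the
  same effect on a boundary.\<close>

definition tensor_bd :: "(int \<Rightarrow> nat) \<Rightarrow> (int \<Rightarrow> nat \<Rightarrow> nat \<Rightarrow> 'a) \<Rightarrow> ('a, 'm) cochain \<Rightarrow>
    (int \<Rightarrow> nat \<Rightarrow> 'm) \<Rightarrow> int \<Rightarrow> nat \<Rightarrow> 'm" where
  "tensor_bd n D X w p k = df X (p - 1) (w (p - 1) k) \<oplus>\<^bsub>ob X p\<^esub> lc (ob X p) (n (p + 1)) (D p k) (w p)"

definition free_complex_from :: "('a, 'r) ring_scheme \<Rightarrow> int \<Rightarrow> (int \<Rightarrow> nat) \<Rightarrow> (int \<Rightarrow> nat \<Rightarrow> nat \<Rightarrow> 'a) \<Rightarrow> bool" where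
  "free_complex_from R a n D \<longleftrightarrow> (\<forall>p k l. D p k l \<in> carrier R) \<and>
     (\<forall>p\<ge>a. \<forall>k<n p. \<forall>l<n (p + 1 + 1). lc (regm R) (n (p + 1)) (D p k) (\<lambda>m. D (p + 1) m l) = \<zero>\<^bsub>R\<^esub>)"

lemma free_complex_square:
  assumes F: "free_complex_from R a n D" and M: "module R M" and p: "p \<ge> a" and k: "k < n p"
    and v: "\<And>l. v l \<in> carrier M"
  shows "lc M (n (p + 1)) (D p k) (\<lambda>l. lc M (n (p + 1 + 1)) (D (p + 1) l) v) = \<zero>\<^bsub>M\<^esub>"
proof -
  interpret M: module R M by fact
  have D: "D p k l \<in> carrier R" for p k l using F by (simp add: free_complex_from_def)
  have "lc M (n (p + 1)) (D p k) (\<lambda>l. lc M (n (p + 1 + 1)) (D (p + 1) l) v)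
    = lc M (n (p + 1 + 1)) (\<lambda>i. lc (regm R) (n (p + 1)) (D p k) (\<lambda>l. D (p + 1) l i)) v"
    by (rule M.lc_lc) (use D v in auto)
  also have "\<dots> = \<zero>\<^bsub>M\<^esub>"
    by (rule M.lc_zero_left) (use F p k v in \<open>auto simp: free_complex_from_def\<close>)
  finally show ?thesis .
qed

text \<open>Equality of cohomology classes after truncation to indices at least \<open>b\<close>;
  raising \<open>b\<close> is the truncation map.\<close>

definition tensor_eq :: "(int \<Rightarrow> nat) \<Rightarrow> (int \<Rightarrow> nat \<Rightarrow> nat \<Rightarrow> 'a) \<Rightarrow> int \<Rightarrow> ('a, 'm) cochain \<Rightarrow>
    (int \<Rightarrow> nat \<Rightarrow> 'm) \<Rightarrow> (int \<Rightarrow> nat \<Rightarrow> 'm) \<Rightarrow> bool" where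
  "tensor_eq n D b X y z \<longleftrightarrow> (\<exists>w. (\<forall>p k. w p k \<in> carrier (ob X p)) \<and>
     (\<forall>p\<ge>b. \<forall>k<n p. y p k = z p k \<oplus>\<^bsub>ob X p\<^esub> tensor_bd n D X w p k))"

locale free_cpx = cring R for R (structure) +
  fixes a :: int and n :: "int \<Rightarrow> nat" and D :: "int \<Rightarrow> nat \<Rightarrow> nat \<Rightarrow> 'a"
  assumes F: "free_complex_from R a n D"
begin

abbreviation "coc b X z \<equiv> tensor_cocycle n D b X z"
abbreviation "tbd X w p k \<equiv> tensor_bd n D X w p k"
abbreviation "teq b X y z \<equiv> tensor_eq n D b X y z"

lemma D [simp]: "D p k l \<in> carrier R" using F by (simp add: free_complex_from_def)

lemma cocD:
  assumes "coc b X z"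
  shows "z p k \<in> carrier (ob X p)"
    "b \<le> p \<Longrightarrow> k < n p \<Longrightarrow> df X p (z p k) = lc (ob X (p + 1)) (n (p + 1)) (D p k) (z (p + 1))"
  using assms by (auto simp: tensor_cocycle_def)

lemma coc_mono: "coc b X z \<Longrightarrow> b \<le> b' \<Longrightarrow> coc b' X z"
  unfolding tensor_cocycle_def by (meson order_trans)

lemma teq_mono: "teq b X y z \<Longrightarrow> b \<le> b' \<Longrightarrow> teq b' X y z"
  unfolding tensor_eq_def by (meson order_trans)

lemma teqI:
  "(\<And>p k. w p k \<in> carrier (ob X p)) \<Longrightarrow>
   (\<And>p k. b \<le> p \<Longrightarrow> k < n p \<Longrightarrow> y p k = z p k \<oplus>\<^bsub>ob X p\<^esub> tbd X w p k) \<Longrightarrow> teq b X y z"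
  unfolding tensor_eq_def by (intro exI[of _ w]) simp

context
  fixes X :: "('a, 'm) cochain"
  assumes X: "is_complex R X"
begin

interpretation M: module R "ob X p" for p by (rule is_complexD(1)[OF X])

private lemma d: "x \<in> carrier (ob X (p - 1)) \<Longrightarrow> df X (p - 1) x \<in> carrier (ob X p)"
  by (rule mod_homD(1)[OF is_complex_pred(1)[OF X]])

private lemma d': "x \<in> carrier (ob X p) \<Longrightarrow> df X p x \<in> carrier (ob X (p + 1))"
  by (rule mod_homD(1)[OF is_complexD(2)[OF X]])

lemma tbd_closed: "(\<And>p k. w p k \<in> carrier (ob X p)) \<Longrightarrow> tbd X w p k \<in> carrier (ob X p)"
  by (simp add: tensor_bd_def d)

lemma tbd_add:
  assumes "\<And>p k. w p k \<in> carrier (ob X p)" "\<And>p k. u p k \<in> carrier (ob X p)"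
  shows "tbd X (\<lambda>p k. w p k \<oplus>\<^bsub>ob X p\<^esub> u p k) p k = tbd X w p k \<oplus>\<^bsub>ob X p\<^esub> tbd X u p k"
  using assms mod_homD(2)[OF is_complex_pred(1)[OF X, of p]]
  by (simp add: tensor_bd_def d M.lc_add M.M.a_ac)

lemma tbd_smult:
  assumes "r \<in> carrier R" "\<And>p k. w p k \<in> carrier (ob X p)"
  shows "tbd X (\<lambda>p k. r \<odot>\<^bsub>ob X p\<^esub> w p k) p k = r \<odot>\<^bsub>ob X p\<^esub> tbd X w p k"
  using assms mod_homD(3)[OF is_complex_pred(1)[OF X, of p]]
  by (simp add: tensor_bd_def d M.lc_smult M.smult_r_distr)

lemma tbd_zero: "tbd X (\<lambda>p k. \<zero>\<^bsub>ob X p\<^esub>) p k = \<zero>\<^bsub>ob X p\<^esub>"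
  using mod_hom_zero[OF M.module_axioms M.module_axioms is_complex_pred(1)[OF X, of p]]
  by (simp add: tensor_bd_def M.lc_zero)

lemma tbd_minus:
  assumes w: "\<And>p k. w p k \<in> carrier (ob X p)"
  shows "tbd X (\<lambda>p k. \<ominus>\<^bsub>ob X p\<^esub> w p k) p k = \<ominus>\<^bsub>ob X p\<^esub> tbd X w p k"
  using w mod_hom_minus[OF M.module_axioms M.module_axioms is_complex_pred(1)[OF X, of p]]
  by (simp add: tensor_bd_def d M.lc_minus M.M.minus_add)

lemma teq_refl: "(\<And>p k. z p k \<in> carrier (ob X p)) \<Longrightarrow> teq b X z z"
  by (rule teqI[of "\<lambda>p k. \<zero>\<^bsub>ob X p\<^esub>"]) (simp_all add: tbd_zero)

lemma teq_sym:
  assumes "teq b X y z" and z: "\<And>p k. z p k \<in> carrier (ob X p)"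
  shows "teq b X z y"
proof -
  obtain w where w: "\<And>p k. w p k \<in> carrier (ob X p)"
    "\<And>p k. b \<le> p \<Longrightarrow> k < n p \<Longrightarrow> y p k = z p k \<oplus>\<^bsub>ob X p\<^esub> tbd X w p k"
    using assms(1) unfolding tensor_eq_def by blast
  show ?thesis
    by (rule teqI[of "\<lambda>p k. \<ominus>\<^bsub>ob X p\<^esub> w p k"])
      (use w z tbd_closed[OF w(1)] tbd_minus[OF w(1)] in \<open>simp_all add: M.M.a_assoc M.M.r_neg\<close>)
qed

lemma teq_trans:
  assumes "teq b X x y" "teq b X y z" and z: "\<And>p k. z p k \<in> carrier (ob X p)"
  shows "teq b X x z"
proof -
  obtain w where w: "\<And>p k. w p k \<in> carrier (ob X p)"
    "\<And>p k. b \<le> p \<Longrightarrow> k < n p \<Longrightarrow> x p k = y p k \<oplus>\<^bsub>ob X p\<^esub> tbd X w p k"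
    using assms(1) unfolding tensor_eq_def by blast
  obtain u where u: "\<And>p k. u p k \<in> carrier (ob X p)"
    "\<And>p k. b \<le> p \<Longrightarrow> k < n p \<Longrightarrow> y p k = z p k \<oplus>\<^bsub>ob X p\<^esub> tbd X u p k"
    using assms(2) unfolding tensor_eq_def by blast
  show ?thesis
    by (rule teqI[of "\<lambda>p k. u p k \<oplus>\<^bsub>ob X p\<^esub> w p k"])
      (use w u z tbd_closed[OF w(1)] tbd_closed[OF u(1)] tbd_add[OF u(1) w(1)] in \<open>simp_all add: M.M.a_assoc\<close>)
qed

lemma teq_add:
  assumes "teq b X y z" "teq b X y' z'"
    and z: "\<And>p k. z p k \<in> carrier (ob X p)" "\<And>p k. z' p k \<in> carrier (ob X p)"
  shows "teq b X (\<lambda>p k. y p k \<oplus>\<^bsub>ob X p\<^esub> y' p k) (\<lambda>p k. z p k \<oplus>\<^bsub>ob X p\<^esub> z' p k)"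
proof -
  obtain w where w: "\<And>p k. w p k \<in> carrier (ob X p)"
    "\<And>p k. b \<le> p \<Longrightarrow> k < n p \<Longrightarrow> y p k = z p k \<oplus>\<^bsub>ob X p\<^esub> tbd X w p k"
    using assms(1) unfolding tensor_eq_def by blast
  obtain u where u: "\<And>p k. u p k \<in> carrier (ob X p)"
    "\<And>p k. b \<le> p \<Longrightarrow> k < n p \<Longrightarrow> y' p k = z' p k \<oplus>\<^bsub>ob X p\<^esub> tbd X u p k"
    using assms(2) unfolding tensor_eq_def by blast
  show ?thesis
    by (rule teqI[of "\<lambda>p k. w p k \<oplus>\<^bsub>ob X p\<^esub> u p k"])
      (use w u z tbd_closed[OF w(1)] tbd_closed[OF u(1)] tbd_add[OF w(1) u(1)] in \<open>simp_all add: M.M.a_ac\<close>)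
qed

lemma teq_smult:
  assumes "teq b X y z" and r: "r \<in> carrier R" and z: "\<And>p k. z p k \<in> carrier (ob X p)"
  shows "teq b X (\<lambda>p k. r \<odot>\<^bsub>ob X p\<^esub> y p k) (\<lambda>p k. r \<odot>\<^bsub>ob X p\<^esub> z p k)"
proof -
  obtain w where w: "\<And>p k. w p k \<in> carrier (ob X p)"
    "\<And>p k. b \<le> p \<Longrightarrow> k < n p \<Longrightarrow> y p k = z p k \<oplus>\<^bsub>ob X p\<^esub> tbd X w p k"
    using assms(1) unfolding tensor_eq_def by blast
  show ?thesis
    by (rule teqI[of "\<lambda>p k. r \<odot>\<^bsub>ob X p\<^esub> w p k"])
      (use w r z tbd_closed[OF w(1)] tbd_smult[OF r w(1)] in \<open>simp_all add: M.smult_r_distr\<close>)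
qed

lemma coc_smult:
  assumes z: "coc b X z" and r: "r \<in> carrier R"
  shows "coc b X (\<lambda>p k. r \<odot>\<^bsub>ob X p\<^esub> z p k)"
  unfolding tensor_cocycle_def
  using cocD[OF z] r mod_homD(3)[OF is_complexD(2)[OF X]] by (simp add: M.lc_smult)

end

lemma coc_map:
  assumes X: "is_complex R X" and Y: "is_complex R Y" and f: "f \<in> chain_maps R X Y" and z: "coc b X z"
  shows "coc b Y (\<lambda>p k. f p (z p k))"
  unfolding tensor_cocycle_def
proof (intro conjI allI impI)
  show "f p (z p k) \<in> carrier (ob Y p)" for p k by (rule mod_homD(1)[OF chain_mapD(1)[OF f] cocD(1)[OF z]])
  fix p k assume "b \<le> p" "k < n p"
  then have "df Y p (f p (z p k)) = f (p + 1) (lc (ob X (p + 1)) (n (p + 1)) (D p k) (z (p + 1)))"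
    using chain_mapD(2)[OF f cocD(1)[OF z]] cocD(2)[OF z] by metis
  also have "\<dots> = lc (ob Y (p + 1)) (n (p + 1)) (D p k) (\<lambda>k. f (p + 1) (z (p + 1) k))"
    by (rule lc_hom[OF is_complexD(1)[OF X] is_complexD(1)[OF Y] chain_mapD(1)[OF f]]) (simp_all add: cocD(1)[OF z])
  finally show "df Y p (f p (z p k)) = \<dots>" .
qed

lemma tbd_map:
  assumes X: "is_complex R X" and Y: "is_complex R Y" and f: "f \<in> chain_maps R X Y"
    and w: "\<And>p k. w p k \<in> carrier (ob X p)"
  shows "f p (tbd X w p k) = tbd Y (\<lambda>p k. f p (w p k)) p k"
proof -
  interpret M: module R "ob X p" by (rule is_complexD(1)[OF X])
  have "f p (lc (ob X p) (n (p + 1)) (D p k) (w p)) = lc (ob Y p) (n (p + 1)) (D p k) (\<lambda>k. f p (w p k))"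
    by (rule lc_hom[OF is_complexD(1)[OF X] is_complexD(1)[OF Y] chain_mapD(1)[OF f]]) (simp_all add: w)
  then show ?thesis
    using mod_homD(2)[OF chain_mapD(1)[OF f, of p]] chain_map_pred[OF f w] w
      mod_homD(1)[OF is_complex_pred(1)[OF X, of p] w]
    by (simp add: tensor_bd_def)
qed

lemma teq_map:
  assumes X: "is_complex R X" and Y: "is_complex R Y" and f: "f \<in> chain_maps R X Y"
    and e: "teq b X y z" and z: "\<And>p k. z p k \<in> carrier (ob X p)"
  shows "teq b Y (\<lambda>p k. f p (y p k)) (\<lambda>p k. f p (z p k))"
proof -
  obtain w where w: "\<And>p k. w p k \<in> carrier (ob X p)"
    "\<And>p k. b \<le> p \<Longrightarrow> k < n p \<Longrightarrow> y p k = z p k \<oplus>\<^bsub>ob X p\<^esub> tbd X w p k"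
    using e unfolding tensor_eq_def by blast
  show ?thesis
    by (rule teqI[of "\<lambda>p k. f p (w p k)"])
      (simp_all add: w z mod_homD(1,2)[OF chain_mapD(1)[OF f]] tbd_closed[OF X w(1)] tbd_map[OF X Y f w(1)])
qed

lemma homotopic_teq:
  assumes X: "is_complex R X" and Y: "is_complex R Y" and f: "f \<in> chain_maps R X Y" and g: "g \<in> chain_maps R X Y"
    and h: "homotopic R X Y f g" and z: "coc b X z"
  shows "teq b Y (\<lambda>p k. f p (z p k)) (\<lambda>p k. g p (z p k))"
proof -
  obtain h where h: "\<And>p. h p \<in> mod_hom R (ob X p) (ob Y (p - 1))"
    "\<And>p x. x \<in> carrier (ob X p) \<Longrightarrow> f p x \<ominus>\<^bsub>ob Y p\<^esub> g p x = df Y (p - 1) (h p x) \<oplus>\<^bsub>ob Y p\<^esub> h (p + 1) (df X p x)"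
    using h unfolding homotopic_def by blast
  have h1: "h (p + 1) \<in> mod_hom R (ob X (p + 1)) (ob Y p)" for p using h(1)[of "p + 1"] by simp
  note zc = cocD(1)[OF z]
  \<comment> \<open>The homotopy applied to the cocycle; it lowers the degree, and the shift of the
    index makes the result a cochain of total degree -1.\<close>
  let ?w = "\<lambda>p k. h (p + 1) (z (p + 1) k)"
  have w: "?w p k \<in> carrier (ob Y p)" for p k by (rule mod_homD(1)[OF h1 zc])
  show ?thesis
  proof (rule teqI[of ?w, OF w])
    fix p k assume pk: "b \<le> p" "k < n p"
    interpret Y: module R "ob Y p" by (rule is_complexD(1)[OF Y])
    have "h (p + 1) (df X p (z p k)) = lc (ob Y p) (n (p + 1)) (D p k) (?w p)"
      unfolding cocD(2)[OF z pk]
      by (rule lc_hom[OF is_complexD(1)[OF X] is_complexD(1)[OF Y] h1]) (simp_all add: zc)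
    then have e: "f p (z p k) \<ominus>\<^bsub>ob Y p\<^esub> g p (z p k) = tbd Y ?w p k"
      using h(2)[OF zc] by (simp add: tensor_bd_def)
    have "f p (z p k) = g p (z p k) \<oplus>\<^bsub>ob Y p\<^esub> (f p (z p k) \<ominus>\<^bsub>ob Y p\<^esub> g p (z p k))"
      using mod_homD(1)[OF chain_mapD(1)[OF f] zc] mod_homD(1)[OF chain_mapD(1)[OF g] zc]
      by (simp add: a_minus_def Y.M.a_ac Y.M.r_neg1 Y.M.r_neg2 Y.M.r_neg)
    then show "f p (z p k) = g p (z p k) \<oplus>\<^bsub>ob Y p\<^esub> tbd Y ?w p k" unfolding e .
  qed
qed

text \<open>Tensoring the acyclic cone of a quasi-isomorphism with a bounded below complex of free modules
  preserves acyclicity; the solution is constructed by descending induction on the degree.\<close>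

lemma quasi_iso_tensor_acyclic:
  assumes X: "is_complex R X" and Y: "is_complex R Y" and s: "s \<in> quasi_isos R X Y"
    and bX: "\<And>p. \<bar>p\<bar> > B \<Longrightarrow> carrier (ob X p) = {\<zero>\<^bsub>ob X p\<^esub>}"
    and bY: "\<And>p. \<bar>p\<bar> > B \<Longrightarrow> carrier (ob Y p) = {\<zero>\<^bsub>ob Y p\<^esub>}"
    and ab: "a \<le> b" and y: "coc b X y" and w: "\<And>p k. w p k \<in> carrier (ob Y p)"
    and syw: "\<And>p k. b \<le> p \<Longrightarrow> k < n p \<Longrightarrow> s p (y p k) = tbd Y w p k"
  shows "\<exists>v x. (\<forall>p k. v p k \<in> carrier (ob X p)) \<and> (\<forall>p k. x p k \<in> carrier (ob Y p)) \<and>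
    (\<forall>p\<ge>b. \<forall>k<n p. y p k = tbd X v p k \<and>
      w (p - 1) k = s (p - 1) (v (p - 1) k) \<oplus>\<^bsub>ob Y (p - 1)\<^esub>
        (df Y (p - 2) (x (p - 2) k) \<ominus>\<^bsub>ob Y (p - 1)\<^esub> lc (ob Y (p - 1)) (n (p + 1)) (D p k) (x (p - 1))))"
proof -
  interpret MX: module R "ob X p" for p by (rule is_complexD(1)[OF X])
  interpret MY: module R "ob Y p" for p by (rule is_complexD(1)[OF Y])
  have sc: "s \<in> chain_maps R X Y" using s by (simp add: quasi_isos_def)
  note sh = chain_mapD(1)[OF sc]
  note yc = cocD(1)[OF y]
  have dX: "x \<in> carrier (ob X (p - 1)) \<Longrightarrow> df X (p - 1) x \<in> carrier (ob X p)" for x p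
    by (rule mod_homD(1)[OF is_complex_pred(1)[OF X]])
  have dY: "x \<in> carrier (ob Y (p - 1)) \<Longrightarrow> df Y (p - 1) x \<in> carrier (ob Y p)" for x p
    by (rule mod_homD(1)[OF is_complex_pred(1)[OF Y]])
  have dY2: "x \<in> carrier (ob Y (p - 2)) \<Longrightarrow> df Y (p - 2) x \<in> carrier (ob Y (p - 1))" for x p
    using dY[of x "p - 1"] by simp
  \<comment> \<open>The pair \<open>(y, w)\<close> is a cocycle of the tensored cone of
    \<open>s\<close>; \<open>E\<close> at \<open>p\<close> contains the two components of the
    equation that \<open>(v, x)\<close> bounds it.\<close>
  define E where "E v x p k \<longleftrightarrow> y p k = tbd X v p k \<and>
      w (p - 1) k = s (p - 1) (v (p - 1) k) \<oplus>\<^bsub>ob Y (p - 1)\<^esub>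
        (df Y (p - 2) (x (p - 2) k) \<ominus>\<^bsub>ob Y (p - 1)\<^esub> lc (ob Y (p - 1)) (n (p + 1)) (D p k) (x (p - 1)))" for v x p k
  define S where "S m \<longleftrightarrow> (\<exists>v x. (\<forall>p k. v p k \<in> carrier (ob X p)) \<and> (\<forall>p k. x p k \<in> carrier (ob Y p)) \<and>
    (\<forall>p\<ge>m. b \<le> p \<longrightarrow> (\<forall>k<n p. E v x p k)))" for m
  have step: "S m" if Sm: "S (m + 1)" for m
  proof (cases "b \<le> m")
    case False
    then have "\<forall>p\<ge>m. b \<le> p \<longrightarrow> p \<ge> m + 1" by linarith
    then show ?thesis using Sm unfolding S_def by meson
  next
    case True
    obtain v x where v: "\<And>p k. v p k \<in> carrier (ob X p)" and x: "\<And>p k. x p k \<in> carrier (ob Y p)"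
      and E': "\<forall>p\<ge>m + 1. b \<le> p \<longrightarrow> (\<forall>k<n p. E v x p k)"
      using Sm unfolding S_def by blast
    have E: "E v x p k" if "m + 1 \<le> p" "k < n p" for p k using E' that True by simp
    \<comment> \<open>\<open>?u\<close> and \<open>?t\<close> are what \<open>v\<close> in degree
      \<open>m - 1\<close> and \<open>x\<close> in degree \<open>m - 2\<close> have to bound once
      the parts chosen earlier are subtracted.\<close>
    let ?u = "\<lambda>k. y m k \<ominus>\<^bsub>ob X m\<^esub> lc (ob X m) (n (m + 1)) (D m k) (v m)"
    let ?t = "\<lambda>k. w (m - 1) k \<oplus>\<^bsub>ob Y (m - 1)\<^esub> lc (ob Y (m - 1)) (n (m + 1)) (D m k) (x (m - 1))"
    have uc: "?u k \<in> carrier (ob X m)" for k using yc v by simp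
    have tc: "?t k \<in> carrier (ob Y (m - 1))" for k using w x by simp
    \<comment> \<open>The equations at \<open>m + 1\<close>, together with the vanishing of the
      squared differential of the free complex, make the pair a cocycle of the cone of
      \<open>s\<close>.\<close>
    have ex: "\<exists>v'\<in>carrier (ob X (m - 1)). \<exists>x'\<in>carrier (ob Y (m - 2)). ?u k = df X (m - 1) v' \<and>
        ?t k = s (m - 1) v' \<oplus>\<^bsub>ob Y (m - 1)\<^esub> df Y (m - 2) x'" if k: "k < n m" for k
    proof (rule quasi_iso_cone_acyclic[OF X Y s uc _ tc])
      have E1: "y (m + 1) l = tbd X v (m + 1) l" if "l < n (m + 1)" for l using E[OF order_refl \<open>l < _\<close>] by (simp add: E_def)
      have E2: "w m l = s m (v m l) \<oplus>\<^bsub>ob Y m\<^esub> (df Y (m - 1) (x (m - 1) l) \<ominus>\<^bsub>ob Y m\<^esub> lc (ob Y m) (n (m + 1 + 1)) (D (m + 1) l) (x m))"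
        if "l < n (m + 1)" for l using E[OF order_refl \<open>l < _\<close>] by (simp add: E_def)
      let ?L = "\<lambda>z. lc (ob X (m + 1)) (n (m + 1)) (D m k) z"
      let ?vv = "\<lambda>l. lc (ob X (m + 1)) (n (m + 1 + 1)) (D (m + 1) l) (v (m + 1))"
      have dv: "df X m (v m l) \<in> carrier (ob X (m + 1))" for l by (rule mod_homD(1)[OF is_complexD(2)[OF X] v])
      have "df X m (?u k) = df X m (y m k) \<ominus>\<^bsub>ob X (m + 1)\<^esub> df X m (lc (ob X m) (n (m + 1)) (D m k) (v m))"
        by (rule mod_hom_diff[OF MX.module_axioms MX.module_axioms is_complexD(2)[OF X]]) (use yc v in simp_all)
      also have "df X m (y m k) = ?L (y (m + 1))" by (rule cocD(2)[OF y True k])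
      also have "\<dots> = ?L (\<lambda>l. df X m (v m l) \<oplus>\<^bsub>ob X (m + 1)\<^esub> ?vv l)"
        by (rule lc_cong) (simp_all add: E1 tensor_bd_def)
      also have "\<dots> = ?L (\<lambda>l. df X m (v m l)) \<oplus>\<^bsub>ob X (m + 1)\<^esub> ?L ?vv"
        by (rule MX.lc_add) (use dv v in simp_all)
      also have "?L ?vv = \<zero>\<^bsub>ob X (m + 1)\<^esub>"
        by (rule free_complex_square[OF F MX.module_axioms _ k v]) (use ab True in simp)
      also have "df X m (lc (ob X m) (n (m + 1)) (D m k) (v m)) = ?L (\<lambda>l. df X m (v m l))"
        by (rule lc_hom[OF MX.module_axioms MX.module_axioms is_complexD(2)[OF X]]) (use v in simp_all)
      finally show "df X m (?u k) = \<zero>\<^bsub>ob X (m + 1)\<^esub>" using dv by (simp add: a_minus_def MX.M.r_neg)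
      let ?K = "\<lambda>z. lc (ob Y m) (n (m + 1)) (D m k) z"
      let ?xx = "\<lambda>l. lc (ob Y m) (n (m + 1 + 1)) (D (m + 1) l) (x m)"
      have sv: "s m (v m l) \<in> carrier (ob Y m)" for l by (rule mod_homD(1)[OF sh v])
      have dx: "df Y (m - 1) (x (m - 1) l) \<in> carrier (ob Y m)" for l by (rule dY[OF x])
      have dw: "df Y (m - 1) (w (m - 1) l) \<in> carrier (ob Y m)" for l by (rule dY[OF w])
      have Kw: "?K (w m) = ?K (\<lambda>l. s m (v m l)) \<oplus>\<^bsub>ob Y m\<^esub> ?K (\<lambda>l. df Y (m - 1) (x (m - 1) l))"
      proof -
        have "?K (w m) = ?K (\<lambda>l. s m (v m l) \<oplus>\<^bsub>ob Y m\<^esub> (df Y (m - 1) (x (m - 1) l) \<ominus>\<^bsub>ob Y m\<^esub> ?xx l))"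
          by (rule lc_cong) (simp_all add: E2)
        also have "\<dots> = ?K (\<lambda>l. s m (v m l)) \<oplus>\<^bsub>ob Y m\<^esub> ?K (\<lambda>l. df Y (m - 1) (x (m - 1) l) \<ominus>\<^bsub>ob Y m\<^esub> ?xx l)"
          by (rule MY.lc_add) (use sv dx x in simp_all)
        also have "?K (\<lambda>l. df Y (m - 1) (x (m - 1) l) \<ominus>\<^bsub>ob Y m\<^esub> ?xx l) = ?K (\<lambda>l. df Y (m - 1) (x (m - 1) l)) \<ominus>\<^bsub>ob Y m\<^esub> ?K ?xx"
          by (rule MY.lc_diff) (use dx x in simp_all)
        also have "?K ?xx = \<zero>\<^bsub>ob Y m\<^esub>"
          by (rule free_complex_square[OF F MY.module_axioms _ k x]) (use ab True in simp)
        finally show ?thesis using dx by (simp add: a_minus_def a_inv_zero[OF MY.M.abelian_group_axioms])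
      qed
      have "s m (?u k) = s m (y m k) \<ominus>\<^bsub>ob Y m\<^esub> s m (lc (ob X m) (n (m + 1)) (D m k) (v m))"
        by (rule mod_hom_diff[OF MX.module_axioms MY.module_axioms sh]) (use yc v in simp_all)
      also have "s m (lc (ob X m) (n (m + 1)) (D m k) (v m)) = ?K (\<lambda>l. s m (v m l))"
        by (rule lc_hom[OF MX.module_axioms MY.module_axioms sh]) (use v in simp_all)
      also have "s m (y m k) = df Y (m - 1) (w (m - 1) k) \<oplus>\<^bsub>ob Y m\<^esub> ?K (w m)"
        using syw[OF True k] by (simp add: tensor_bd_def)
      finally have 1: "s m (?u k) = df Y (m - 1) (w (m - 1) k) \<oplus>\<^bsub>ob Y m\<^esub> ?K (w m) \<ominus>\<^bsub>ob Y m\<^esub> ?K (\<lambda>l. s m (v m l))" .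
      have 2: "df Y (m - 1) (?t k) = df Y (m - 1) (w (m - 1) k) \<oplus>\<^bsub>ob Y m\<^esub> ?K (\<lambda>l. df Y (m - 1) (x (m - 1) l))"
      proof -
        have "df Y (m - 1) (lc (ob Y (m - 1)) (n (m + 1)) (D m k) (x (m - 1))) = ?K (\<lambda>l. df Y (m - 1) (x (m - 1) l))"
          by (rule lc_hom[OF MY.module_axioms MY.module_axioms is_complex_pred(1)[OF Y]]) (use x in simp_all)
        then show ?thesis using mod_homD(2)[OF is_complex_pred(1)[OF Y, of m]] w x by simp
      qed
      have KK: "?K (\<lambda>l. s m (v m l)) \<in> carrier (ob Y m)" "?K (\<lambda>l. df Y (m - 1) (x (m - 1) l)) \<in> carrier (ob Y m)"
        using sv dx by simp_all
      show "s m (?u k) = df Y (m - 1) (?t k)"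
        unfolding 1 2 Kw using KK dw[of k] by (simp add: a_minus_def MY.M.a_ac MY.M.r_neg1 MY.M.r_neg2 MY.M.r_neg)
    qed
    define P where "P k v' x' \<longleftrightarrow> v' \<in> carrier (ob X (m - 1)) \<and> x' \<in> carrier (ob Y (m - 2)) \<and>
      (k < n m \<longrightarrow> ?u k = df X (m - 1) v' \<and> ?t k = s (m - 1) v' \<oplus>\<^bsub>ob Y (m - 1)\<^esub> df Y (m - 2) x')" for k v' x'
    have "\<exists>v' x'. P k v' x'" for k
    proof (cases "k < n m")
      case True
      then show ?thesis unfolding P_def using ex[OF True] by blast
    next
      case False
      then have "P k \<zero>\<^bsub>ob X (m - 1)\<^esub> \<zero>\<^bsub>ob Y (m - 2)\<^esub>" by (simp add: P_def)
      then show ?thesis by blast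
    qed
    then obtain v' x' where P: "\<And>k. P k (v' k) (x' k)" by metis
    have v': "v' k \<in> carrier (ob X (m - 1))" and x': "x' k \<in> carrier (ob Y (m - 2))"
      and u: "k < n m \<Longrightarrow> ?u k = df X (m - 1) (v' k)"
      and t: "k < n m \<Longrightarrow> ?t k = s (m - 1) (v' k) \<oplus>\<^bsub>ob Y (m - 1)\<^esub> df Y (m - 2) (x' k)" for k
      using P[of k] by (simp_all only: P_def)
    \<comment> \<open>The equations at indices above \<open>m\<close> involve neither of the two
      entries that change.\<close>
    let ?v = "v(m - 1 := v')" and ?x = "x(m - 2 := x')"
    have "E ?v ?x p k" if p: "m \<le> p" and k: "k < n p" for p k
    proof (cases "p = m")
      case False
      then have "m + 1 \<le> p" using p by simp
      from E[OF this k] show ?thesis using \<open>m + 1 \<le> p\<close> by (simp add: E_def tensor_bd_def)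
    next
      case p: True
      have L: "lc (ob X m) (n (m + 1)) (D m k) (v m) \<in> carrier (ob X m)" using v by simp
      have K: "lc (ob Y (m - 1)) (n (m + 1)) (D m k) (x (m - 1)) \<in> carrier (ob Y (m - 1))" using x by simp
      have "y m k = ?u k \<oplus>\<^bsub>ob X m\<^esub> lc (ob X m) (n (m + 1)) (D m k) (v m)"
        using yc L by (simp add: a_minus_def MX.M.a_assoc MX.M.l_neg)
      moreover have "w (m - 1) k = ?t k \<ominus>\<^bsub>ob Y (m - 1)\<^esub> lc (ob Y (m - 1)) (n (m + 1)) (D m k) (x (m - 1))"
        using w K by (simp add: a_minus_def MY.M.a_assoc MY.M.r_neg)
      moreover have "s (m - 1) (v' k) \<in> carrier (ob Y (m - 1))" by (rule mod_homD(1)[OF sh v'])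
      ultimately show ?thesis using p k u[of k] t[of k] K dY2[OF x']
        by (simp add: E_def tensor_bd_def a_minus_def MY.M.a_assoc)
    qed
    moreover have "\<forall>p k. ?v p k \<in> carrier (ob X p)" "\<forall>p k. ?x p k \<in> carrier (ob Y p)" using v v' x x' by auto
    ultimately show ?thesis unfolding S_def by (intro exI[of _ ?v] exI[of _ ?x]) simp
  qed
  \<comment> \<open>Beyond \<open>B\<close> both complexes vanish and zero solves the equations. The
    slack covers the index \<open>p - 1\<close>, and the summand with \<open>b\<close> starts the
    descent at or above \<open>b\<close>.\<close>
  have "S (\<bar>B\<bar> + 3 + \<bar>b\<bar>)"
  proof -
    let ?v = "\<lambda>p (k::nat). \<zero>\<^bsub>ob X p\<^esub>" and ?x = "\<lambda>p (k::nat). \<zero>\<^bsub>ob Y p\<^esub>"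
    have "E ?v ?x p k" if p: "\<bar>B\<bar> + 3 + \<bar>b\<bar> \<le> p" for p k
    proof -
      have "\<bar>p\<bar> > B" "\<bar>p - 1\<bar> > B" using p by linarith+
      then have "carrier (ob X p) = {\<zero>\<^bsub>ob X p\<^esub>}" and Y1: "carrier (ob Y (p - 1)) = {\<zero>\<^bsub>ob Y (p - 1)\<^esub>}" using bX bY by auto
      then have "y p k = tbd X ?v p k" using yc[of p k] tbd_zero[OF X, of p k] by simp
      moreover have "s (p - 1) (\<zero>\<^bsub>ob X (p - 1)\<^esub>) \<oplus>\<^bsub>ob Y (p - 1)\<^esub>
        (df Y (p - 2) (\<zero>\<^bsub>ob Y (p - 2)\<^esub>) \<ominus>\<^bsub>ob Y (p - 1)\<^esub> lc (ob Y (p - 1)) (n (p + 1)) (D p k) (?x (p - 1))) \<in> carrier (ob Y (p - 1))"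
        using mod_homD(1)[OF sh MX.M.zero_closed] dY2[OF MY.M.zero_closed] by (intro MY.M.a_closed MY.M.minus_closed MY.lc_closed) simp_all
      ultimately show ?thesis using w[of "p - 1" k] Y1 unfolding E_def by auto
    qed
    then show ?thesis unfolding S_def by (intro exI[of _ ?v] exI[of _ ?x]) simp
  qed
  then have "S b"
  proof (rule int_le_induct[rotated])
    show "b \<le> \<bar>B\<bar> + 3 + \<bar>b\<bar>" by linarith
    show "S (i - 1)" if "S i" for i using step[of "i - 1"] that by simp
  qed
  then show ?thesis unfolding S_def E_def by simp
qed

end

subsection \<open>Action of roofs on tensor cocycles\<close>

lemma bounded_complex_bound:
  assumes "X \<in> bounded_complexes R" "Y \<in> bounded_complexes R"
  shows "\<exists>B. (\<forall>p. \<bar>p\<bar> > B \<longrightarrow> carrier (ob X p) = {\<zero>\<^bsub>ob X p\<^esub>}) \<and> (\<forall>p. \<bar>p\<bar> > B \<longrightarrow> carrier (ob Y p) = {\<zero>\<^bsub>ob Y p\<^esub>})"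
proof -
  obtain B C where B: "\<forall>p. \<bar>p\<bar> > B \<longrightarrow> carrier (ob X p) = {\<zero>\<^bsub>ob X p\<^esub>}"
    and C: "\<forall>p. \<bar>p\<bar> > C \<longrightarrow> carrier (ob Y p) = {\<zero>\<^bsub>ob Y p\<^esub>}"
    using assms by (auto simp: bounded_complexes_def)
  then show ?thesis by (intro exI[of _ "max B C"]) simp
qed

lemma chain_map_comp:
  assumes "f \<in> chain_maps R X Y" "g \<in> chain_maps R Y Z"
  shows "g \<circ>\<circ> f \<in> chain_maps R X Z"
  using assms by (auto simp: chain_maps_def mod_hom_def graded_comp_def Pi_iff)

lemma quasi_iso_chain_map: "s \<in> quasi_isos R X Y \<Longrightarrow> s \<in> chain_maps R X Y"
  by (simp add: quasi_isos_def)

lemma (in abelian_group) add_diff_cancel: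
  "x \<in> carrier G \<Longrightarrow> y \<in> carrier G \<Longrightarrow> x \<oplus> y \<ominus> x = y"
  by (simp add: a_minus_def a_comm[of x y] a_assoc r_neg)

lemma (in abelian_group) diff_add_cancel:
  "x \<in> carrier G \<Longrightarrow> y \<in> carrier G \<Longrightarrow> y \<oplus> (x \<ominus> y) = x"
  by (simp add: a_minus_def a_comm[of x] r_neg2 a_assoc[symmetric] r_neg)

text \<open>Shifting the free complex by one negates its differential. This pays for the sign in a
  shifted complex and in a mapping cone.\<close>

lemma free_complex_from_shift:
  assumes R: "cring R" and F: "free_complex_from R a n D"
  shows "free_complex_from R (a + c) (\<lambda>p. n (p - c)) (\<lambda>p k l. \<ominus>\<^bsub>R\<^esub> D (p - c) k l)"
proof -
  interpret cring R by fact
  have D: "D p k l \<in> carrier R" for p k l using F by (simp add: free_complex_from_def)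
  have "lc (regm R) (n (p + 1)) (\<lambda>l. \<ominus>\<^bsub>R\<^esub> D p k l) (\<lambda>m. \<ominus>\<^bsub>R\<^esub> D (p + 1) m l) = \<zero>\<^bsub>R\<^esub>"
    if p: "a \<le> p" "k < n p" "l < n (p + 1 + 1)" for p k l
  proof -
    have "lc (regm R) (n (p + 1)) (\<lambda>l. \<ominus>\<^bsub>R\<^esub> D p k l) (\<lambda>m. \<ominus>\<^bsub>R\<^esub> D (p + 1) m l) = \<ominus>\<^bsub>R\<^esub> lc (regm R) (n (p + 1)) (D p k) (\<lambda>m. \<ominus>\<^bsub>R\<^esub> D (p + 1) m l)"
      by (rule lcR_minus_left) (use D in auto)
    also have "lc (regm R) (n (p + 1)) (D p k) (\<lambda>m. \<ominus>\<^bsub>R\<^esub> D (p + 1) m l) = \<ominus>\<^bsub>R\<^esub> lc (regm R) (n (p + 1)) (D p k) (\<lambda>m. D (p + 1) m l)"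
      by (rule lcR_minus) (use D in auto)
    also have "lc (regm R) (n (p + 1)) (D p k) (\<lambda>m. D (p + 1) m l) = \<zero>\<^bsub>R\<^esub>"
      using F p by (simp add: free_complex_from_def)
    finally show ?thesis by simp
  qed
  from this[of "_ - c"] show ?thesis using D by (simp add: free_complex_from_def diff_add_eq)
qed

section \<open>Quasi-isomorphisms and roofs on tensor cohomology\<close>

context free_cpx
begin

text \<open>Injectivity of \<open>s\<close> on tensor cohomology: the difference of the two cocycles
  is the first component of a cocycle of the cone, and the cone stays acyclic.\<close>

lemma teq_inj:
  assumes X: "X \<in> bounded_complexes R" and Y: "Y \<in> bounded_complexes R" and s: "s \<in> quasi_isos R X Y"
    and ab: "a \<le> b" and y: "coc b X y" and y': "coc b X y'"
    and e: "teq b Y (\<lambda>p k. s p (y p k)) (\<lambda>p k. s p (y' p k))"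
  shows "teq b X y y'"
proof -
  note X' = bounded_is_complex[OF X] and Y' = bounded_is_complex[OF Y]
  interpret MX: module R "ob X p" for p by (rule is_complexD(1)[OF X'])
  interpret MY: module R "ob Y p" for p by (rule is_complexD(1)[OF Y'])
  obtain B where B: "\<And>p. \<bar>p\<bar> > B \<Longrightarrow> carrier (ob X p) = {\<zero>\<^bsub>ob X p\<^esub>}" "\<And>p. \<bar>p\<bar> > B \<Longrightarrow> carrier (ob Y p) = {\<zero>\<^bsub>ob Y p\<^esub>}"
    using bounded_complex_bound[OF X Y] by blast
  obtain w where w: "\<And>p k. w p k \<in> carrier (ob Y p)"
    "\<And>p k. b \<le> p \<Longrightarrow> k < n p \<Longrightarrow> s p (y p k) = s p (y' p k) \<oplus>\<^bsub>ob Y p\<^esub> tbd Y w p k"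
    using e unfolding tensor_eq_def by blast
  note sh = chain_mapD(1)[OF quasi_iso_chain_map[OF s]]
  let ?y = "\<lambda>p k. y p k \<ominus>\<^bsub>ob X p\<^esub> y' p k"
  have c: "coc b X ?y"
    unfolding tensor_cocycle_def
    using cocD[OF y] cocD[OF y'] mod_hom_diff[OF MX.module_axioms MX.module_axioms is_complexD(2)[OF X']]
    by (simp add: MX.lc_diff)
  have sy: "s p (?y p k) = tbd Y w p k" if "b \<le> p" "k < n p" for p k
  proof -
    have "s p (?y p k) = s p (y p k) \<ominus>\<^bsub>ob Y p\<^esub> s p (y' p k)"
      by (rule mod_hom_diff[OF MX.module_axioms MY.module_axioms sh cocD(1)[OF y] cocD(1)[OF y']])
    then show ?thesis unfolding w(2)[OF that]
      using MY.M.add_diff_cancel[OF mod_homD(1)[OF sh cocD(1)[OF y']] tbd_closed[OF Y' w(1)]] by simp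
  qed
  obtain v where v: "\<forall>p k. v p k \<in> carrier (ob X p)" "\<forall>p\<ge>b. \<forall>k<n p. ?y p k = tbd X v p k"
    using quasi_iso_tensor_acyclic[OF X' Y' s B(1) B(2) ab c w(1) sy] by blast
  show ?thesis
  proof (rule teqI[of v])
    fix p k assume "b \<le> p" "k < n p"
    then have "y p k \<ominus>\<^bsub>ob X p\<^esub> y' p k = tbd X v p k" using v(2) by blast
    then show "y p k = y' p k \<oplus>\<^bsub>ob X p\<^esub> tbd X v p k"
      using MX.M.diff_add_cancel[OF cocD(1)[OF y, of p k] cocD(1)[OF y', of p k]] by simp
  qed (use v in auto)
qed

text \<open>Surjectivity of \<open>s\<close> on tensor cohomology. The pair of zero and
  \<open>x\<close> is a cone cocycle one degree off, so acyclicity is applied to the free complex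
  shifted by one. The first component of the bounding pair is then a cocycle, and the second bounds
  the difference between \<open>x\<close> and its image.\<close>

lemma coc_surj:
  assumes X: "X \<in> bounded_complexes R" and Y: "Y \<in> bounded_complexes R" and s: "s \<in> quasi_isos R X Y"
    and ab: "a \<le> b" and x: "coc b Y x"
  shows "\<exists>v. coc b X v \<and> teq b Y x (\<lambda>p k. s p (v p k))"
proof -
  note X' = bounded_is_complex[OF X] and Y' = bounded_is_complex[OF Y]
  interpret MX: module R "ob X p" for p by (rule is_complexD(1)[OF X'])
  interpret MY: module R "ob Y p" for p by (rule is_complexD(1)[OF Y'])
  obtain B where B: "\<And>p. \<bar>p\<bar> > B \<Longrightarrow> carrier (ob X p) = {\<zero>\<^bsub>ob X p\<^esub>}" "\<And>p. \<bar>p\<bar> > B \<Longrightarrow> carrier (ob Y p) = {\<zero>\<^bsub>ob Y p\<^esub>}"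
    using bounded_complex_bound[OF X Y] by blast
  let ?n = "\<lambda>p. n (p - 1)" and ?D = "\<lambda>p k l. \<ominus> D (p - 1) k l"
  interpret S: free_cpx R "a + 1" ?n ?D
    by (rule free_cpx.intro[OF is_cring free_cpx_axioms.intro[OF free_complex_from_shift[OF is_cring F, of 1]]])
  note sh = chain_mapD(1)[OF quasi_iso_chain_map[OF s]]
  let ?y = "\<lambda>p (k::nat). \<zero>\<^bsub>ob X p\<^esub>"
  have dz: "df X p \<zero>\<^bsub>ob X p\<^esub> = \<zero>\<^bsub>ob X (p + 1)\<^esub>" for p
    by (rule mod_hom_zero[OF MX.module_axioms MX.module_axioms is_complexD(2)[OF X']])
  have c: "S.coc (b + 1) X ?y" unfolding tensor_cocycle_def by (simp add: dz MX.lc_zero)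
  have sy: "s p (?y p k) = S.tbd Y x p k" if p: "b + 1 \<le> p" "k < n (p - 1)" for p k
  proof -
    have "lc (ob Y p) (n p) (?D p k) (x p) = \<ominus>\<^bsub>ob Y p\<^esub> lc (ob Y p) (n p) (D (p - 1) k) (x p)"
      by (rule MY.lc_minus_left) (use cocD(1)[OF x] in simp_all)
    moreover have "df Y (p - 1) (x (p - 1) k) = lc (ob Y p) (n p) (D (p - 1) k) (x p)"
      using cocD(2)[OF x, of "p - 1" k] p by simp
    moreover have "s p \<zero>\<^bsub>ob X p\<^esub> = \<zero>\<^bsub>ob Y p\<^esub>" by (rule mod_hom_zero[OF MX.module_axioms MY.module_axioms sh])
    ultimately show ?thesis using cocD(1)[OF x] by (simp add: tensor_bd_def MY.M.r_neg)
  qed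
  have E: "\<exists>v x'. (\<forall>p k. v p k \<in> carrier (ob X p)) \<and> (\<forall>p k. x' p k \<in> carrier (ob Y p)) \<and>
    (\<forall>p\<ge>b + 1. \<forall>k<n (p - 1). ?y p k = S.tbd X v p k \<and>
      x (p - 1) k = s (p - 1) (v (p - 1) k) \<oplus>\<^bsub>ob Y (p - 1)\<^esub>
        (df Y (p - 2) (x' (p - 2) k) \<ominus>\<^bsub>ob Y (p - 1)\<^esub> lc (ob Y (p - 1)) (n (p + 1 - 1)) (?D p k) (x' (p - 1))))"
  proof (rule S.quasi_iso_tensor_acyclic[OF X' Y' s _ _ _ c cocD(1)[OF x] sy])
    show "carrier (ob X p) = {\<zero>\<^bsub>ob X p\<^esub>}" if "\<bar>p\<bar> > B" for p by (rule B(1)[OF that])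
    show "carrier (ob Y p) = {\<zero>\<^bsub>ob Y p\<^esub>}" if "\<bar>p\<bar> > B" for p by (rule B(2)[OF that])
  qed (use ab in simp)
  obtain v x' where v: "\<And>p k. v p k \<in> carrier (ob X p)" "\<And>p k. x' p k \<in> carrier (ob Y p)"
    and vx: "\<forall>p\<ge>b + 1. \<forall>k<n (p - 1). ?y p k = S.tbd X v p k \<and>
      x (p - 1) k = s (p - 1) (v (p - 1) k) \<oplus>\<^bsub>ob Y (p - 1)\<^esub>
        (df Y (p - 2) (x' (p - 2) k) \<ominus>\<^bsub>ob Y (p - 1)\<^esub> lc (ob Y (p - 1)) (n (p + 1 - 1)) (?D p k) (x' (p - 1)))"
    using E by blast
  have vx1: "\<zero>\<^bsub>ob X (p + 1)\<^esub> = S.tbd X v (p + 1) k" and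
    vx2: "x p k = s p (v p k) \<oplus>\<^bsub>ob Y p\<^esub>
        (df Y (p - 1) (x' (p - 1) k) \<ominus>\<^bsub>ob Y p\<^esub> lc (ob Y p) (n (p + 1)) (\<lambda>l. \<ominus> D p k l) (x' p))"
    if "b \<le> p" "k < n p" for p k
    using vx[THEN spec, of "p + 1"] that by (simp_all add: add.commute)
  have "coc b X v"
    unfolding tensor_cocycle_def
  proof (intro conjI allI impI)
    fix p k assume pk: "b \<le> p" "k < n p"
    let ?L = "lc (ob X (p + 1)) (n (p + 1)) (D p k) (v (p + 1))"
    have "lc (ob X (p + 1)) (n (p + 1)) (\<lambda>l. \<ominus> D p k l) (v (p + 1)) = \<ominus>\<^bsub>ob X (p + 1)\<^esub> ?L"
      by (rule MX.lc_minus_left) (use v in simp_all)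
    then have "df X p (v p k) \<oplus>\<^bsub>ob X (p + 1)\<^esub> \<ominus>\<^bsub>ob X (p + 1)\<^esub> ?L = \<zero>\<^bsub>ob X (p + 1)\<^esub>"
      using vx1[OF pk] by (simp add: tensor_bd_def add.commute)
    moreover have "df X p (v p k) \<in> carrier (ob X (p + 1))" by (rule mod_homD(1)[OF is_complexD(2)[OF X'] v(1)])
    moreover have "?L \<in> carrier (ob X (p + 1))" using v by simp
    ultimately show "df X p (v p k) = ?L" by (metis MX.M.a_inv_closed MX.M.minus_equality MX.M.minus_minus)
  qed (rule v)
  moreover have "teq b Y x (\<lambda>p k. s p (v p k))"
  proof (rule teqI[of x', OF v(2)])
    fix p k assume pk: "b \<le> p" "k < n p"
    have "lc (ob Y p) (n (p + 1)) (\<lambda>l. \<ominus> D p k l) (x' p) = \<ominus>\<^bsub>ob Y p\<^esub> lc (ob Y p) (n (p + 1)) (D p k) (x' p)"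
      by (rule MY.lc_minus_left) (use v in simp_all)
    then show "x p k = s p (v p k) \<oplus>\<^bsub>ob Y p\<^esub> tbd Y x' p k" using vx2[OF pk] v by (simp add: tensor_bd_def a_minus_def)
  qed
  ultimately show ?thesis by blast
qed

text \<open>The effect on classes of \<open>f\<close> after the inverse of \<open>s\<close>. It is a
  relation, because the preimage \<open>y\<close> under \<open>s\<close> is determined only up to
  coboundaries and no quotient is formed.\<close>

definition act :: "int \<Rightarrow> ('a, 'm) cochain \<Rightarrow> ('a, 'm) cochain \<Rightarrow> ('a, 'm) roof \<Rightarrow> (int \<Rightarrow> nat \<Rightarrow> 'm) \<Rightarrow> (int \<Rightarrow> nat \<Rightarrow> 'm) \<Rightarrow> bool" where
  "act b X Y \<rho> z z' \<longleftrightarrow> coc b X z \<and> coc b Y z' \<and>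
    (\<exists>y. coc b (fst \<rho>) y \<and> teq b X z (\<lambda>p k. fst (snd \<rho>) p (y p k)) \<and> teq b Y z' (\<lambda>p k. snd (snd \<rho>) p (y p k)))"

lemma roofsD:
  assumes "(Z, s, f) \<in> roofs R X Y"
  shows "Z \<in> bounded_complexes R" "s \<in> quasi_isos R Z X" "f \<in> chain_maps R Z Y"
  using assms by (auto simp: roofs_def)

lemma act_total:
  assumes X: "X \<in> bounded_complexes R" and Y: "is_complex R Y" and r: "(Z, s, f) \<in> roofs R X Y"
    and ab: "a \<le> b" and z: "coc b X z"
  shows "\<exists>z'. act b X Y (Z, s, f) z z'"
proof -
  note r = roofsD[OF r]
  obtain y where y: "coc b Z y" "teq b X z (\<lambda>p k. s p (y p k))" using coc_surj[OF r(1) X r(2) ab z] by blast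
  have c: "coc b Y (\<lambda>p k. f p (y p k))" by (rule coc_map[OF bounded_is_complex[OF r(1)] Y r(3) y(1)])
  show ?thesis unfolding act_def using y z c teq_refl[OF Y cocD(1)[OF c]]
    by (intro exI[of _ "\<lambda>p k. f p (y p k)"] conjI exI[of _ y]) simp_all
qed

text \<open>A lift of \<open>z\<close> to the common refinement \<open>W\<close> of the two roofs
  compares both images. With equal roofs this is single valuedness, with equal inputs it is
  independence of the representative.\<close>

lemma act_unique:
  assumes X: "X \<in> bounded_complexes R" and Y: "is_complex R Y" and rel: "(\<rho>, \<rho>') \<in> roof_rel R X Y"
    and ab: "a \<le> b" and z: "act b X Y \<rho> z v" and z': "act b X Y \<rho>' z' v'" and e: "teq b X z z'"
  shows "teq b Y v v'"
proof -
  obtain Z s f Z' s' f' where \<rho>: "\<rho> = (Z, s, f)" "\<rho>' = (Z', s', f')" by (cases \<rho>, cases \<rho>')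
  have R: "(Z, s, f) \<in> roofs R X Y" "(Z', s', f') \<in> roofs R X Y" using rel \<rho> by (auto simp: roof_rel_def)
  obtain W u u' where W: "W \<in> bounded_complexes R" and u: "u \<in> chain_maps R W Z" and u': "u' \<in> chain_maps R W Z'"
    and su: "s \<circ>\<circ> u \<in> quasi_isos R W X" and h1: "homotopic R W X (s \<circ>\<circ> u) (s' \<circ>\<circ> u')"
    and h2: "homotopic R W Y (f \<circ>\<circ> u) (f' \<circ>\<circ> u')"
    using rel \<rho> by (auto simp: roof_rel_def)
  note r = roofsD[OF R(1)] and r' = roofsD[OF R(2)]
  note sc = quasi_iso_chain_map[OF r(2)] and sc' = quasi_iso_chain_map[OF r'(2)]
  note cX = bounded_is_complex[OF X] and cZ = bounded_is_complex[OF r(1)] and cZ' = bounded_is_complex[OF r'(1)]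
    and cW = bounded_is_complex[OF W]
  obtain y where y: "coc b Z y" "teq b X z (\<lambda>p k. s p (y p k))" "teq b Y v (\<lambda>p k. f p (y p k))"
    and zc: "coc b X z" "coc b Y v" using z \<rho> by (auto simp: act_def)
  obtain y' where y': "coc b Z' y'" "teq b X z' (\<lambda>p k. s' p (y' p k))" "teq b Y v' (\<lambda>p k. f' p (y' p k))"
    and zc': "coc b X z'" "coc b Y v'" using z' \<rho> by (auto simp: act_def)
  obtain x where x: "coc b W x" "teq b X z (\<lambda>p k. (s \<circ>\<circ> u) p (x p k))"
    using coc_surj[OF W X su ab zc(1)] by blast
  let ?ux = "\<lambda>p k. u p (x p k)" and ?ux' = "\<lambda>p k. u' p (x p k)"
  have ux: "coc b Z ?ux" and ux': "coc b Z' ?ux'" using coc_map[OF cW cZ u x(1)] coc_map[OF cW cZ' u' x(1)] by auto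
  have sux: "teq b X z (\<lambda>p k. s p (?ux p k))" using x(2) by (simp add: graded_comp_def)
  have c1: "s p (?ux p k) \<in> carrier (ob X p)" "s p (y p k) \<in> carrier (ob X p)"
    "s' p (?ux' p k) \<in> carrier (ob X p)" "s' p (y' p k) \<in> carrier (ob X p)" for p k
    using cocD(1)[OF coc_map[OF cZ cX sc ux]] cocD(1)[OF coc_map[OF cZ cX sc y(1)]]
      cocD(1)[OF coc_map[OF cZ' cX sc' ux']] cocD(1)[OF coc_map[OF cZ' cX sc' y'(1)]] by auto
  have c2: "f p (?ux p k) \<in> carrier (ob Y p)" "f p (y p k) \<in> carrier (ob Y p)"
    "f' p (?ux' p k) \<in> carrier (ob Y p)" "f' p (y' p k) \<in> carrier (ob Y p)" for p k
    using cocD(1)[OF coc_map[OF cZ Y r(3) ux]] cocD(1)[OF coc_map[OF cZ Y r(3) y(1)]]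
      cocD(1)[OF coc_map[OF cZ' Y r'(3) ux']] cocD(1)[OF coc_map[OF cZ' Y r'(3) y'(1)]] by auto
  have "teq b X (\<lambda>p k. s p (y p k)) (\<lambda>p k. s p (?ux p k))"
    by (rule teq_trans[OF cX teq_sym[OF cX y(2)] sux]) (use c1 in auto)
  then have "teq b Z y ?ux" by (rule teq_inj[OF r(1) X r(2) ab y(1) ux])
  then have "teq b Y (\<lambda>p k. f p (y p k)) (\<lambda>p k. f p (?ux p k))" by (rule teq_map[OF cZ Y r(3) _ cocD(1)[OF ux]])
  then have 1: "teq b Y v (\<lambda>p k. f p (?ux p k))" by (rule teq_trans[OF Y y(3)]) (use c2 in auto)
  have "teq b Y (\<lambda>p k. (f \<circ>\<circ> u) p (x p k)) (\<lambda>p k. (f' \<circ>\<circ> u') p (x p k))"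
    by (rule homotopic_teq[OF cW Y chain_map_comp[OF u r(3)] chain_map_comp[OF u' r'(3)] h2 x(1)])
  then have "teq b Y (\<lambda>p k. f p (?ux p k)) (\<lambda>p k. f' p (?ux' p k))" by (simp add: graded_comp_def)
  then have 2: "teq b Y v (\<lambda>p k. f' p (?ux' p k))" by (rule teq_trans[OF Y 1]) (use c2 in auto)
  have "teq b X (\<lambda>p k. (s \<circ>\<circ> u) p (x p k)) (\<lambda>p k. (s' \<circ>\<circ> u') p (x p k))"
    by (rule homotopic_teq[OF cW cX chain_map_comp[OF u sc] chain_map_comp[OF u' sc'] h1 x(1)])
  then have "teq b X (\<lambda>p k. s p (?ux p k)) (\<lambda>p k. s' p (?ux' p k))" by (simp add: graded_comp_def)
  then have "teq b X z (\<lambda>p k. s' p (?ux' p k))" by (rule teq_trans[OF cX sux]) (use c1 in auto)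
  then have "teq b X (\<lambda>p k. s' p (?ux' p k)) z" by (rule teq_sym[OF cX]) (use c1 in auto)
  then have "teq b X (\<lambda>p k. s' p (?ux' p k)) z'" by (rule teq_trans[OF cX _ e]) (rule cocD(1)[OF zc'(1)])
  then have "teq b X (\<lambda>p k. s' p (?ux' p k)) (\<lambda>p k. s' p (y' p k))"
    by (rule teq_trans[OF cX _ y'(2)]) (use c1 in auto)
  then have "teq b Z' ?ux' y'" by (rule teq_inj[OF r'(1) X r'(2) ab ux' y'(1)])
  then have "teq b Y (\<lambda>p k. f' p (?ux' p k)) (\<lambda>p k. f' p (y' p k))" by (rule teq_map[OF cZ' Y r'(3) _ cocD(1)[OF y'(1)]])
  then have 3: "teq b Y v (\<lambda>p k. f' p (y' p k))" by (rule teq_trans[OF Y 2]) (use c2 in auto)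
  have "teq b Y (\<lambda>p k. f' p (y' p k)) v'" by (rule teq_sym[OF Y y'(3)]) (use c2 in auto)
  then show ?thesis by (rule teq_trans[OF Y 3]) (rule cocD(1)[OF zc'(2)])
qed

lemma act_smult:
  assumes X: "is_complex R X" and Y: "is_complex R Y" and \<rho>: "(Z, s, f) \<in> roofs R X Y"
    and r: "r \<in> carrier R" and z: "act b X Y (Z, s, f) z v"
  shows "act b X Y (Z, s, f) (\<lambda>p k. r \<odot>\<^bsub>ob X p\<^esub> z p k) (\<lambda>p k. r \<odot>\<^bsub>ob Y p\<^esub> v p k)"
proof -
  note ro = roofsD[OF \<rho>]
  note cZ = bounded_is_complex[OF ro(1)] and sc = quasi_iso_chain_map[OF ro(2)]
  obtain y where y: "coc b Z y" "teq b X z (\<lambda>p k. s p (y p k))" "teq b Y v (\<lambda>p k. f p (y p k))"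
    and zc: "coc b X z" "coc b Y v" using z by (auto simp: act_def)
  have "teq b X (\<lambda>p k. r \<odot>\<^bsub>ob X p\<^esub> z p k) (\<lambda>p k. r \<odot>\<^bsub>ob X p\<^esub> s p (y p k))"
    by (rule teq_smult[OF X y(2) r cocD(1)[OF coc_map[OF cZ X sc y(1)]]])
  moreover have "teq b Y (\<lambda>p k. r \<odot>\<^bsub>ob Y p\<^esub> v p k) (\<lambda>p k. r \<odot>\<^bsub>ob Y p\<^esub> f p (y p k))"
    by (rule teq_smult[OF Y y(3) r cocD(1)[OF coc_map[OF cZ Y ro(3) y(1)]]])
  ultimately show ?thesis unfolding act_def
    using coc_smult[OF X zc(1) r] coc_smult[OF Y zc(2) r] coc_smult[OF cZ y(1) r]
      mod_homD(3)[OF chain_mapD(1)[OF sc] r cocD(1)[OF y(1)]] mod_homD(3)[OF chain_mapD(1)[OF ro(3)] r cocD(1)[OF y(1)]]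
    by (intro conjI exI[of _ "\<lambda>p k. r \<odot>\<^bsub>ob Z p\<^esub> y p k"]) simp_all
qed

lemma act_mono: "act b X Y \<rho> z v \<Longrightarrow> b \<le> b' \<Longrightarrow> act b' X Y \<rho> z v"
  unfolding act_def using coc_mono teq_mono by meson

end

lemma roof_rel_refl:
  assumes X: "is_complex R X" and Y: "is_complex R Y" and r: "\<rho> \<in> roofs R X Y"
  shows "(\<rho>, \<rho>) \<in> roof_rel R X Y"
proof -
  obtain Z s f where \<rho>: "\<rho> = (Z, s, f)" by (cases \<rho>)
  have r': "Z \<in> bounded_complexes R" "s \<in> quasi_isos R Z X" "f \<in> chain_maps R Z Y" using r \<rho> by (auto simp: roofs_def)
  have h: "homotopic R Z V g g" if V: "is_complex R V" and g: "g \<in> chain_maps R Z V" for V g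
  proof -
    interpret V: module R "ob V p" for p by (rule is_complexD(1)[OF V])
    have d: "df V (p - 1) \<zero>\<^bsub>ob V (p - 1)\<^esub> = \<zero>\<^bsub>ob V p\<^esub>" for p
      by (rule mod_hom_zero[OF V.module_axioms V.module_axioms is_complex_pred(1)[OF V]])
    show ?thesis unfolding homotopic_def
      using mod_homD(1)[OF chain_mapD(1)[OF g]] d
      by (intro exI[of _ "\<lambda>p x. \<zero>\<^bsub>ob V (p - 1)\<^esub>"]) (simp add: mod_hom_def a_minus_def V.M.r_neg)
  qed
  have id: "(\<lambda>n x. x) \<in> chain_maps R Z Z" by (auto simp: chain_maps_def mod_hom_def)
  have "s \<circ>\<circ> (\<lambda>n x. x) = s" "f \<circ>\<circ> (\<lambda>n x. x) = f" by (simp_all add: graded_comp_def o_def)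
  then show ?thesis
    using r r' id h[OF X quasi_iso_chain_map[OF r'(2)]] h[OF Y r'(3)]
    unfolding \<rho> roof_rel_def by (auto intro!: bexI[of _ Z] bexI[of _ "\<lambda>n x. x"])
qed

abbreviation derived_hom :: "('a, 'r) ring_scheme \<Rightarrow> ('a, 'm) cochain \<Rightarrow> ('a, 'm) cochain \<Rightarrow> ('a, 'm) roof set set" where
  "derived_hom R X Y \<equiv> roofs R X Y // roof_rel R X Y"

lemma derived_homE:
  assumes "F \<in> derived_hom R X Y"
  obtains \<rho> where "\<rho> \<in> roofs R X Y" "F = roof_class R X Y \<rho>"
  using assms by (auto simp: quotient_def roof_class_def)

lemma roof_class_iff: "\<tau> \<in> roof_class R X Y \<rho> \<longleftrightarrow> (\<rho>, \<tau>) \<in> roof_rel R X Y"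
  by (simp add: roof_class_def)

lemma derived_hom_sub: "F \<in> derived_hom R X Y \<Longrightarrow> \<tau> \<in> F \<Longrightarrow> \<tau> \<in> roofs R X Y"
  by (auto simp: quotient_def roof_rel_def)

lemma derived_map_roof:
  assumes A: "A \<in> bounded_complexes R" and f: "f \<in> chain_maps R A B"
  shows "(A, \<lambda>n x. x, f) \<in> roofs R A B"
  using assms id_quasi_iso[OF bounded_is_complex[OF A]] by (simp add: roofs_def)

lemma derived_map_mem:
  assumes A: "A \<in> bounded_complexes R" and B: "is_complex R B" and f: "f \<in> chain_maps R A B"
  shows "(A, \<lambda>n x. x, f) \<in> derived_map R A B f" "derived_map R A B f \<in> derived_hom R A B"
  using roof_rel_refl[OF bounded_is_complex[OF A] B derived_map_roof[OF A f]] derived_map_roof[OF A f]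
  by (auto simp: derived_map_def roof_class_def quotient_def)

text \<open>\<open>derived_comp\<close> is a union of classes, so an equation between composites
  yields information only once some member is known. When the second factor is a chain map, the
  roofs complete trivially with \<open>W = Z\<close>.\<close>

lemma derived_comp_map_nonempty:
  assumes X: "X \<in> bounded_complexes R" and A: "A \<in> bounded_complexes R" and B: "is_complex R B"
    and u: "u \<in> chain_maps R A B" and F: "F \<in> derived_hom R X A"
  shows "\<exists>\<tau>\<in>roofs R X B. \<tau> \<in> derived_comp R X A B (derived_map R A B u) F"
proof -
  obtain Z s f where r: "(Z, s, f) \<in> roofs R X A" "F = roof_class R X A (Z, s, f)" using derived_homE[OF F] by (metis prod_cases3)
  have m: "(Z, s, f) \<in> F" using r roof_rel_refl[OF bounded_is_complex[OF X] bounded_is_complex[OF A] r(1)] by (simp add: roof_class_iff)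
  have Z: "Z \<in> bounded_complexes R" "s \<in> quasi_isos R Z X" "f \<in> chain_maps R Z A" using r(1) by (auto simp: roofs_def)
  let ?i = "\<lambda>(n::int) x. x"
  have e: "s \<circ>\<circ> ?i = s" "f \<circ>\<circ> ?i = f" "?i \<circ>\<circ> f = f" by (simp_all add: graded_comp_def o_def)
  have h: "homotopic R Z A f f"
  proof -
    interpret V: module R "ob A p" for p by (rule is_complexD(1)[OF bounded_is_complex[OF A]])
    have d: "df A (p - 1) \<zero>\<^bsub>ob A (p - 1)\<^esub> = \<zero>\<^bsub>ob A p\<^esub>" for p
      by (rule mod_hom_zero[OF V.module_axioms V.module_axioms is_complex_pred(1)[OF bounded_is_complex[OF A]]])
    show ?thesis unfolding homotopic_def
      using mod_homD(1)[OF chain_mapD(1)[OF Z(3)]] d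
      by (intro exI[of _ "\<lambda>p x. \<zero>\<^bsub>ob A (p - 1)\<^esub>"]) (simp add: mod_hom_def a_minus_def V.M.r_neg)
  qed
  have ro: "(Z, s, u \<circ>\<circ> f) \<in> roofs R X B" using Z chain_map_comp[OF Z(3) u] by (simp add: roofs_def)
  have "(Z, s, u \<circ>\<circ> f) \<in> roof_class R X B (Z, s \<circ>\<circ> ?i, u \<circ>\<circ> f)"
    using roof_rel_refl[OF bounded_is_complex[OF X] B ro] by (simp add: roof_class_iff e)
  moreover have "roof_class R X B (Z, s \<circ>\<circ> ?i, u \<circ>\<circ> f) \<subseteq> derived_comp R X A B (derived_map R A B u) F"
    unfolding derived_comp_def
    using m derived_map_mem(1)[OF A B u] Z(1,3) id_quasi_iso[OF bounded_is_complex[OF Z(1)]] h e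
    by (intro Union_upper CollectI exI[of _ Z] exI[of _ ?i] exI[of _ f] exI[of _ s] exI[of _ A] exI[of _ u] conjI) simp_all
  ultimately show ?thesis using ro by blast
qed

section \<open>Morphisms of the derived category as relations on cocycles\<close>

context free_cpx
begin

definition Act :: "int \<Rightarrow> ('a, 'm) cochain \<Rightarrow> ('a, 'm) cochain \<Rightarrow> ('a, 'm) roof set \<Rightarrow> (int \<Rightarrow> nat \<Rightarrow> 'm) \<Rightarrow> (int \<Rightarrow> nat \<Rightarrow> 'm) \<Rightarrow> bool" where
  "Act b X Y F z v \<longleftrightarrow> (\<exists>\<tau>\<in>F. act b X Y \<tau> z v)"

lemma Act_coc: "Act b X Y F z v \<Longrightarrow> coc b X z" "Act b X Y F z v \<Longrightarrow> coc b Y v"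
  by (auto simp: Act_def act_def)

lemma Act_mono: "Act b X Y F z v \<Longrightarrow> b \<le> b' \<Longrightarrow> Act b' X Y F z v"
  by (auto simp: Act_def intro: act_mono)

lemma Act_total:
  assumes X: "X \<in> bounded_complexes R" and Y: "is_complex R Y" and F: "F \<in> derived_hom R X Y"
    and ab: "a \<le> b" and z: "coc b X z"
  shows "\<exists>v. Act b X Y F z v"
proof -
  obtain \<rho> where \<rho>: "\<rho> \<in> roofs R X Y" "F = roof_class R X Y \<rho>" by (rule derived_homE[OF F])
  obtain Z s f where r: "\<rho> = (Z, s, f)" by (cases \<rho>)
  obtain v where v: "act b X Y \<rho> z v" using act_total[OF X Y \<rho>(1)[unfolded r] ab z] r by blast
  moreover have "\<rho> \<in> F" unfolding \<rho>(2) roof_class_iff by (rule roof_rel_refl[OF bounded_is_complex[OF X] Y \<rho>(1)])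
  ultimately show ?thesis unfolding Act_def by blast
qed

lemma Act_unique:
  assumes X: "X \<in> bounded_complexes R" and Y: "is_complex R Y" and F: "F \<in> derived_hom R X Y"
    and ab: "a \<le> b" and z: "Act b X Y F z v" and z': "Act b X Y F z' v'" and e: "teq b X z z'"
  shows "teq b Y v v'"
proof -
  obtain \<rho> where \<rho>: "\<rho> \<in> roofs R X Y" "F = roof_class R X Y \<rho>" by (rule derived_homE[OF F])
  obtain Z s f where r: "\<rho> = (Z, s, f)" by (cases \<rho>)
  obtain \<tau> \<tau>' where \<tau>: "\<tau> \<in> F" "act b X Y \<tau> z v" "\<tau>' \<in> F" "act b X Y \<tau>' z' v'" using z z' by (auto simp: Act_def)
  have rel: "(\<rho>, \<tau>) \<in> roof_rel R X Y" "(\<rho>, \<tau>') \<in> roof_rel R X Y" using \<tau> \<rho>(2) by (auto simp: roof_class_iff)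
  obtain v0 where v0: "act b X Y \<rho> z v0" using act_total[OF X Y \<rho>(1)[unfolded r] ab Act_coc(1)[OF z]] r by blast
  have "teq b Y v0 v" by (rule act_unique[OF X Y rel(1) ab v0 \<tau>(2) teq_refl[OF bounded_is_complex[OF X] cocD(1)[OF Act_coc(1)[OF z]]]])
  then have "teq b Y v v0" by (rule teq_sym[OF Y _ cocD(1)[OF Act_coc(2)[OF z]]])
  then show ?thesis
    by (rule teq_trans[OF Y _ act_unique[OF X Y rel(2) ab v0 \<tau>(4) e] cocD(1)[OF Act_coc(2)[OF z']]])
qed

lemma Act_smult:
  assumes X: "X \<in> bounded_complexes R" and Y: "is_complex R Y" and F: "F \<in> derived_hom R X Y"
    and r: "r \<in> carrier R" and z: "Act b X Y F z v"
  shows "Act b X Y F (\<lambda>p k. r \<odot>\<^bsub>ob X p\<^esub> z p k) (\<lambda>p k. r \<odot>\<^bsub>ob Y p\<^esub> v p k)"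
proof -
  obtain \<tau> where \<tau>: "\<tau> \<in> F" "act b X Y \<tau> z v" using z by (auto simp: Act_def)
  obtain Z s f where r': "\<tau> = (Z, s, f)" by (cases \<tau>)
  have "act b X Y \<tau> (\<lambda>p k. r \<odot>\<^bsub>ob X p\<^esub> z p k) (\<lambda>p k. r \<odot>\<^bsub>ob Y p\<^esub> v p k)"
    unfolding r' by (rule act_smult[OF bounded_is_complex[OF X] Y]) (use derived_hom_sub[OF F \<tau>(1)] \<tau>(2) r r' in auto)
  then show ?thesis using \<tau>(1) by (auto simp: Act_def)
qed

lemma coc_zero:
  assumes X: "is_complex R X" shows "coc b X (\<lambda>p k. \<zero>\<^bsub>ob X p\<^esub>)"
proof -
  interpret X: module R "ob X p" for p by (rule is_complexD(1)[OF X])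
  show ?thesis unfolding tensor_cocycle_def
    using mod_hom_zero[OF X.module_axioms X.module_axioms is_complexD(2)[OF X]] by (simp add: X.lc_zero)
qed

text \<open>The image of \<open>0\<close> is obtained from \<open>0 = 0 \<cdot> 0\<close> and linearity.\<close>

lemma Act_null:
  assumes X: "X \<in> bounded_complexes R" and Y: "is_complex R Y" and F: "F \<in> derived_hom R X Y"
    and ab: "a \<le> b" and z: "Act b X Y F z v" and e: "teq b X z (\<lambda>p k. \<zero>\<^bsub>ob X p\<^esub>)"
  shows "teq b Y v (\<lambda>p k. \<zero>\<^bsub>ob Y p\<^esub>)"
proof -
  note X' = bounded_is_complex[OF X]
  interpret MX: module R "ob X p" for p by (rule is_complexD(1)[OF X'])
  interpret MY: module R "ob Y p" for p by (rule is_complexD(1)[OF Y])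
  have "Act b X Y F (\<lambda>p k. \<zero> \<odot>\<^bsub>ob X p\<^esub> z p k) (\<lambda>p k. \<zero> \<odot>\<^bsub>ob Y p\<^esub> v p k)"
    by (rule Act_smult[OF X Y F zero_closed z])
  then have "Act b X Y F (\<lambda>p k. \<zero>\<^bsub>ob X p\<^esub>) (\<lambda>p k. \<zero>\<^bsub>ob Y p\<^esub>)"
    using cocD(1)[OF Act_coc(1)[OF z]] cocD(1)[OF Act_coc(2)[OF z]] by simp
  then show ?thesis by (rule Act_unique[OF X Y F ab z _ e])
qed

text \<open>The completion \<open>W\<close> serves both factors: a lift of \<open>z\<close> to
  \<open>W\<close> maps to cocycles in \<open>Z\<close> and \<open>Z'\<close> whose images in
  \<open>Y\<close> are cohomologous, since the square over \<open>Y\<close> commutes up to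
  homotopy.\<close>

lemma Act_comp:
  assumes X: "X \<in> bounded_complexes R" and Y: "Y \<in> bounded_complexes R" and V: "is_complex R V"
    and F: "F \<in> derived_hom R X Y" and G: "G \<in> derived_hom R Y V" and \<tau>: "\<tau> \<in> derived_comp R X Y V G F"
    and ab: "a \<le> b" and z: "act b X V \<tau> z v" and zy: "Act b X Y F z y" and yv: "Act b Y V G y v'"
  shows "teq b V v v'"
proof -
  note X' = bounded_is_complex[OF X] and Y' = bounded_is_complex[OF Y]
  obtain W u g' Z s f Z' t g where m: "(Z, s, f) \<in> F" "(Z', t, g) \<in> G" and W: "W \<in> bounded_complexes R"
    and u: "u \<in> quasi_isos R W Z" and g': "g' \<in> chain_maps R W Z'" and h: "homotopic R W Y (f \<circ>\<circ> u) (t \<circ>\<circ> g')"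
    and \<tau>': "\<tau> \<in> roof_class R X V (W, s \<circ>\<circ> u, g \<circ>\<circ> g')"
    using \<tau> unfolding derived_comp_def by blast
  have rel: "((W, s \<circ>\<circ> u, g \<circ>\<circ> g'), \<tau>) \<in> roof_rel R X V" using \<tau>' by (simp add: roof_class_iff)
  then have ro: "(W, s \<circ>\<circ> u, g \<circ>\<circ> g') \<in> roofs R X V" by (auto simp: roof_rel_def)
  note rw = roofsD[OF ro]
  note rF = roofsD[OF derived_hom_sub[OF F m(1)]] and rG = roofsD[OF derived_hom_sub[OF G m(2)]]
  note cW = bounded_is_complex[OF W] and cZ = bounded_is_complex[OF rF(1)] and cZ' = bounded_is_complex[OF rG(1)]
  note uc = quasi_iso_chain_map[OF u]
  have zc: "coc b X z" using z by (simp add: act_def)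
  obtain x where x: "coc b W x" "teq b X z (\<lambda>p k. (s \<circ>\<circ> u) p (x p k))"
    using coc_surj[OF W X rw(2) ab zc] by blast
  let ?ux = "\<lambda>p k. u p (x p k)" and ?gx = "\<lambda>p k. g' p (x p k)"
  have ux: "coc b Z ?ux" and gx: "coc b Z' ?gx" using coc_map[OF cW cZ uc x(1)] coc_map[OF cW cZ' g' x(1)] by auto
  have fc: "coc b Y (\<lambda>p k. f p (?ux p k))" by (rule coc_map[OF cZ Y' rF(3) ux])
  have tc: "coc b Y (\<lambda>p k. t p (?gx p k))" by (rule coc_map[OF cZ' Y' quasi_iso_chain_map[OF rG(2)] gx])
  have gc: "coc b V (\<lambda>p k. g p (?gx p k))" by (rule coc_map[OF cZ' V rG(3) gx])
  have "act b X V (W, s \<circ>\<circ> u, g \<circ>\<circ> g') z (\<lambda>p k. g p (?gx p k))"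
    unfolding act_def using zc gc x teq_refl[OF V cocD(1)[OF gc]] by (intro conjI exI[of _ x]) (simp_all add: graded_comp_def)
  then have "teq b V (\<lambda>p k. g p (?gx p k)) v"
    by (rule act_unique[OF X V rel ab _ z teq_refl[OF X' cocD(1)[OF zc]]])
  then have 1: "teq b V v (\<lambda>p k. g p (?gx p k))"
    by (rule teq_sym[OF V]) (use z in \<open>simp add: act_def tensor_cocycle_def\<close>)
  have "act b X Y (Z, s, f) z (\<lambda>p k. f p (?ux p k))"
    unfolding act_def using zc fc x(2) ux teq_refl[OF Y' cocD(1)[OF fc]] by (intro conjI exI[of _ ?ux]) (simp_all add: graded_comp_def)
  then have "Act b X Y F z (\<lambda>p k. f p (?ux p k))" using m(1) by (auto simp: Act_def)
  then have e1: "teq b Y (\<lambda>p k. f p (?ux p k)) y"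
    by (rule Act_unique[OF X Y' F ab _ zy teq_refl[OF X' cocD(1)[OF zc]]])
  have e2: "teq b Y (\<lambda>p k. f p (?ux p k)) (\<lambda>p k. t p (?gx p k))"
    using homotopic_teq[OF cW Y' chain_map_comp[OF uc rF(3)] chain_map_comp[OF g' quasi_iso_chain_map[OF rG(2)]] h x(1)]
    by (simp add: graded_comp_def)
  have "act b Y V (Z', t, g) (\<lambda>p k. f p (?ux p k)) (\<lambda>p k. g p (?gx p k))"
    unfolding act_def using fc gc gx e2 teq_refl[OF V cocD(1)[OF gc]] by (intro conjI exI[of _ ?gx]) simp_all
  then have "Act b Y V G (\<lambda>p k. f p (?ux p k)) (\<lambda>p k. g p (?gx p k))" using m(2) by (auto simp: Act_def)
  then have "teq b V (\<lambda>p k. g p (?gx p k)) v'" by (rule Act_unique[OF Y V G ab _ yv e1])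
  then show ?thesis by (rule teq_trans[OF V 1 _ cocD(1)[OF Act_coc(2)[OF yv]]])
qed

lemma act_derived_map:
  assumes X: "X \<in> bounded_complexes R" and Y: "is_complex R Y" and f: "f \<in> chain_maps R X Y" and z: "coc b X z"
  shows "act b X Y (X, \<lambda>n x. x, f) z (\<lambda>p k. f p (z p k))"
proof -
  have c: "coc b Y (\<lambda>p k. f p (z p k))" by (rule coc_map[OF bounded_is_complex[OF X] Y f z])
  show ?thesis unfolding act_def
    using z c teq_refl[OF Y cocD(1)[OF c]] teq_refl[OF bounded_is_complex[OF X] cocD(1)[OF z]] by auto
qed

lemma Act_derived_map:
  assumes X: "X \<in> bounded_complexes R" and Y: "is_complex R Y" and f: "f \<in> chain_maps R X Y" and z: "coc b X z"
  shows "Act b X Y (derived_map R X Y f) z (\<lambda>p k. f p (z p k))"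
  using act_derived_map[OF assms] derived_map_mem(1)[OF X Y f] by (auto simp: Act_def)

lemma id_chain_map: "(\<lambda>n x. x) \<in> chain_maps R X X" by (auto simp: chain_maps_def mod_hom_def)

text \<open>The identity roof is a member of the composite, so \<open>Act_comp\<close> compares
  \<open>z\<close> itself with \<open>v\<close>.\<close>

lemma Act_retract:
  assumes X: "X \<in> bounded_complexes R" and Y: "Y \<in> bounded_complexes R"
    and F: "F \<in> derived_hom R X Y" and G: "G \<in> derived_hom R Y X"
    and id: "derived_comp R X Y X G F = derived_map R X X (\<lambda>n x. x)"
    and ab: "a \<le> b" and zy: "Act b X Y F z y" and yv: "Act b Y X G y v"
  shows "teq b X z v"
proof -
  note X' = bounded_is_complex[OF X]
  have "(X, \<lambda>n x. x, \<lambda>n x. x) \<in> derived_comp R X Y X G F"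
    unfolding id by (rule derived_map_mem(1)[OF X X' id_chain_map])
  then show ?thesis
    by (rule Act_comp[OF X Y X' F G _ ab act_derived_map[OF X X' id_chain_map Act_coc(1)[OF zy]] zy yv])
qed

text \<open>A roof in the common composite computes both ways around the square, and
  \<open>derived_comp_map_nonempty\<close> supplies one.\<close>

lemma Act_square:
  assumes X: "X \<in> bounded_complexes R" and Y: "Y \<in> bounded_complexes R" and A: "A \<in> bounded_complexes R"
    and B: "is_complex R B" and u: "u \<in> chain_maps R A B"
    and al: "al \<in> derived_hom R X A" and F: "F \<in> derived_hom R X Y" and be: "be \<in> derived_hom R Y B"
    and sq: "derived_comp R X Y B be F = derived_comp R X A B (derived_map R A B u) al"
    and ab: "a \<le> b" and 1: "Act b X Y F z y" "Act b Y B be y v" and 2: "Act b X A al z w"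
  shows "teq b B v (\<lambda>p k. u p (w p k))"
proof -
  obtain \<tau> where \<tau>: "\<tau> \<in> roofs R X B" "\<tau> \<in> derived_comp R X A B (derived_map R A B u) al"
    using derived_comp_map_nonempty[OF X A B u al] by blast
  obtain Z s f where r: "\<tau> = (Z, s, f)" by (cases \<tau>)
  obtain v0 where v0: "act b X B \<tau> z v0" using act_total[OF X B \<tau>(1)[unfolded r] ab Act_coc(1)[OF 2]] r by blast
  have "teq b B v0 v" by (rule Act_comp[OF X Y B F be _ ab v0 1]) (use \<tau>(2) sq in simp)
  then have "teq b B v v0" by (rule teq_sym[OF B _ cocD(1)[OF Act_coc(2)[OF 1(2)]]])
  moreover have "teq b B v0 (\<lambda>p k. u p (w p k))"
    by (rule Act_comp[OF X A B al derived_map_mem(2)[OF A B u] \<tau>(2) ab v0 2 Act_derived_map[OF A B u Act_coc(2)[OF 2]]])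
  ultimately show ?thesis
    by (rule teq_trans[OF B]) (rule cocD(1)[OF coc_map[OF bounded_is_complex[OF A] B u Act_coc(2)[OF 2]]])
qed

end

subsection \<open>Exactness along mapping cones\<close>

lemma dsum_simps [simp]:
  "Pr x y \<in> carrier (dsum_module M N) \<longleftrightarrow> x \<in> carrier M \<and> y \<in> carrier N"
  "\<zero>\<^bsub>dsum_module M N\<^esub> = Pr \<zero>\<^bsub>M\<^esub> \<zero>\<^bsub>N\<^esub>"
  "Pr x y \<oplus>\<^bsub>dsum_module M N\<^esub> Pr x' y' = Pr (x \<oplus>\<^bsub>M\<^esub> x') (y \<oplus>\<^bsub>N\<^esub> y')"
  "r \<odot>\<^bsub>dsum_module M N\<^esub> Pr x y = Pr (r \<odot>\<^bsub>M\<^esub> x) (r \<odot>\<^bsub>N\<^esub> y)"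
  by (auto simp: dsum_module_def)

lemma dsum_carrierE:
  assumes "p \<in> carrier (dsum_module M N)"
  obtains x y where "p = Pr x y" "x \<in> carrier M" "y \<in> carrier N"
  using assms by (auto simp: dsum_module_def)

lemma dsum_carrier_iff: "p \<in> carrier (dsum_module M N) \<longleftrightarrow> (\<exists>x\<in>carrier M. \<exists>y\<in>carrier N. p = Pr x y)"
  by (auto simp: dsum_module_def)

lemma dsum_module:
  assumes M: "module R M" and N: "module R N" shows "module R (dsum_module M N)"
proof -
  interpret M: module R M by fact
  interpret N: module R N by fact
  show ?thesis
  proof (rule moduleI)
    show "abelian_group (dsum_module M N)"
    proof (rule abelian_groupI)
      fix x assume "x \<in> carrier (dsum_module M N)"
      then obtain a b where ab: "x = Pr a b" "a \<in> carrier M" "b \<in> carrier N" by (rule dsum_carrierE)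
      then show "\<exists>y\<in>carrier (dsum_module M N). y \<oplus>\<^bsub>dsum_module M N\<^esub> x = \<zero>\<^bsub>dsum_module M N\<^esub>"
        by (intro bexI[of _ "Pr (\<ominus>\<^bsub>M\<^esub> a) (\<ominus>\<^bsub>N\<^esub> b)"]) (simp_all add: M.M.l_neg N.M.l_neg)
    qed (auto simp: dsum_carrier_iff M.M.a_ac N.M.a_ac)
  qed (auto simp: dsum_carrier_iff M.smult_l_distr N.smult_l_distr M.smult_r_distr N.smult_r_distr
      M.smult_assoc1 N.smult_assoc1 M.R.is_cring)
qed

lemma lc_dsum: "lc (dsum_module M N) n c (\<lambda>l. Pr (x l) (y l)) = Pr (lc M n c x) (lc N n c y)"
  by (induction n) simp_all

lemma cone_simps [simp]:
  "ob (cone X Y f) p = dsum_module (ob X (p + 1)) (ob Y p)"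
  "df (cone X Y f) p (Pr x y) = Pr (\<ominus>\<^bsub>ob X (p + 1 + 1)\<^esub> df X (p + 1) x) (f (p + 1) x \<oplus>\<^bsub>ob Y (p + 1)\<^esub> df Y p y)"
  by (simp_all add: cone_def)

lemma cone_is_complex:
  assumes A: "is_complex R A" and B: "is_complex R B" and u: "u \<in> chain_maps R A B"
  shows "is_complex R (cone A B u)"
proof -
  interpret MA: module R "ob A p" for p by (rule is_complexD(1)[OF A])
  interpret MB: module R "ob B p" for p by (rule is_complexD(1)[OF B])
  note dA = mod_homD[OF is_complexD(2)[OF A]] and dB = mod_homD[OF is_complexD(2)[OF B]]
    and um = mod_homD[OF chain_mapD(1)[OF u]]
  have dA2: "df A (p + 1) x \<in> carrier (ob A (2 + p))" if "x \<in> carrier (ob A (p + 1))" for x p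
    using dA(1)[OF that] by (simp add: add.commute)
  have "df (cone A B u) p \<in> mod_hom R (ob (cone A B u) p) (ob (cone A B u) (p + 1))" for p
    unfolding mod_hom_def
    by (auto simp: dsum_carrier_iff dA dA2 dB um MA.M.minus_add MB.M.a_ac MA.smult_r_minus MB.smult_r_distr simp del: dsum_simps(1))
  moreover have "df (cone A B u) (p + 1) (df (cone A B u) p x) = \<zero>\<^bsub>ob (cone A B u) (p + 1 + 1)\<^esub>"
    if x: "x \<in> carrier (ob (cone A B u) p)" for p x
  proof -
    obtain y z where yz: "x = Pr y z" "y \<in> carrier (ob A (p + 1))" "z \<in> carrier (ob B p)"
      using x by (auto simp: dsum_carrier_iff)
    have e1: "df A (p + 1 + 1) (\<ominus>\<^bsub>ob A (p + 1 + 1)\<^esub> df A (p + 1) y) = \<ominus>\<^bsub>ob A (p + 1 + 1 + 1)\<^esub> \<zero>\<^bsub>ob A (p + 1 + 1 + 1)\<^esub>"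
      using mod_hom_minus[OF MA.module_axioms MA.module_axioms is_complexD(2)[OF A] dA(1)[OF yz(2)]]
        is_complexD(3)[OF A yz(2)] by simp
    have e2: "u (p + 1 + 1) (\<ominus>\<^bsub>ob A (p + 1 + 1)\<^esub> df A (p + 1) y) = \<ominus>\<^bsub>ob B (p + 1 + 1)\<^esub> df B (p + 1) (u (p + 1) y)"
      using mod_hom_minus[OF MA.module_axioms MB.module_axioms chain_mapD(1)[OF u] dA(1)[OF yz(2)]]
        chain_mapD(2)[OF u yz(2)] by simp
    have e3: "df B (p + 1) (u (p + 1) y \<oplus>\<^bsub>ob B (p + 1)\<^esub> df B p z) = df B (p + 1) (u (p + 1) y)"
      using dB(2)[OF um(1)[OF yz(2)] dB(1)[OF yz(3)]] is_complexD(3)[OF B yz(3)] dB(1)[OF um(1)[OF yz(2)]] by simp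
    show ?thesis
      unfolding yz(1) cone_simps e1 e2 e3 using dB(1)[OF um(1)[OF yz(2)]]
      by (simp add: MB.M.l_neg a_inv_zero[OF MA.M.abelian_group_axioms])
  qed
  ultimately show ?thesis
    unfolding is_complex_def using dsum_module[OF MA.module_axioms MB.module_axioms] by simp
qed

lemma cone_in_chain_map:
  assumes A: "is_complex R A" and B: "is_complex R B" and u: "u \<in> chain_maps R A B"
  shows "cone_in A \<in> chain_maps R B (cone A B u)"
proof -
  interpret MA: module R "ob A p" for p by (rule is_complexD(1)[OF A])
  interpret MB: module R "ob B p" for p by (rule is_complexD(1)[OF B])
  note dB = mod_homD[OF is_complexD(2)[OF B]]
  have "df A (p + 1) \<zero>\<^bsub>ob A (p + 1)\<^esub> = \<zero>\<^bsub>ob A (p + 1 + 1)\<^esub>" "u (p + 1) \<zero>\<^bsub>ob A (p + 1)\<^esub> = \<zero>\<^bsub>ob B (p + 1)\<^esub>" for p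
    using mod_hom_zero[OF MA.module_axioms MA.module_axioms is_complexD(2)[OF A]]
      mod_hom_zero[OF MA.module_axioms MB.module_axioms chain_mapD(1)[OF u]] by auto
  then show ?thesis
    unfolding chain_maps_def mod_hom_def cone_in_def
    by (auto simp: dB(1) a_inv_zero[OF MA.M.abelian_group_axioms])
qed

context free_cpx
begin

text \<open>A cochain that bounds the image of \<open>m\<close> in the cone has two components: its
  part in \<open>A\<close> is the cocycle \<open>w\<close>, and its part in \<open>B\<close> bounds
  the difference of \<open>m\<close> and the image of \<open>w\<close> under
  \<open>u\<close>.\<close>

lemma cone_tensor_exact:
  assumes A: "is_complex R A" and B: "is_complex R B" and u: "u \<in> chain_maps R A B"
    and m: "coc b B m" and e: "teq b (cone A B u) (\<lambda>p k. cone_in A p (m p k)) (\<lambda>p k. \<zero>\<^bsub>ob (cone A B u) p\<^esub>)"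
  shows "\<exists>w. coc b A w \<and> teq b B m (\<lambda>p k. u p (w p k))"
proof -
  interpret MA: module R "ob A p" for p by (rule is_complexD(1)[OF A])
  interpret MB: module R "ob B p" for p by (rule is_complexD(1)[OF B])
  obtain W where W: "\<And>p k. W p k \<in> carrier (ob (cone A B u) p)"
    "\<And>p k. b \<le> p \<Longrightarrow> k < n p \<Longrightarrow> cone_in A p (m p k) = \<zero>\<^bsub>ob (cone A B u) p\<^esub> \<oplus>\<^bsub>ob (cone A B u) p\<^esub> tbd (cone A B u) W p k"
    using e unfolding tensor_eq_def by blast
  define x y where "x p k = pfst (W p k)" and "y p k = psnd (W p k)" for p k
  have xy: "W p k = Pr (x p k) (y p k)" "x p k \<in> carrier (ob A (p + 1))" "y p k \<in> carrier (ob B p)" for p k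
    using W(1)[of p k] by (auto simp: x_def y_def dsum_carrier_iff)
  have Wf: "W p = (\<lambda>l. Pr (x p l) (y p l))" for p using xy(1) by blast
  have dx: "df A p (x (p - 1) k) \<in> carrier (ob A (p + 1))" for p k
    using mod_homD(1)[OF is_complexD(2)[OF A], of "x (p - 1) k" p] xy(2)[of "p - 1" k] by simp
  have ux: "u p (x (p - 1) k) \<in> carrier (ob B p)" for p k
    using mod_homD(1)[OF chain_mapD(1)[OF u], of "x (p - 1) k" p] xy(2)[of "p - 1" k] by simp
  have dy: "df B (p - 1) (y (p - 1) k) \<in> carrier (ob B p)" for p k
    by (rule mod_homD(1)[OF is_complex_pred(1)[OF B] xy(3)])
  have key: "\<zero>\<^bsub>ob A (p + 1)\<^esub> = \<ominus>\<^bsub>ob A (p + 1)\<^esub> df A p (x (p - 1) k) \<oplus>\<^bsub>ob A (p + 1)\<^esub> lc (ob A (p + 1)) (n (p + 1)) (D p k) (x p)"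
    "m p k = (u p (x (p - 1) k) \<oplus>\<^bsub>ob B p\<^esub> df B (p - 1) (y (p - 1) k)) \<oplus>\<^bsub>ob B p\<^esub> lc (ob B p) (n (p + 1)) (D p k) (y p)"
    if pk: "b \<le> p" "k < n p" for p k
  proof -
    have "tbd (cone A B u) W p k = Pr (\<ominus>\<^bsub>ob A (p + 1)\<^esub> df A p (x (p - 1) k) \<oplus>\<^bsub>ob A (p + 1)\<^esub> lc (ob A (p + 1)) (n (p + 1)) (D p k) (x p))
      ((u p (x (p - 1) k) \<oplus>\<^bsub>ob B p\<^esub> df B (p - 1) (y (p - 1) k)) \<oplus>\<^bsub>ob B p\<^esub> lc (ob B p) (n (p + 1)) (D p k) (y p))"
      unfolding tensor_bd_def Wf by (simp add: lc_dsum)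
    then show "\<zero>\<^bsub>ob A (p + 1)\<^esub> = \<ominus>\<^bsub>ob A (p + 1)\<^esub> df A p (x (p - 1) k) \<oplus>\<^bsub>ob A (p + 1)\<^esub> lc (ob A (p + 1)) (n (p + 1)) (D p k) (x p)"
      "m p k = (u p (x (p - 1) k) \<oplus>\<^bsub>ob B p\<^esub> df B (p - 1) (y (p - 1) k)) \<oplus>\<^bsub>ob B p\<^esub> lc (ob B p) (n (p + 1)) (D p k) (y p)"
      using W(2)[OF pk] dx ux dy xy by (simp_all add: cone_in_def)
  qed
  \<comment> \<open>Degree \<open>p\<close> of the cone contains degree \<open>p + 1\<close> of
    \<open>A\<close>, hence the shift.\<close>
  let ?w = "\<lambda>p. x (p - 1)"
  have wc: "?w p k \<in> carrier (ob A p)" for p k using xy(2)[of "p - 1" k] by simp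
  have "coc b A ?w"
    unfolding tensor_cocycle_def
  proof (intro conjI allI impI wc)
    fix p k assume pk: "b \<le> p" "k < n p"
    let ?L = "lc (ob A (p + 1)) (n (p + 1)) (D p k) (x p)"
    have L: "?L \<in> carrier (ob A (p + 1))" using xy(2) by simp
    have "df A p (x (p - 1) k) = df A p (x (p - 1) k) \<oplus>\<^bsub>ob A (p + 1)\<^esub> (\<ominus>\<^bsub>ob A (p + 1)\<^esub> df A p (x (p - 1) k) \<oplus>\<^bsub>ob A (p + 1)\<^esub> ?L)"
      unfolding key(1)[OF pk, symmetric] using dx by simp
    then show "df A p (?w p k) = lc (ob A (p + 1)) (n (p + 1)) (D p k) (?w (p + 1))"
      using dx L MA.M.r_neg2[of "df A p (x (p - 1) k)" "p + 1" ?L] by simp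
  qed
  moreover have "teq b B m (\<lambda>p k. u p (?w p k))"
    by (rule teqI[of y, OF xy(3)]) (use key(2) ux dy xy(3) in \<open>simp add: tensor_bd_def MB.M.a_assoc\<close>)
  ultimately show ?thesis by blast
qed

end

subsection \<open>A ghost lemma for generation in the derived category\<close>

text \<open>Exactness starts at index \<open>a + 1\<close>; the homology at \<open>a\<close> is the
  resolved module.\<close>

definition free_resolution_from :: "('a, 'r) ring_scheme \<Rightarrow> int \<Rightarrow> (int \<Rightarrow> nat) \<Rightarrow> (int \<Rightarrow> nat \<Rightarrow> nat \<Rightarrow> 'a) \<Rightarrow> bool" where
  "free_resolution_from R a n D \<longleftrightarrow> free_complex_from R a n D \<and>
     (\<forall>p\<ge>a. \<forall>z. (\<forall>l. z l \<in> carrier R) \<longrightarrow> (\<forall>k<n p. lc (regm R) (n (p + 1)) (D p k) z = \<zero>\<^bsub>R\<^esub>) \<longrightarrow>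
       (\<exists>w. (\<forall>l. w l \<in> carrier R) \<and> (\<forall>l<n (p + 1). z l = lc (regm R) (n (p + 1 + 1)) (D (p + 1) l) w)))"

text \<open>The truncations \<open>F\<^sub>\<ge>\<^sub>i \<rightarrow> F\<^sub>\<ge>\<^sub>j\<close> of free resolutions induce the zero map on the cohomology of the
  tensor product with \<open>X\<close>, locally at \<open>q\<close>.\<close>

definition ghost :: "('a, 'r) ring_scheme \<Rightarrow> 'a set \<Rightarrow> nat \<Rightarrow> nat \<Rightarrow> ('a, 'm) cochain \<Rightarrow> bool" where
  "ghost R q i j X \<longleftrightarrow> (\<forall>a n D z. free_resolution_from R a n D \<longrightarrow> tensor_cocycle n D (a + int i) X z \<longrightarrow>
     (\<exists>s\<in>carrier R - q. tensor_eq n D (a + int j) X (\<lambda>p k. s \<odot>\<^bsub>ob X p\<^esub> z p k) (\<lambda>p k. \<zero>\<^bsub>ob X p\<^esub>)))"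

lemma free_resolution_from_shift:
  assumes R: "cring R" and F: "free_resolution_from R a n D"
  shows "free_resolution_from R (a + c) (\<lambda>p. n (p - c)) (\<lambda>p k l. \<ominus>\<^bsub>R\<^esub> D (p - c) k l)"
proof -
  interpret cring R by fact
  have fc: "free_complex_from R a n D" using F by (simp add: free_resolution_from_def)
  then have D: "D p k l \<in> carrier R" for p k l by (simp add: free_complex_from_def)
  have "\<exists>w. (\<forall>l. w l \<in> carrier R) \<and> (\<forall>l<n (p + 1). z l = lc (regm R) (n (p + 1 + 1)) (\<lambda>m. \<ominus>\<^bsub>R\<^esub> D (p + 1) l m) w)"
    if p: "a \<le> p" and z: "\<forall>l. z l \<in> carrier R"
      and cyc: "\<forall>k<n p. lc (regm R) (n (p + 1)) (\<lambda>l. \<ominus>\<^bsub>R\<^esub> D p k l) z = \<zero>\<^bsub>R\<^esub>" for p and z :: "nat \<Rightarrow> 'a"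
  proof -
    have "lc (regm R) (n (p + 1)) (D p k) z = \<zero>\<^bsub>R\<^esub>" if k: "k < n p" for k
    proof -
      have "\<ominus>\<^bsub>R\<^esub> lc (regm R) (n (p + 1)) (D p k) z = \<zero>\<^bsub>R\<^esub>"
        using cyc k lcR_minus_left[of "D p k" z "n (p + 1)"] D z by simp
      then show ?thesis using D z by (metis lc_regm_closed minus_minus minus_zero)
    qed
    then obtain w where w: "\<forall>l. w l \<in> carrier R" "\<forall>l<n (p + 1). z l = lc (regm R) (n (p + 1 + 1)) (D (p + 1) l) w"
      using F p z unfolding free_resolution_from_def by blast
    have "lc (regm R) (n (p + 1 + 1)) (\<lambda>m. \<ominus>\<^bsub>R\<^esub> D (p + 1) l m) (\<lambda>l. \<ominus>\<^bsub>R\<^esub> w l) = lc (regm R) (n (p + 1 + 1)) (D (p + 1) l) w" for l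
    proof -
      have "lc (regm R) (n (p + 1 + 1)) (\<lambda>m. \<ominus>\<^bsub>R\<^esub> D (p + 1) l m) (\<lambda>l. \<ominus>\<^bsub>R\<^esub> w l) = \<ominus>\<^bsub>R\<^esub> lc (regm R) (n (p + 1 + 1)) (D (p + 1) l) (\<lambda>l. \<ominus>\<^bsub>R\<^esub> w l)"
        by (rule lcR_minus_left) (use D w in auto)
      also have "lc (regm R) (n (p + 1 + 1)) (D (p + 1) l) (\<lambda>l. \<ominus>\<^bsub>R\<^esub> w l) = \<ominus>\<^bsub>R\<^esub> lc (regm R) (n (p + 1 + 1)) (D (p + 1) l) w"
        by (rule lcR_minus) (use D w in auto)
      finally show ?thesis using D w by simp
    qed
    then show ?thesis using w by (intro exI[of _ "\<lambda>l. \<ominus>\<^bsub>R\<^esub> w l"]) simp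
  qed
  from this[of "_ - c"] have "\<forall>p\<ge>a + c. \<forall>z. (\<forall>l. z l \<in> carrier R) \<longrightarrow>
      (\<forall>k<n (p - c). lc (regm R) (n (p + 1 - c)) (\<lambda>l. \<ominus>\<^bsub>R\<^esub> D (p - c) k l) z = \<zero>\<^bsub>R\<^esub>) \<longrightarrow>
      (\<exists>w. (\<forall>l. w l \<in> carrier R) \<and> (\<forall>l<n (p + 1 - c). z l = lc (regm R) (n (p + 1 + 1 - c)) (\<lambda>m. \<ominus>\<^bsub>R\<^esub> D (p + 1 - c) l m) w))"
    by (simp add: diff_add_eq)
  then show ?thesis using free_complex_from_shift[OF R fc, of c] unfolding free_resolution_from_def by blast
qed

context cring
begin

lemma free_cpxI: "free_resolution_from R a n D \<Longrightarrow> free_cpx R a n D"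
  by (rule free_cpx.intro[OF is_cring free_cpx_axioms.intro]) (simp add: free_resolution_from_def)

text \<open>A class on \<open>Y\<close> passes through \<open>X\<close>, where it is killed, and
  comes back unchanged. This covers isomorphic objects as well as direct summands.\<close>

lemma ghost_retract:
  assumes X: "X \<in> bounded_complexes R" and Y: "Y \<in> bounded_complexes R" and ij: "i \<le> j"
    and FF: "F \<in> derived_hom R Y X" and GG: "G \<in> derived_hom R X Y"
    and id: "derived_comp R Y X Y G F = derived_map R Y Y (\<lambda>n x. x)"
    and gX: "ghost R q i j X"
  shows "ghost R q i j Y"
  unfolding ghost_def
proof (intro allI impI)
  fix a n D z assume res: "free_resolution_from R a n D" and z: "tensor_cocycle n D (a + int i) Y z"
  interpret free_cpx R a n D by (rule free_cpxI[OF res])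
  note X' = bounded_is_complex[OF X] and Y' = bounded_is_complex[OF Y]
  have le: "a \<le> a + int i" "a \<le> a + int j" "a + int i \<le> a + int j" using ij by simp_all
  obtain x where x: "Act (a + int i) Y X F z x" using Act_total[OF Y X' FF le(1) z] by blast
  obtain z2 where z2: "Act (a + int i) X Y G x z2" using Act_total[OF X Y' GG le(1) Act_coc(2)[OF x]] by blast
  have e: "teq (a + int i) Y z z2" by (rule Act_retract[OF Y X FF GG id le(1) x z2])
  obtain s where s: "s \<in> carrier R - q" "teq (a + int j) X (\<lambda>p k. s \<odot>\<^bsub>ob X p\<^esub> x p k) (\<lambda>p k. \<zero>\<^bsub>ob X p\<^esub>)"
    using gX res Act_coc(2)[OF x] unfolding ghost_def by blast
  have sR: "s \<in> carrier R" using s by blast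
  have "teq (a + int j) Y (\<lambda>p k. s \<odot>\<^bsub>ob Y p\<^esub> z2 p k) (\<lambda>p k. \<zero>\<^bsub>ob Y p\<^esub>)"
    by (rule Act_null[OF X Y' GG le(2) Act_smult[OF X Y' GG sR Act_mono[OF z2 le(3)]] s(2)])
  moreover have "teq (a + int j) Y (\<lambda>p k. s \<odot>\<^bsub>ob Y p\<^esub> z p k) (\<lambda>p k. s \<odot>\<^bsub>ob Y p\<^esub> z2 p k)"
    by (rule teq_smult[OF Y' teq_mono[OF e le(3)] sR cocD(1)[OF Act_coc(2)[OF z2]]])
  ultimately have "teq (a + int j) Y (\<lambda>p k. s \<odot>\<^bsub>ob Y p\<^esub> z p k) (\<lambda>p k. \<zero>\<^bsub>ob Y p\<^esub>)"
    using teq_trans[OF Y'] cocD(1)[OF coc_zero[OF Y']] by blast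
  then show "\<exists>s\<in>carrier R - q. teq (a + int j) Y (\<lambda>p k. s \<odot>\<^bsub>ob Y p\<^esub> z p k) (\<lambda>p k. \<zero>\<^bsub>ob Y p\<^esub>)"
    using s(1) by blast
qed

text \<open>The identity is also the zero morphism, so it sends a cocycle both to itself and to
  zero.\<close>

lemma ghost_zero_object:
  assumes q: "primeideal q R" and X: "X \<in> bounded_complexes R" and ij: "i \<le> j"
    and id: "derived_map R X X (\<lambda>n x. x) = derived_map R X X (\<lambda>n x. \<zero>\<^bsub>ob X n\<^esub>)"
  shows "ghost R q i j X"
  unfolding ghost_def
proof (intro allI impI)
  fix a n D z assume res: "free_resolution_from R a n D" and z: "tensor_cocycle n D (a + int i) X z"
  interpret free_cpx R a n D by (rule free_cpxI[OF res])
  note X' = bounded_is_complex[OF X]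
  interpret M: module R "ob X p" for p by (rule is_complexD(1)[OF X'])
  have le: "a \<le> a + int i" "a + int i \<le> a + int j" using ij by simp_all
  have "df X p \<zero>\<^bsub>ob X p\<^esub> = \<zero>\<^bsub>ob X (p + 1)\<^esub>" for p
    by (rule mod_hom_zero[OF M.module_axioms M.module_axioms is_complexD(2)[OF X']])
  then have zc: "(\<lambda>n x. \<zero>\<^bsub>ob X n\<^esub>) \<in> chain_maps R X X" by (auto simp: chain_maps_def mod_hom_def)
  have a1: "Act (a + int i) X X (derived_map R X X (\<lambda>n x. x)) z (\<lambda>p k. z p k)" by (rule Act_derived_map[OF X X' id_chain_map z])
  have a2: "Act (a + int i) X X (derived_map R X X (\<lambda>n x. x)) z (\<lambda>p k. \<zero>\<^bsub>ob X p\<^esub>)"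
    unfolding id by (rule Act_derived_map[OF X X' zc z])
  have "teq (a + int i) X z (\<lambda>p k. \<zero>\<^bsub>ob X p\<^esub>)"
    by (rule Act_unique[OF X X' derived_map_mem(2)[OF X X' id_chain_map] le(1) a1 a2 teq_refl[OF X' cocD(1)[OF z]]])
  then have "teq (a + int j) X (\<lambda>p k. \<one> \<odot>\<^bsub>ob X p\<^esub> z p k) (\<lambda>p k. \<zero>\<^bsub>ob X p\<^esub>)"
    using teq_mono[OF _ le(2)] cocD(1)[OF z] by simp
  then show "\<exists>s\<in>carrier R - q. teq (a + int j) X (\<lambda>p k. s \<odot>\<^bsub>ob X p\<^esub> z p k) (\<lambda>p k. \<zero>\<^bsub>ob X p\<^esub>)"
    using primeideal_one_compl[OF q] by blast
qed

text \<open>The identity of \<open>Z\<close> is the sum of the composites through \<open>X\<close>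
  and through \<open>Y\<close>. Each summand is killed by its own multiplier, and the product of the
  two kills the sum.\<close>

lemma ghost_sum:
  assumes q: "primeideal q R" and X: "X \<in> bounded_complexes R" and Y: "Y \<in> bounded_complexes R"
    and Z: "Z \<in> bounded_complexes R" and ij: "i \<le> j"
    and I: "I \<in> derived_hom R X Z" and J: "J \<in> derived_hom R Y Z" and P: "P \<in> derived_hom R Z X" and Q: "Q \<in> derived_hom R Z Y"
    and sum: "derived_add R Z Z (derived_comp R Z X Z I P) (derived_comp R Z Y Z J Q) = derived_map R Z Z (\<lambda>n x. x)"
    and gX: "ghost R q i j X" and gY: "ghost R q i j Y"
  shows "ghost R q i j Z"
  unfolding ghost_def
proof (intro allI impI)
  fix a n D z assume res: "free_resolution_from R a n D" and z: "tensor_cocycle n D (a + int i) Z z"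
  interpret free_cpx R a n D by (rule free_cpxI[OF res])
  note X' = bounded_is_complex[OF X] and Y' = bounded_is_complex[OF Y] and Z' = bounded_is_complex[OF Z]
  interpret M: module R "ob Z p" for p by (rule is_complexD(1)[OF Z'])
  let ?i = "a + int i" and ?j = "a + int j"
  have le: "a \<le> ?i" "a \<le> ?j" "?i \<le> ?j" using ij by simp_all
  let ?\<tau> = "(Z, \<lambda>n x. x, \<lambda>n x. x)"
  have "?\<tau> \<in> derived_add R Z Z (derived_comp R Z X Z I P) (derived_comp R Z Y Z J Q)"
    unfolding sum by (rule derived_map_mem(1)[OF Z Z' id_chain_map])
  \<comment> \<open>Sums of morphisms are formed on roofs with common \<open>W\<close> and
    \<open>s\<close>, so both composites act through one lift of \<open>z\<close>.\<close>
  then obtain W s f g where fg: "(W, s, f) \<in> derived_comp R Z X Z I P" "(W, s, g) \<in> derived_comp R Z Y Z J Q"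
    and rel: "((W, s, \<lambda>n x. f n x \<oplus>\<^bsub>ob Z n\<^esub> g n x), ?\<tau>) \<in> roof_rel R Z Z"
    unfolding derived_add_def roof_class_def by blast
  have comp_roof: "\<tau> \<in> roofs R Z Z" if "\<tau> \<in> derived_comp R Z V Z G F" for V G F \<tau>
    using that unfolding derived_comp_def roof_class_def by (auto simp: roof_rel_def)
  note rf = roofsD[OF comp_roof[OF fg(1)]] and rg = roofsD[OF comp_roof[OF fg(2)]]
  have "(W, s, \<lambda>n x. f n x \<oplus>\<^bsub>ob Z n\<^esub> g n x) \<in> roofs R Z Z" using rel by (auto simp: roof_rel_def)
  note rs = roofsD[OF this]
  note W' = bounded_is_complex[OF rf(1)]
  obtain x where x: "coc ?i W x" "teq ?i Z z (\<lambda>p k. s p (x p k))" using coc_surj[OF rf(1) Z rf(2) le(1) z] by blast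
  let ?f = "\<lambda>p k. f p (x p k)" and ?g = "\<lambda>p k. g p (x p k)"
  have fc: "coc ?i Z ?f" and gc: "coc ?i Z ?g" using coc_map[OF W' Z' rf(3) x(1)] coc_map[OF W' Z' rg(3) x(1)] by auto
  have sc: "coc ?i Z (\<lambda>p k. ?f p k \<oplus>\<^bsub>ob Z p\<^esub> ?g p k)" using coc_map[OF W' Z' rs(3) x(1)] by simp
  have "act ?i Z Z (W, s, \<lambda>n x. f n x \<oplus>\<^bsub>ob Z n\<^esub> g n x) z (\<lambda>p k. ?f p k \<oplus>\<^bsub>ob Z p\<^esub> ?g p k)"
    unfolding act_def using z sc x teq_refl[OF Z' cocD(1)[OF sc]] by auto
  then have "teq ?i Z (\<lambda>p k. ?f p k \<oplus>\<^bsub>ob Z p\<^esub> ?g p k) z"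
    using act_unique[OF Z Z' rel le(1) _ act_derived_map[OF Z Z' id_chain_map z] teq_refl[OF Z' cocD(1)[OF z]]] by blast
  then have zfg: "teq ?i Z z (\<lambda>p k. ?f p k \<oplus>\<^bsub>ob Z p\<^esub> ?g p k)" by (rule teq_sym[OF Z' _ cocD(1)[OF z]])
  have af: "act ?i Z Z (W, s, f) z ?f" unfolding act_def using z fc x teq_refl[OF Z' cocD(1)[OF fc]] by auto
  have ag: "act ?i Z Z (W, s, g) z ?g" unfolding act_def using z gc x teq_refl[OF Z' cocD(1)[OF gc]] by auto
  have kill: "\<exists>s\<in>carrier R - q. teq ?j Z (\<lambda>p k. s \<odot>\<^bsub>ob Z p\<^esub> h p k) (\<lambda>p k. \<zero>\<^bsub>ob Z p\<^esub>)"
    if V: "V \<in> bounded_complexes R" and FP: "F \<in> derived_hom R Z V" and G: "G \<in> derived_hom R V Z"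
      and \<tau>: "\<tau> \<in> derived_comp R Z V Z G F" and h: "act ?i Z Z \<tau> z h" and gV: "ghost R q i j V" for V F G \<tau> h
  proof -
    note V' = bounded_is_complex[OF V]
    obtain y where y: "Act ?i Z V F z y" using Act_total[OF Z V' FP le(1) z] by blast
    obtain v where v: "Act ?i V Z G y v" using Act_total[OF V Z' G le(1) Act_coc(2)[OF y]] by blast
    have e: "teq ?i Z h v" by (rule Act_comp[OF Z V Z' FP G \<tau> le(1) h y v])
    obtain s where s: "s \<in> carrier R - q" "teq ?j V (\<lambda>p k. s \<odot>\<^bsub>ob V p\<^esub> y p k) (\<lambda>p k. \<zero>\<^bsub>ob V p\<^esub>)"
      using gV res Act_coc(2)[OF y] unfolding ghost_def by blast
    have sR: "s \<in> carrier R" using s by blast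
    have "teq ?j Z (\<lambda>p k. s \<odot>\<^bsub>ob Z p\<^esub> v p k) (\<lambda>p k. \<zero>\<^bsub>ob Z p\<^esub>)"
      by (rule Act_null[OF V Z' G le(2) Act_smult[OF V Z' G sR Act_mono[OF v le(3)]] s(2)])
    moreover have "teq ?j Z (\<lambda>p k. s \<odot>\<^bsub>ob Z p\<^esub> h p k) (\<lambda>p k. s \<odot>\<^bsub>ob Z p\<^esub> v p k)"
      by (rule teq_smult[OF Z' teq_mono[OF e le(3)] sR cocD(1)[OF Act_coc(2)[OF v]]])
    ultimately have "teq ?j Z (\<lambda>p k. s \<odot>\<^bsub>ob Z p\<^esub> h p k) (\<lambda>p k. \<zero>\<^bsub>ob Z p\<^esub>)"
      using teq_trans[OF Z'] cocD(1)[OF coc_zero[OF Z']] by blast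
    then show ?thesis using s(1) by blast
  qed
  obtain s1 where s1: "s1 \<in> carrier R - q" "teq ?j Z (\<lambda>p k. s1 \<odot>\<^bsub>ob Z p\<^esub> ?f p k) (\<lambda>p k. \<zero>\<^bsub>ob Z p\<^esub>)"
    using kill[OF X P I fg(1) af gX] by blast
  obtain s2 where s2: "s2 \<in> carrier R - q" "teq ?j Z (\<lambda>p k. s2 \<odot>\<^bsub>ob Z p\<^esub> ?g p k) (\<lambda>p k. \<zero>\<^bsub>ob Z p\<^esub>)"
    using kill[OF Y Q J fg(2) ag gY] by blast
  have sR: "s1 \<in> carrier R" "s2 \<in> carrier R" using s1 s2 by auto
  note zc = cocD(1)[OF coc_zero[OF Z']]
  have k1: "teq ?j Z (\<lambda>p k. (s1 \<otimes> s2) \<odot>\<^bsub>ob Z p\<^esub> ?f p k) (\<lambda>p k. \<zero>\<^bsub>ob Z p\<^esub>)"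
    using teq_smult[OF Z' s1(2) sR(2) zc] sR cocD(1)[OF fc] by (simp add: M.smult_assoc1[symmetric] m_comm)
  have k2: "teq ?j Z (\<lambda>p k. (s1 \<otimes> s2) \<odot>\<^bsub>ob Z p\<^esub> ?g p k) (\<lambda>p k. \<zero>\<^bsub>ob Z p\<^esub>)"
    using teq_smult[OF Z' s2(2) sR(1) zc] sR cocD(1)[OF gc] by (simp add: M.smult_assoc1[symmetric])
  have "teq ?j Z (\<lambda>p k. (s1 \<otimes> s2) \<odot>\<^bsub>ob Z p\<^esub> (?f p k \<oplus>\<^bsub>ob Z p\<^esub> ?g p k)) (\<lambda>p k. \<zero>\<^bsub>ob Z p\<^esub>)"
    using teq_add[OF Z' k1 k2 zc zc] sR cocD(1)[OF fc] cocD(1)[OF gc] by (simp add: M.smult_r_distr)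
  moreover have "teq ?j Z (\<lambda>p k. (s1 \<otimes> s2) \<odot>\<^bsub>ob Z p\<^esub> z p k) (\<lambda>p k. (s1 \<otimes> s2) \<odot>\<^bsub>ob Z p\<^esub> (?f p k \<oplus>\<^bsub>ob Z p\<^esub> ?g p k))"
    by (rule teq_smult[OF Z' teq_mono[OF zfg le(3)] _ cocD(1)[OF sc]]) (use sR in simp)
  ultimately have "teq ?j Z (\<lambda>p k. (s1 \<otimes> s2) \<odot>\<^bsub>ob Z p\<^esub> z p k) (\<lambda>p k. \<zero>\<^bsub>ob Z p\<^esub>)"
    using teq_trans[OF Z' _ _ zc] by blast
  then show "\<exists>s\<in>carrier R - q. teq ?j Z (\<lambda>p k. s \<odot>\<^bsub>ob Z p\<^esub> z p k) (\<lambda>p k. \<zero>\<^bsub>ob Z p\<^esub>)"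
    using primeideal_mult_compl[OF q s1(1) s2(1)] by blast
qed

lemma shift_complex_simps [simp]:
  "ob (shift_complex X) p = ob X (p + 1)" "df (shift_complex X) p x = \<ominus>\<^bsub>ob X (p + 1 + 1)\<^esub> df X (p + 1) x"
  by (simp_all add: shift_complex_def)

text \<open>The sign of the shifted differential is moved to the free complex.\<close>

lemma ghost_shift_iff:
  assumes X: "is_complex R X"
  shows "ghost R q i j (shift_complex X) \<longleftrightarrow> ghost R q i j X"
proof
  interpret M: module R "ob X p" for p by (rule is_complexD(1)[OF X])
  note d = mod_homD(1)[OF is_complexD(2)[OF X]] and d' = mod_homD(1)[OF is_complex_pred(1)[OF X]]
  have neg: "x = y" if "\<ominus>\<^bsub>ob X p\<^esub> x = \<ominus>\<^bsub>ob X p\<^esub> y" "x \<in> carrier (ob X p)" "y \<in> carrier (ob X p)" for x y p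
    using that by (metis M.M.minus_minus)
  { assume g: "ghost R q i j X"
    show "ghost R q i j (shift_complex X)"
      unfolding ghost_def
    proof (intro allI impI)
      fix a n D z assume res: "free_resolution_from R a n D" and z: "tensor_cocycle n D (a + int i) (shift_complex X) z"
      \<comment> \<open>Degree \<open>p\<close> of the shifted complex is degree
        \<open>p + 1\<close> of \<open>X\<close>, so all indices of the free resolution move up by
        one.\<close>
      let ?n = "\<lambda>p. n (p - 1)" and ?D = "\<lambda>p k l. \<ominus> D (p - 1) k l" and ?z = "\<lambda>p. z (p - 1)"
      have res': "free_resolution_from R (a + 1) ?n ?D" by (rule free_resolution_from_shift[OF is_cring res])
      have D: "D p k l \<in> carrier R" for p k l using res by (simp add: free_resolution_from_def free_complex_from_def)
      have zc: "z p k \<in> carrier (ob X (p + 1))" for p k using z by (simp add: tensor_cocycle_def)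
      have zc': "?z p k \<in> carrier (ob X p)" for p k using zc[of "p - 1" k] by simp
      have "tensor_cocycle ?n ?D (a + 1 + int i) X ?z"
        unfolding tensor_cocycle_def
      proof (intro conjI allI impI zc')
        fix p k assume pk: "a + 1 + int i \<le> p" "k < n (p - 1)"
        have "\<ominus>\<^bsub>ob X (p + 1)\<^esub> df X p (z (p - 1) k) = lc (ob X (p + 1)) (n p) (D (p - 1) k) (z p)"
          using z[unfolded tensor_cocycle_def, THEN conjunct2, THEN spec, of "p - 1"] pk by simp
        moreover have "lc (ob X (p + 1)) (n p) (\<lambda>l. \<ominus> D (p - 1) k l) (z p) = \<ominus>\<^bsub>ob X (p + 1)\<^esub> lc (ob X (p + 1)) (n p) (D (p - 1) k) (z p)"
          by (rule M.lc_minus_left) (use D zc in auto)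
        ultimately show "df X p (z (p - 1) k) = lc (ob X (p + 1)) (n (p + 1 - 1)) (\<lambda>l. \<ominus> D (p - 1) k l) (z (p + 1 - 1))"
          using d[OF zc'] by (metis M.M.minus_minus add_diff_cancel_right')
      qed
      then obtain s where s: "s \<in> carrier R - q"
        and e: "tensor_eq ?n ?D (a + 1 + int j) X (\<lambda>p k. s \<odot>\<^bsub>ob X p\<^esub> ?z p k) (\<lambda>p k. \<zero>\<^bsub>ob X p\<^esub>)"
        using g res' unfolding ghost_def by blast
      obtain w where w: "\<And>p k. w p k \<in> carrier (ob X p)"
        "\<forall>p\<ge>a + 1 + int j. \<forall>k<n (p - 1). s \<odot>\<^bsub>ob X p\<^esub> z (p - 1) k = \<zero>\<^bsub>ob X p\<^esub> \<oplus>\<^bsub>ob X p\<^esub> tensor_bd ?n ?D X w p k"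
        using e unfolding tensor_eq_def by blast
      let ?w = "\<lambda>p k. \<ominus>\<^bsub>ob X (p + 1)\<^esub> w (p + 1) k"
      have "tensor_eq n D (a + int j) (shift_complex X) (\<lambda>p k. s \<odot>\<^bsub>ob X (p + 1)\<^esub> z p k) (\<lambda>p k. \<zero>\<^bsub>ob X (p + 1)\<^esub>)"
        unfolding tensor_eq_def
      proof (intro exI[of _ ?w] conjI allI impI)
        show "?w p k \<in> carrier (ob (shift_complex X) p)" for p k using w(1) by simp
        fix p k assume pk: "a + int j \<le> p" "k < n p"
        have "s \<odot>\<^bsub>ob X (p + 1)\<^esub> z p k = \<zero>\<^bsub>ob X (p + 1)\<^esub> \<oplus>\<^bsub>ob X (p + 1)\<^esub> (df X p (w p k) \<oplus>\<^bsub>ob X (p + 1)\<^esub> lc (ob X (p + 1)) (n (p + 1)) (\<lambda>l. \<ominus> D p k l) (w (p + 1)))"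
          using w(2)[THEN spec, of "p + 1"] pk by (simp add: tensor_bd_def add.commute)
        moreover have "lc (ob X (p + 1)) (n (p + 1)) (\<lambda>l. \<ominus> D p k l) (w (p + 1)) = lc (ob X (p + 1)) (n (p + 1)) (D p k) (?w p)"
          using M.lc_minus_left[of "D p k" "w (p + 1)" "p + 1" "n (p + 1)"] M.lc_minus[of "D p k" "w (p + 1)" "p + 1" "n (p + 1)"] D w(1) by simp
        moreover have "\<ominus>\<^bsub>ob X (p + 1)\<^esub> df X p (\<ominus>\<^bsub>ob X p\<^esub> w p k) = df X p (w p k)"
          using mod_hom_minus[OF M.module_axioms M.module_axioms is_complexD(2)[OF X] w(1)] d[OF w(1)] by simp
        ultimately show "s \<odot>\<^bsub>ob X (p + 1)\<^esub> z p k = \<zero>\<^bsub>ob X (p + 1)\<^esub> \<oplus>\<^bsub>ob (shift_complex X) p\<^esub> tensor_bd n D (shift_complex X) ?w p k"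
          by (simp add: tensor_bd_def)
      qed
      then show "\<exists>s\<in>carrier R - q. tensor_eq n D (a + int j) (shift_complex X)
          (\<lambda>p k. s \<odot>\<^bsub>ob (shift_complex X) p\<^esub> z p k) (\<lambda>p k. \<zero>\<^bsub>ob (shift_complex X) p\<^esub>)"
        using s by auto
    qed }
  { assume g: "ghost R q i j (shift_complex X)"
    show "ghost R q i j X"
      unfolding ghost_def
    proof (intro allI impI)
      fix a n D z assume res: "free_resolution_from R a n D" and z: "tensor_cocycle n D (a + int i) X z"
      let ?n = "\<lambda>p. n (p + 1)" and ?D = "\<lambda>p k l. \<ominus> D (p + 1) k l" and ?z = "\<lambda>p. z (p + 1)"
      have res': "free_resolution_from R (a - 1) ?n ?D" using free_resolution_from_shift[OF is_cring res, of "-1"] by simp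
      have D: "D p k l \<in> carrier R" for p k l using res by (simp add: free_resolution_from_def free_complex_from_def)
      have zc: "z p k \<in> carrier (ob X p)" for p k using z by (simp add: tensor_cocycle_def)
      have "tensor_cocycle ?n ?D (a - 1 + int i) (shift_complex X) ?z"
        unfolding tensor_cocycle_def
      proof (intro conjI allI impI)
        show "z (p + 1) k \<in> carrier (ob (shift_complex X) p)" for p k using zc by simp
        fix p k assume pk: "a - 1 + int i \<le> p" "k < n (p + 1)"
        have "df X (p + 1) (z (p + 1) k) = lc (ob X (p + 1 + 1)) (n (p + 1 + 1)) (D (p + 1) k) (z (p + 1 + 1))"
          using z pk unfolding tensor_cocycle_def by simp
        moreover have "lc (ob X (p + 1 + 1)) (n (p + 1 + 1)) (\<lambda>l. \<ominus> D (p + 1) k l) (z (p + 1 + 1)) = \<ominus>\<^bsub>ob X (p + 1 + 1)\<^esub> lc (ob X (p + 1 + 1)) (n (p + 1 + 1)) (D (p + 1) k) (z (p + 1 + 1))"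
          by (rule M.lc_minus_left) (use D zc in auto)
        ultimately show "df (shift_complex X) p (z (p + 1) k) = lc (ob (shift_complex X) (p + 1)) (n (p + 1 + 1)) (\<lambda>l. \<ominus> D (p + 1) k l) (z (p + 1 + 1))"
          by simp
      qed
      then obtain s where s: "s \<in> carrier R - q"
        and e: "tensor_eq ?n ?D (a - 1 + int j) (shift_complex X) (\<lambda>p k. s \<odot>\<^bsub>ob (shift_complex X) p\<^esub> ?z p k) (\<lambda>p k. \<zero>\<^bsub>ob (shift_complex X) p\<^esub>)"
        using g res' unfolding ghost_def by blast
      obtain w where w: "\<forall>p k. w p k \<in> carrier (ob (shift_complex X) p)"
        "\<forall>p\<ge>a - 1 + int j. \<forall>k<n (p + 1). s \<odot>\<^bsub>ob (shift_complex X) p\<^esub> z (p + 1) k = \<zero>\<^bsub>ob (shift_complex X) p\<^esub> \<oplus>\<^bsub>ob (shift_complex X) p\<^esub> tensor_bd ?n ?D (shift_complex X) w p k"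
        using e unfolding tensor_eq_def by blast
      have wc: "w (p - 1) k \<in> carrier (ob X p)" for p k using w(1)[THEN spec, of "p - 1"] by simp
      let ?w = "\<lambda>p k. \<ominus>\<^bsub>ob X p\<^esub> w (p - 1) k"
      have "tensor_eq n D (a + int j) X (\<lambda>p k. s \<odot>\<^bsub>ob X p\<^esub> z p k) (\<lambda>p k. \<zero>\<^bsub>ob X p\<^esub>)"
        unfolding tensor_eq_def
      proof (intro exI[of _ ?w] conjI allI impI)
        show "?w p k \<in> carrier (ob X p)" for p k using wc by simp
        fix p k assume pk: "a + int j \<le> p" "k < n p"
        have w1: "w (p - 2) k \<in> carrier (ob X (p - 1))" using wc[of "p - 1" k] by simp
        have "s \<odot>\<^bsub>ob X p\<^esub> z p k = \<zero>\<^bsub>ob X p\<^esub> \<oplus>\<^bsub>ob X p\<^esub> (\<ominus>\<^bsub>ob X p\<^esub> df X (p - 1) (w (p - 2) k) \<oplus>\<^bsub>ob X p\<^esub> lc (ob X p) (n (p + 1)) (\<lambda>l. \<ominus> D p k l) (w (p - 1)))"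
          using w(2)[THEN spec, of "p - 1"] pk by (simp add: tensor_bd_def)
        moreover have "lc (ob X p) (n (p + 1)) (\<lambda>l. \<ominus> D p k l) (w (p - 1)) = lc (ob X p) (n (p + 1)) (D p k) (?w p)"
          using M.lc_minus_left[of "D p k" "w (p - 1)" p "n (p + 1)"] M.lc_minus[of "D p k" "w (p - 1)" p "n (p + 1)"] D wc by simp
        moreover have "df X (p - 1) (\<ominus>\<^bsub>ob X (p - 1)\<^esub> w (p - 2) k) = \<ominus>\<^bsub>ob X p\<^esub> df X (p - 1) (w (p - 2) k)"
          by (rule mod_hom_minus[OF M.module_axioms M.module_axioms is_complex_pred(1)[OF X] w1])
        ultimately show "s \<odot>\<^bsub>ob X p\<^esub> z p k = \<zero>\<^bsub>ob X p\<^esub> \<oplus>\<^bsub>ob X p\<^esub> tensor_bd n D X ?w p k"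
          by (simp add: tensor_bd_def)
      qed
      then show "\<exists>s\<in>carrier R - q. tensor_eq n D (a + int j) X (\<lambda>p k. s \<odot>\<^bsub>ob X p\<^esub> z p k) (\<lambda>p k. \<zero>\<^bsub>ob X p\<^esub>)"
        using s by blast
    qed }
qed

end

lemma derived_additive_simps [simp]:
  "obj (derived_additive R) = bounded_complexes R"
  "hom_set (derived_additive R) X Y = derived_hom R X Y"
  "ident (derived_additive R) X = derived_map R X X (\<lambda>n x. x)"
  "hom_comp (derived_additive R) = derived_comp R"
  by (simp_all add: derived_additive_def)

section \<open>Triangles and generation\<close>

context cring
begin

text \<open>A class on \<open>M\<close> dies in \<open>Y\<close> on the first stretch of
  truncations, so by exactness a multiple of it comes from a class on \<open>X\<close>, and that one
  dies on the second stretch. Exactness is available for cone triangles, hence the transport along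
  the isomorphisms \<open>al\<close>, \<open>be\<close> and \<open>ga\<close>.\<close>

lemma ghost_triangle:
  fixes X Y M :: "('a, 'a fg_elem) cochain"
  assumes q: "primeideal q R" and tri: "(X, M, Y, f, g, h) \<in> derived_triangles R"
    and ij: "i \<le> j" and jk: "j \<le> k" and gY: "ghost R q i j Y" and gX: "ghost R q j k X"
  shows "ghost R q i k M"
  unfolding ghost_def
proof (intro allI impI)
  fix a n D z assume res: "free_resolution_from R a n D" and z: "tensor_cocycle n D (a + int i) M z"
  have bd: "X \<in> bounded_complexes R" "M \<in> bounded_complexes R" "Y \<in> bounded_complexes R"
    and fh: "f \<in> derived_hom R X M" and gh: "g \<in> derived_hom R M Y"
    using tri unfolding derived_triangles_def by auto
  obtain A B u al be ga where AB: "A \<in> bounded_complexes R" "B \<in> bounded_complexes R" "u \<in> chain_maps R A B"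
    and al: "is_iso (derived_additive R) X A al" and be: "is_iso (derived_additive R) M B be"
    and ga: "is_iso (derived_additive R) Y (cone A B u) ga"
    and sq1: "derived_comp R X M B be f = derived_comp R X A B (derived_map R A B u) al"
    and sq2: "derived_comp R M Y (cone A B u) ga g =
          derived_comp R M B (cone A B u) (derived_map R B (cone A B u) (cone_in A)) be"
    using tri unfolding derived_triangles_def by blast
  obtain al' where al: "al \<in> derived_hom R X A" "al' \<in> derived_hom R A X"
    "derived_comp R A X A al al' = derived_map R A A (\<lambda>n x. x)"
    using al by (auto simp: is_iso_def)
  obtain be' where be: "be \<in> derived_hom R M B" "be' \<in> derived_hom R B M"
    "derived_comp R M B M be' be = derived_map R M M (\<lambda>n x. x)"
    using be by (auto simp: is_iso_def)
  have ga: "ga \<in> derived_hom R Y (cone A B u)" using ga by (simp add: is_iso_def)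
  interpret free_cpx R a n D by (rule free_cpxI[OF res])
  let ?i = "a + int i" and ?j = "a + int j" and ?k = "a + int k"
  have le: "a \<le> ?i" "a \<le> ?j" "a \<le> ?k" "?i \<le> ?j" "?j \<le> ?k" using ij jk by simp_all
  note X' = bounded_is_complex[OF bd(1)] and M' = bounded_is_complex[OF bd(2)] and Y' = bounded_is_complex[OF bd(3)]
    and A' = bounded_is_complex[OF AB(1)] and B' = bounded_is_complex[OF AB(2)]
  note C' = cone_is_complex[OF A' B' AB(3)] and cin = cone_in_chain_map[OF A' B' AB(3)]
  interpret MM: module R "ob M p" for p by (rule is_complexD(1)[OF M'])
  obtain y where y: "Act ?i M Y g z y" using Act_total[OF bd(2) Y' gh le(1) z] by blast
  obtain s where s: "s \<in> carrier R - q" "teq ?j Y (\<lambda>p k. s \<odot>\<^bsub>ob Y p\<^esub> y p k) (\<lambda>p k. \<zero>\<^bsub>ob Y p\<^esub>)"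
    using gY res Act_coc(2)[OF y] unfolding ghost_def by blast
  have sR: "s \<in> carrier R" using s by blast
  let ?z = "\<lambda>p k. s \<odot>\<^bsub>ob M p\<^esub> z p k" and ?y = "\<lambda>p k. s \<odot>\<^bsub>ob Y p\<^esub> y p k"
  have sy: "Act ?j M Y g ?z ?y" by (rule Act_smult[OF bd(2) Y' gh sR Act_mono[OF y le(4)]])
  note szc = Act_coc(1)[OF sy]
  obtain m where m: "Act ?j M B be ?z m" using Act_total[OF bd(2) B' be(1) le(2) szc] by blast
  obtain c where c: "Act ?j Y (cone A B u) ga ?y c" using Act_total[OF bd(3) C' ga le(2) Act_coc(2)[OF sy]] by blast
  have c0: "teq ?j (cone A B u) c (\<lambda>p k. \<zero>\<^bsub>ob (cone A B u) p\<^esub>)" by (rule Act_null[OF bd(3) C' ga le(2) c s(2)])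
  have "teq ?j (cone A B u) c (\<lambda>p k. cone_in A p (m p k))"
    by (rule Act_square[OF bd(2) bd(3) AB(2) C' cin be(1) gh ga sq2 le(2) sy c m])
  then have "teq ?j (cone A B u) (\<lambda>p k. cone_in A p (m p k)) c" by (rule teq_sym[OF C' _ cocD(1)[OF coc_map[OF B' C' cin Act_coc(2)[OF m]]]])
  then have "teq ?j (cone A B u) (\<lambda>p k. cone_in A p (m p k)) (\<lambda>p k. \<zero>\<^bsub>ob (cone A B u) p\<^esub>)"
    by (rule teq_trans[OF C' _ c0 cocD(1)[OF coc_zero[OF C']]])
  then obtain w where w: "coc ?j A w" "teq ?j B m (\<lambda>p k. u p (w p k))"
    using cone_tensor_exact[OF A' B' AB(3) Act_coc(2)[OF m]] by blast
  \<comment> \<open>Back from \<open>A\<close> to \<open>X\<close> along the inverse of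
    \<open>al\<close>; the next steps check that \<open>x\<close> and \<open>?z\<close> have the
    same class in \<open>B\<close>.\<close>
  obtain x where x: "Act ?j A X al' w x" using Act_total[OF AB(1) X' al(2) le(2) w(1)] by blast
  obtain w1 where w1: "Act ?j X A al x w1" using Act_total[OF bd(1) A' al(1) le(2) Act_coc(2)[OF x]] by blast
  have ww: "teq ?j A w w1" by (rule Act_retract[OF AB(1) bd(1) al(2,1,3) le(2) x w1])
  obtain m1 where m1: "Act ?j X M f x m1" using Act_total[OF bd(1) M' fh le(2) Act_coc(2)[OF x]] by blast
  obtain b1 where b1: "Act ?j M B be m1 b1" using Act_total[OF bd(2) B' be(1) le(2) Act_coc(2)[OF m1]] by blast
  have e1: "teq ?j B b1 (\<lambda>p k. u p (w1 p k))"
    by (rule Act_square[OF bd(1) bd(2) AB(1) B' AB(3) al(1) fh be(1) sq1 le(2) m1 b1 w1])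
  have uw: "coc ?j B (\<lambda>p k. u p (w p k))" "coc ?j B (\<lambda>p k. u p (w1 p k))"
    using coc_map[OF A' B' AB(3) w(1)] coc_map[OF A' B' AB(3) Act_coc(2)[OF w1]] by auto
  have e2: "teq ?j B (\<lambda>p k. u p (w p k)) (\<lambda>p k. u p (w1 p k))" by (rule teq_map[OF A' B' AB(3) ww cocD(1)[OF Act_coc(2)[OF w1]]])
  have e4: "teq ?j B m (\<lambda>p k. u p (w1 p k))" by (rule teq_trans[OF B' w(2) e2 cocD(1)[OF uw(2)]])
  have e5: "teq ?j B (\<lambda>p k. u p (w1 p k)) b1" by (rule teq_sym[OF B' e1 cocD(1)[OF uw(2)]])
  have e3: "teq ?j B m b1" by (rule teq_trans[OF B' e4 e5 cocD(1)[OF Act_coc(2)[OF b1]]])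
  \<comment> \<open>Applying the inverse of \<open>be\<close> turns the comparison in
    \<open>B\<close> into one in \<open>M\<close>: \<open>?z\<close> is cohomologous to the image
    \<open>m1\<close> of \<open>x\<close>.\<close>
  obtain m2 where m2: "Act ?j B M be' m m2" using Act_total[OF AB(2) M' be(2) le(2) Act_coc(2)[OF m]] by blast
  obtain m3 where m3: "Act ?j B M be' b1 m3" using Act_total[OF AB(2) M' be(2) le(2) Act_coc(2)[OF b1]] by blast
  have f1: "teq ?j M ?z m2" by (rule Act_retract[OF bd(2) AB(2) be le(2) m m2])
  have f2: "teq ?j M m2 m3" by (rule Act_unique[OF AB(2) M' be(2) le(2) m2 m3 e3])
  have "teq ?j M m1 m3" by (rule Act_retract[OF bd(2) AB(2) be le(2) b1 m3])
  then have f3: "teq ?j M m3 m1" by (rule teq_sym[OF M' _ cocD(1)[OF Act_coc(2)[OF m3]]])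
  have f4: "teq ?j M ?z m1"
    by (rule teq_trans[OF M' teq_trans[OF M' f1 f2 cocD(1)[OF Act_coc(2)[OF m3]]] f3 cocD(1)[OF Act_coc(2)[OF m1]]])
  obtain t where t: "t \<in> carrier R - q" "teq ?k X (\<lambda>p k. t \<odot>\<^bsub>ob X p\<^esub> x p k) (\<lambda>p k. \<zero>\<^bsub>ob X p\<^esub>)"
    using gX res Act_coc(2)[OF x] unfolding ghost_def by blast
  have tR: "t \<in> carrier R" using t by blast
  have k1: "teq ?k M (\<lambda>p k. t \<odot>\<^bsub>ob M p\<^esub> m1 p k) (\<lambda>p k. \<zero>\<^bsub>ob M p\<^esub>)"
    by (rule Act_null[OF bd(1) M' fh le(3) Act_smult[OF bd(1) M' fh tR Act_mono[OF m1 le(5)]] t(2)])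
  have k2: "teq ?k M (\<lambda>p k. t \<odot>\<^bsub>ob M p\<^esub> ?z p k) (\<lambda>p k. t \<odot>\<^bsub>ob M p\<^esub> m1 p k)"
    by (rule teq_smult[OF M' teq_mono[OF f4 le(5)] tR cocD(1)[OF Act_coc(2)[OF m1]]])
  have "teq ?k M (\<lambda>p k. t \<odot>\<^bsub>ob M p\<^esub> ?z p k) (\<lambda>p k. \<zero>\<^bsub>ob M p\<^esub>)"
    by (rule teq_trans[OF M' k2 k1 cocD(1)[OF coc_zero[OF M']]])
  then have "teq ?k M (\<lambda>p k. (t \<otimes> s) \<odot>\<^bsub>ob M p\<^esub> z p k) (\<lambda>p k. \<zero>\<^bsub>ob M p\<^esub>)"
    using tR sR cocD(1)[OF z] by (simp add: MM.smult_assoc1)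
  then show "\<exists>s\<in>carrier R - q. teq ?k M (\<lambda>p k. s \<odot>\<^bsub>ob M p\<^esub> z p k) (\<lambda>p k. \<zero>\<^bsub>ob M p\<^esub>)"
    using primeideal_mult_compl[OF q t(1) s(1)] by blast
qed

lemma shift_bounded:
  assumes X: "X \<in> bounded_complexes R" shows "shift_complex X \<in> bounded_complexes R"
proof -
  note X' = bounded_is_complex[OF X]
  interpret M: module R "ob X p" for p by (rule is_complexD(1)[OF X'])
  note d = mod_homD[OF is_complexD(2)[OF X']]
  have fg: "fg_module R (ob X p)" for p using X by (simp add: bounded_complexes_def)
  have hom: "(\<lambda>x. \<ominus>\<^bsub>ob X (p + 1)\<^esub> df X p x) \<in> mod_hom R (ob X p) (ob X (p + 1))" for p
    unfolding mod_hom_def by (auto simp: d M.M.minus_add M.smult_r_minus)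
  have dd: "\<ominus>\<^bsub>ob X (p + 1 + 1)\<^esub> df X (p + 1) (\<ominus>\<^bsub>ob X (p + 1)\<^esub> df X p x) = \<zero>\<^bsub>ob X (p + 1 + 1)\<^esub>"
    if x: "x \<in> carrier (ob X p)" for p x
    using mod_hom_minus[OF M.module_axioms M.module_axioms is_complexD(2)[OF X'] d(1)[OF x]] is_complexD(3)[OF X' x]
    by (simp add: a_inv_zero[OF M.M.abelian_group_axioms])
  obtain b where b: "\<forall>n. \<bar>n\<bar> > b \<longrightarrow> carrier (ob X n) = {\<zero>\<^bsub>ob X n\<^esub>}" using X by (auto simp: bounded_complexes_def)
  have "\<forall>n. \<bar>n\<bar> > b + 1 \<longrightarrow> carrier (ob X (n + 1)) = {\<zero>\<^bsub>ob X (n + 1)\<^esub>}"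
  proof (intro allI impI)
    fix n :: int assume "\<bar>n\<bar> > b + 1"
    then have "\<bar>n + 1\<bar> > b" by linarith
    then show "carrier (ob X (n + 1)) = {\<zero>\<^bsub>ob X (n + 1)\<^esub>}" using b by blast
  qed
  then have bb: "\<exists>b. \<forall>n. \<bar>n\<bar> > b \<longrightarrow> carrier (ob (shift_complex X) n) = {\<zero>\<^bsub>ob (shift_complex X) n\<^esub>}" by auto
  have hom': "df (shift_complex X) p \<in> mod_hom R (ob (shift_complex X) p) (ob (shift_complex X) (p + 1))" for p
    using hom[of "p + 1"] by (simp add: shift_complex_def)
  show ?thesis unfolding bounded_complexes_def using fg hom' dd[of _ "_ + 1"] bb by simp
qed

lemma ghost_gen:
  fixes X :: "('a, 'a fg_elem) cochain"
  assumes q: "primeideal q R" and ij: "i \<le> j" and S: "\<And>X. X \<in> S \<Longrightarrow> X \<in> bounded_complexes R \<Longrightarrow> ghost R q i j X"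
    and X: "X \<in> gen (Db_mod R) S"
  shows "X \<in> bounded_complexes R \<and> ghost R q i j X"
  using X
proof (induction rule: gen.induct)
  case (base X)
  then show ?case using S by simp
next
  case (iso X Y)
  then obtain f g where fg: "f \<in> derived_hom R X Y" "g \<in> derived_hom R Y X" "derived_comp R Y X Y f g = derived_map R Y Y (\<lambda>n x. x)"
    by (auto simp: isomorphic_def is_iso_def)
  then show ?case using ghost_retract[of X Y i j g f q] ij fg iso by simp
next
  case (empty_sum Z)
  then show ?case using ghost_zero_object[of q Z i j] q ij by (simp add: zero_objects_def)
next
  case (binary_sum X Y Z)
  then obtain I J P Q where IJ: "I \<in> derived_hom R X Z" "J \<in> derived_hom R Y Z" "P \<in> derived_hom R Z X" "Q \<in> derived_hom R Z Y"
    "derived_add R Z Z (derived_comp R Z X Z I P) (derived_comp R Z Y Z J Q) = derived_map R Z Z (\<lambda>n x. x)"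
    by (auto simp: direct_sum_def)
  then show ?case using ghost_sum[of q X Y Z i j I J P Q] q ij IJ binary_sum by simp
next
  case (summand Z X Y)
  then obtain I P where IP: "I \<in> derived_hom R X Z" "P \<in> derived_hom R Z X"
    "derived_comp R X Z X P I = derived_map R X X (\<lambda>n x. x)"
    by (auto simp: direct_sum_def)
  then show ?case using ghost_retract[of Z X i j I P q] ij IP summand by simp
next
  case (shift X)
  then show ?case by (simp add: shift_bounded ghost_shift_iff bounded_is_complex)
next
  case (unshift X)
  then show ?case by (simp add: ghost_shift_iff bounded_is_complex)
qed

text \<open>Every level of generation uses one truncation step. In the triangle the object
  \<open>B\<close> of level \<open>m - 1\<close> takes the steps up to \<open>m - 1\<close> and the
  object \<open>A\<close> of level 1 takes the last one, so \<open>G\<close> has to be ghost at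
  every \<open>i\<close>.\<close>

lemma ghost_gen_n:
  fixes X G :: "('a, 'a fg_elem) cochain"
  assumes q: "primeideal q R" and G: "\<And>i. ghost R q i (Suc i) G" and X: "X \<in> gen_n (Db_mod R) {G} m"
  shows "X \<in> bounded_complexes R \<and> ghost R q 0 m X"
proof -
  have one: "X \<in> bounded_complexes R \<and> ghost R q i (Suc i) X" if "X \<in> gen (Db_mod R) {G}" for i and X :: "('a, 'a fg_elem) cochain"
    by (rule ghost_gen[OF q _ _ that]) (use G in auto)
  show ?thesis using X
  proof (induction m arbitrary: X rule: nat_less_induct)
    case (1 m)
    consider "m = 0" | "m = Suc 0" | k where "m = Suc (Suc k)" by (metis nat.exhaust)
    then show ?case
    proof cases
      case 1
      then show ?thesis using ghost_zero_object[of q X 0 0] q "1.prems" by (simp add: zero_objects_def)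
    next
      case 2
      then show ?thesis using one[of X 0] "1.prems" by simp
    next
      case 3
      show ?thesis
      proof (rule ghost_gen[OF q])
        show "X \<in> gen (Db_mod R) (star (Db_mod R) (gen (Db_mod R) {G}) (gen_n (Db_mod R) {G} (Suc k)))"
          using "1.prems" 3 by simp
        fix M assume "M \<in> star (Db_mod R) (gen (Db_mod R) {G}) (gen_n (Db_mod R) {G} (Suc k))"
        then obtain A B f g h where AB: "A \<in> gen (Db_mod R) {G}" "B \<in> gen_n (Db_mod R) {G} (Suc k)"
          and tri: "(A, M, B, f, g, h) \<in> derived_triangles R" by (auto simp: star_def)
        have gB: "ghost R q 0 (Suc k) B" using "1.IH" AB(2) 3 by blast
        have gA: "ghost R q (Suc k) m A" using one[OF AB(1), of "Suc k"] 3 by simp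
        show "ghost R q 0 m M" by (rule ghost_triangle[OF q tri _ _ gB gA]) (use 3 in simp_all)
      qed simp
    qed
  qed
qed

end

subsection \<open>Generic splitting of complexes\<close>

text \<open>The sum of \<open>U\<close> and the submodule generated by the first \<open>m\<close>
  members of \<open>g\<close>.\<close>

definition span_mod :: "('a, 'r) ring_scheme \<Rightarrow> ('a, 'm) module \<Rightarrow> 'm set \<Rightarrow> (nat \<Rightarrow> 'm) \<Rightarrow> nat \<Rightarrow> 'm set" where
  "span_mod R M U g m = {x \<in> carrier M. \<exists>c. (\<forall>i. c i \<in> carrier R) \<and> x \<ominus>\<^bsub>M\<^esub> lc M m c g \<in> U}"

definition linear_on :: "('a, 'r) ring_scheme \<Rightarrow> ('a, 'm) module \<Rightarrow> 'm set \<Rightarrow> ('m \<Rightarrow> 'a) \<Rightarrow> bool" where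
  "linear_on R M N f \<longleftrightarrow> (\<forall>x\<in>N. f x \<in> carrier R) \<and> (\<forall>x\<in>N. \<forall>y\<in>N. f (x \<oplus>\<^bsub>M\<^esub> y) = f x \<oplus>\<^bsub>R\<^esub> f y) \<and>
     (\<forall>r\<in>carrier R. \<forall>x\<in>N. f (r \<odot>\<^bsub>M\<^esub> x) = r \<otimes>\<^bsub>R\<^esub> f x)"

lemma linear_onD:
  assumes "linear_on R M N f"
  shows "x \<in> N \<Longrightarrow> f x \<in> carrier R" "x \<in> N \<Longrightarrow> y \<in> N \<Longrightarrow> f (x \<oplus>\<^bsub>M\<^esub> y) = f x \<oplus>\<^bsub>R\<^esub> f y"
    "r \<in> carrier R \<Longrightarrow> x \<in> N \<Longrightarrow> f (r \<odot>\<^bsub>M\<^esub> x) = r \<otimes>\<^bsub>R\<^esub> f x"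
  using assms by (auto simp: linear_on_def)

locale split_data = M: module R M for R (structure) and M :: "('a, 'm) module" +
  fixes p :: "'a set" and u :: 'a and U :: "'m set" and g :: "nat \<Rightarrow> 'm"
  assumes p: "primeideal p R" and u: "u \<in> carrier R - p" and up: "\<And>x. x \<in> p \<Longrightarrow> u \<otimes> x = \<zero>"
    and U: "U \<subseteq> carrier M" "\<zero>\<^bsub>M\<^esub> \<in> U" "\<And>x y. x \<in> U \<Longrightarrow> y \<in> U \<Longrightarrow> x \<oplus>\<^bsub>M\<^esub> y \<in> U"
      "\<And>r x. r \<in> carrier R \<Longrightarrow> x \<in> U \<Longrightarrow> r \<odot>\<^bsub>M\<^esub> x \<in> U"
    and g: "\<And>i. g i \<in> carrier M"
begin

abbreviation "N m \<equiv> span_mod R M U g m"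

lemma uR: "u \<in> carrier R" using u by blast

lemma N_sub: "x \<in> N m \<Longrightarrow> x \<in> carrier M" by (simp add: span_mod_def)

lemma U_N: assumes x: "x \<in> U" shows "x \<in> N m"
proof -
  have "lc M m (\<lambda>_. \<zero>) g = \<zero>\<^bsub>M\<^esub>" by (rule M.lc_zero_left) (use g in auto)
  then show ?thesis using x U(1) unfolding span_mod_def
    by (auto intro!: exI[of _ "\<lambda>_. \<zero>"] simp: a_minus_def a_inv_zero[OF M.M.abelian_group_axioms])
qed

lemma N_iff: "x \<in> N m \<longleftrightarrow> (\<exists>v\<in>U. \<exists>c. (\<forall>i. c i \<in> carrier R) \<and> x = v \<oplus>\<^bsub>M\<^esub> lc M m c g)"
proof
  assume "x \<in> N m"
  then obtain c where c: "x \<in> carrier M" "\<forall>i. c i \<in> carrier R" "x \<ominus>\<^bsub>M\<^esub> lc M m c g \<in> U" by (auto simp: span_mod_def)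
  then have "x = (x \<ominus>\<^bsub>M\<^esub> lc M m c g) \<oplus>\<^bsub>M\<^esub> lc M m c g" using g by (simp add: a_minus_def M.M.a_assoc M.M.l_neg)
  then show "\<exists>v\<in>U. \<exists>c. (\<forall>i. c i \<in> carrier R) \<and> x = v \<oplus>\<^bsub>M\<^esub> lc M m c g" using c by blast
next
  assume "\<exists>v\<in>U. \<exists>c. (\<forall>i. c i \<in> carrier R) \<and> x = v \<oplus>\<^bsub>M\<^esub> lc M m c g"
  then obtain v c where c: "v \<in> U" "\<forall>i. c i \<in> carrier R" "x = v \<oplus>\<^bsub>M\<^esub> lc M m c g" by blast
  have vM: "v \<in> carrier M" using c U(1) by blast
  have "x \<ominus>\<^bsub>M\<^esub> lc M m c g = v" using c vM g by (simp add: a_minus_def M.M.a_assoc M.M.r_neg)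
  then have "x \<ominus>\<^bsub>M\<^esub> lc M m c g \<in> U" using c by simp
  moreover have "x \<in> carrier M" using c vM g by simp
  ultimately show "x \<in> N m" using c(2) unfolding span_mod_def by blast
qed

lemma N_add: assumes "x \<in> N m" "y \<in> N m" shows "x \<oplus>\<^bsub>M\<^esub> y \<in> N m"
proof -
  obtain v c where c: "v \<in> U" "\<forall>i. c i \<in> carrier R" "x = v \<oplus>\<^bsub>M\<^esub> lc M m c g" using assms(1) N_iff by blast
  obtain w d where d: "w \<in> U" "\<forall>i. d i \<in> carrier R" "y = w \<oplus>\<^bsub>M\<^esub> lc M m d g" using assms(2) N_iff by blast
  have vw: "v \<in> carrier M" "w \<in> carrier M" using c d U(1) by auto
  have "x \<oplus>\<^bsub>M\<^esub> y = (v \<oplus>\<^bsub>M\<^esub> w) \<oplus>\<^bsub>M\<^esub> lc M m (\<lambda>i. c i \<oplus> d i) g"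
    using c d vw g by (simp add: M.lc_add_left M.M.a_ac)
  then show ?thesis unfolding N_iff using U(3)[OF c(1) d(1)] c d by (intro bexI[of _ "v \<oplus>\<^bsub>M\<^esub> w"] exI[of _ "\<lambda>i. c i \<oplus> d i"]) auto
qed

lemma N_smult: assumes r: "r \<in> carrier R" and "x \<in> N m" shows "r \<odot>\<^bsub>M\<^esub> x \<in> N m"
proof -
  obtain v c where c: "v \<in> U" "\<forall>i. c i \<in> carrier R" "x = v \<oplus>\<^bsub>M\<^esub> lc M m c g" using assms(2) N_iff by blast
  have v: "v \<in> carrier M" using c U(1) by auto
  have "r \<odot>\<^bsub>M\<^esub> x = r \<odot>\<^bsub>M\<^esub> v \<oplus>\<^bsub>M\<^esub> lc M m (\<lambda>i. r \<otimes> c i) g"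
    using c v g r by (simp add: M.lc_smult_left M.smult_r_distr)
  then show ?thesis unfolding N_iff using U(4)[OF r c(1)] c r by (intro bexI[of _ "r \<odot>\<^bsub>M\<^esub> v"] exI[of _ "\<lambda>i. r \<otimes> c i"]) auto
qed

lemma N_minus: assumes x: "x \<in> N m" shows "\<ominus>\<^bsub>M\<^esub> x \<in> N m"
  using N_smult[of "\<ominus> \<one>", OF _ x] N_sub[OF x] by (simp add: M.smult_l_minus)

lemma N_diff: "x \<in> N m \<Longrightarrow> y \<in> N m \<Longrightarrow> x \<ominus>\<^bsub>M\<^esub> y \<in> N m"
  by (simp add: a_minus_def N_add N_minus)

lemma N_Suc: "x \<in> N (Suc m) \<Longrightarrow> \<exists>r\<in>carrier R. x \<ominus>\<^bsub>M\<^esub> r \<odot>\<^bsub>M\<^esub> g m \<in> N m"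
proof -
  assume "x \<in> N (Suc m)"
  then obtain v c where c: "v \<in> U" "\<forall>i. c i \<in> carrier R" "x = v \<oplus>\<^bsub>M\<^esub> lc M (Suc m) c g" using N_iff by blast
  have v: "v \<in> carrier M" using c U(1) by auto
  have "x \<ominus>\<^bsub>M\<^esub> c m \<odot>\<^bsub>M\<^esub> g m = v \<oplus>\<^bsub>M\<^esub> lc M m c g"
    using c v g by (simp add: a_minus_def M.M.a_assoc M.M.r_neg)
  then have "x \<ominus>\<^bsub>M\<^esub> c m \<odot>\<^bsub>M\<^esub> g m \<in> N m" unfolding N_iff using c by auto
  then show ?thesis using c by blast
qed

text \<open>Either a multiple of the last generator outside \<open>p\<close> is dependent on the others, or the last
  coordinate is well defined up to \<open>p\<close>, which \<open>u\<close> annihilates.\<close>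

lemma dual_basis:
  "\<exists>s\<in>carrier R - p. \<exists>\<alpha>. (\<forall>i. linear_on R M (N m) (\<alpha> i)) \<and> (\<forall>i. \<forall>x\<in>U. \<alpha> i x = \<zero>) \<and>
     (\<forall>x\<in>N m. s \<odot>\<^bsub>M\<^esub> x \<ominus>\<^bsub>M\<^esub> lc M m (\<lambda>i. \<alpha> i x) g \<in> U)"
proof (induction m)
  case 0
  have "\<one> \<odot>\<^bsub>M\<^esub> x \<ominus>\<^bsub>M\<^esub> lc M 0 (\<lambda>i. \<zero>) g \<in> U" if "x \<in> N 0" for x
    using that U(1) by (auto simp: N_iff a_minus_def a_inv_zero[OF M.M.abelian_group_axioms])
  then show ?case
    by (intro bexI[of _ \<one>] exI[of _ "\<lambda>i x. \<zero>"]) (use primeideal_one_compl[OF p] in \<open>auto simp: linear_on_def\<close>)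
next
  case (Suc m)
  then obtain s \<alpha> where s: "s \<in> carrier R - p" and \<alpha>: "\<And>i. linear_on R M (N m) (\<alpha> i)" "\<And>i x. x \<in> U \<Longrightarrow> \<alpha> i x = \<zero>"
    and sa: "\<And>x. x \<in> N m \<Longrightarrow> s \<odot>\<^bsub>M\<^esub> x \<ominus>\<^bsub>M\<^esub> lc M m (\<lambda>i. \<alpha> i x) g \<in> U" by blast
  have sR: "s \<in> carrier R" using s by blast
  show ?case
  proof (cases "\<exists>t\<in>carrier R - p. t \<odot>\<^bsub>M\<^esub> g m \<in> N m")
    case True
    then obtain t where t: "t \<in> carrier R - p" "t \<odot>\<^bsub>M\<^esub> g m \<in> N m" by blast
    have tR: "t \<in> carrier R" using t by blast
    \<comment> \<open>A multiple of \<open>g m\<close> depends on the earlier generators, so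
      multiplication by \<open>t\<close> maps the larger span into the smaller one.\<close>
    have tN: "t \<odot>\<^bsub>M\<^esub> x \<in> N m" if x: "x \<in> N (Suc m)" for x
    proof -
      obtain r where r: "r \<in> carrier R" "x \<ominus>\<^bsub>M\<^esub> r \<odot>\<^bsub>M\<^esub> g m \<in> N m" using N_Suc[OF x] by blast
      have "t \<odot>\<^bsub>M\<^esub> x = t \<odot>\<^bsub>M\<^esub> (x \<ominus>\<^bsub>M\<^esub> r \<odot>\<^bsub>M\<^esub> g m) \<oplus>\<^bsub>M\<^esub> r \<odot>\<^bsub>M\<^esub> (t \<odot>\<^bsub>M\<^esub> g m)"
        using tR r(1) N_sub[OF x] g[of m]
        by (simp add: a_minus_def M.smult_r_distr M.smult_r_minus M.smult_assoc1[symmetric] M.R.m_comm M.M.a_assoc M.M.l_neg)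
      then show ?thesis using N_add[OF N_smult[OF tR r(2)] N_smult[OF r(1) t(2)]] by simp
    qed
    let ?\<alpha> = "\<lambda>i x. if i < m then \<alpha> i (t \<odot>\<^bsub>M\<^esub> x) else \<zero>"
    have lin: "linear_on R M (N (Suc m)) (?\<alpha> i)" for i
    proof (cases "i < m")
      case True
      have add: "t \<odot>\<^bsub>M\<^esub> (x \<oplus>\<^bsub>M\<^esub> y) = t \<odot>\<^bsub>M\<^esub> x \<oplus>\<^bsub>M\<^esub> t \<odot>\<^bsub>M\<^esub> y" if "x \<in> N (Suc m)" "y \<in> N (Suc m)" for x y
        using that N_sub tR by (simp add: M.smult_r_distr)
      have sm: "t \<odot>\<^bsub>M\<^esub> (r \<odot>\<^bsub>M\<^esub> x) = r \<odot>\<^bsub>M\<^esub> (t \<odot>\<^bsub>M\<^esub> x)" if "r \<in> carrier R" "x \<in> N (Suc m)" for r x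
        using that N_sub tR by (simp add: M.smult_assoc1[symmetric] M.R.m_comm)
      show ?thesis unfolding linear_on_def using True linear_onD[OF \<alpha>(1)[of i]] tN add sm by simp
    qed (simp add: linear_on_def)
    have "(s \<otimes> t) \<odot>\<^bsub>M\<^esub> x \<ominus>\<^bsub>M\<^esub> lc M (Suc m) (\<lambda>i. ?\<alpha> i x) g \<in> U" if x: "x \<in> N (Suc m)" for x
    proof -
      have "lc M m (\<lambda>i. ?\<alpha> i x) g = lc M m (\<lambda>i. \<alpha> i (t \<odot>\<^bsub>M\<^esub> x)) g" by (rule lc_cong) auto
      moreover have "lc M m (\<lambda>i. \<alpha> i (t \<odot>\<^bsub>M\<^esub> x)) g \<in> carrier M" using linear_onD(1)[OF \<alpha>(1) tN[OF x]] g by simp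
      ultimately have "lc M (Suc m) (\<lambda>i. ?\<alpha> i x) g = lc M m (\<lambda>i. \<alpha> i (t \<odot>\<^bsub>M\<^esub> x)) g" using g[of m] by simp
      then show ?thesis using sa[OF tN[OF x]] sR tR N_sub[OF x] by (simp add: M.smult_assoc1)
    qed
    moreover have "\<forall>i. \<forall>x\<in>U. ?\<alpha> i x = \<zero>" using \<alpha>(2) U(4)[OF tR] by simp
    ultimately show ?thesis using primeideal_mult_compl[OF p s t(1)] lin
      by (intro bexI[of _ "s \<otimes> t"] exI[of _ ?\<alpha>]) blast+
  next
    case False
    define \<beta> where "\<beta> x = u \<otimes> (SOME r. r \<in> carrier R \<and> x \<ominus>\<^bsub>M\<^esub> r \<odot>\<^bsub>M\<^esub> g m \<in> N m)" for x
    have \<beta>: "\<beta> x = u \<otimes> r" if x: "x \<in> carrier M" and r: "r \<in> carrier R" "x \<ominus>\<^bsub>M\<^esub> r \<odot>\<^bsub>M\<^esub> g m \<in> N m" for x r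
    proof -
      let ?r = "SOME r. r \<in> carrier R \<and> x \<ominus>\<^bsub>M\<^esub> r \<odot>\<^bsub>M\<^esub> g m \<in> N m"
      have r': "?r \<in> carrier R \<and> x \<ominus>\<^bsub>M\<^esub> ?r \<odot>\<^bsub>M\<^esub> g m \<in> N m" by (rule someI[of _ r]) (use r in blast)
      have "(r \<ominus> ?r) \<odot>\<^bsub>M\<^esub> g m = (x \<ominus>\<^bsub>M\<^esub> ?r \<odot>\<^bsub>M\<^esub> g m) \<ominus>\<^bsub>M\<^esub> (x \<ominus>\<^bsub>M\<^esub> r \<odot>\<^bsub>M\<^esub> g m)"
        using x r(1) r' g[of m]
        by (simp add: a_minus_def M.smult_l_distr M.smult_l_minus M.M.minus_add M.M.a_ac M.M.r_neg1 M.M.r_neg2)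
      also have "\<dots> \<in> N m" using N_diff r r' by blast
      finally have "r \<ominus> ?r \<in> p" using False r(1) r' by blast
      then have "u \<otimes> (r \<ominus> ?r) = \<zero>" by (rule up)
      then have "u \<otimes> r \<ominus> u \<otimes> ?r = \<zero>" using uR r(1) r' by (simp add: a_minus_def M.R.r_distr M.R.r_minus)
      then have "u \<otimes> r = u \<otimes> ?r" using M.R.r_right_minus_eq uR r(1) r' by blast
      then show ?thesis by (simp add: \<beta>_def)
    qed
    have \<beta>R: "\<beta> x \<in> carrier R" if x: "x \<in> N (Suc m)" for x
      using N_Suc[OF x] \<beta>[OF N_sub[OF x]] uR by auto
    have \<beta>add: "\<beta> (x \<oplus>\<^bsub>M\<^esub> y) = \<beta> x \<oplus> \<beta> y" if x: "x \<in> N (Suc m)" and y: "y \<in> N (Suc m)" for x y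
    proof -
      obtain r where r: "r \<in> carrier R" "x \<ominus>\<^bsub>M\<^esub> r \<odot>\<^bsub>M\<^esub> g m \<in> N m" using N_Suc[OF x] by blast
      obtain r' where r': "r' \<in> carrier R" "y \<ominus>\<^bsub>M\<^esub> r' \<odot>\<^bsub>M\<^esub> g m \<in> N m" using N_Suc[OF y] by blast
      have "(x \<oplus>\<^bsub>M\<^esub> y) \<ominus>\<^bsub>M\<^esub> (r \<oplus> r') \<odot>\<^bsub>M\<^esub> g m = (x \<ominus>\<^bsub>M\<^esub> r \<odot>\<^bsub>M\<^esub> g m) \<oplus>\<^bsub>M\<^esub> (y \<ominus>\<^bsub>M\<^esub> r' \<odot>\<^bsub>M\<^esub> g m)"
        using N_sub[OF x] N_sub[OF y] r(1) r'(1) g[of m] by (simp add: a_minus_def M.smult_l_distr M.M.minus_add M.M.a_ac)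
      also have "\<dots> \<in> N m" by (rule N_add[OF r(2) r'(2)])
      finally have "\<beta> (x \<oplus>\<^bsub>M\<^esub> y) = u \<otimes> (r \<oplus> r')" using N_sub[OF x] N_sub[OF y] r(1) r'(1) by (intro \<beta>) auto
      then show ?thesis using \<beta>[OF N_sub[OF x] r] \<beta>[OF N_sub[OF y] r'] uR r r' by (simp add: M.R.r_distr)
    qed
    have \<beta>smult: "\<beta> (c \<odot>\<^bsub>M\<^esub> x) = c \<otimes> \<beta> x" if x: "x \<in> N (Suc m)" and c: "c \<in> carrier R" for x c
    proof -
      obtain r where r: "r \<in> carrier R" "x \<ominus>\<^bsub>M\<^esub> r \<odot>\<^bsub>M\<^esub> g m \<in> N m" using N_Suc[OF x] by blast
      have "(c \<odot>\<^bsub>M\<^esub> x) \<ominus>\<^bsub>M\<^esub> (c \<otimes> r) \<odot>\<^bsub>M\<^esub> g m = c \<odot>\<^bsub>M\<^esub> (x \<ominus>\<^bsub>M\<^esub> r \<odot>\<^bsub>M\<^esub> g m)"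
        using N_sub[OF x] r(1) c g[of m] by (simp add: a_minus_def M.smult_r_distr M.smult_r_minus M.smult_assoc1)
      also have "\<dots> \<in> N m" by (rule N_smult[OF c r(2)])
      finally have "\<beta> (c \<odot>\<^bsub>M\<^esub> x) = u \<otimes> (c \<otimes> r)" using N_sub[OF x] r(1) c by (intro \<beta>) auto
      then show ?thesis using \<beta>[OF N_sub[OF x] r] uR r c by (simp add: M.R.m_ac)
    qed
    have \<beta>U: "\<beta> x = \<zero>" if x: "x \<in> U" for x
    proof -
      have xM: "x \<in> carrier M" using x U(1) by blast
      have "x \<ominus>\<^bsub>M\<^esub> \<zero> \<odot>\<^bsub>M\<^esub> g m = x" using xM g[of m] by (simp add: a_minus_def a_inv_zero[OF M.M.abelian_group_axioms])
      then have "\<beta> x = u \<otimes> \<zero>" using U_N[OF x, of m] xM by (intro \<beta>) auto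
      then show ?thesis using uR by simp
    qed
    \<comment> \<open>\<open>u x\<close> minus its component along \<open>g m\<close> lies in the
      smaller span, where the induction hypothesis applies.\<close>
    let ?\<rho> = "\<lambda>x. u \<odot>\<^bsub>M\<^esub> x \<ominus>\<^bsub>M\<^esub> \<beta> x \<odot>\<^bsub>M\<^esub> g m"
    have \<rho>: "?\<rho> x \<in> N m" if x: "x \<in> N (Suc m)" for x
    proof -
      obtain r where r: "r \<in> carrier R" "x \<ominus>\<^bsub>M\<^esub> r \<odot>\<^bsub>M\<^esub> g m \<in> N m" using N_Suc[OF x] by blast
      have "?\<rho> x = u \<odot>\<^bsub>M\<^esub> (x \<ominus>\<^bsub>M\<^esub> r \<odot>\<^bsub>M\<^esub> g m)"
        using N_sub[OF x] r(1) uR g[of m] \<beta>[OF N_sub[OF x] r] by (simp add: a_minus_def M.smult_r_distr M.smult_r_minus M.smult_assoc1)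
      then show ?thesis using N_smult[OF uR r(2)] by simp
    qed
    have \<rho>add: "?\<rho> (x \<oplus>\<^bsub>M\<^esub> y) = ?\<rho> x \<oplus>\<^bsub>M\<^esub> ?\<rho> y" if "x \<in> N (Suc m)" "y \<in> N (Suc m)" for x y
      using that \<beta>add[OF that] \<beta>R N_sub uR g[of m]
      by (simp add: a_minus_def M.smult_r_distr M.smult_l_distr M.M.minus_add M.M.a_ac)
    have \<rho>smult: "?\<rho> (c \<odot>\<^bsub>M\<^esub> x) = c \<odot>\<^bsub>M\<^esub> ?\<rho> x" if x: "x \<in> N (Suc m)" and c: "c \<in> carrier R" for x c
      using \<beta>smult[OF x c] \<beta>R[OF x] N_sub[OF x] uR c g[of m]
      by (simp add: a_minus_def M.smult_r_distr M.smult_r_minus M.smult_assoc1[symmetric] M.R.m_comm)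
    let ?\<alpha> = "\<lambda>i x. if i < m then \<alpha> i (?\<rho> x) else s \<otimes> \<beta> x"
    have lin: "linear_on R M (N (Suc m)) (?\<alpha> i)" for i
    proof (cases "i < m")
      case True
      then show ?thesis unfolding linear_on_def using linear_onD[OF \<alpha>(1)[of i]] \<rho> \<rho>add \<rho>smult by simp
    next
      case False
      then show ?thesis unfolding linear_on_def using \<beta>R \<beta>add \<beta>smult sR by (simp add: M.R.r_distr M.R.m_lcomm)
    qed
    have "(s \<otimes> u) \<odot>\<^bsub>M\<^esub> x \<ominus>\<^bsub>M\<^esub> lc M (Suc m) (\<lambda>i. ?\<alpha> i x) g \<in> U" if x: "x \<in> N (Suc m)" for x
    proof -
      let ?L = "lc M m (\<lambda>i. \<alpha> i (?\<rho> x)) g"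
      have "lc M m (\<lambda>i. ?\<alpha> i x) g = ?L" by (rule lc_cong) auto
      then have "lc M (Suc m) (\<lambda>i. ?\<alpha> i x) g = ?L \<oplus>\<^bsub>M\<^esub> (s \<otimes> \<beta> x) \<odot>\<^bsub>M\<^esub> g m" by simp
      moreover have L: "?L \<in> carrier M" using linear_onD(1)[OF \<alpha>(1) \<rho>[OF x]] g by simp
      moreover have "s \<odot>\<^bsub>M\<^esub> ?\<rho> x = (s \<otimes> u) \<odot>\<^bsub>M\<^esub> x \<ominus>\<^bsub>M\<^esub> (s \<otimes> \<beta> x) \<odot>\<^bsub>M\<^esub> g m"
        using sR uR \<beta>R[OF x] N_sub[OF x] g[of m] by (simp add: a_minus_def M.smult_r_distr M.smult_r_minus M.smult_assoc1)
      ultimately have "(s \<otimes> u) \<odot>\<^bsub>M\<^esub> x \<ominus>\<^bsub>M\<^esub> lc M (Suc m) (\<lambda>i. ?\<alpha> i x) g = s \<odot>\<^bsub>M\<^esub> ?\<rho> x \<ominus>\<^bsub>M\<^esub> ?L"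
        using sR uR \<beta>R[OF x] N_sub[OF x] g[of m] by (simp add: a_minus_def M.M.minus_add M.M.a_ac)
      then show ?thesis using sa[OF \<rho>[OF x]] by simp
    qed
    moreover have "\<forall>i. \<forall>x\<in>U. ?\<alpha> i x = \<zero>"
    proof (intro allI ballI)
      fix i x assume x: "x \<in> U"
      have xM: "x \<in> carrier M" using x U(1) by blast
      have "?\<rho> x = u \<odot>\<^bsub>M\<^esub> x" using \<beta>U[OF x] xM uR g[of m] by (simp add: a_minus_def a_inv_zero[OF M.M.abelian_group_axioms])
      then show "?\<alpha> i x = \<zero>" using \<alpha>(2)[OF U(4)[OF uR x]] \<beta>U[OF x] sR by simp
    qed
    ultimately show ?thesis using primeideal_mult_compl[OF p s u] lin
      by (intro bexI[of _ "s \<otimes> u"] exI[of _ ?\<alpha>]) blast+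
  qed
qed

end

lemma fg_module_gens:
  fixes M :: "('a, 'm) module"
  assumes M: "fg_module R M"
  shows "\<exists>m g. (\<forall>i. g i \<in> carrier M) \<and> (\<forall>x\<in>carrier M. \<exists>c. (\<forall>i. c i \<in> carrier R) \<and> x = lc M m c g)"
proof -
  interpret M: module R M using M by (simp add: fg_module_def)
  obtain A where A: "finite A" "A \<subseteq> carrier M" "\<And>N. submodule N R M \<Longrightarrow> A \<subseteq> N \<Longrightarrow> N = carrier M"
    using M by (auto simp: fg_module_def)
  obtain xs where xs: "set xs = A" using A(1) finite_list by blast
  define g where "g i = (if i < length xs then xs ! i else \<zero>\<^bsub>M\<^esub>)" for i
  have g: "g i \<in> carrier M" for i using A(2) xs by (auto simp: g_def)
  let ?N = "{lc M (length xs) c g | c. \<forall>i. c i \<in> carrier R}"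
  have sm: "r \<odot>\<^bsub>M\<^esub> x \<in> ?N" if r: "r \<in> carrier R" and x: "x \<in> ?N" for r x
  proof -
    obtain c where c: "\<forall>i. c i \<in> carrier R" "x = lc M (length xs) c g" using x by blast
    have "r \<odot>\<^bsub>M\<^esub> x = lc M (length xs) (\<lambda>i. r \<otimes>\<^bsub>R\<^esub> c i) g" using M.lc_smult_left[of r c g] c g r by simp
    then show ?thesis using c r by (intro CollectI exI[of _ "\<lambda>i. r \<otimes>\<^bsub>R\<^esub> c i"]) simp
  qed
  have N: "?N \<subseteq> carrier M" using g by auto
  have "submodule ?N R M"
  proof (rule M.submoduleI[OF N])
    have "lc M (length xs) (\<lambda>_. \<zero>\<^bsub>R\<^esub>) g = \<zero>\<^bsub>M\<^esub>" by (rule M.lc_zero_left) (use g in auto)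
    then show "\<zero>\<^bsub>M\<^esub> \<in> ?N" by (intro CollectI exI[of _ "\<lambda>_. \<zero>\<^bsub>R\<^esub>"]) simp
    fix x assume x: "x \<in> ?N"
    then have "(\<ominus>\<^bsub>R\<^esub> \<one>\<^bsub>R\<^esub>) \<odot>\<^bsub>M\<^esub> x \<in> ?N" by (intro sm) simp_all
    then show "\<ominus>\<^bsub>M\<^esub> x \<in> ?N" using x N by (simp add: M.smult_l_minus subset_iff)
    fix y assume y: "y \<in> ?N"
    obtain c where c: "\<forall>i. c i \<in> carrier R" "x = lc M (length xs) c g" using x by blast
    obtain d where d: "\<forall>i. d i \<in> carrier R" "y = lc M (length xs) d g" using y by blast
    have "x \<oplus>\<^bsub>M\<^esub> y = lc M (length xs) (\<lambda>i. c i \<oplus>\<^bsub>R\<^esub> d i) g" using M.lc_add_left[of c d g] c d g by simp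
    then show "x \<oplus>\<^bsub>M\<^esub> y \<in> ?N" using c d by (intro CollectI exI[of _ "\<lambda>i. c i \<oplus>\<^bsub>R\<^esub> d i"]) simp
  qed (rule sm)
  moreover have "A \<subseteq> ?N"
  proof
    fix x assume "x \<in> A"
    then obtain k where k: "k < length xs" "x = xs ! k" using xs by (metis in_set_conv_nth)
    then have "x = lc M (length xs) (\<lambda>l. if l = k then \<one>\<^bsub>R\<^esub> else \<zero>\<^bsub>R\<^esub>) g"
      using g M.lc_unit_left[of g "length xs" k] by (simp add: g_def)
    then show "x \<in> ?N" by (intro CollectI exI[of _ "\<lambda>l. if l = k then \<one>\<^bsub>R\<^esub> else \<zero>\<^bsub>R\<^esub>"]) simp
  qed
  ultimately have "?N = carrier M" by (rule A(3))
  then show ?thesis using g by (intro exI[of _ "length xs"] exI[of _ g]) blast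
qed

lemma mod_homI:
  "(\<And>x. x \<in> carrier M \<Longrightarrow> f x \<in> carrier N) \<Longrightarrow>
   (\<And>x y. x \<in> carrier M \<Longrightarrow> y \<in> carrier M \<Longrightarrow> f (x \<oplus>\<^bsub>M\<^esub> y) = f x \<oplus>\<^bsub>N\<^esub> f y) \<Longrightarrow>
   (\<And>r x. r \<in> carrier R \<Longrightarrow> x \<in> carrier M \<Longrightarrow> f (r \<odot>\<^bsub>M\<^esub> x) = r \<odot>\<^bsub>N\<^esub> f x) \<Longrightarrow> f \<in> mod_hom R M N"
  by (simp add: mod_hom_def)

lemma mod_hom_smult:
  assumes N: "module R N" and f: "f \<in> mod_hom R M N" and t: "t \<in> carrier R"
  shows "(\<lambda>x. t \<odot>\<^bsub>N\<^esub> f x) \<in> mod_hom R M N"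
proof -
  interpret N: module R N by fact
  show ?thesis by (rule mod_homI) (use t in \<open>simp_all add: mod_homD[OF f] N.smult_r_distr N.smult_assoc1[symmetric] N.R.m_comm\<close>)
qed

lemma mod_hom_add:
  assumes N: "module R N" and f: "f \<in> mod_hom R M N" and g: "g \<in> mod_hom R M N"
  shows "(\<lambda>x. f x \<oplus>\<^bsub>N\<^esub> g x) \<in> mod_hom R M N"
proof -
  interpret N: module R N by fact
  show ?thesis by (rule mod_homI) (simp_all add: mod_homD[OF f] mod_homD[OF g] N.smult_r_distr N.M.a_ac)
qed

lemma mod_hom_sub:
  assumes N: "module R N" and f: "f \<in> mod_hom R M N" and g: "g \<in> mod_hom R M N"
  shows "(\<lambda>x. f x \<ominus>\<^bsub>N\<^esub> g x) \<in> mod_hom R M N"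
proof -
  interpret N: module R N by fact
  show ?thesis by (rule mod_homI)
    (simp_all add: mod_homD[OF f] mod_homD[OF g] N.smult_r_distr N.smult_r_minus a_minus_def N.M.minus_add N.M.a_ac)
qed

lemma mod_hom_compose: "f \<in> mod_hom R L M \<Longrightarrow> g \<in> mod_hom R M N \<Longrightarrow> (\<lambda>x. g (f x)) \<in> mod_hom R L N"
  by (rule mod_homI) (simp_all add: mod_homD)

section \<open>Linear algebra and splitting of complexes at the generic prime\<close>

locale generic_prime = noeth_cring R for R (structure) +
  fixes p :: "'a set" and u :: 'a
  assumes p: "primeideal p R" and u: "u \<in> carrier R - p" and up: "\<And>x. x \<in> p \<Longrightarrow> u \<otimes> x = \<zero>"
begin

lemma split_dataI:
  assumes "module R M" "U \<subseteq> carrier M" "\<zero>\<^bsub>M\<^esub> \<in> U" "\<And>x y. x \<in> U \<Longrightarrow> y \<in> U \<Longrightarrow> x \<oplus>\<^bsub>M\<^esub> y \<in> U"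
      "\<And>r x. r \<in> carrier R \<Longrightarrow> x \<in> U \<Longrightarrow> r \<odot>\<^bsub>M\<^esub> x \<in> U" "\<And>i. g i \<in> carrier M"
  shows "split_data R M p u U g"
  using assms p u up by (simp add: split_data_def split_data_axioms_def)

lemma split_data_zero: "module R M \<Longrightarrow> (\<And>i. g i \<in> carrier M) \<Longrightarrow> split_data R M p u {\<zero>\<^bsub>M\<^esub>} g"
proof -
  assume M: "module R M" and g: "\<And>i. g i \<in> carrier M"
  interpret M: module R M by fact
  show ?thesis by (rule split_dataI[OF M]) (use g in auto)
qed

text \<open>A dual basis with \<open>U = 0\<close> for generators of the image of \<open>f\<close>.
  They are taken as images of elements of \<open>L\<close>, so that coordinates can be lifted to
  \<open>L\<close>.\<close>

lemma image_coordinates: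
  fixes M :: "('a, 'm) module"
  assumes L: "fg_module R L" and M: "module R M" and f: "f \<in> mod_hom R L M"
  shows "\<exists>s\<in>carrier R - p. \<exists>m b \<alpha>. (\<forall>i. b i \<in> carrier L) \<and> (\<forall>i. linear_on R M (f ` carrier L) (\<alpha> i)) \<and>
    (\<forall>i. \<alpha> i \<zero>\<^bsub>M\<^esub> = \<zero>) \<and> (\<forall>x\<in>f ` carrier L. s \<odot>\<^bsub>M\<^esub> x = lc M m (\<lambda>i. \<alpha> i x) (\<lambda>i. f (b i)))"
proof -
  have L': "module R L" using L by (simp add: fg_module_def)
  interpret L: module R L by fact
  interpret M: module R M by fact
  obtain m b where b: "\<forall>i. b i \<in> carrier L" "\<forall>x\<in>carrier L. \<exists>c. (\<forall>i. c i \<in> carrier R) \<and> x = lc L m c b"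
    using fg_module_gens[OF L] by blast
  have fb: "f (b i) \<in> carrier M" for i using b mod_homD(1)[OF f] by simp
  interpret split_data R M p u "{\<zero>\<^bsub>M\<^esub>}" "\<lambda>i. f (b i)" by (rule split_data_zero[OF M fb])
  have sub: "x \<in> N m" if "x \<in> f ` carrier L" for x
  proof -
    obtain y where y: "y \<in> carrier L" "x = f y" using \<open>x \<in> _\<close> by blast
    obtain c where c: "\<forall>i. c i \<in> carrier R" "y = lc L m c b" using b(2) y(1) by blast
    have "x = \<zero>\<^bsub>M\<^esub> \<oplus>\<^bsub>M\<^esub> lc M m c (\<lambda>i. f (b i))" using y c lc_hom[OF L' M f, of c b m] b(1) fb by simp
    then show ?thesis unfolding N_iff using c(1) by blast
  qed
  obtain s \<alpha> where s: "s \<in> carrier R - p" and al: "\<forall>i. linear_on R M (N m) (\<alpha> i)" "\<forall>i. \<forall>x\<in>{\<zero>\<^bsub>M\<^esub>}. \<alpha> i x = \<zero>"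
    "\<forall>x\<in>N m. s \<odot>\<^bsub>M\<^esub> x \<ominus>\<^bsub>M\<^esub> lc M m (\<lambda>i. \<alpha> i x) (\<lambda>i. f (b i)) \<in> {\<zero>\<^bsub>M\<^esub>}" using dual_basis[of m] by blast
  have lin: "linear_on R M (f ` carrier L) (\<alpha> i)" for i
    using al(1)[THEN spec, of i] sub unfolding linear_on_def by blast
  have e: "s \<odot>\<^bsub>M\<^esub> x = lc M m (\<lambda>i. \<alpha> i x) (\<lambda>i. f (b i))" if x: "x \<in> f ` carrier L" for x
  proof -
    have xN: "x \<in> N m" by (rule sub[OF x])
    have "lc M m (\<lambda>i. \<alpha> i x) (\<lambda>i. f (b i)) \<in> carrier M" using linear_onD(1)[OF al(1)[THEN spec] xN] fb by simp
    moreover have "s \<odot>\<^bsub>M\<^esub> x \<in> carrier M" using s N_sub[OF xN] by simp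
    moreover have "s \<odot>\<^bsub>M\<^esub> x \<ominus>\<^bsub>M\<^esub> lc M m (\<lambda>i. \<alpha> i x) (\<lambda>i. f (b i)) = \<zero>\<^bsub>M\<^esub>" using al(3) xN by blast
    ultimately show ?thesis using M.M.diff_add_cancel[of "s \<odot>\<^bsub>M\<^esub> x" "lc M m (\<lambda>i. \<alpha> i x) (\<lambda>i. f (b i))"] by simp
  qed
  have z: "\<alpha> i \<zero>\<^bsub>M\<^esub> = \<zero>" for i using al(2) by simp
  show ?thesis by (intro bexI[OF _ s] exI[of _ m] exI[of _ b] exI[of _ \<alpha>]) (use b(1) lin z e in simp)
qed

text \<open>Over a field every linear map has a generalized inverse, and clearing denominators makes
  this hold up to a factor \<open>t\<close>. The inverse is a retraction \<open>\<pi>\<close> of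
  \<open>M\<close> onto the image, again up to a factor, followed by a lift of the image to
  \<open>L\<close> in coordinates.\<close>

lemma hom_regular:
  fixes M :: "('a, 'm) module"
  assumes L: "fg_module R L" and M: "fg_module R M" and f: "f \<in> mod_hom R L M"
  shows "\<exists>t\<in>carrier R - p. \<exists>h\<in>mod_hom R M L. \<forall>x\<in>carrier L. f (h (f x)) = t \<odot>\<^bsub>M\<^esub> f x"
proof -
  have L': "module R L" and M': "module R M" using L M by (simp_all add: fg_module_def)
  interpret L: module R L by fact
  interpret M: module R M by fact
  note fD = mod_homD[OF f]
  let ?B = "f ` carrier L"
  obtain s m b \<alpha> where s: "s \<in> carrier R - p" and b: "\<And>i. b i \<in> carrier L" and al: "\<And>i. linear_on R M ?B (\<alpha> i)"
    and sB: "\<And>x. x \<in> ?B \<Longrightarrow> s \<odot>\<^bsub>M\<^esub> x = lc M m (\<lambda>i. \<alpha> i x) (\<lambda>i. f (b i))"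
    using image_coordinates[OF L M' f] by blast
  have B: "?B \<subseteq> carrier M" using fD(1) by blast
  have Bz: "\<zero>\<^bsub>M\<^esub> \<in> ?B" using mod_hom_zero[OF L' M' f] L.M.zero_closed by (metis imageI)
  have Ba: "x \<oplus>\<^bsub>M\<^esub> y \<in> ?B" if "x \<in> ?B" "y \<in> ?B" for x y
  proof -
    obtain v w where "v \<in> carrier L" "x = f v" "w \<in> carrier L" "y = f w" using \<open>x \<in> ?B\<close> \<open>y \<in> ?B\<close> by blast
    then have "x \<oplus>\<^bsub>M\<^esub> y = f (v \<oplus>\<^bsub>L\<^esub> w)" "v \<oplus>\<^bsub>L\<^esub> w \<in> carrier L" by (simp_all add: fD)
    then show ?thesis by blast
  qed
  have Bs: "r \<odot>\<^bsub>M\<^esub> x \<in> ?B" if "r \<in> carrier R" "x \<in> ?B" for r x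
  proof -
    obtain v where "v \<in> carrier L" "x = f v" using \<open>x \<in> ?B\<close> by blast
    then have "r \<odot>\<^bsub>M\<^esub> x = f (r \<odot>\<^bsub>L\<^esub> v)" "r \<odot>\<^bsub>L\<^esub> v \<in> carrier L" using \<open>r \<in> carrier R\<close> by (simp_all add: fD)
    then show ?thesis by blast
  qed
  obtain n g where gg: "\<forall>i. g i \<in> carrier M" "\<forall>x\<in>carrier M. \<exists>c. (\<forall>i. c i \<in> carrier R) \<and> x = lc M n c g"
    using fg_module_gens[OF M] by blast
  interpret split_data R M p u ?B g by (rule split_dataI[OF M' B Bz Ba Bs]) (use gg in simp_all)
  have "x \<in> N n" if "x \<in> carrier M" for x
  proof -
    obtain c where c: "\<forall>i. c i \<in> carrier R" "x = lc M n c g" using gg(2) \<open>x \<in> carrier M\<close> by blast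
    have "x = \<zero>\<^bsub>M\<^esub> \<oplus>\<^bsub>M\<^esub> lc M n c g" using c g by simp
    then show ?thesis unfolding N_iff using c(1) Bz by blast
  qed
  then have NM: "N n = carrier M" using N_sub by blast
  obtain t \<gamma> where t: "t \<in> carrier R - p" and ga: "\<And>i. linear_on R M (carrier M) (\<gamma> i)" "\<And>i x. x \<in> ?B \<Longrightarrow> \<gamma> i x = \<zero>"
    "\<And>x. x \<in> carrier M \<Longrightarrow> t \<odot>\<^bsub>M\<^esub> x \<ominus>\<^bsub>M\<^esub> lc M n (\<lambda>i. \<gamma> i x) g \<in> ?B" using dual_basis[of n] unfolding NM by blast
  have tR: "t \<in> carrier R" and sR: "s \<in> carrier R" using s t by auto
  \<comment> \<open>Subtracting the coordinates modulo \<open>?B\<close> leaves an element of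
    \<open>?B\<close>; on \<open>?B\<close> these coordinates vanish, so there \<open>\<pi>\<close>
    is multiplication by \<open>t\<close>.\<close>
  define \<pi> where "\<pi> x = t \<odot>\<^bsub>M\<^esub> x \<ominus>\<^bsub>M\<^esub> lc M n (\<lambda>i. \<gamma> i x) g" for x
  note gl = linear_onD[OF ga(1)]
  have piB: "\<pi> x \<in> ?B" if "x \<in> carrier M" for x using ga(3)[OF that] by (simp add: \<pi>_def)
  have pi0: "\<pi> x = t \<odot>\<^bsub>M\<^esub> x" if x: "x \<in> ?B" for x
  proof -
    have "lc M n (\<lambda>i. \<gamma> i x) g = \<zero>\<^bsub>M\<^esub>" by (rule M.lc_zero_left) (use ga(2)[OF x] g in auto)
    then show ?thesis using x B tR by (auto simp: \<pi>_def a_minus_def a_inv_zero[OF M.M.abelian_group_axioms])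
  qed
  have pia: "\<pi> (x \<oplus>\<^bsub>M\<^esub> y) = \<pi> x \<oplus>\<^bsub>M\<^esub> \<pi> y" if "x \<in> carrier M" "y \<in> carrier M" for x y
    using that tR gl g by (simp add: \<pi>_def a_minus_def M.lc_add_left M.smult_r_distr M.M.minus_add M.M.a_ac)
  have pis: "\<pi> (r \<odot>\<^bsub>M\<^esub> x) = r \<odot>\<^bsub>M\<^esub> \<pi> x" if "r \<in> carrier R" "x \<in> carrier M" for r x
    using that tR gl g
    by (simp add: \<pi>_def a_minus_def M.lc_smult_left M.smult_r_distr M.smult_r_minus M.smult_assoc1[symmetric] m_comm)
  note alD = linear_onD[OF al]
  define h where "h x = lc L m (\<lambda>i. \<alpha> i (\<pi> x)) b" for x
  have "h \<in> mod_hom R M L"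
    by (rule mod_homI) (simp_all add: h_def b alD piB pia pis L.lc_add_left L.lc_smult_left)
  moreover have "f (h (f x)) = (s \<otimes> t) \<odot>\<^bsub>M\<^esub> f x" if x: "x \<in> carrier L" for x
  proof -
    have fx: "f x \<in> ?B" "f x \<in> carrier M" using x fD(1) by auto
    have "f (h (f x)) = lc M m (\<lambda>i. \<alpha> i (\<pi> (f x))) (\<lambda>i. f (b i))"
      unfolding h_def by (rule lc_hom[OF L' M' f]) (use b alD(1)[OF piB[OF fx(2)]] in auto)
    also have "\<dots> = s \<odot>\<^bsub>M\<^esub> \<pi> (f x)" using sB[OF piB[OF fx(2)]] by simp
    finally show ?thesis using pi0[OF fx(1)] sR tR fx(2) by (simp add: M.smult_assoc1)
  qed
  ultimately show ?thesis using primeideal_mult_compl[OF p s t] by blast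
qed

text \<open>The image of \<open>f\<close> is free at the generic prime, so a multiple of
  \<open>f\<close> passes through a free module. The coordinates are those of \<open>f x\<close>,
  which is why they vanish on the kernel of \<open>f\<close>.\<close>

lemma hom_factor:
  fixes M :: "('a, 'm) module"
  assumes L: "fg_module R L" and M: "module R M" and f: "f \<in> mod_hom R L M"
  shows "\<exists>t\<in>carrier R - p. \<exists>m a b. (\<forall>i. a i \<in> mod_hom R L (regm R)) \<and> (\<forall>i. b i \<in> carrier L) \<and>
    (\<forall>i. \<forall>x\<in>carrier L. f x = \<zero>\<^bsub>M\<^esub> \<longrightarrow> a i x = \<zero>) \<and>
    (\<forall>x\<in>carrier L. t \<odot>\<^bsub>M\<^esub> f x = lc M m (\<lambda>i. a i x) (\<lambda>i. f (b i)))"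
proof -
  have L': "module R L" using L by (simp add: fg_module_def)
  obtain s m b \<alpha> where s: "s \<in> carrier R - p" and b: "\<And>i. b i \<in> carrier L" and al: "\<And>i. linear_on R M (f ` carrier L) (\<alpha> i)"
    and z: "\<And>i. \<alpha> i \<zero>\<^bsub>M\<^esub> = \<zero>"
    and sB: "\<And>x. x \<in> f ` carrier L \<Longrightarrow> s \<odot>\<^bsub>M\<^esub> x = lc M m (\<lambda>i. \<alpha> i x) (\<lambda>i. f (b i))"
    using image_coordinates[OF L M f] by blast
  have "(\<lambda>x. \<alpha> i (f x)) \<in> mod_hom R L (regm R)" for i
    by (rule mod_homI) (use linear_onD[OF al[of i]] in \<open>simp_all add: mod_homD[OF f]\<close>)
  then show ?thesis using b z sB
    by (intro bexI[OF _ s] exI[of _ m] exI[of _ "\<lambda>i x. \<alpha> i (f x)"] exI[of _ b]) simp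
qed

text \<open>Bounded complexes impose conditions in finitely many degrees; these are renumbered from
  0 for \<open>prime_common\<close>.\<close>

lemma common_multiplier:
  fixes P :: "int \<Rightarrow> 'a \<Rightarrow> bool"
  assumes ex: "\<And>k. \<exists>t\<in>carrier R - p. P k t"
    and up: "\<And>k r t. r \<in> carrier R \<Longrightarrow> t \<in> carrier R \<Longrightarrow> P k t \<Longrightarrow> P k (r \<otimes> t)"
    and far: "\<And>k t. \<bar>k\<bar> > B \<Longrightarrow> t \<in> carrier R \<Longrightarrow> P k t"
  shows "\<exists>t\<in>carrier R - p. \<forall>k. P k t"
proof -
  have ex': "\<exists>t\<in>carrier R - p. P (int i - \<bar>B\<bar>) t" for i by (rule ex)
  let ?P = "\<lambda>i t. P (int i - \<bar>B\<bar>) t"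
  have "\<exists>t\<in>carrier R - p. \<forall>i<nat (2 * \<bar>B\<bar> + 1). ?P i t"
    by (rule prime_common[OF p, of _ ?P]) (use ex' up in simp_all)
  then obtain t where t: "t \<in> carrier R - p" "\<forall>i<nat (2 * \<bar>B\<bar> + 1). P (int i - \<bar>B\<bar>) t" by blast
  have "P k t" for k
  proof (cases "\<bar>k\<bar> \<le> \<bar>B\<bar>")
    case True
    then have "nat (k + \<bar>B\<bar>) < nat (2 * \<bar>B\<bar> + 1)" "int (nat (k + \<bar>B\<bar>)) - \<bar>B\<bar> = k" by linarith+
    then show ?thesis using t(2) by metis
  next
    case False
    then show ?thesis using far t(1) by auto
  qed
  then show ?thesis using t(1) by blast
qed

end

text \<open>The maps \<open>a\<close> lead to, and the elements \<open>b\<close> come from, a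
  complex of free modules with zero differential: therefore \<open>a\<close> kills coboundaries and
  \<open>b\<close> consists of cocycles. \<open>H\<close> is the homotopy.\<close>

definition splits_at :: "('a, 'r) ring_scheme \<Rightarrow> ('a, 'm) cochain \<Rightarrow> 'a \<Rightarrow> bool" where
  "splits_at R X t \<longleftrightarrow> (\<exists>H m a b. (\<forall>k. H k \<in> mod_hom R (ob X k) (ob X (k - 1))) \<and>
     (\<forall>k i. a k i \<in> mod_hom R (ob X k) (regm R)) \<and>
     (\<forall>k i. b k i \<in> carrier (ob X k) \<and> df X k (b k i) = \<zero>\<^bsub>ob X (k + 1)\<^esub>) \<and>
     (\<forall>k i. \<forall>x\<in>carrier (ob X (k - 1)). a k i (df X (k - 1) x) = \<zero>\<^bsub>R\<^esub>) \<and>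
     (\<forall>k. \<forall>x\<in>carrier (ob X k). t \<odot>\<^bsub>ob X k\<^esub> x = lc (ob X k) (m k) (\<lambda>i. a k i x) (b k) \<oplus>\<^bsub>ob X k\<^esub>
        (df X (k - 1) (H k x) \<oplus>\<^bsub>ob X k\<^esub> H (k + 1) (df X k x))))"

context generic_prime
begin

text \<open>Up to homotopy, multiplication by \<open>t\<close> factors through a complex of free modules with zero
  differential, as every complex over the field \<open>R\<^sub>p\<close> is homotopic to such a complex.\<close>

lemma generic_splitting:
  fixes X :: "('a, 'm) cochain"
  assumes X: "X \<in> bounded_complexes R"
  shows "\<exists>t\<in>carrier R - p. splits_at R X t"
proof -
  note X' = bounded_is_complex[OF X]
  interpret M: module R "ob X k" for k by (rule is_complexD(1)[OF X'])
  have fg: "fg_module R (ob X k)" for k using X by (simp add: bounded_complexes_def)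
  obtain B where B: "\<And>k. \<bar>k\<bar> > B \<Longrightarrow> carrier (ob X k) = {\<zero>\<^bsub>ob X k\<^esub>}" using X unfolding bounded_complexes_def by blast
  note dD = mod_homD[OF is_complexD(2)[OF X']] and dD' = mod_homD[OF is_complex_pred(1)[OF X']]
  \<comment> \<open>A generalized inverse, up to the factor \<open>t\<close>, of the differential
    into degree \<open>k\<close>.\<close>
  define P where "P k t \<longleftrightarrow> (\<exists>h\<in>mod_hom R (ob X k) (ob X (k - 1)). \<forall>x\<in>carrier (ob X (k - 1)).
    df X (k - 1) (h (df X (k - 1) x)) = t \<odot>\<^bsub>ob X k\<^esub> df X (k - 1) x)" for k t
  have "\<exists>t\<in>carrier R - p. \<forall>k. P k t"
  proof (rule common_multiplier[of P B])
    fix k show "\<exists>t\<in>carrier R - p. P k t"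
      unfolding P_def by (rule hom_regular[OF fg fg is_complex_pred(1)[OF X']])
  next
    fix k r t assume r: "r \<in> carrier R" and t: "t \<in> carrier R" and "P k t"
    then obtain h where h: "h \<in> mod_hom R (ob X k) (ob X (k - 1))" "\<And>x. x \<in> carrier (ob X (k - 1)) \<Longrightarrow>
      df X (k - 1) (h (df X (k - 1) x)) = t \<odot>\<^bsub>ob X k\<^esub> df X (k - 1) x" unfolding P_def by blast
    show "P k (r \<otimes> t)" unfolding P_def
      by (rule bexI[OF _ mod_hom_smult[OF M.module_axioms h(1) r]])
         (use r t h(2) mod_homD(1)[OF h(1)] in \<open>simp add: dD' M.smult_assoc1\<close>)
  next
    fix k t assume k: "\<bar>k\<bar> > B" and t: "t \<in> carrier R"
    have h: "(\<lambda>x. \<zero>\<^bsub>ob X (k - 1)\<^esub>) \<in> mod_hom R (ob X k) (ob X (k - 1))" by (rule mod_homI) simp_all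
    have "df X (k - 1) \<zero>\<^bsub>ob X (k - 1)\<^esub> = t \<odot>\<^bsub>ob X k\<^esub> df X (k - 1) x" if x: "x \<in> carrier (ob X (k - 1))" for x
    proof -
      have "df X (k - 1) \<zero>\<^bsub>ob X (k - 1)\<^esub> \<in> carrier (ob X k)" "t \<odot>\<^bsub>ob X k\<^esub> df X (k - 1) x \<in> carrier (ob X k)"
        using dD'(1) x t by simp_all
      then show ?thesis using B[OF k] by simp
    qed
    then show "P k t" unfolding P_def by (intro bexI[OF _ h] ballI)
  qed
  then obtain T where T: "T \<in> carrier R - p" "\<And>k. P k T" by blast
  have TR: "T \<in> carrier R" using T by blast
  have "\<forall>k. \<exists>h. h \<in> mod_hom R (ob X k) (ob X (k - 1)) \<and> (\<forall>x\<in>carrier (ob X (k - 1)).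
    df X (k - 1) (h (df X (k - 1) x)) = T \<odot>\<^bsub>ob X k\<^esub> df X (k - 1) x)" using T(2) unfolding P_def by blast
  from choice[OF this] obtain h where h: "\<And>k. h k \<in> mod_hom R (ob X k) (ob X (k - 1))"
    and dhd: "\<And>k x. x \<in> carrier (ob X (k - 1)) \<Longrightarrow> df X (k - 1) (h k (df X (k - 1) x)) = T \<odot>\<^bsub>ob X k\<^esub> df X (k - 1) x" by blast
  have h': "h (k + 1) \<in> mod_hom R (ob X (k + 1)) (ob X k)" for k using h[of "k + 1"] by simp
  note hD = mod_homD[OF h] and hD' = mod_homD[OF h']
  \<comment> \<open>\<open>\<psi>\<close> is null-homotopic by construction. As
    \<open>d h d = T d\<close>, the difference \<open>\<phi>\<close> between multiplication by
    \<open>T\<close> and \<open>\<psi>\<close> kills coboundaries and takes cocycles as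
    values.\<close>
  define \<psi> where "\<psi> k x = df X (k - 1) (h k x) \<oplus>\<^bsub>ob X k\<^esub> h (k + 1) (df X k x)" for k x
  define \<phi> where "\<phi> k x = T \<odot>\<^bsub>ob X k\<^esub> x \<ominus>\<^bsub>ob X k\<^esub> \<psi> k x" for k x
  have id: "(\<lambda>x. x) \<in> mod_hom R (ob X k) (ob X k)" for k by (rule mod_homI) simp_all
  have psi: "\<psi> k \<in> mod_hom R (ob X k) (ob X k)" for k
    unfolding \<psi>_def
    by (rule mod_hom_add[OF M.module_axioms mod_hom_compose[OF h is_complex_pred(1)[OF X']] mod_hom_compose[OF is_complexD(2)[OF X'] h']])
  have phi: "\<phi> k \<in> mod_hom R (ob X k) (ob X k)" for k
    unfolding \<phi>_def by (rule mod_hom_sub[OF M.module_axioms mod_hom_smult[OF M.module_axioms id TR] psi])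
  note psiD = mod_homD[OF psi] and phiD = mod_homD[OF phi]
  have hz: "h k \<zero>\<^bsub>ob X k\<^esub> = \<zero>\<^bsub>ob X (k - 1)\<^esub>" for k by (rule mod_hom_zero[OF M.module_axioms M.module_axioms h])
  have dz: "df X k \<zero>\<^bsub>ob X k\<^esub> = \<zero>\<^bsub>ob X (k + 1)\<^esub>" for k by (rule mod_hom_zero[OF M.module_axioms M.module_axioms is_complexD(2)[OF X']])
  have self: "x \<ominus>\<^bsub>ob X k\<^esub> x = \<zero>\<^bsub>ob X k\<^esub>" if "x \<in> carrier (ob X k)" for x k using that by (simp add: a_minus_def M.M.r_neg)
  have dphi: "df X k (\<phi> k x) = \<zero>\<^bsub>ob X (k + 1)\<^esub>" if x: "x \<in> carrier (ob X k)" for k x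
  proof -
    have "df X k (df X (k - 1) (h k x)) = \<zero>\<^bsub>ob X (k + 1)\<^esub>" by (rule is_complex_pred(2)[OF X' hD(1)[OF x]])
    moreover have "df X k (h (k + 1) (df X k x)) = T \<odot>\<^bsub>ob X (k + 1)\<^esub> df X k x" using dhd[of x "k + 1"] x by simp
    ultimately have "df X k (\<psi> k x) = T \<odot>\<^bsub>ob X (k + 1)\<^esub> df X k x"
      using x TR hD hD' by (simp add: \<psi>_def dD dD')
    then show ?thesis using x TR psiD(1) self
      by (simp add: \<phi>_def mod_hom_diff[OF M.module_axioms M.module_axioms is_complexD(2)[OF X']] dD)
  qed
  have phid: "\<phi> k (df X (k - 1) x) = \<zero>\<^bsub>ob X k\<^esub>" if x: "x \<in> carrier (ob X (k - 1))" for k x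
  proof -
    have "\<psi> k (df X (k - 1) x) = T \<odot>\<^bsub>ob X k\<^esub> df X (k - 1) x"
      using x TR dhd[OF x] is_complex_pred(2)[OF X' x] hz[of "k + 1"] by (simp add: \<psi>_def dD')
    then show ?thesis using x TR dD'(1) self by (simp add: \<phi>_def)
  qed
  \<comment> \<open>A multiple of \<open>\<phi>\<close> passes through a free module; the
    coordinates kill coboundaries because \<open>\<phi>\<close> does.\<close>
  define Q where "Q k t \<longleftrightarrow> (\<exists>m a b. (\<forall>i. a i \<in> mod_hom R (ob X k) (regm R)) \<and> (\<forall>i. b i \<in> carrier (ob X k)) \<and>
    (\<forall>i. \<forall>x\<in>carrier (ob X k). \<phi> k x = \<zero>\<^bsub>ob X k\<^esub> \<longrightarrow> a i x = \<zero>) \<and>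
    (\<forall>x\<in>carrier (ob X k). t \<odot>\<^bsub>ob X k\<^esub> \<phi> k x = lc (ob X k) m (\<lambda>i. a i x) (\<lambda>i. \<phi> k (b i))))" for k t
  have "\<exists>t\<in>carrier R - p. \<forall>k. Q k t"
  proof (rule common_multiplier[of Q B])
    fix k show "\<exists>t\<in>carrier R - p. Q k t"
      unfolding Q_def by (rule hom_factor[OF fg M.module_axioms phi])
  next
    fix k r t assume r: "r \<in> carrier R" and t: "t \<in> carrier R" and "Q k t"
    then obtain m a b where ab: "\<And>i. a i \<in> mod_hom R (ob X k) (regm R)" "\<And>i. b i \<in> carrier (ob X k)"
      "\<And>i x. x \<in> carrier (ob X k) \<Longrightarrow> \<phi> k x = \<zero>\<^bsub>ob X k\<^esub> \<Longrightarrow> a i x = \<zero>"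
      "\<And>x. x \<in> carrier (ob X k) \<Longrightarrow> t \<odot>\<^bsub>ob X k\<^esub> \<phi> k x = lc (ob X k) m (\<lambda>i. a i x) (\<lambda>i. \<phi> k (b i))"
      unfolding Q_def by blast
    have ra: "(\<lambda>x. r \<otimes> a i x) \<in> mod_hom R (ob X k) (regm R)" for i using mod_hom_smult[OF regm_module ab(1) r] by simp
    have e: "(r \<otimes> t) \<odot>\<^bsub>ob X k\<^esub> \<phi> k x = lc (ob X k) m (\<lambda>i. r \<otimes> a i x) (\<lambda>i. \<phi> k (b i))" if x: "x \<in> carrier (ob X k)" for x
    proof -
      have ax: "a i x \<in> carrier R" for i using mod_homD(1)[OF ab(1) x] by simp
      show ?thesis using M.lc_smult_left[of r "\<lambda>i. a i x" "\<lambda>i. \<phi> k (b i)"] ax r t x ab(2) phiD(1) ab(4)[OF x] by (simp add: M.smult_assoc1)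
    qed
    show "Q k (r \<otimes> t)" unfolding Q_def
      by (intro exI[of _ m] exI[of _ "\<lambda>i x. r \<otimes> a i x"] exI[of _ b]) (use ra ab(2,3) e r in simp)
  next
    fix k t assume k: "\<bar>k\<bar> > B" and t: "t \<in> carrier R"
    have "t \<odot>\<^bsub>ob X k\<^esub> \<phi> k x = \<zero>\<^bsub>ob X k\<^esub>" if x: "x \<in> carrier (ob X k)" for x
    proof -
      have "t \<odot>\<^bsub>ob X k\<^esub> \<phi> k x \<in> carrier (ob X k)" using t phiD(1)[OF x] by simp
      then show ?thesis using B[OF k] by simp
    qed
    moreover have "(\<lambda>x. \<zero>) \<in> mod_hom R (ob X k) (regm R)" by (rule mod_homI) simp_all
    ultimately show "Q k t" unfolding Q_def by (intro exI[of _ 0] exI[of _ "\<lambda>i x. \<zero>"] exI[of _ "\<lambda>i. \<zero>\<^bsub>ob X k\<^esub>"]) simp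
  qed
  then obtain S where S: "S \<in> carrier R - p" "\<forall>k. Q k S" by blast
  have SR: "S \<in> carrier R" using S by blast
  from choice[OF S(2)[unfolded Q_def]] obtain m where "\<forall>k. \<exists>a b. (\<forall>i. a i \<in> mod_hom R (ob X k) (regm R)) \<and> (\<forall>i. b i \<in> carrier (ob X k)) \<and>
    (\<forall>i. \<forall>x\<in>carrier (ob X k). \<phi> k x = \<zero>\<^bsub>ob X k\<^esub> \<longrightarrow> a i x = \<zero>) \<and>
    (\<forall>x\<in>carrier (ob X k). S \<odot>\<^bsub>ob X k\<^esub> \<phi> k x = lc (ob X k) (m k) (\<lambda>i. a i x) (\<lambda>i. \<phi> k (b i)))" by blast
  from choice[OF this] obtain a where "\<forall>k. \<exists>b. (\<forall>i. a k i \<in> mod_hom R (ob X k) (regm R)) \<and> (\<forall>i. b i \<in> carrier (ob X k)) \<and>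
    (\<forall>i. \<forall>x\<in>carrier (ob X k). \<phi> k x = \<zero>\<^bsub>ob X k\<^esub> \<longrightarrow> a k i x = \<zero>) \<and>
    (\<forall>x\<in>carrier (ob X k). S \<odot>\<^bsub>ob X k\<^esub> \<phi> k x = lc (ob X k) (m k) (\<lambda>i. a k i x) (\<lambda>i. \<phi> k (b i)))" by blast
  from choice[OF this] obtain b where a: "\<And>k i. a k i \<in> mod_hom R (ob X k) (regm R)" and b: "\<And>k i. b k i \<in> carrier (ob X k)"
    and az: "\<And>k i x. x \<in> carrier (ob X k) \<Longrightarrow> \<phi> k x = \<zero>\<^bsub>ob X k\<^esub> \<Longrightarrow> a k i x = \<zero>"
    and e: "\<And>k x. x \<in> carrier (ob X k) \<Longrightarrow> S \<odot>\<^bsub>ob X k\<^esub> \<phi> k x = lc (ob X k) (m k) (\<lambda>i. a k i x) (\<lambda>i. \<phi> k (b k i))" by blast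
  let ?H = "\<lambda>k x. S \<odot>\<^bsub>ob X (k - 1)\<^esub> h k x"
  have "(S \<otimes> T) \<odot>\<^bsub>ob X k\<^esub> x = lc (ob X k) (m k) (\<lambda>i. a k i x) (\<lambda>i. \<phi> k (b k i)) \<oplus>\<^bsub>ob X k\<^esub>
        (df X (k - 1) (?H k x) \<oplus>\<^bsub>ob X k\<^esub> ?H (k + 1) (df X k x))" if x: "x \<in> carrier (ob X k)" for k x
  proof -
    have "T \<odot>\<^bsub>ob X k\<^esub> x = \<phi> k x \<oplus>\<^bsub>ob X k\<^esub> \<psi> k x"
      using x TR psiD(1)[OF x] by (simp add: \<phi>_def a_minus_def M.M.a_assoc M.M.l_neg)
    then have "(S \<otimes> T) \<odot>\<^bsub>ob X k\<^esub> x = S \<odot>\<^bsub>ob X k\<^esub> \<phi> k x \<oplus>\<^bsub>ob X k\<^esub> S \<odot>\<^bsub>ob X k\<^esub> \<psi> k x"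
      using x TR SR psiD(1)[OF x] phiD(1)[OF x] by (simp add: M.smult_assoc1 M.smult_r_distr)
    moreover have "S \<odot>\<^bsub>ob X k\<^esub> \<psi> k x = df X (k - 1) (?H k x) \<oplus>\<^bsub>ob X k\<^esub> ?H (k + 1) (df X k x)"
      using x SR hD(1)[OF x] hD'(1)[OF dD(1)[OF x]] by (simp add: \<psi>_def M.smult_r_distr dD')
    ultimately show ?thesis using e[OF x] by simp
  qed
  moreover have "?H k \<in> mod_hom R (ob X k) (ob X (k - 1))" for k by (rule mod_hom_smult[OF M.module_axioms h SR])
  moreover have "a k i (df X (k - 1) x) = \<zero>" if "x \<in> carrier (ob X (k - 1))" for k i x
    by (rule az[OF dD'(1)[OF that] phid[OF that]])
  ultimately have "splits_at R X (S \<otimes> T)" unfolding splits_at_def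
    by (intro exI[of _ ?H] exI[of _ m] exI[of _ a] exI[of _ "\<lambda>k i. \<phi> k (b k i)"]) (use a b dphi phiD(1) in simp)
  then show ?thesis using primeideal_mult_compl[OF p S(1) T(1)] by blast
qed

end

text \<open>\<open>t z\<close> is a boundary plus a part that passes through free modules with zero
  differential. There each coordinate of \<open>z\<close> is a cycle of the resolution itself, so it
  bounds by exactness. That it is a cycle in degree \<open>k\<close> rests on the cocycle condition
  at \<open>k - 1\<close>, which costs the one truncation step.\<close>

lemma (in cring) ghost_of_splitting:
  fixes X :: "('a, 'm) cochain"
  assumes X: "is_complex R X" and t: "t \<in> carrier R - q" and sp: "splits_at R X t"
  shows "ghost R q i (Suc i) X"
  unfolding ghost_def
proof (intro allI impI bexI[OF _ t])
  fix c n D z assume res: "free_resolution_from R c n D" and z: "tensor_cocycle n D (c + int i) X z"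
  interpret M: module R "ob X k" for k by (rule is_complexD(1)[OF X])
  interpret free_cpx R c n D by (rule free_cpxI[OF res])
  note dD = mod_homD[OF is_complexD(2)[OF X]] and dD' = mod_homD[OF is_complex_pred(1)[OF X]]
  obtain H m a b where "(\<forall>k. H k \<in> mod_hom R (ob X k) (ob X (k - 1))) \<and>
     (\<forall>k i. a k i \<in> mod_hom R (ob X k) (regm R)) \<and>
     (\<forall>k i. b k i \<in> carrier (ob X k) \<and> df X k (b k i) = \<zero>\<^bsub>ob X (k + 1)\<^esub>) \<and>
     (\<forall>k i. \<forall>x\<in>carrier (ob X (k - 1)). a k i (df X (k - 1) x) = \<zero>\<^bsub>R\<^esub>) \<and>
     (\<forall>k. \<forall>x\<in>carrier (ob X k). t \<odot>\<^bsub>ob X k\<^esub> x = lc (ob X k) (m k) (\<lambda>i. a k i x) (b k) \<oplus>\<^bsub>ob X k\<^esub>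
        (df X (k - 1) (H k x) \<oplus>\<^bsub>ob X k\<^esub> H (k + 1) (df X k x)))"
    using sp unfolding splits_at_def by (elim exE)
  then have H: "\<And>k. H k \<in> mod_hom R (ob X k) (ob X (k - 1))"
    and a: "\<And>k i. a k i \<in> mod_hom R (ob X k) (regm R)"
    and b: "\<And>k i. b k i \<in> carrier (ob X k)" "\<And>k i. df X k (b k i) = \<zero>\<^bsub>ob X (k + 1)\<^esub>"
    and ad: "\<And>k i x. x \<in> carrier (ob X (k - 1)) \<Longrightarrow> a k i (df X (k - 1) x) = \<zero>\<^bsub>R\<^esub>"
    and e: "\<And>k x. x \<in> carrier (ob X k) \<Longrightarrow> t \<odot>\<^bsub>ob X k\<^esub> x = lc (ob X k) (m k) (\<lambda>i. a k i x) (b k) \<oplus>\<^bsub>ob X k\<^esub>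
        (df X (k - 1) (H k x) \<oplus>\<^bsub>ob X k\<^esub> H (k + 1) (df X k x))"
    by blast+
  have H': "H (k + 1) \<in> mod_hom R (ob X (k + 1)) (ob X k)" for k using H[of "k + 1"] by simp
  have aR: "a k i x \<in> carrier R" if "x \<in> carrier (ob X k)" for k i x using mod_homD(1)[OF a that] by simp
  note zc = cocD(1)[OF z]
  have "\<exists>w. (\<forall>l. w l \<in> carrier R) \<and> (c + int (Suc i) \<le> k \<longrightarrow>
      (\<forall>l<n k. a k j (z k l) = lc (regm R) (n (k + 1)) (D k l) w))" for k j
  proof (cases "c + int (Suc i) \<le> k")
    case True
    have "lc (regm R) (n (k - 1 + 1)) (D (k - 1) l) (\<lambda>l. a k j (z k l)) = \<zero>\<^bsub>R\<^esub>" if l: "l < n (k - 1)" for l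
    proof -
      have "df X (k - 1) (z (k - 1) l) = lc (ob X k) (n k) (D (k - 1) l) (z k)"
        using cocD(2)[OF z _ l] True by simp
      then have "a k j (lc (ob X k) (n k) (D (k - 1) l) (z k)) = \<zero>\<^bsub>R\<^esub>" using ad[OF zc] by metis
      then show ?thesis using lc_hom[OF M.module_axioms regm_module a, of "D (k - 1) l" "z k" k j "n k"] zc by simp
    qed
    then have "\<exists>w. (\<forall>l. w l \<in> carrier R) \<and> (\<forall>l<n (k - 1 + 1). a k j (z k l) = lc (regm R) (n (k - 1 + 1 + 1)) (D (k - 1 + 1) l) w)"
      using res[unfolded free_resolution_from_def, THEN conjunct2, THEN spec[of _ "k - 1"]] True aR[OF zc] by simp
    then show ?thesis using True by simp
  next
    case False
    then show ?thesis by (intro exI[of _ "\<lambda>l. \<zero>\<^bsub>R\<^esub>"]) simp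
  qed
  then have "\<forall>k. \<exists>w. \<forall>j. (\<forall>l. w j l \<in> carrier R) \<and> (c + int (Suc i) \<le> k \<longrightarrow>
      (\<forall>l<n k. a k j (z k l) = lc (regm R) (n (k + 1)) (D k l) (w j)))" by (intro allI choice)
  from choice[OF this] obtain w where w: "\<And>k j l. w k j l \<in> carrier R"
    and aw: "\<And>k j l. c + int (Suc i) \<le> k \<Longrightarrow> l < n k \<Longrightarrow> a k j (z k l) = lc (regm R) (n (k + 1)) (D k l) (w k j)" by blast
  \<comment> \<open>\<open>?w1\<close> bounds the homotopy part and \<open>?w2\<close> the part
    through the free modules.\<close>
  let ?w1 = "\<lambda>k l. H (k + 1) (z (k + 1) l)" and ?w2 = "\<lambda>k l. lc (ob X k) (m k) (\<lambda>j. w k j l) (b k)"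
  have w1: "?w1 k l \<in> carrier (ob X k)" for k l using mod_homD(1)[OF H' zc] .
  have w2: "?w2 k l \<in> carrier (ob X k)" for k l using w b by simp
  have b1: "tbd X ?w1 k l = df X (k - 1) (H k (z k l)) \<oplus>\<^bsub>ob X k\<^esub> H (k + 1) (df X k (z k l))"
    if k: "c + int (Suc i) \<le> k" and l: "l < n k" for k l
    using cocD(2)[OF z _ l] k lc_hom[OF M.module_axioms M.module_axioms H', of "D k l" "z (k + 1)" k "n (k + 1)"] zc
    by (simp add: tensor_bd_def)
  have b2: "tbd X ?w2 k l = lc (ob X k) (m k) (\<lambda>i. a k i (z k l)) (b k)"
    if k: "c + int (Suc i) \<le> k" and l: "l < n k" for k l
  proof -
    have "df X (k - 1) (?w2 (k - 1) l) = lc (ob X k) (m (k - 1)) (\<lambda>j. w (k - 1) j l) (\<lambda>j. df X (k - 1) (b (k - 1) j))"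
      by (rule lc_hom[OF M.module_axioms M.module_axioms is_complex_pred(1)[OF X]]) (use w b in auto)
    also have "\<dots> = \<zero>\<^bsub>ob X k\<^esub>" by (rule M.lc_zero) (use w b(2)[of "k - 1"] in simp_all)
    finally have 1: "df X (k - 1) (?w2 (k - 1) l) = \<zero>\<^bsub>ob X k\<^esub>" .
    have "lc (ob X k) (n (k + 1)) (D k l) (?w2 k) = lc (ob X k) (m k) (\<lambda>j. lc (regm R) (n (k + 1)) (D k l) (w k j)) (b k)"
      by (rule M.lc_lc) (use w b in auto)
    also have "\<dots> = lc (ob X k) (m k) (\<lambda>j. a k j (z k l)) (b k)" using aw[OF k l] by simp
    finally show ?thesis using 1 aR[OF zc] b by (simp add: tensor_bd_def)
  qed
  show "teq (c + int (Suc i)) X (\<lambda>k l. t \<odot>\<^bsub>ob X k\<^esub> z k l) (\<lambda>k l. \<zero>\<^bsub>ob X k\<^esub>)"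
  proof (rule teqI[of "\<lambda>k l. ?w2 k l \<oplus>\<^bsub>ob X k\<^esub> ?w1 k l"])
    show "?w2 k l \<oplus>\<^bsub>ob X k\<^esub> ?w1 k l \<in> carrier (ob X k)" for k l using w1 w2 by simp
    fix k l assume kl: "c + int (Suc i) \<le> k" "l < n k"
    have "tbd X (\<lambda>k l. ?w2 k l \<oplus>\<^bsub>ob X k\<^esub> ?w1 k l) k l = tbd X ?w2 k l \<oplus>\<^bsub>ob X k\<^esub> tbd X ?w1 k l"
      by (rule tbd_add[OF X w2 w1])
    also have "\<dots> = t \<odot>\<^bsub>ob X k\<^esub> z k l" unfolding b1[OF kl] b2[OF kl] using e[OF zc] by simp
    finally show "t \<odot>\<^bsub>ob X k\<^esub> z k l = \<zero>\<^bsub>ob X k\<^esub> \<oplus>\<^bsub>ob X k\<^esub> tbd X (\<lambda>k l. ?w2 k l \<oplus>\<^bsub>ob X k\<^esub> ?w1 k l) k l"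
      using t zc by simp
  qed
qed

section \<open>From ghosts to Tor\<close>

context cring
begin

text \<open>\<open>R/J\<close> has to live on the element type of \<open>Db_mod\<close>: the
  quotient ring is made a module and transported by \<open>fg_module_representable\<close>.\<close>

lemma cyclic_module:
  assumes J: "ideal J R"
  shows "\<exists>(N :: ('a, 'a fg_elem) module) \<pi>. fg_module R N \<and> \<pi> \<in> mod_hom R (regm R) N \<and>
    carrier N \<subseteq> \<pi> ` carrier R \<and> (\<forall>r\<in>carrier R. \<pi> r = \<zero>\<^bsub>N\<^esub> \<longleftrightarrow> r \<in> J)"
proof -
  interpret J: ideal J R by fact
  interpret Q: cring "R Quot J" by (rule J.quotient_is_cring[OF is_cring])
  interpret h: ring_hom_ring R "R Quot J" "(+>) J" by (rule J.rcos_ring_hom_ring)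
  define M :: "('a, 'a set) module" where "M = \<lparr>carrier = carrier (R Quot J), mult = mult (R Quot J), one = one (R Quot J),
    zero = zero (R Quot J), add = add (R Quot J), smult = (\<lambda>r X. (J +> r) \<otimes>\<^bsub>R Quot J\<^esub> X)\<rparr>"
  have Ms: "carrier M = carrier (R Quot J)" "add M = add (R Quot J)" "zero M = zero (R Quot J)"
    "r \<odot>\<^bsub>M\<^esub> X = (J +> r) \<otimes>\<^bsub>R Quot J\<^esub> X" for r X by (simp_all add: M_def)
  have zJ: "\<zero>\<^bsub>M\<^esub> = J" by (simp only: Ms FactRing_def ring_record_simps)
  have cQ: "carrier (R Quot J) = (+>) J ` carrier R" by (simp only: FactRing_def A_RCOSETS_def' UNION_singleton_eq_range partial_object.simps)
  interpret M: module R M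
  proof (rule moduleI)
    show "abelian_group M"
      by (rule abelian_groupI) (auto simp: Ms Q.a_ac intro: bexI[of _ "\<ominus>\<^bsub>R Quot J\<^esub> _"] Q.l_neg)
  qed (auto simp: Ms Q.m_ac Q.l_distr Q.r_distr is_cring)
  have "fg_module R M"
    unfolding fg_module_def
  proof (intro conjI exI[of _ "{J +> \<one>}"] allI impI)
    fix N assume N: "submodule N R M \<and> {J +> \<one>} \<subseteq> N"
    interpret N: submodule N R M using N by simp
    have "J +> r \<in> N" if r: "r \<in> carrier R" for r
    proof -
      have "r \<odot>\<^bsub>M\<^esub> (J +> \<one>) \<in> N" using N r by (intro N.smult_closed) auto
      then show ?thesis using r by (simp add: Ms h.hom_mult[symmetric])
    qed
    then show "N = carrier M" using N.subset by (auto simp: Ms cQ)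
  qed (use M.module_axioms in \<open>auto simp: Ms\<close>)
  then obtain N :: "('a, 'a fg_elem) module" and e where N: "fg_module R N" and e: "e \<in> mod_hom R M N" "bij_betw e (carrier M) (carrier N)"
    using fg_module_representable by blast
  have N': "module R N" using N by (simp add: fg_module_def)
  have "(+>) J \<in> mod_hom R (regm R) M" by (rule mod_homI) (simp_all add: Ms)
  then have pi: "(\<lambda>r. e (J +> r)) \<in> mod_hom R (regm R) N" by (rule mod_hom_compose[OF _ e(1)])
  have surj: "carrier N \<subseteq> (\<lambda>r. e (J +> r)) ` carrier R"
    using e(2) by (auto simp: bij_betw_def Ms cQ)
  have "e (J +> r) = \<zero>\<^bsub>N\<^esub> \<longleftrightarrow> r \<in> J" if r: "r \<in> carrier R" for r
  proof -
    have inj: "inj_on e (carrier M)" using e(2) by (simp add: bij_betw_def)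
    have rM: "J +> r \<in> carrier M" using r by (simp add: Ms)
    have "e (J +> r) = \<zero>\<^bsub>N\<^esub> \<longleftrightarrow> e (J +> r) = e \<zero>\<^bsub>M\<^esub>" using mod_hom_zero[OF M.module_axioms N' e(1)] by simp
    also have "\<dots> \<longleftrightarrow> J +> r = \<zero>\<^bsub>M\<^esub>" using inj_on_eq_iff[OF inj rM M.M.zero_closed] .
    also have "\<dots> \<longleftrightarrow> r \<in> J" unfolding zJ using J.a_rcos_const[of r] J.a_rcos_self[OF r] by metis
    finally show ?thesis .
  qed
  then show ?thesis using N pi surj by blast
qed

text \<open>The zero modules keep the zero element of \<open>N\<close>, so one constant function
  serves as differential in all degrees.\<close>

lemma concentrated_complex:
  fixes N :: "('a, 'm) module"
  assumes N: "fg_module R N"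
  shows "\<lparr>ob = (\<lambda>k. if k = 0 then N else N\<lparr>carrier := {\<zero>\<^bsub>N\<^esub>}\<rparr>), df = (\<lambda>k x. \<zero>\<^bsub>N\<^esub>)\<rparr> \<in> bounded_complexes R"
proof -
  have N': "module R N" using N by (simp add: fg_module_def)
  interpret N: module R N by fact
  let ?Z = "N\<lparr>carrier := {\<zero>\<^bsub>N\<^esub>}\<rparr>"
  interpret Z: module R ?Z
    by (rule moduleI, rule is_cring, rule abelian_groupI) auto
  have Z: "fg_module R ?Z"
    unfolding fg_module_def
  proof (intro conjI exI[of _ "{}"] allI impI)
    fix K assume "submodule K R ?Z \<and> {} \<subseteq> K"
    then interpret K: submodule K R ?Z by simp
    show "K = carrier ?Z" using K.subset K.one_closed by auto
  qed (use Z.module_axioms in auto)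
  show ?thesis unfolding bounded_complexes_def
    by (auto simp: N Z intro!: mod_homI exI[of _ 0])
qed

text \<open>Degree \<open>m\<close> of the resolution moves to index 0, the degree in which the
  module of \<open>concentrated_complex\<close> sits.\<close>

lemma free_resolution_from_nat:
  assumes F: "free_resolution R r D"
  shows "free_resolution_from R (- int m) (\<lambda>p. r (nat (p + int m))) (\<lambda>p. D (nat (p + int m)))"
proof -
  have s: "nat (p + 1 + int m) = Suc (nat (p + int m))" if "- int m \<le> p" for p using that by linarith
  have s2: "nat (p + 1 + 1 + int m) = Suc (Suc (nat (p + int m)))" if "- int m \<le> p" for p using that by linarith
  show ?thesis
    unfolding free_resolution_from_def free_complex_from_def
  proof (intro conjI allI impI)
    show "D (nat (p + int m)) k l \<in> carrier R" for p k l by (rule free_resolutionD(1)[OF F])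
  next
    fix p k l assume p: "- int m \<le> p" and k: "k < r (nat (p + int m))" and l: "l < r (nat (p + 1 + 1 + int m))"
    show "lc (regm R) (r (nat (p + 1 + int m))) (D (nat (p + int m)) k) (\<lambda>j. D (nat (p + 1 + int m)) j l) = \<zero>"
      using free_resolution_matrix[OF F k] l unfolding s[OF p] s2[OF p] by simp
  next
    fix p and z :: "nat \<Rightarrow> 'a" assume p: "- int m \<le> p" and z: "\<forall>l. z l \<in> carrier R"
      and c: "\<forall>k<r (nat (p + int m)). lc (regm R) (r (nat (p + 1 + int m))) (D (nat (p + int m)) k) z = \<zero>"
    show "\<exists>w. (\<forall>l. w l \<in> carrier R) \<and> (\<forall>l<r (nat (p + 1 + int m)). z l = lc (regm R) (r (nat (p + 1 + 1 + int m))) (D (nat (p + 1 + int m)) l) w)"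
      using free_resolutionD(3)[OF F, of z "nat (p + int m)"] z c unfolding s[OF p] s2[OF p] by simp
  qed
qed

text \<open>For \<open>R/J\<close> placed in degree 0, a cocycle of total degree 0 is a cycle of
  degree \<open>m\<close> of the resolution modulo \<open>J\<close>. Truncation to degrees at least
  \<open>m\<close> keeps the boundaries in degree \<open>m\<close> as they are, so a zero truncation
  map on cohomology means vanishing Tor.\<close>

lemma tor_vanishes_of_ghost:
  assumes F: "free_resolution R r D" and J: "ideal J R"
    and gh: "\<And>X :: ('a, 'a fg_elem) cochain. X \<in> bounded_complexes R \<Longrightarrow> ghost R q 0 m X"
  shows "tor_vanishes R q J r D m"
proof (rule tor_vanishesI)
  fix z assume z: "\<And>l. z l \<in> carrier R" and zJ: "\<And>j k. m = Suc j \<Longrightarrow> k < r j \<Longrightarrow> bd R r D j z k \<in> J"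
  obtain N :: "('a, 'a fg_elem) module" and \<pi> where N: "fg_module R N" and pi: "\<pi> \<in> mod_hom R (regm R) N"
    and surj: "carrier N \<subseteq> \<pi> ` carrier R" and ker: "\<And>r. r \<in> carrier R \<Longrightarrow> \<pi> r = \<zero>\<^bsub>N\<^esub> \<longleftrightarrow> r \<in> J"
    using cyclic_module[OF J] by blast
  have N': "module R N" using N by (simp add: fg_module_def)
  interpret N: module R N by fact
  interpret r: module R "regm R" by (rule regm_module)
  note piD = mod_homD[OF pi, unfolded regm_simps] and Dc = free_resolutionD(1)[OF F]
  define X where "X = \<lparr>ob = (\<lambda>k::int. if k = 0 then N else N\<lparr>carrier := {\<zero>\<^bsub>N\<^esub>}\<rparr>), df = (\<lambda>k x. \<zero>\<^bsub>N\<^esub>)\<rparr>"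
  have X: "X \<in> bounded_complexes R" unfolding X_def by (rule concentrated_complex[OF N])
  interpret MX: module R "ob X k" for k by (rule is_complexD(1)[OF bounded_is_complex[OF X]])
  have X0: "ob X 0 = N" and Xz: "\<zero>\<^bsub>ob X k\<^esub> = \<zero>\<^bsub>N\<^esub>" and Xd: "df X k x = \<zero>\<^bsub>N\<^esub>" for k x by (simp_all add: X_def)
  let ?n = "\<lambda>p. r (nat (p + int m))" and ?D = "\<lambda>p. D (nat (p + int m))"
  let ?z = "\<lambda>p k. if p = (0::int) then \<pi> (z k) else \<zero>\<^bsub>N\<^esub>"
  have lcpi: "\<pi> (lc (regm R) n c y) = lc N n c (\<lambda>l. \<pi> (y l))"
    if "\<And>l. c l \<in> carrier R" "\<And>l. y l \<in> carrier R" for n c y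
    by (rule lc_hom[OF regm_module N' pi]) (use that in simp_all)
  have zX: "?z p k \<in> carrier (ob X p)" for p k using piD(1)[OF z] by (simp add: X_def)
  have "tensor_cocycle ?n ?D (- int m + int 0) X ?z"
    unfolding tensor_cocycle_def
  proof (intro conjI allI impI zX)
    fix p k assume p: "- int m + int 0 \<le> p" and k: "k < ?n p"
    show "df X p (?z p k) = lc (ob X (p + 1)) (?n (p + 1)) (?D p k) (?z (p + 1))"
    \<comment> \<open>Only the equation with values in degree 0 has content, and it says that
      \<open>z\<close> is a cycle modulo \<open>J\<close>. For \<open>m = 0\<close> it lies below
      the range.\<close>
    proof (cases "p + 1 = 0")
      case True
      then have pm: "p = -1" by simp
      then obtain j where j: "m = Suc j" using p by (cases m) auto
      have nj: "nat (p + int m) = j" "nat (p + 1 + int m) = Suc j" using pm j by (simp_all add: nat_add_distrib)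
      have "bd R r D j z k \<in> J" by (rule zJ[OF j]) (use k nj in simp)
      moreover have "bd R r D j z k \<in> carrier R" using Dc z by simp
      ultimately have "\<pi> (bd R r D j z k) = \<zero>\<^bsub>N\<^esub>" using ker by blast
      then show ?thesis unfolding nj True using lcpi[of "D j k" z "r (Suc j)"] Dc z by (simp add: Xd X0 j nat_add_distrib)
    next
      case False
      have "lc (ob X (p + 1)) (?n (p + 1)) (?D p k) (?z (p + 1)) = \<zero>\<^bsub>ob X (p + 1)\<^esub>"
        by (rule MX.lc_zero) (use False Dc Xz in simp_all)
      then show ?thesis by (simp add: Xd Xz)
    qed
  qed
  then obtain s where s: "s \<in> carrier R - q"
    and eq: "tensor_eq ?n ?D (- int m + int m) X (\<lambda>p k. s \<odot>\<^bsub>ob X p\<^esub> ?z p k) (\<lambda>p k. \<zero>\<^bsub>ob X p\<^esub>)"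
    using gh[OF X] free_resolution_from_nat[OF F, of m] unfolding ghost_def by blast
  have sR: "s \<in> carrier R" using s by blast
  obtain w where w: "\<And>p k. w p k \<in> carrier (ob X p)"
    and we: "\<And>p k. 0 \<le> p \<Longrightarrow> k < ?n p \<Longrightarrow> s \<odot>\<^bsub>ob X p\<^esub> ?z p k = \<zero>\<^bsub>ob X p\<^esub> \<oplus>\<^bsub>ob X p\<^esub> tensor_bd ?n ?D X w p k"
    using eq unfolding tensor_eq_def add.left_inverse by blast
  have "\<forall>l. \<exists>v. v \<in> carrier R \<and> w 0 l = \<pi> v" using w[of 0] surj X0 by (metis imageE subsetD)
  from choice[OF this] obtain v where v: "\<And>l. v l \<in> carrier R" "\<And>l. w 0 l = \<pi> (v l)" by blast
  have "s \<otimes> z l \<ominus> bd R r D m v l \<in> J" if l: "l < r m" for l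
  proof -
    have bR: "bd R r D m v l \<in> carrier R" using Dc v by simp
    have nm: "nat (1 + int m) = Suc m" by simp
    have w0: "w 0 = (\<lambda>l. \<pi> (v l))" using v(2) by blast
    have lN: "lc N (r (Suc m)) (D m l) (\<lambda>l. \<pi> (v l)) \<in> carrier N" using Dc v(1) piD(1) by simp
    have "s \<odot>\<^bsub>N\<^esub> \<pi> (z l) = lc N (r (Suc m)) (D m l) (\<lambda>l. \<pi> (v l))"
      using we[of 0 l] l lN by (simp add: tensor_bd_def Xd X0 nm w0)
    also have "\<dots> = \<pi> (bd R r D m v l)" using lcpi[of "D m l" v] Dc v(1) by simp
    finally have e: "\<pi> (s \<otimes> z l) = \<pi> (bd R r D m v l)" using piD(3)[OF sR z] by simp
    have "\<pi> (s \<otimes> z l \<ominus> bd R r D m v l) = \<pi> (s \<otimes> z l) \<ominus>\<^bsub>N\<^esub> \<pi> (bd R r D m v l)"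
      using mod_hom_diff[OF regm_module N' pi, of "s \<otimes> z l" "bd R r D m v l"] sR z bR by simp
    also have "\<dots> = \<zero>\<^bsub>N\<^esub>" unfolding e using piD(1)[OF bR] by (simp add: a_minus_def N.M.r_neg)
    finally show ?thesis using ker[of "s \<otimes> z l \<ominus> bd R r D m v l"] sR z bR by simp
  qed
  then show "\<exists>s\<in>carrier R - q. \<exists>w. (\<forall>l. w l \<in> carrier R) \<and> (\<forall>l<r m. s \<otimes> z l \<ominus> bd R r D m w l \<in> J)"
    by (intro bexI[OF _ s] exI[of _ v]) (simp add: v(1))
qed

end

theorem theorem6p5:
  fixes R :: "('a, 'r) ring_scheme"
  assumes "cring R" and "noetherian_ring R"
    and "krull_dim R < \<infinity>"
    and "\<And>p. p \<in> Assh R \<Longrightarrow> field (localization_at R p)"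
  shows "triangulated_dim (Db_mod R) \<ge> krull_dim R - 1"
proof -
  interpret noeth_cring R by (rule noeth_cring.intro[OF assms(1,2)])
  from assms(3) show ?thesis
  proof (cases rule: krull_dim_cases)
    case 1
    \<comment> \<open>The case of a ring without primes, the zero ring.\<close>
    then have "krull_dim R - 1 = - \<infinity>" by (simp add: minus_ereal_def one_ereal_def)
    then show ?thesis by simp
  next
    case (2 d P)
    have p: "primeideal (P 0) R" using 2(3) by (simp add: Assh_def)
    obtain u where u: "u \<in> carrier R - P 0" "\<And>x. x \<in> P 0 \<Longrightarrow> u \<otimes>\<^bsub>R\<^esub> x = \<zero>\<^bsub>R\<^esub>"
      using field_localization_annihilates[OF p assms(4)[OF 2(3)]] by blast
    interpret generic_prime R "P 0" u
      by (rule generic_prime.intro[OF noeth_cring_axioms generic_prime_axioms.intro[OF p u]])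
    \<comment> \<open>Level \<open>n\<close> of the generation stands for dimension
      \<open>n - 1\<close>, so this inequality is the bound.\<close>
    have "d \<le> n" if G: "G \<in> bounded_complexes R" and gen: "gen_n (Db_mod R) {G} n = bounded_complexes R" for n G
    proof (rule ccontr)
      assume "\<not> d \<le> n"
      then obtain d' where d': "d = Suc d'" "n \<le> d'" by (cases d) auto
      obtain t where t: "t \<in> carrier R - P 0" "splits_at R G t" using generic_splitting[OF G] by blast
      \<comment> \<open>The chain avoiding \<open>t\<close> has length \<open>d - 1\<close>, which
        is still at least \<open>n\<close>; its initial piece of length \<open>n\<close> provides
        the prime \<open>Q n\<close>.\<close>
      obtain Q where Q: "prime_chain R d' Q" "t \<notin> Q d'"
        using prime_chain_avoiding[of d' P t] 2(2) d'(1) t(1) by blast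
      have mono: "Q i \<subseteq> Q j" if "i \<le> j" "j \<le> d'" for i j
        using \<open>i \<le> j\<close> \<open>j \<le> d'\<close>
      proof (induction j rule: dec_induct)
        case (step j)
        then show ?case using Q(1) unfolding prime_chain_def by (meson Suc_le_eq less_imp_le order_trans psubset_imp_subset)
      qed simp
      have Qn: "prime_chain R n Q" using Q(1) d'(2) by (auto simp: prime_chain_def)
      have q: "primeideal (Q n) R" using Qn by (simp add: prime_chain_def)
      have tq: "t \<in> carrier R - Q n" using mono[OF d'(2)] Q(2) t(1) by auto
      have gh: "ghost R (Q n) 0 n X" if X: "X \<in> bounded_complexes R" for X :: "('a, 'a fg_elem) cochain"
        using ghost_gen_n[OF q ghost_of_splitting[OF bounded_is_complex[OF G] tq t(2)], of X n] X gen by simp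
      obtain I r D J where IJ: "resolves R I r D" "ideal J R" "\<not> tor_vanishes R (Q n) J r D n"
        using tor_nonvanishing[OF Qn] by blast
      then show False using tor_vanishes_of_ghost[OF resolvesD(1)[OF IJ(1)] IJ(2) gh] by blast
    qed
    then show ?thesis unfolding triangulated_dim_def 2(1)
      by (intro INF_greatest) (auto simp: one_ereal_def)
  qed
qed

end
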